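(* Let $w\in S_\infty$, $\varphi$ a flag, $r^{(\bullet)}\in\mathrm{RFC}(w,\varphi)$ and $i>0$. If $e_i(r^{(\bullet)})\neq0$, then $\hat P(e_i(r^{(\bullet)}))=\hat P(r^{(\bullet)})$ and $\hat Q(e_i(r^{(\bullet)}))=e_i\big(\hat Q(r^{(\bullet)})\big)$.
   Context: $s_i\in S_\infty$ swaps $i,i+1$; reduced words for $w$ are minimal-length words $i_1\cdots i_m$ with $w=s_{i_1}\cdots s_{i_m}$. An increasing factorization $r^{(\bullet)}=(r^{(k)}|\cdots|r^{(1)})$ of $r$ writes $r=r^{(k)}\cdots r^{(1)}$ with consecutive, possibly empty, strictly increasing subwords (one may pad with empty components on the left). A flag is a weakly increasing $\varphi:\mathbb{Z}_{>0}\to\mathbb{Z}_{>0}$ with $\varphi(m)\ge m$; $r^{(\bullet)}$ is $\varphi$-flagged if $\varphi(r^{(j)}_1)\ge j$ whenever $r^{(j)}$ is nonempty. $\mathrm{RFC}(w,\varphi)$ is the set of $\varphi$-flagged increasing factorizations of reduced words for $w$. Raising operator on factorizations (Morse–Schilling), acting on components $i+1,i$: take elements $b$ of $r^{(i)}$ in decreasing order, pairing each with the smallest not-yet-paired $a\in r^{(i+1)}$ with $a>b$ (else $b$ unpaired); $L_i$ = unpaired letters of $r^{(i+1)}$. If $L_i=\varnothing$, $e_i(r^{(\bullet)})=0$; otherwise with $a=\max L_i$, $s=\min\{t\ge0:a+t+1\notin r^{(i+1)}\}$, $e_i$ removes $a$ from $r^{(i+1)}$ and adds $a+s$ to $r^{(i)}$.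 Coxeter–Knuth equivalence $\sim$: transitive closure of $\mathbf a xyz\mathbf b\sim\mathbf a xzy\mathbf b$ ($y<x<z$), $\mathbf a xyz\mathbf b\sim\mathbf a yxz\mathbf b$ ($y<z<x$), $\mathbf a\, i(i+1)i\,\mathbf b\sim\mathbf a\,(i+1)i(i+1)\,\mathbf b$. Tableaux are fillings of finite sets of boxes (row $r\in\mathbb{Z}$, column $c\in\mathbb{Z}_{>0}$), rows left-justified, rows indexed upward. Weak descent tableau $\mathsf{WeakDesTab}(\rho)$: with run factorization (maximal strictly increasing runs) $(\sigma^{(k)}|\cdots|\sigma^{(1)})$, place $\sigma^{(k)}$ in row $\sigma^{(k)}_1$; for $i=k-1,\dots,1$ place $\sigma^{(i)}$ in row $\sigma^{(i)}_1$ if that is below the row of $\sigma^{(i+1)}$, else directly below it. Virtual: uses a non-positive row; else $\mathrm{des}(\rho)$ is its shape. $\mu\le\nu$ iff all partial sums satisfy $\sum_{i\le k}\mu_i\le\sum_{i\le k}\nu_i$; for non-virtual reduced words $\rho\le\tau$ iff $\rho\sim\tau$ and $\mathrm{des}(\rho)\le\mathrm{des}(\tau)$; each $\sim$-class has a unique non-virtual $\le$-minimal element $\hat\rho$; $\hat P(r^{(\bullet)})=\hat P(r):=\mathsf{WeakDesTab}(\hat r)$. It is known that if $\sigma x$ is reduced, the diagram of $\hat P(\sigma x)$ is that of $\hat P(\sigma)$ plus one box. $\hat Q(r^{(\bullet)})$ fills the diagram of $\hat P(r)$, a box getting $j$ iff it lies in the diagram of $\hat P(r^{(k)}\cdots r^{(j)})$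 but not of $\hat P(r^{(k)}\cdots r^{(j+1)})$; it is a key tableau. Raising operator on key tableaux $T$: for a word $\rho=\rho_1\cdots\rho_k$, $m_i(\rho,j)$ = number of $i+1$'s minus number of $i$'s in $\rho_j\cdots\rho_k$, $m_i(\rho)=\max_jm_i(\rho,j)$; $\mathsf{col}(T)$ reads entries down each column, columns right to left. If $m_i(\mathsf{col}(T))\le0$, $e_i(T)=0$; otherwise with $q$ the largest index with $m_i(\mathsf{col}(T),q)=m_i(\mathsf{col}(T))$, change to $i$ all entries $i+1$ to the right of $\mathsf{col}(T)_q$ in its row, then change to $i+1$ all entries $i$ in the same columns as these entries. *)

theory Defs
  imports "HOL-Combinatorics.Permutations"
begin

definition S_infty :: "(nat \<Rightarrow> nat) set" where
  "S_infty = {w. w permutes {1..} \<and> finite {x. w x \<noteq> x}}"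

definition word_perm :: "nat list \<Rightarrow> nat \<Rightarrow> nat" where
  "word_perm r = foldr (\<lambda>i f. transpose i (Suc i) \<circ> f) r id"

definition reduced_words :: "(nat \<Rightarrow> nat) \<Rightarrow> nat list set" where
  "reduced_words w = {r. is_arg_min length (\<lambda>u. set u \<subseteq> {1..} \<and> word_perm u = w) r}"

definition flag :: "(nat \<Rightarrow> nat) \<Rightarrow> bool" where
  "flag \<phi> \<longleftrightarrow> mono_on {1..} \<phi> \<and> (\<forall>m\<ge>1. m \<le> \<phi> m)"

text \<open>A factorization \<open>(r\<^sup>k | \<dots> | r\<^sup>1)\<close> is the list of its components in reading order, so the
  component with number \<open>j\<close> is the \<open>j\<close>-th one from the right. Components with a number beyond the
  length count as empty, in accordance with padding on the left.\<close>

type_synonym factorization = "nat list list"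

definition component :: "factorization \<Rightarrow> nat \<Rightarrow> nat list" where
  "component F j = (if 1 \<le> j \<and> j \<le> length F then F ! (length F - j) else [])"

definition increasing_factorization :: "factorization \<Rightarrow> nat list \<Rightarrow> bool" where
  "increasing_factorization F r \<longleftrightarrow> concat F = r \<and> (\<forall>s\<in>set F. sorted_wrt (<) s)"

definition flagged :: "(nat \<Rightarrow> nat) \<Rightarrow> factorization \<Rightarrow> bool" where
  "flagged \<phi> F \<longleftrightarrow> (\<forall>j\<ge>1. component F j \<noteq> [] \<longrightarrow> j \<le> \<phi> (hd (component F j)))"

definition RFC :: "(nat \<Rightarrow> nat) \<Rightarrow> (nat \<Rightarrow> nat) \<Rightarrow> factorization set" where
  "RFC w \<phi> = {F. (\<exists>r\<in>reduced_words w. increasing_factorization F r) \<and> flagged \<phi> F}"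

text \<open>\<open>remaining A bs\<close> is what is left of \<open>A\<close> after each letter of \<open>bs\<close>, in list order, has been
  paired with the smallest larger letter still available.\<close>

fun remaining :: "nat set \<Rightarrow> nat list \<Rightarrow> nat set" where
  "remaining A [] = A"
| "remaining A (b # bs) =
     remaining (if \<exists>a\<in>A. b < a then A - {Min {a \<in> A. b < a}} else A) bs"

definition unpaired :: "nat \<Rightarrow> factorization \<Rightarrow> nat set" where
  "unpaired i F = remaining (set (component F (Suc i))) (rev (component F i))"

text \<open>For both raising operators, \<open>None\<close> stands for the value \<open>0\<close>.\<close>

definition raise_fact :: "nat \<Rightarrow> factorization \<Rightarrow> factorization option" where
  "raise_fact i F =
     (if unpaired i F = {} then None
      else let a = Max (unpaired i F);
               s = (LEAST t. a + t + 1 \<notin> set (component F (Suc i)))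
           in Some (F[length F - Suc i := remove1 a (component F (Suc i)),
                      length F - i := insort (a + s) (component F i)]))"

inductive ck_step :: "nat list \<Rightarrow> nat list \<Rightarrow> bool" where
  "y < x \<Longrightarrow> x < z \<Longrightarrow> ck_step (a @ [x, y, z] @ b) (a @ [x, z, y] @ b)"
| "y < z \<Longrightarrow> z < x \<Longrightarrow> ck_step (a @ [x, y, z] @ b) (a @ [y, x, z] @ b)"
| "ck_step (a @ [i, i + 1, i] @ b) (a @ [i + 1, i, i + 1] @ b)"

definition coxeter_knuth :: "nat list \<Rightarrow> nat list \<Rightarrow> bool" where
  "coxeter_knuth = equivclp ck_step"

text \<open>A tableau maps boxes (row, column) to entries; its diagram is its domain. Rows are indexed
  upward, so a lower row has a smaller index; columns start at 1.\<close>

type_synonym tableau = "int \<times> nat \<rightharpoonup> nat"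

fun runs :: "nat list \<Rightarrow> nat list list" where
  "runs [] = []"
| "runs [x] = [[x]]"
| "runs (x # y # zs) =
     (if x < y then (x # hd (runs (y # zs))) # tl (runs (y # zs)) else [x] # runs (y # zs))"

fun rows_below :: "int \<Rightarrow> nat list list \<Rightarrow> int list" where
  "rows_below p [] = []"
| "rows_below p (s # ss) =
     (let q = (if int (hd s) < p then int (hd s) else p - 1) in q # rows_below q ss)"

fun run_rows :: "nat list list \<Rightarrow> int list" where
  "run_rows [] = []"
| "run_rows (s # ss) = int (hd s) # rows_below (int (hd s)) ss"

definition weak_des_tab :: "nat list \<Rightarrow> tableau" where
  "weak_des_tab \<rho> = (\<lambda>(r, c).
     case map_of (zip (run_rows (runs \<rho>)) (runs \<rho>)) r of
       None \<Rightarrow> None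
     | Some s \<Rightarrow> if 1 \<le> c \<and> c \<le> length s then Some (s ! (c - 1)) else None)"

definition virtual :: "nat list \<Rightarrow> bool" where
  "virtual \<rho> \<longleftrightarrow> (\<exists>(r, c)\<in>dom (weak_des_tab \<rho>). r \<le> 0)"

definition des :: "nat list \<Rightarrow> nat \<Rightarrow> nat" where
  "des \<rho> i = card {c. (int i, c) \<in> dom (weak_des_tab \<rho>)}"

definition comp_le :: "(nat \<Rightarrow> nat) \<Rightarrow> (nat \<Rightarrow> nat) \<Rightarrow> bool" where
  "comp_le \<mu> \<nu> \<longleftrightarrow> (\<forall>k. (\<Sum>i=1..k. \<mu> i) \<le> (\<Sum>i=1..k. \<nu> i))"

definition word_le :: "nat list \<Rightarrow> nat list \<Rightarrow> bool" where
  "word_le \<rho> \<tau> \<longleftrightarrow> coxeter_knuth \<rho> \<tau> \<and> comp_le (des \<rho>) (des \<tau>)"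

definition minimal_in_class :: "nat list \<Rightarrow> nat list \<Rightarrow> bool" where
  "minimal_in_class \<rho> \<sigma> \<longleftrightarrow> coxeter_knuth \<rho> \<sigma> \<and> \<not> virtual \<sigma> \<and>
     (\<forall>\<tau>. coxeter_knuth \<rho> \<tau> \<and> \<not> virtual \<tau> \<and> word_le \<tau> \<sigma> \<longrightarrow> \<tau> = \<sigma>)"

definition hat :: "nat list \<Rightarrow> nat list" where
  "hat \<rho> = (THE \<sigma>. minimal_in_class \<rho> \<sigma>)"

definition P_word :: "nat list \<Rightarrow> tableau" where
  "P_word \<rho> = weak_des_tab (hat \<rho>)"

definition P_hat :: "factorization \<Rightarrow> tableau" where
  "P_hat F = P_word (concat F)"

text \<open>\<open>left_diagram F j\<close> is the diagram of the insertion tableau of the word formed by the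
  components with numbers \<open>k, \<dots>, j\<close>; it is empty for \<open>j = k + 1\<close>.\<close>

definition left_diagram :: "factorization \<Rightarrow> nat \<Rightarrow> (int \<times> nat) set" where
  "left_diagram F j = dom (P_word (concat (take (Suc (length F) - j) F)))"

definition Q_hat :: "factorization \<Rightarrow> tableau" where
  "Q_hat F = (\<lambda>x.
     if x \<in> dom (P_hat F)
     then Some (THE j. j \<in> {1..length F} \<and> x \<in> left_diagram F j \<and> x \<notin> left_diagram F (Suc j))
     else None)"

definition col_boxes :: "tableau \<Rightarrow> (int \<times> nat) list" where
  "col_boxes T =
     concat (map (\<lambda>c. map (\<lambda>r. (r, c)) (rev (sorted_list_of_set {r. (r, c) \<in> dom T})))
       (rev (sorted_list_of_set (snd ` dom T))))"

definition col_word :: "tableau \<Rightarrow> nat list" where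
  "col_word T = map (\<lambda>x. the (T x)) (col_boxes T)"

text \<open>Positions in a word are counted from 0 here.\<close>

definition m_suffix :: "nat \<Rightarrow> nat list \<Rightarrow> nat \<Rightarrow> int" where
  "m_suffix i \<rho> j = int (count_list (drop j \<rho>) (Suc i)) - int (count_list (drop j \<rho>) i)"

definition m_max :: "nat \<Rightarrow> nat list \<Rightarrow> int" where
  "m_max i \<rho> = Max (m_suffix i \<rho> ` {..<length \<rho>})"

text \<open>The entry at the selected position \<open>q\<close> is itself an \<open>i + 1\<close> and is changed too: ``to the right''
  is meant weakly. The second change applies to those entries that are \<open>i\<close> in the original
  tableau. The empty word, for which \<open>m_max\<close> is unspecified, is sent to \<open>0\<close>.\<close>

definition raise_key :: "nat \<Rightarrow> tableau \<Rightarrow> tableau option" where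
  "raise_key i T =
     (let \<rho> = col_word T in
      if \<rho> = [] \<or> m_max i \<rho> \<le> 0 then None
      else let q = (GREATEST j. j < length \<rho> \<and> m_suffix i \<rho> j = m_max i \<rho>);
               (r, c) = col_boxes T ! q;
               X = {(r', c'). r' = r \<and> c \<le> c' \<and> T (r', c') = Some (Suc i)}
           in Some (\<lambda>x. if x \<in> X then Some i
                        else if T x = Some i \<and> snd x \<in> snd ` X then Some (Suc i)
                        else T x))"

end

theory Submission
  imports Defs
begin

text \<open>
  Edelman-Greene row insertion (\<open>tab\<close>) is a complete invariant of Coxeter-Knuth classes, and raising
  stays within a class. Hence \<open>P_hat\<close> is unchanged, and of the diagrams that define \<open>Q_hat\<close> only the one
  after component \<open>i + 1\<close> changes.

  The diagram of \<open>P_hat\<close> of a word is described by a left key: the set of rows meeting column \<open>j\<close>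
  consists of the letters of the first factor in the extremal factorization of the class into
  decreasing words for which column \<open>j\<close> comes first. Extremal factorizations exist and are unique
  for every permutation of the column lengths, by reflecting adjacent components. This gives nested
  columns, growth by one box per letter, and the key condition: when a box is added to column \<open>c\<close>
  in row \<open>r\<close>, every lower row that reaches column \<open>c\<close> also reaches column \<open>c + 1\<close>.

  Let the components \<open>x\<close> and \<open>y\<close>, with numbers \<open>i + 1\<close> and \<open>i\<close>, follow a prefix \<open>\<tau>\<close>, and let \<open>g c\<close> be the number
  of labels \<open>i + 1\<close> minus the number of labels \<open>i\<close> in the first \<open>c\<close> columns. By induction on the rows of the
  insertion tableau of \<open>\<tau>\<close>, the maximum of \<open>g\<close> is the number of unpaired letters of \<open>x\<close>, and raising
  removes one label \<open>i + 1\<close> from the smallest column \<open>d\<close> where \<open>g\<close> is maximal. Together with the key condition,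
  these column counts determine the new diagram, and it is the one that \<open>raise_key\<close> produces: the
  box selected there begins the horizontal run of labels \<open>i + 1\<close> that ends in column \<open>d\<close>.
\<close>

section \<open>Words\<close>

text \<open>Minimality, by which \<open>hat\<close> is defined, gives no hold on its diagram. The
  shape is therefore found first, as the left key, and only then is a word of that shape exhibited
  and shown to be the unique minimum (\<open>hat_word\<close>). Existence of the minimum and growth
  by one box come out on the way.

  Extremality is encoded by a number: raising as far as possible never decreases the sum of the
  squared component lengths, and the insertion tableau attains the maximum in its class. Such a sum
  is local, so extremality passes to blocks of a factorization and survives the exchange of a block
  for an equivalent one of the same lengths.

  Two symmetries transport results: reversing a word transposes its tableau, so columns are rows of
  the reversed word; reversing and complementing turns raising into lowering. Reducedness has to be
  stable under both.\<close>

lemma equivclp_map: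
  assumes "\<And>x y. r x y \<Longrightarrow> equivclp s (f x) (f y)" and "equivclp r x y"
  shows "equivclp s (f x) (f y)"
  using assms(2)
proof (induct rule: equivclp_induct)
  case base
  show ?case by simp
next
  case (step y z)
  then have "equivclp s (f y) (f z)"
    using assms(1) equivclp_sym by metis
  then show ?case using step(3) equivclp_trans by metis
qed

abbreviation ckeq (infix "\<approx>" 50) where "u \<approx> v \<equiv> coxeter_knuth u v"

section \<open>Commutation and braid moves; reducedness\<close>

inductive tstep :: "nat list \<Rightarrow> nat list \<Rightarrow> bool" where
  comm: "x + 1 < y \<Longrightarrow> tstep (a @ [x, y] @ b) (a @ [y, x] @ b)"
| braid: "tstep (a @ [i, i + 1, i] @ b) (a @ [i + 1, i, i + 1] @ b)"

definition tits :: "nat list \<Rightarrow> nat list \<Rightarrow> bool" where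
  "tits = equivclp tstep"

text \<open>By Tits' theorem this is reducedness, but only the easy direction is needed; the advantage
  of this form is that it is visibly stable under factors, reversal and complementation.\<close>

definition red :: "nat list \<Rightarrow> bool" where
  "red u \<longleftrightarrow> 0 \<notin> set u \<and> (\<forall>v a p q. tits u v \<longrightarrow> v \<noteq> p @ [a, a] @ q)"

lemma tits_refl [simp]: "tits u u"
  by (simp add: tits_def)

lemma tits_sym: "tits u v \<Longrightarrow> tits v u"
  unfolding tits_def by (rule equivclp_sym)

lemma tits_trans [trans]: "tits u v \<Longrightarrow> tits v w \<Longrightarrow> tits u w"
  unfolding tits_def by (rule equivclp_trans)

lemma tits_step: "tstep u v \<Longrightarrow> tits u v"
  unfolding tits_def by (rule r_into_equivclp)

lemma tits_cong: "tits u v \<Longrightarrow> tits (a @ u @ b) (a @ v @ b)"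
  unfolding tits_def
proof (rule equivclp_map[where f = "\<lambda>u. a @ u @ b"])
  fix x y assume "tstep x y"
  then have "tstep (a @ x @ b) (a @ y @ b)"
  proof cases
    case (comm x y p q)
    then show ?thesis using tstep.comm[of x y "a @ p" "q @ b"] by simp
  next
    case (braid p i q)
    then show ?thesis using tstep.braid[of "a @ p" i "q @ b"] by simp
  qed
  then show "equivclp tstep (a @ x @ b) (a @ y @ b)" by (rule r_into_equivclp)
qed

lemma tits_set: "tits u v \<Longrightarrow> set u = set v"
proof -
  have "tstep x y \<Longrightarrow> equivclp (=) (set x) (set y)" for x y
    by (induct rule: tstep.induct) auto
  then have "tits u v \<Longrightarrow> equivclp (=) (set u) (set v)"
    unfolding tits_def using equivclp_map[where f = set] by metis
  moreover have "equivclp (=) x y \<Longrightarrow> x = y" for x y :: "nat set"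
    by (induct rule: equivclp_induct) auto
  ultimately show "tits u v \<Longrightarrow> set u = set v" by blast
qed

lemma tits_rev: "tits u v \<Longrightarrow> tits (rev u) (rev v)"
  unfolding tits_def
proof (rule equivclp_map[where f = rev])
  fix x y assume "tstep x y"
  then show "equivclp tstep (rev x) (rev y)"
  proof cases
    case (comm x y p q)
    then show ?thesis
      using equivclp_sym[OF r_into_equivclp[of tstep, OF tstep.comm[of x y "rev q" "rev p"]]]
      by simp
  next
    case (braid p i q)
    then show ?thesis
      using r_into_equivclp[of tstep, OF tstep.braid[of "rev q" i "rev p"]] by simp
  qed
qed

text \<open>Complementation reverses the order of the letters; the bound keeps the truncated
  subtraction injective on the word.\<close>

lemma tits_map_compl: "tits u v \<Longrightarrow> set u \<subseteq> {..K} \<Longrightarrow> tits (map ((-) K) u) (map ((-) K) v)"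
proof -
  have *: "tits (map ((-) K) x) (map ((-) K) y)" if "tstep x y" "set x \<subseteq> {..K}" for x y
    using that
  proof (cases rule: tstep.cases)
    case (comm x y p q)
    then have "K - y + 1 < K - x" using that(2) by auto
    then show ?thesis
      using comm tits_sym[OF tits_step[OF tstep.comm[of "K - y" "K - x" "map ((-) K) p" "map ((-) K) q"]]]
        tits_step[OF tstep.comm[of "K - y" "K - x" "map ((-) K) p" "map ((-) K) q"]]
      by simp
  next
    case (braid p i q)
    then have "K - i = K - (i + 1) + 1" using that(2) by auto
    then show ?thesis
      using braid tits_sym[OF tits_step[OF tstep.braid[of "map ((-) K) p" "K - (i+1)" "map ((-) K) q"]]]
      by simp
  qed
  show "tits u v \<Longrightarrow> set u \<subseteq> {..K} \<Longrightarrow> ?thesis"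
    unfolding tits_def
  proof (induct rule: equivclp_induct)
    case base
    show ?case by simp
  next
    case (step y z)
    have s: "set y = set u" "set z = set u"
      using step(1,2) tits_set[of u y] tits_set[of y z] tits_step[of y z] tits_step[of z y]
      by (auto simp: tits_def)
    have "tits (map ((-) K) y) (map ((-) K) z)"
      using step(2,4) s *[of y z] *[of z y] tits_sym by auto
    then show ?case using step(3,4) tits_trans unfolding tits_def by blast
  qed
qed

lemma red_tits: "red u \<Longrightarrow> tits u v \<Longrightarrow> red v"
  unfolding red_def using tits_trans tits_set by metis

lemma red_factor: "red (a @ u @ b) \<Longrightarrow> red u"
  unfolding red_def
proof (intro conjI allI impI notI)
  assume r: "0 \<notin> set (a @ u @ b) \<and> (\<forall>v aa p q. tits (a @ u @ b) v \<longrightarrow> v \<noteq> p @ [aa, aa] @ q)"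
  show "0 \<in> set u \<Longrightarrow> False" using r by simp
  fix v c p q assume "tits u v" "v = p @ [c, c] @ q"
  then have "tits (a @ u @ b) ((a @ p) @ [c, c] @ (q @ b))"
    using tits_cong[of u v a b] by simp
  then show False using r by blast
qed

lemma red_appendD1: "red (u @ v) \<Longrightarrow> red u"
  using red_factor[of "[]" u v] by simp

lemma red_appendD2: "red (u @ v) \<Longrightarrow> red v"
  using red_factor[of u v "[]"] by simp

lemma red_pos: "red u \<Longrightarrow> x \<in> set u \<Longrightarrow> 0 < x"
  unfolding red_def by (metis gr0I)

lemma not_red_double: "\<not> red (p @ [a, a] @ q)"
  unfolding red_def using tits_refl by blast

lemma red_rev: "red u \<Longrightarrow> red (rev u)"
  unfolding red_def
proof (intro conjI allI impI notI)
  assume r: "0 \<notin> set u \<and> (\<forall>v aa p q. tits u v \<longrightarrow> v \<noteq> p @ [aa, aa] @ q)"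
  show "0 \<in> set (rev u) \<Longrightarrow> False" using r by simp
  fix v c p q assume "tits (rev u) v" "v = p @ [c, c] @ q"
  then have "tits u (rev q @ [c, c] @ rev p)"
    using tits_rev[of "rev u" v] by simp
  then show False using r by blast
qed

lemma map_compl_compl: "set u \<subseteq> {..K} \<Longrightarrow> map ((-) K) (map ((-) K) u) = (u::nat list)"
  by (induct u) auto

text \<open>The bound is strict, because a letter \<open>K\<close> would be sent to 0, which
  \<open>red\<close> excludes.\<close>

lemma red_compl: "red u \<Longrightarrow> set u \<subseteq> {..<K} \<Longrightarrow> red (map ((-) K) u)"
  unfolding red_def
proof (intro conjI allI impI notI)
  assume r: "0 \<notin> set u \<and> (\<forall>v aa p q. tits u v \<longrightarrow> v \<noteq> p @ [aa, aa] @ q)"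
    and K: "set u \<subseteq> {..<K}"
  show "0 \<in> set (map ((-) K) u) \<Longrightarrow> False" using K by auto
  fix v c p q assume v: "tits (map ((-) K) u) v" "v = p @ [c, c] @ q"
  have "tits (map ((-) K) (map ((-) K) u)) (map ((-) K) v)"
    by (rule tits_map_compl[OF v(1)]) auto
  moreover have "map ((-) K) (map ((-) K) u) = u"
    by (rule map_compl_compl) (use K in auto)
  moreover have "map ((-) K) v = map ((-) K) p @ [K - c, K - c] @ map ((-) K) q"
    using v(2) by simp
  ultimately show False using r by metis
qed

section \<open>From permutations to words\<close>

lemma word_perm_append: "word_perm (u @ v) = word_perm u \<circ> word_perm v"
  unfolding word_perm_def by (induct u) (auto simp: comp_assoc)

lemma word_perm_tits: "tits u v \<Longrightarrow> word_perm u = word_perm v"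
proof -
  have c: "word_perm [x, y] = word_perm [y, x]" if "x + 1 < y" for x y
  proof
    fix z
    show "word_perm [x, y] z = word_perm [y, x] z"
      using that by (cases "z = x"; cases "z = Suc x"; cases "z = y"; cases "z = Suc y")
        (simp_all add: word_perm_def transpose_def)
  qed
  have b: "word_perm [i, i + 1, i] = word_perm [i + 1, i, i + 1]" for i
  proof
    fix z
    show "word_perm [i, i + 1, i] z = word_perm [i + 1, i, i + 1] z"
      by (cases "z = i"; cases "z = Suc i"; cases "z = Suc (Suc i)")
        (simp_all add: word_perm_def transpose_def)
  qed
  have "equivclp (=) (word_perm x) (word_perm y)" if "tstep x y" for x y
    using that
  proof cases
    case (comm x y p q)
    then show ?thesis using c[of x y] unfolding word_perm_append comm(1,2) by (metis equivclp_refl)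
  next
    case (braid p i q)
    then show ?thesis using b[of i] unfolding word_perm_append braid(1,2) by (metis equivclp_refl)
  qed
  then have "tits u v \<Longrightarrow> equivclp (=) (word_perm u) (word_perm v)"
    unfolding tits_def using equivclp_map[where f = word_perm] by metis
  moreover have "equivclp (=) x y \<Longrightarrow> x = y" for x y :: "nat \<Rightarrow> nat"
    by (induct rule: equivclp_induct) auto
  ultimately show "tits u v \<Longrightarrow> ?thesis" by blast
qed

lemma tits_length: "tits u v \<Longrightarrow> length u = length v"
proof -
  have "tstep x y \<Longrightarrow> equivclp (=) (length x) (length y)" for x y
    by (induct rule: tstep.induct) auto
  then have "tits u v \<Longrightarrow> equivclp (=) (length u) (length v)"
    unfolding tits_def using equivclp_map[where f = length] by metis
  moreover have "equivclp (=) x y \<Longrightarrow> x = y" for x y :: nat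
    by (induct rule: equivclp_induct) auto
  ultimately show "tits u v \<Longrightarrow> ?thesis" by blast
qed

text \<open>A doubled letter in an equivalent word cancels and leaves a shorter word for the same
  permutation.\<close>

lemma reduced_words_red:
  assumes "r \<in> reduced_words w"
  shows "red r"
  unfolding red_def
proof (intro conjI allI impI notI)
  have m: "set r \<subseteq> {1..}" "word_perm r = w"
    and l: "\<And>u. set u \<subseteq> {1..} \<Longrightarrow> word_perm u = w \<Longrightarrow> \<not> length u < length r"
    using assms unfolding reduced_words_def is_arg_min_def by auto
  show "0 \<in> set r \<Longrightarrow> False" using m by auto
  fix v a p q assume v: "tits r v" "v = p @ [a, a] @ q"
  have "word_perm [a, a] = id" unfolding word_perm_def by simp
  then have "word_perm (p @ q) = word_perm v"
    unfolding v(2) word_perm_append by (simp add: comp_assoc)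
  then have "word_perm (p @ q) = w" using word_perm_tits[OF v(1)] m by simp
  moreover have "set (p @ q) \<subseteq> {1..}" using tits_set[OF v(1)] m v(2) by auto
  moreover have "length (p @ q) < length r" using tits_length[OF v(1)] v(2) by simp
  ultimately show False using l by blast
qed

section \<open>Coxeter-Knuth equivalence\<close>

lemma ck_tits: "u \<approx> v \<Longrightarrow> tits u v"
  unfolding coxeter_knuth_def tits_def
proof (rule equivclp_map[where f = id, simplified])
  fix x y assume "ck_step x y"
  then show "equivclp tstep x y"
  proof cases
    case (1 y x z a b)
    then show ?thesis using r_into_equivclp[of tstep, OF tstep.comm[of y z "a @ [x]" b]] by simp
  next
    case (2 y z x a b)
    then show ?thesis
      using equivclp_sym[OF r_into_equivclp[of tstep, OF tstep.comm[of y x "a" "[z] @ b"]]]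
      by simp
  next
    case (3 a i b)
    then show ?thesis using r_into_equivclp[of tstep, OF tstep.braid[of a i b]] by simp
  qed
qed

lemma ck_refl [simp]: "u \<approx> u"
  by (simp add: coxeter_knuth_def)

lemma ck_sym: "u \<approx> v \<Longrightarrow> v \<approx> u"
  unfolding coxeter_knuth_def by (rule equivclp_sym)

lemma ck_trans [trans]: "u \<approx> v \<Longrightarrow> v \<approx> w \<Longrightarrow> u \<approx> w"
  unfolding coxeter_knuth_def by (rule equivclp_trans)

lemma ck_step_ck: "ck_step u v \<Longrightarrow> u \<approx> v"
  unfolding coxeter_knuth_def by (rule r_into_equivclp)

lemma ck_cong: "u \<approx> v \<Longrightarrow> a @ u @ b \<approx> a @ v @ b"
  unfolding coxeter_knuth_def
proof (rule equivclp_map[where f = "\<lambda>u. a @ u @ b"])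
  fix x y assume "ck_step x y"
  then have "ck_step (a @ x @ b) (a @ y @ b)"
  proof cases
    case (1 y x z p q)
    then show ?thesis using ck_step.intros(1)[of y x z "a @ p" "q @ b"] by simp
  next
    case (2 y z x p q)
    then show ?thesis using ck_step.intros(2)[of y z x "a @ p" "q @ b"] by simp
  next
    case (3 p i q)
    then show ?thesis using ck_step.intros(3)[of "a @ p" i "q @ b"] by simp
  qed
  then show "equivclp ck_step (a @ x @ b) (a @ y @ b)" by (rule r_into_equivclp)
qed

lemma ck_append: "u \<approx> v \<Longrightarrow> u' \<approx> v' \<Longrightarrow> u @ u' \<approx> v @ v'"
  using ck_cong[of u v "[]" u'] ck_cong[of u' v' v "[]"] ck_trans by auto

lemma ck_rev: "u \<approx> v \<Longrightarrow> rev u \<approx> rev v"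
  unfolding coxeter_knuth_def
proof (rule equivclp_map[where f = rev])
  fix x y assume "ck_step x y"
  then show "equivclp ck_step (rev x) (rev y)"
  proof cases
    case (1 y x z a b)
    then show ?thesis
      using r_into_equivclp[of ck_step, OF ck_step.intros(2)[of y x z "rev b" "rev a"]]
      by simp
  next
    case (2 y z x a b)
    then show ?thesis
      using r_into_equivclp[of ck_step, OF ck_step.intros(1)[of y z x "rev b" "rev a"]]
      by simp
  next
    case (3 a i b)
    then show ?thesis
      using r_into_equivclp[of ck_step, OF ck_step.intros(3)[of "rev b" i "rev a"]] by simp
  qed
qed

lemma ck_length: "u \<approx> v \<Longrightarrow> length u = length v"
  using ck_tits tits_length by blast

lemma ck_set: "u \<approx> v \<Longrightarrow> set u = set v"
  using ck_tits tits_set by blast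

lemma red_ck: "red u \<Longrightarrow> u \<approx> v \<Longrightarrow> red v"
  using ck_tits red_tits by blast

lemma ck_map_compl: "u \<approx> v \<Longrightarrow> set u \<subseteq> {..K} \<Longrightarrow> map ((-) K) u \<approx> map ((-) K) v"
proof -
  have *: "map ((-) K) x \<approx> map ((-) K) y" if "ck_step x y" "set x \<subseteq> {..K}" for x y
    using that
  proof (cases rule: ck_step.cases)
    case (1 y x z p q)
    then have "K - z < K - x" "K - x < K - y" using that(2) by auto
    then show ?thesis
      using 1 ck_sym[OF ck_step_ck[OF ck_step.intros(1)[of "K - z" "K - x" "K - y" "map ((-) K) p" "map ((-) K) q"]]]
      by simp
  next
    case (2 y z x p q)
    then have "K - x < K - z" "K - z < K - y" using that(2) by auto
    then show ?thesis
      using 2 ck_sym[OF ck_step_ck[OF ck_step.intros(2)[of "K - x" "K - z" "K - y" "map ((-) K) p" "map ((-) K) q"]]]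
      by simp
  next
    case (3 p i q)
    then have "K - i = K - (i + 1) + 1" using that(2) by auto
    then show ?thesis
      using 3 ck_sym[OF ck_step_ck[OF ck_step.intros(3)[of "map ((-) K) p" "K - (i+1)" "map ((-) K) q"]]]
      by simp
  qed
  show "u \<approx> v \<Longrightarrow> set u \<subseteq> {..K} \<Longrightarrow> ?thesis"
    unfolding coxeter_knuth_def
  proof (induct rule: equivclp_induct)
    case base
    show ?case by simp
  next
    case (step y z)
    have s: "set y = set u" "set z = set u"
      using step(1,2) ck_set[of u y] ck_set[of y z] ck_step_ck[of y z] ck_step_ck[of z y]
      by (auto simp: coxeter_knuth_def)
    have "map ((-) K) y \<approx> map ((-) K) z"
      using step(2,4) s *[of y z] *[of z y] ck_sym by auto
    then show ?case using step(3,4) ck_trans unfolding coxeter_knuth_def by blast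
  qed
qed

section \<open>Edelman-Greene row insertion\<close>

abbreviation incr :: "nat list \<Rightarrow> bool" where "incr \<equiv> sorted_wrt (<)"

text \<open>The bumped letter is returned as a list of length at most one. The special rule of
  Edelman-Greene insertion applies when the row contains both \<open>b\<close> and
  \<open>b + 1\<close>; only \<open>b\<close> is tested here, as reducedness supplies
  \<open>b + 1\<close> (\<open>red_next\<close>).\<close>

fun rowins :: "nat list \<Rightarrow> nat \<Rightarrow> nat list \<times> nat list" where
  "rowins [] b = ([b], [])"
| "rowins (a # R) b = (if b < a then (b # R, [a]) else if b = a then (a # R, [Suc a])
     else (a # fst (rowins R b), snd (rowins R b)))"

fun roww :: "nat list \<Rightarrow> nat list \<Rightarrow> nat list \<times> nat list" where
  "roww R [] = (R, [])"
| "roww R (b # bs) = (fst (roww (fst (rowins R b)) bs),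
     snd (rowins R b) @ snd (roww (fst (rowins R b)) bs))"

lemma rowins_length: "length (fst (rowins R b)) + length (snd (rowins R b)) = Suc (length R)"
  by (induct R) auto

lemma rowins_set: "x \<in> set (fst (rowins R b)) \<Longrightarrow> x \<in> set R \<or> x = b"
  by (induct R) (auto split: if_splits)

lemma rowins_nonempty [simp]: "fst (rowins R b) \<noteq> []"
  by (cases R) auto

lemma rowins_incr: "incr R \<Longrightarrow> incr (fst (rowins R b))"
  by (induct R) (auto dest: rowins_set)

lemma rowins_mem: "b \<in> set (fst (rowins R b))"
  by (induct R) auto

lemma rowins_hd_le: "hd (fst (rowins R b)) \<le> b"
  by (cases R) auto

lemma rowins_bump_gt: "w \<in> set (snd (rowins R b)) \<Longrightarrow> b < w"
  by (induct R) (auto split: if_splits)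

lemma rowins_snd: "snd (rowins R b) = [] \<or> (\<exists>w. snd (rowins R b) = [w])"
  by (induct R) auto

lemma rowins_bump_mem: "w \<in> set (snd (rowins R b)) \<Longrightarrow> w \<in> set R \<or> (w = Suc b \<and> b \<in> set R)"
  by (induct R) (auto split: if_splits)

lemma rowins_appended: "incr R \<Longrightarrow> snd (rowins R b) = [] \<Longrightarrow> fst (rowins R b) = R @ [b]"
  by (induct R) (auto split: if_splits)

lemma rowins_bump_le: "incr R \<Longrightarrow> x \<in> set R \<Longrightarrow> y < x \<Longrightarrow> \<exists>w. snd (rowins R y) = [w] \<and> w \<le> x"
  by (induct R) auto

text \<open>Half of the row bumping lemma: for an increasing pair the place of insertion moves to
  the right. If the first letter is appended, so is the second.\<close>

lemma rowins_up:
  assumes "incr R" "x < z" "snd (rowins (fst (rowins R x)) z) = [w]"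
  shows "\<exists>v. snd (rowins R x) = [v] \<and> v < w"
  using assms
proof (induct R)
  case Nil
  then show ?case by simp
next
  case (Cons a R)
  show ?case
  proof (cases "x \<le> a")
    case True
    then have w: "snd (rowins R z) = [w]" using Cons.prems by (auto split: if_splits)
    then have "w \<in> set R \<or> w = Suc z \<and> z \<in> set R" using rowins_bump_mem[of w R z] by simp
    moreover have "z < w" using w rowins_bump_gt[of w R z] by simp
    ultimately show ?thesis using True Cons.prems by auto
  next
    case False
    then show ?thesis using Cons by (auto split: if_splits)
  qed
qed

lemma roww_length: "length (fst (roww R u)) + length (snd (roww R u)) = length R + length u"
proof (induct u arbitrary: R)
  case (Cons b u)
  show ?case using Cons[of "fst (rowins R b)"] rowins_length[of R b] by simp
qed simp

lemma roww_append:
  "roww R (u @ v) = (fst (roww (fst (roww R u)) v), snd (roww R u) @ snd (roww (fst (roww R u)) v))"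
  by (induct u arbitrary: R) auto

lemma roww_nonempty: "R \<noteq> [] \<or> u \<noteq> [] \<Longrightarrow> fst (roww R u) \<noteq> []"
proof (induct u arbitrary: R)
  case (Cons b u)
  show ?case using Cons(1)[of "fst (rowins R b)"] by simp
qed auto

lemma roww_incr: "incr R \<Longrightarrow> incr (fst (roww R u))"
  by (induct u arbitrary: R) (auto simp: rowins_incr)

section \<open>Row insertion and the Coxeter-Knuth relations\<close>

lemma ck_r1: "y < x \<Longrightarrow> x < z \<Longrightarrow> [x, y, z] \<approx> [x, z, y]"
  using ck_step_ck[OF ck_step.intros(1)[of y x z "[]" "[]"]] by simp

lemma ck_r2: "y < z \<Longrightarrow> z < x \<Longrightarrow> [x, y, z] \<approx> [y, x, z]"
  using ck_step_ck[OF ck_step.intros(2)[of y z x "[]" "[]"]] by simp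

lemma ck_r3: "[i, Suc i, i] \<approx> [Suc i, i, Suc i]"
  using ck_step_ck[OF ck_step.intros(3)[of "[]" i "[]"]] by simp

lemma ck_Cons: "u \<approx> v \<Longrightarrow> a # u \<approx> a # v"
  using ck_cong[of u v "[a]" "[]"] by simp

text \<open>The small letter \<open>b\<close> crosses one letter \<open>r\<close> of the row at a
  time, with the left neighbour \<open>l\<close> of \<open>r\<close> as the witness
  \<open>b < l < r\<close>; the first letter has no left neighbour, so the motion stops behind
  it.\<close>

lemma ck_slide: "incr (a # R) \<Longrightarrow> b < a \<Longrightarrow> (a # R) @ [b] \<approx> a # b # R"
proof (induct R rule: rev_induct)
  case (snoc r R)
  define l where "l = last (a # R)"
  define P where "P = butlast (a # R)"
  have P: "a # R = P @ [l]" unfolding l_def P_def by (metis append_butlast_last_id list.simps(3))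
  have inc: "incr ((P @ [l]) @ [r])" using snoc.prems(1) P by (metis append_Cons)
  have "l \<in> set (a # R)" using P by simp
  then have "a \<le> l" using snoc.prems(1) by (auto simp: sorted_wrt_append)
  moreover have "l < r" using inc by (auto simp: sorted_wrt_append)
  ultimately have "[l, b, r] \<approx> [l, r, b]" using snoc.prems(2) ck_r1 by simp
  then have "P @ [l, r, b] \<approx> P @ [l, b, r]" using ck_cong[of _ _ P "[]"] ck_sym by auto
  moreover have e: "(a # R @ [r]) @ [b] = P @ [l, r, b]" "((a # R) @ [b]) @ [r] = P @ [l, b, r]"
    using arg_cong[OF P, of "\<lambda>u. u @ [r, b]"] arg_cong[OF P, of "\<lambda>u. u @ [b, r]"] by auto
  ultimately have "(a # R @ [r]) @ [b] \<approx> ((a # R) @ [b]) @ [r]" by (simp only: e)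
  also have "\<dots> \<approx> (a # b # R) @ [r]"
    by (rule ck_append[OF snoc.hyps]) (use snoc.prems in \<open>auto simp: sorted_wrt_append\<close>)
  finally show ?case by simp
qed simp

lemma tits_commute: "(\<And>x y. x \<in> set u \<Longrightarrow> y \<in> set v \<Longrightarrow> x + 1 < y) \<Longrightarrow> tits (u @ v) (v @ u)"
proof (induct u)
  case (Cons x u)
  have 1: "tits (x # v) (v @ [x])" if "\<And>y. y \<in> set v \<Longrightarrow> x + 1 < y" for v
    using that
  proof (induct v)
    case (Cons y v)
    have "tits (x # y # v) (y # x # v)"
      using tits_step[OF tstep.comm[of x y "[]" v]] Cons by simp
    also have "tits (y # x # v) (y # v @ [x])"
      using tits_cong[of "x # v" "v @ [x]" "[y]" "[]"] Cons by simp
    finally show ?case by simp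
  qed simp
  have "tits ((x # u) @ v) (x # v @ u)"
    using tits_cong[of "u @ v" "v @ u" "[x]" "[]"] Cons by simp
  also have "tits (x # v @ u) ((v @ [x]) @ u)"
    using tits_cong[OF 1, of v "[]" u] Cons by simp
  finally show ?case by simp
qed simp

text \<open>If the next letter were larger than \<open>Suc a\<close>, the final \<open>a\<close>
  would commute past all of \<open>R\<close> and meet the first \<open>a\<close>.\<close>

lemma red_next:
  assumes "incr (a # R)" "red ((a # R) @ [a])"
  obtains R0 where "R = Suc a # R0"
proof (cases R)
  case Nil
  then show ?thesis using assms not_red_double[of "[]" a "[]"] by simp
next
  case (Cons r R0)
  show ?thesis
  proof (cases "r = Suc a")
    case True
    then show ?thesis using Cons that by simp
  next
    case False
    then have "\<And>y. y \<in> set R \<Longrightarrow> a + 1 < y" using assms Cons by fastforce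
    then have "tits ([a] @ R) (R @ [a])" using tits_commute[of "[a]" R] by simp
    then have "tits ((a # R) @ [a]) ([a, a] @ R)"
      using tits_cong[OF tits_sym, of "[a] @ R" "R @ [a]" "[a]" "[]"] by simp
    then show ?thesis using red_tits[OF assms(2)] not_red_double[of "[]" a R] by force
  qed
qed

lemma rowins_ck: "incr R \<Longrightarrow> red (R @ [b]) \<Longrightarrow> R @ [b] \<approx> snd (rowins R b) @ fst (rowins R b)"
proof (induct R)
  case (Cons a R)
  consider "b < a" | "b = a" | "a < b" by linarith
  then show ?case
  proof cases
    case 1
    then show ?thesis using ck_slide[OF Cons.prems(1)] by simp
  next
    case 2
    then obtain R0 where R: "R = Suc a # R0" using red_next Cons.prems by blast
    \<comment> \<open>Sliding the inserted \<open>a\<close> behind \<open>Suc a\<close> creates the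
      factor \<open>a, Suc a, a\<close>; the braid relation then releases the bumped letter
      \<open>Suc a\<close> in front.\<close>
    have "a # (Suc a # R0) @ [a] \<approx> a # Suc a # a # R0"
      by (rule ck_Cons, rule ck_slide) (use Cons.prems R in auto)
    also have "\<dots> \<approx> [Suc a, a, Suc a] @ R0" using ck_append[OF ck_r3, of R0 R0 a] by simp
    finally show ?thesis using 2 R by simp
  next
    case 3
    have r: "red (R @ [b])" using red_appendD2[of "[a]" "R @ [b]"] Cons.prems by simp
    then have IH: "a # R @ [b] \<approx> a # snd (rowins R b) @ fst (rowins R b)"
      using Cons ck_Cons by simp
    show ?thesis
    proof (cases "snd (rowins R b) = []")
      case True
      then show ?thesis using IH 3 by simp
    next
      case False
      then obtain w where w: "snd (rowins R b) = [w]" using rowins_snd by blast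
      obtain h T where T: "fst (rowins R b) = h # T" by (meson rowins_nonempty list.exhaust)
      have "h \<le> b" using rowins_hd_le[of R b] T by simp
      moreover have "b < w" using rowins_bump_gt[of w R b] w by simp
      moreover have "a < h" using rowins_set[of h R b] T Cons.prems 3 by auto
      \<comment> \<open>The bumped letter \<open>w\<close> crosses the head \<open>a\<close>, with
        the first letter \<open>h\<close> of the new tail as the witness between them.\<close>
      ultimately have "[w, a, h] \<approx> [a, w, h]" using ck_r2 by simp
      then have "[a, w, h] @ T \<approx> [w, a, h] @ T" by (rule ck_append[OF ck_sym ck_refl])
      then show ?thesis using ck_trans[OF IH] w T 3 by simp
    qed
  qed
qed simp

text \<open>Compare the letters with the head \<open>a\<close>. If all of them pass it, the rest of
  the row decides; otherwise the head position emits a known letter, and the bumped words either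
  agree or differ by one relation.\<close>

lemma roww_ck1:
  assumes "incr R" "y < x" "x < z"
  shows "fst (roww R [x, y, z]) = fst (roww R [x, z, y])
    \<and> snd (roww R [x, y, z]) \<approx> snd (roww R [x, z, y])"
  using assms
proof (induct R)
  case Nil
  then show ?case by simp
next
  case (Cons a R)
  have bump: "snd (rowins R z) = [] \<or> (\<exists>w. snd (rowins R z) = [w] \<and> a < w \<and> z < w)" for z
    using rowins_snd[of R z] rowins_bump_mem[of _ R z] rowins_bump_gt[of _ R z] Cons.prems(1)
    by fastforce
  have up: "snd (rowins (fst (rowins R x)) z) = [] \<or>
      (\<exists>v w. snd (rowins (fst (rowins R x)) z) = [w] \<and> snd (rowins R x) = [v] \<and> v < w \<and> x < v \<and> a < v)"
    using rowins_snd[of "fst (rowins R x)" z] rowins_up[of R x z] bump[of x] Cons.prems by force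
  consider "a < y" | "y = a" | "y < a" "x < a" | "y < a" "x = a" | "y < a" "a < x" by linarith
  then show ?case
  proof cases
    case 1
    then show ?thesis using Cons by simp
  next
    case 2
    then show ?thesis using Cons.prems up by (auto intro!: ck_r1)
  next
    case 3
    then show ?thesis using Cons.prems bump[of z] by (auto intro!: ck_r1)
  next
    case 4
    then show ?thesis using Cons.prems bump[of z] by (auto intro!: ck_r1)
  next
    case 5
    then show ?thesis using Cons.prems up by (auto intro!: ck_r1)
  qed
qed

text \<open>The delicate case is \<open>x = a\<close>. Reducedness then puts \<open>Suc a\<close>
  next to the head, and the Knuth relation between the inserted words becomes a braid relation
  between the bumped ones.\<close>

lemma roww_ck2:
  assumes "incr R" "y < z" "z < x" "red (R @ [x])"
  shows "fst (roww R [x, y, z]) = fst (roww R [y, x, z])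
    \<and> snd (roww R [x, y, z]) \<approx> snd (roww R [y, x, z])"
  using assms
proof (induct R)
  case Nil
  then show ?case by simp
next
  case (Cons a R)
  have r: "red (R @ [x])" using red_appendD2[of "[a]" "R @ [x]"] Cons.prems by simp
  have bump: "snd (rowins R z) = [] \<or> (\<exists>w. snd (rowins R z) = [w] \<and> a < w \<and> z < w)" for z
    using rowins_snd[of R z] rowins_bump_mem[of _ R z] rowins_bump_gt[of _ R z] Cons.prems(1)
    by fastforce
  obtain h T where T: "fst (rowins R x) = h # T" by (meson rowins_nonempty list.exhaust)
  have h: "h \<le> x" using rowins_hd_le[of R x] T by simp
  have "\<exists>w. snd (rowins (fst (rowins R x)) z) = [w] \<and> w \<le> x"
    using rowins_bump_le[OF rowins_incr[of R x] rowins_mem Cons.prems(3)] Cons.prems(1) by simp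
  then obtain w where w: "snd (rowins (fst (rowins R x)) z) = [w]" "w \<le> x" by blast
  have zw: "z < w" using rowins_bump_gt[of w "fst (rowins R x)" z] w by simp
  have ah: "a < h" if "a < x" using rowins_set[of h R x] T Cons.prems that by auto
  consider "a < y" | "y = a" | "y < a" "x < a" | "y < a" "x = a" | "y < a" "a < x" "z \<le> a"
    | "y < a" "a < x" "a < z" by linarith
  then show ?case
  proof cases
    case 1
    then show ?thesis using Cons r by simp
  next
    case 2
    then show ?thesis using Cons.prems bump[of x] w zw by (auto intro!: ck_r2)
  next
    case 3
    then show ?thesis using Cons.prems by (cases R) (auto intro!: ck_r1)
  next
    case 4
    then obtain R0 where R: "R = Suc a # R0" using red_next[of a R] Cons.prems by auto
    show ?thesis using 4 Cons.prems R by (auto intro!: ck_sym[OF ck_r3])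
  next
    case 5
    then show ?thesis using Cons.prems bump[of x] T ah h by (auto intro!: ck_r2)
  next
    case 6
    then show ?thesis using Cons.prems bump[of x] w zw by (auto intro!: ck_r2)
  qed
qed

lemma roww_ck3:
  assumes "incr R" "red (R @ [i])" "red (R @ [Suc i])"
  shows "fst (roww R [i, Suc i, i]) = fst (roww R [Suc i, i, Suc i])
    \<and> snd (roww R [i, Suc i, i]) \<approx> snd (roww R [Suc i, i, Suc i])"
  using assms
proof (induct R)
  case Nil
  then show ?case by simp
next
  case (Cons a R)
  have r: "red (R @ [i])" "red (R @ [Suc i])"
    using red_appendD2[of "[a]" "R @ [i]"] red_appendD2[of "[a]" "R @ [Suc i]"] Cons.prems by auto
  consider "a < i" | "i = a" | "Suc i = a" | "Suc i < a" by linarith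
  then show ?case
  proof cases
    case 1
    then show ?thesis using Cons r by simp
  next
    case 2
    then obtain R0 where R: "R = Suc a # R0" using red_next[of a R] Cons.prems by auto
    show ?thesis using 2 R by (auto intro!: ck_r3)
  next
    case 3
    then obtain R0 where R: "R = Suc a # R0" using red_next[of a R] Cons.prems by auto
    show ?thesis using 3 R by (auto intro!: ck_r3)
  next
    case 4
    then show ?thesis using Cons.prems by (cases R) (auto intro!: ck_sym[OF ck_r1])
  qed
qed

lemma roww_equiv: "incr R \<Longrightarrow> red (R @ u) \<Longrightarrow> R @ u \<approx> snd (roww R u) @ fst (roww R u)"
proof (induct u arbitrary: R)
  case (Cons b u)
  let ?R = "fst (rowins R b)" and ?z = "snd (rowins R b)"
  have "red (R @ [b])" using Cons.prems red_appendD1[of "R @ [b]" u] by simp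
  then have 1: "R @ b # u \<approx> ?z @ ?R @ u"
    using ck_append[OF rowins_ck ck_refl, of R b u] Cons.prems by simp
  then have "red (?R @ u)" using red_appendD2[OF red_ck[OF Cons.prems(2)]] by simp
  then have "?R @ u \<approx> snd (roww ?R u) @ fst (roww ?R u)" using Cons rowins_incr by blast
  then have "?z @ ?R @ u \<approx> ?z @ snd (roww ?R u) @ fst (roww ?R u)" by (rule ck_append[OF ck_refl])
  then show ?case using ck_trans[OF 1] by simp
qed simp

lemma roww_ck_step:
  assumes "ck_step u v" "incr R" "red (R @ u)"
  shows "fst (roww R u) = fst (roww R v) \<and> snd (roww R u) \<approx> snd (roww R v)"
proof -
  have red': "red (R @ v)"
    by (rule red_ck[OF assms(3) ck_append[OF ck_refl ck_step_ck[OF assms(1)]]])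
  \<comment> \<open>Inserting \<open>p\<close> stays in the class, so the resulting row followed by
    \<open>t\<close> is a factor of a reduced word.\<close>
  have red3: "red (fst (roww R p) @ t)" if "red (R @ p @ t @ q)" for p t q
  proof -
    have 1: "red (R @ p)" using that red_appendD1[of "R @ p" "t @ q"] by simp
    have "R @ p @ t @ q \<approx> snd (roww R p) @ fst (roww R p) @ t @ q"
      using ck_append[OF roww_equiv[OF assms(2) 1], of "t @ q" "t @ q"] by simp
    then have "red (snd (roww R p) @ (fst (roww R p) @ t) @ q)" using red_ck[OF that] by simp
    then show ?thesis by (rule red_factor)
  qed
  have fin: ?thesis if "u = p @ t @ q" "v = p @ t' @ q"
      "fst (roww (fst (roww R p)) t) = fst (roww (fst (roww R p)) t')"
      "snd (roww (fst (roww R p)) t) \<approx> snd (roww (fst (roww R p)) t')" for p t t' q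
    using that ck_cong[OF that(4)] by (simp add: roww_append)
  note i = roww_incr[OF assms(2)]
  show ?thesis
    using assms(1)
  proof cases
    case (1 y x z p q)
    show ?thesis
      by (rule fin[OF 1(1,2)]) (use roww_ck1[OF i 1(3,4)] in auto)
  next
    case (2 y z x p q)
    have "red (fst (roww R p) @ [x])"
      using red3[of p "[x]" "[y, z] @ q"] assms(3) 2(1) by simp
    then show ?thesis
      by (intro fin[OF 2(1,2)]) (use roww_ck2[OF i 2(3,4)] in auto)
  next
    case (3 p j q)
    have "red (fst (roww R p) @ [j])" "red (fst (roww R p) @ [Suc j])"
      using red3[of p "[j]" "[Suc j, j] @ q"] red3[of p "[Suc j]" "[j, Suc j] @ q"] assms(3) red' 3
      by auto
    then show ?thesis
      by (intro fin[OF 3]) (use roww_ck3[OF i] in auto)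
  qed
qed

lemma roww_ck:
  assumes "u \<approx> v" "incr R" "red (R @ u)"
  shows "fst (roww R u) = fst (roww R v) \<and> snd (roww R u) \<approx> snd (roww R v)"
proof -
  have "equivclp ck_step u v" using assms(1) by (simp add: coxeter_knuth_def)
  then show ?thesis
  proof (induct rule: equivclp_induct)
    case (step y z)
    have y: "red (R @ y)"
      using red_ck[OF assms(3)] ck_append[OF ck_refl, of u y R] step(1) by (simp add: coxeter_knuth_def)
    from step(2) have "y \<approx> z"
      using ck_step_ck ck_sym by blast
    then have "red (R @ z)" using red_ck[OF y] ck_append[OF ck_refl, of y z R] by simp
    then have "fst (roww R y) = fst (roww R z) \<and> snd (roww R y) \<approx> snd (roww R z)"
      using step(2) roww_ck_step[OF _ assms(2), of y z] roww_ck_step[OF _ assms(2), of z y] y ck_sym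
      by metis
    then show ?case using step(3) ck_trans[of "snd (roww R u)" "snd (roww R y)"] by metis
  qed simp
qed

section \<open>The insertion tableau\<close>

function tab :: "nat list \<Rightarrow> nat list list" where
  "tab u = (if u = [] then [] else fst (roww [] u) # tab (snd (roww [] u)))"
  by auto
termination
proof (relation "measure length")
  fix u :: "nat list" assume "u \<noteq> []"
  then show "(snd (roww [] u), u) \<in> measure length"
    using roww_length[of "[]" u] roww_nonempty[of "[]" u] by (cases "fst (roww [] u)") auto
qed simp

declare tab.simps [simp del]

lemma bump_shorter: "u \<noteq> [] \<Longrightarrow> length (snd (roww [] u)) < length u"
  using roww_length[of "[]" u] roww_nonempty[of "[]" u] by (cases "fst (roww [] u)") auto

lemma tab_Nil [simp]: "tab [] = []"
  by (subst tab.simps) simp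

lemma red_bump: "red u \<Longrightarrow> red (snd (roww [] u))"
  using red_appendD1[OF red_ck[OF _ roww_equiv[of "[]" u]]] by simp

text \<open>\<open>tab\<close> computes whole rows, feeding the complete bumped word to the next
  row. So invariance of the first row and equivalence of the bumped words suffice for the
  induction.\<close>

lemma tab_ck: "red u \<Longrightarrow> u \<approx> v \<Longrightarrow> tab u = tab v"
proof (induct "length u" arbitrary: u v rule: less_induct)
  case less
  show ?case
  proof (cases "u = []")
    case True
    then show ?thesis using ck_length[OF less(3)] by simp
  next
    case False
    then have v: "v \<noteq> []" using ck_length[OF less(3)] by auto
    have *: "fst (roww [] u) = fst (roww [] v)" "snd (roww [] u) \<approx> snd (roww [] v)"
      using roww_ck[OF less(3), of "[]"] less(2) by auto
    have "tab (snd (roww [] u)) = tab (snd (roww [] v))"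
      by (rule less(1)[OF bump_shorter[OF False] red_bump[OF less(2)] *(2)])
    then show ?thesis using False v *(1) by (simp add: tab.simps[of u] tab.simps[of v])
  qed
qed

lemma tab_equiv: "red u \<Longrightarrow> u \<approx> concat (rev (tab u))"
proof (induct "length u" arbitrary: u rule: less_induct)
  case less
  show ?case
  proof (cases "u = []")
    case False
    have "snd (roww [] u) \<approx> concat (rev (tab (snd (roww [] u))))"
      by (rule less(1)[OF bump_shorter[OF False] red_bump[OF less(2)]])
    then have "snd (roww [] u) @ fst (roww [] u) \<approx> concat (rev (tab u))"
      using False by (subst tab.simps) (simp add: ck_append)
    then show ?thesis using ck_trans[OF roww_equiv[of "[]" u]] less(2) by simp
  qed simp
qed

lemma tab_eq_ck: "red u \<Longrightarrow> red v \<Longrightarrow> tab u = tab v \<Longrightarrow> u \<approx> v"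
  using tab_equiv[of u] ck_sym[OF tab_equiv[of v]] ck_trans[of u "concat (rev (tab u))" v] by simp

text \<open>Column strictness of two adjacent rows. It is the condition under which inserting
  \<open>V\<close> into \<open>U\<close> replaces the row letter by letter
  (\<open>roww_above\<close>).\<close>

definition above :: "nat list \<Rightarrow> nat list \<Rightarrow> bool" where
  "above U V \<longleftrightarrow> length U \<le> length V \<and> (\<forall>i<length U. V ! i < U ! i)"

lemma above_Nil [simp]: "above [] V"
  by (simp add: above_def)

lemma above_Cons: "above (u # U) V \<longleftrightarrow> (\<exists>v V'. V = v # V' \<and> v < u \<and> above U V')"
  by (cases V) (auto simp: above_def less_Suc_eq_0_disj)

lemma roww_pass: "\<forall>x\<in>set V. v < x \<Longrightarrow> roww (v # U) V = (v # fst (roww U V), snd (roww U V))"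
  by (induct V arbitrary: U) auto

lemma roww_Nil_incr: "incr V \<Longrightarrow> roww [] V = (V, [])"
proof (induct V)
  case (Cons v V)
  then show ?case using roww_pass[of V v "[]"] by simp
qed simp

lemma roww_above: "incr V \<Longrightarrow> above U V \<Longrightarrow> roww U V = (V, U)"
proof (induct U arbitrary: V)
  case Nil
  then show ?case by (simp add: roww_Nil_incr)
next
  case (Cons u U)
  then obtain v V' where V: "V = v # V'" "v < u" "above U V'" using above_Cons by blast
  have "roww U V' = (V', U)" using Cons V by simp
  moreover have "roww (v # U) V' = (v # fst (roww U V'), snd (roww U V'))"
    by (rule roww_pass) (use Cons.prems V in auto)
  ultimately show ?case using V by simp
qed

fun tableau :: "nat list list \<Rightarrow> bool" where
  "tableau [] = True"
| "tableau [R] = (incr R \<and> R \<noteq> [])"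
| "tableau (R # S # Rs) = (incr R \<and> above S R \<and> tableau (S # Rs))"

lemma tableau_Cons: "tableau (R # Rs) \<Longrightarrow> incr R \<and> R \<noteq> [] \<and> tableau Rs"
proof (induct Rs arbitrary: R)
  case (Cons S Rs)
  then show ?case by (cases R) (auto simp: above_def)
qed simp

lemma tab_append:
  assumes "u @ x \<noteq> []"
  shows "tab (u @ x) = fst (roww (fst (roww [] u)) x)
    # tab (snd (roww [] u) @ snd (roww (fst (roww [] u)) x))"
  by (subst tab.simps) (use assms in \<open>simp add: roww_append\<close>)

lemma roww_tableau: "tableau (R # Rs) \<Longrightarrow> roww [] (concat (rev (R # Rs))) = (R, concat (rev Rs))"
proof (induct Rs arbitrary: R)
  case Nil
  then show ?case by (simp add: roww_Nil_incr)
next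
  case (Cons S Rs)
  then have "roww [] (concat (rev (S # Rs))) = (S, concat (rev Rs))" by simp
  moreover have "roww S R = (R, S)" using Cons.prems by (simp add: roww_above)
  ultimately show ?case by (simp add: roww_append)
qed

lemma tab_tableau: "tableau Rs \<Longrightarrow> tab (concat (rev Rs)) = Rs"
proof (induct Rs)
  case (Cons R Rs)
  have "R \<noteq> []" "tableau Rs" using tableau_Cons[OF Cons.prems] by auto
  then show ?case
    using Cons roww_tableau[OF Cons.prems] by (subst tab.simps) simp
qed simp

section \<open>Shapes and reverse insertion\<close>

definition rlen :: "nat list \<Rightarrow> nat \<Rightarrow> nat" where
  "rlen u i = (if i < length (tab u) then length (tab u ! i) else 0)"

lemma rlen_Nil [simp]: "rlen [] i = 0"
  by (simp add: rlen_def)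

lemma rlen_0: "rlen u 0 = length (fst (roww [] u))"
  unfolding rlen_def by (subst (1 2) tab.simps) simp

lemma rlen_Suc: "rlen u (Suc i) = rlen (snd (roww [] u)) i"
  unfolding rlen_def by (subst (1 2) tab.simps) simp

lemma rlen_single: "rlen [w] = (rlen [])(0 := 1)"
proof
  fix k show "rlen [w] k = ((rlen [])(0 := 1)) k"
    by (cases k) (simp_all add: rlen_0 rlen_Suc)
qed

lemma rlen_ck: "red u \<Longrightarrow> u \<approx> v \<Longrightarrow> rlen u = rlen v"
  using tab_ck unfolding rlen_def by (simp add: fun_eq_iff)

text \<open>If the second insertion ends in the first row, its new box has row index 0. If both
  letters bump, the bumped letters are ordered like the inserted ones and the rest of the tableau
  decides. The remaining case, an appended first letter, excludes \<open>x < y\<close>.\<close>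

lemma rlen_two:
  "\<exists>i j. rlen (u @ [x]) = (rlen u)(i := Suc (rlen u i))
    \<and> rlen (u @ [x, y]) = (rlen (u @ [x]))(j := Suc (rlen (u @ [x]) j))
    \<and> (x < y \<longrightarrow> j \<le> i) \<and> (y < x \<longrightarrow> i < j)"
proof (induct "length u" arbitrary: u x y rule: less_induct)
  case less
  define R where "R = fst (roww [] u)"
  define s where "s = snd (roww [] u)"
  define R1 where "R1 = fst (rowins R x)"
  define xs where "xs = snd (rowins R x)"
  define R2 where "R2 = fst (rowins R1 y)"
  define ys where "ys = snd (rowins R1 y)"
  note d = R_def s_def R1_def xs_def R2_def ys_def
  have R: "incr R" "incr R1" unfolding d by (simp_all add: roww_incr rowins_incr)
  have r0: "rlen u 0 = length R" "rlen (u @ [x]) 0 = length R1" "rlen (u @ [x, y]) 0 = length R2"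
    by (simp_all add: rlen_0 roww_append d)
  have rS: "rlen u (Suc i) = rlen s i" "rlen (u @ [x]) (Suc i) = rlen (s @ xs) i"
    "rlen (u @ [x, y]) (Suc i) = rlen (s @ xs @ ys) i" for i
    by (simp_all add: rlen_Suc roww_append d)
  have lR: "length R1 + length xs = Suc (length R)" "length R2 + length ys = Suc (length R1)"
    unfolding d by (simp_all add: rowins_length)
  have Suc_upd: "f = g(Suc i := Suc (g (Suc i)))"
    if "f 0 = g 0" "\<And>k. f (Suc k) = f' k" "\<And>k. g (Suc k) = g' k" "f' = g'(i := Suc (g' i))"
    for f g f' g' :: "nat \<Rightarrow> nat" and i
  proof
    fix k show "f k = (g(Suc i := Suc (g (Suc i)))) k"
      using that by (cases k) auto
  qed
  have zero_upd: "f = g(0 := Suc (g 0))"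
    if "f 0 = Suc (g 0)" "\<And>k. f (Suc k) = f' k" "\<And>k. g (Suc k) = f' k"
    for f g f' :: "nat \<Rightarrow> nat"
  proof
    fix k show "f k = (g(0 := Suc (g 0))) k"
      using that by (cases k) auto
  qed
  have ne: "length s < length u" if "xs \<noteq> [] \<or> ys \<noteq> []" "xs = [] \<Longrightarrow> u \<noteq> []"
  proof -
    have "u \<noteq> []" using that d by (cases "u = []") auto
    then show ?thesis using bump_shorter d by blast
  qed
  show ?case
  proof (cases "ys = []")
    case True
    have yx: "\<not> y < x" 
    proof
      assume "y < x"
      then have "ys \<noteq> []" using rowins_bump_le[OF R(2) _ , of x y] rowins_mem[of x R] d by auto
      then show False using True by simp
    qed
    have j: "rlen (u @ [x, y]) = (rlen (u @ [x]))(0 := Suc (rlen (u @ [x]) 0))"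
      by (rule zero_upd[where f' = "rlen (s @ xs)"]) (use True r0 rS lR in auto)
    have "\<exists>i. rlen (u @ [x]) = (rlen u)(i := Suc (rlen u i))"
    proof (cases "xs = []")
      case True
      have "rlen (u @ [x]) = (rlen u)(0 := Suc (rlen u 0))"
        by (rule zero_upd[where f' = "rlen s"]) (use True r0 rS lR in auto)
      then show ?thesis by blast
    next
      case False
      then obtain v where v: "xs = [v]" using rowins_snd d by blast
      \<comment> \<open>The second letter 0 is a dummy: only the effect of the first insertion is
        used.\<close>
      obtain i where "rlen (s @ [v]) = (rlen s)(i := Suc (rlen s i))"
        using less[OF ne, of v 0] False by blast
      then have "rlen (u @ [x]) = (rlen u)(Suc i := Suc (rlen u (Suc i)))"
        by (intro Suc_upd[of _ _ "rlen (s @ [v])" "rlen s"]) (use v r0 rS lR in auto)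
      then show ?thesis by blast
    qed
    then show ?thesis using j yx by blast
  next
    case False
    then obtain w where w: "ys = [w]" using rowins_snd d by blast
    show ?thesis
    proof (cases "xs = []")
      case True
      have 1: "rlen (u @ [x]) = (rlen u)(0 := Suc (rlen u 0))"
        by (rule zero_upd[where f' = "rlen s"]) (use True r0 rS lR in auto)
      have xy: "\<not> x < y"
        using rowins_up[OF R(1), of x y w] w True d by auto
      show ?thesis
      \<comment> \<open>For empty \<open>u\<close> the bumped word is not shorter than
        \<open>u\<close>, so the induction hypothesis does not apply.\<close>
      proof (cases "u = []")
        case True
        then have "R = []" "s = []" using d by auto
        then have "rlen (u @ [x, y]) = (rlen (u @ [x]))(Suc 0 := Suc (rlen (u @ [x]) (Suc 0)))"
          using True \<open>xs = []\<close> w rS r0 lR rlen_single[of w]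
          by (intro Suc_upd[of _ _ "rlen [w]" "rlen []"]) auto
        then show ?thesis using 1 xy by blast
      next
        case False
        then have "length s < length u" using ne w by blast
        then obtain j where "rlen (s @ [w]) = (rlen s)(j := Suc (rlen s j))"
          using less[of s w 0] by blast
        then have "rlen (u @ [x, y]) = (rlen (u @ [x]))(Suc j := Suc (rlen (u @ [x]) (Suc j)))"
          by (intro Suc_upd[of _ _ "rlen (s @ [w])" "rlen s"]) (use w r0 rS lR True in auto)
        then show ?thesis using 1 xy by blast
      qed
    next
      case False
      then obtain v where v: "xs = [v]" using rowins_snd d by blast
      have lt: "length s < length u" using ne False by blast
      have vw: "x < y \<Longrightarrow> v < w" using rowins_up[OF R(1), of x y w] w v d by auto
      have wv: "y < x \<Longrightarrow> w < v"
      proof -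
        assume "y < x"
        then have "w \<le> x" using rowins_bump_le[OF R(2) _ , of x y] rowins_mem[of x R] d w by auto
        moreover have "x < v" using rowins_bump_gt[of v R x] v d by simp
        ultimately show ?thesis by simp
      qed
      obtain i j where ij: "rlen (s @ [v]) = (rlen s)(i := Suc (rlen s i))"
        "rlen (s @ [v, w]) = (rlen (s @ [v]))(j := Suc (rlen (s @ [v]) j))"
        "v < w \<longrightarrow> j \<le> i" "w < v \<longrightarrow> i < j"
        using less[OF lt, of v w] by blast
      have "rlen (u @ [x]) = (rlen u)(Suc i := Suc (rlen u (Suc i)))"
        by (intro Suc_upd[of _ _ "rlen (s @ [v])" "rlen s"]) (use ij v r0 rS lR in auto)
      moreover have "rlen (u @ [x, y]) = (rlen (u @ [x]))(Suc j := Suc (rlen (u @ [x]) (Suc j)))"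
        by (intro Suc_upd[of _ _ "rlen (s @ [v, w])" "rlen (s @ [v])"]) (use ij v w r0 rS lR in auto)
      ultimately show ?thesis using ij vw wv by (meson Suc_le_mono Suc_less_eq)
    qed
  qed
qed

lemma rlen_one: "\<exists>i. rlen (u @ [x]) = (rlen u)(i := Suc (rlen u i))"
  using rlen_two[of u x 0] by blast

text \<open>Reverse bumping in one row. Replacing the head on one side while meeting an equal letter
  on the other would, by \<open>red_next\<close>, repeat \<open>Suc\<close> of that letter in an
  increasing row.\<close>

lemma rowins_inj:
  assumes "incr R" "incr R'" "red (R @ [x])" "red (R' @ [x'])"
    and "fst (rowins R x) = fst (rowins R' x')" "snd (rowins R x) = [w]" "snd (rowins R' x') = [w]"
  shows "R = R' \<and> x = x'"
  using assms
proof (induct R arbitrary: R')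
  case (Cons a R)
  obtain a' R1 where R': "R' = a' # R1" using Cons.prems by (cases R') auto
  have nx: "S = Suc b # tl S" if i: "incr (b # S)" and j: "red (b # S @ [b])" for b S
  proof -
    have "red ((b # S) @ [b])" using j by simp
    then obtain R0 where "S = Suc b # R0" using red_next[OF i] by blast
    then show ?thesis by simp
  qed
  have gt: "x < w" "x' < w"
    using rowins_bump_gt[of w "a # R" x] rowins_bump_gt[of w R' x']
    unfolding Cons.prems(6,7) by simp_all
  have r: "red (R @ [x])" "red (R1 @ [x'])"
    using red_appendD2[of "[a]" "R @ [x]"] red_appendD2[of "[a']" "R1 @ [x']"] Cons.prems R' by auto
  have hd: "hd (fst (rowins R x)) \<le> x" "hd (fst (rowins R1 x')) \<le> x'"
    "fst (rowins R x) \<noteq> []" "fst (rowins R1 x') \<noteq> []"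
    by (simp_all add: rowins_hd_le)
  consider "x < a" "x' < a'" | "x < a" "x' = a'" | "x < a" "a' < x'" | "x = a" "x' < a'"
    | "x = a" "x' = a'" | "x = a" "a' < x'" | "a < x" "x' < a'" | "a < x" "x' = a'" | "a < x" "a' < x'"
    by linarith
  then show ?case
  proof cases
    case 2
    then show ?thesis using Cons.prems R' nx[of a' R1] by (cases R) auto
  next
    case 3
    then have e: "R = fst (rowins R1 x')" "a = w" using Cons.prems(5-7) R' by auto
    then have "hd R \<in> set R" using hd by simp
    then have "a < hd R" using Cons.prems(1) by simp
    then show ?thesis using e hd gt by simp
  next
    case 4
    then show ?thesis using Cons.prems R' nx[of a R] by (cases R1) auto
  next
    case 7
    then have e: "R1 = fst (rowins R x)" "a' = w" using Cons.prems(5-7) R' by auto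
    then have "hd R1 \<in> set R1" using hd by simp
    then have "a' < hd R1" using Cons.prems(2) R' by simp
    then show ?thesis using e hd gt by simp
  next
    case 9
    then show ?thesis using Cons.prems R' Cons.hyps[of R1] r by auto
  qed (use Cons.prems R' hd gt in auto)
qed simp

text \<open>Reverse insertion: the shapes before the insertion tell in which row the new box lies,
  so the bumping can be undone row by row.\<close>

lemma tab_cancel:
  assumes "red (u @ [x])" "red (v @ [y])" "tab (u @ [x]) = tab (v @ [y])" "rlen u = rlen v"
  shows "tab u = tab v \<and> x = y"
  using assms
proof (induct "length u" arbitrary: u v x y rule: less_induct)
  case less
  define R where "R = fst (roww [] u)"
  define s where "s = snd (roww [] u)"
  define R' where "R' = fst (roww [] v)"
  define s' where "s' = snd (roww [] v)"
  note d = R_def s_def R'_def s'_def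
  have iR: "incr R" "incr R'" unfolding d by (simp_all add: roww_incr)
  have ru: "red u" "red v" using less red_appendD1 by auto
  have e: "u \<approx> s @ R" "v \<approx> s' @ R'" using roww_equiv[of "[]"] ru d by auto
  have "s @ R @ [x] \<approx> u @ [x]" "s' @ R' @ [y] \<approx> v @ [y]"
    using ck_append[OF ck_sym[OF e(1)], of "[x]" "[x]"] ck_append[OF ck_sym[OF e(2)], of "[y]" "[y]"]
    by auto
  then have red3: "red (s @ R @ [x])" "red (s' @ R' @ [y])"
    using less(2,3) red_ck ck_sym by blast+
  then have rR: "red (R @ [x])" "red (R' @ [y])" using red_appendD2 by blast+
  have "R @ [x] \<approx> snd (rowins R x) @ fst (rowins R x)"
     "R' @ [y] \<approx> snd (rowins R' y) @ fst (rowins R' y)" using rowins_ck iR rR by auto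
  then have "red ((s @ snd (rowins R x)) @ fst (rowins R x))"
     "red ((s' @ snd (rowins R' y)) @ fst (rowins R' y))"
    using red_ck[OF red3(1) ck_append[OF ck_refl]] red_ck[OF red3(2) ck_append[OF ck_refl]] by auto
  then have rs: "red (s @ snd (rowins R x))" "red (s' @ snd (rowins R' y))"
    using red_appendD1 by blast+
  have t: "fst (rowins R x) = fst (rowins R' y)"
     "tab (s @ snd (rowins R x)) = tab (s' @ snd (rowins R' y))"
    using less(4) tab_append[of u "[x]"] tab_append[of v "[y]"] d by auto
  have rl: "length R = length R'" "rlen s = rlen s'"
    using fun_cong[OF less(5), of 0] fun_cong[OF less(5), of "Suc _"]
    by (auto simp: rlen_0 rlen_Suc d)
  then have ls: "length (snd (rowins R x)) = length (snd (rowins R' y))"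
    using rowins_length[of R x] rowins_length[of R' y] t by simp
  have tabu: "tab u = tab v" if "R = R'" "tab s = tab s'"
  proof (cases "u = []")
    case True
    then have "R' = []" using that d by simp
    then have "v = []" using roww_nonempty[of "[]" v] d by auto
    then show ?thesis using True by simp
  next
    case False
    then have "R' \<noteq> []" using that d roww_nonempty[of "[]" u] by auto
    then have "v \<noteq> []" using d by auto
    then show ?thesis using False that d by (simp add: tab.simps[of u] tab.simps[of v])
  qed
  show ?case
  proof (cases "snd (rowins R x) = []")
    case True
    then have "snd (rowins R' y) = []" using ls by simp
    then show ?thesis using True t rowins_appended iR tabu by simp
  next
    case False
    then obtain w w' where w: "snd (rowins R x) = [w]" "snd (rowins R' y) = [w']"
      using rowins_snd[of R x] rowins_snd[of R' y] ls by auto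
    have "u \<noteq> []" using False d by auto
    then have "length s < length u" using bump_shorter d by blast
    then have "tab s = tab s' \<and> w = w'"
      using less(1)[of s w s' w'] rs t w rl by simp
    then show ?thesis using rowins_inj[OF iR rR t(1) w(1)] w tabu by simp
  qed
qed

section \<open>Two adjacent components\<close>

abbreviation sl :: "nat set \<Rightarrow> nat list" where "sl \<equiv> sorted_list_of_set"

lemma sl_eqI: "incr xs \<Longrightarrow> set xs = X \<Longrightarrow> sl X = xs"
  using sorted_list_of_set_unique[of X xs] by (metis List.finite_set distinct_card strict_sorted_iff)

lemma incr_sl [simp]: "incr (sl X)"
  by (rule strict_sorted_list_of_set)

lemma sl_Un: "finite X \<Longrightarrow> finite Y \<Longrightarrow> (\<And>x y. x \<in> X \<Longrightarrow> y \<in> Y \<Longrightarrow> x < y) \<Longrightarrow> sl (X \<union> Y) = sl X @ sl Y"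
  by (rule sl_eqI) (auto simp: sorted_wrt_append)

lemma sl_run: "sl {a..<b} = [a..<b]"
  by (rule sl_eqI) auto

lemma sl_set: "incr xs \<Longrightarrow> sl (set xs) = xs"
  by (rule sl_eqI) auto

text \<open>Scanning the values upwards, \<open>pool A B t\<close> counts the letters of \<open>B\<close> below \<open>t\<close> not yet used
  by a larger letter of \<open>A\<close>; this matches the same letters of \<open>A\<close> as the pairing process.\<close>

fun pool :: "nat set \<Rightarrow> nat set \<Rightarrow> nat \<Rightarrow> nat" where
  "pool A B 0 = 0"
| "pool A B (Suc t) = (pool A B t - of_bool (t \<in> A)) + of_bool (t \<in> B)"

definition unp :: "nat set \<Rightarrow> nat set \<Rightarrow> nat set" where
  "unp A B = {a \<in> A. pool A B a = 0}"

definition pairedL :: "nat set \<Rightarrow> nat set \<Rightarrow> nat set" where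
  "pairedL A B = {a \<in> A. 0 < pool A B a}"

lemma pairedL_unp: "pairedL A B = A - unp A B" "pairedL A B \<union> unp A B = A"
  "pairedL A B \<inter> unp A B = {}"
  by (auto simp: pairedL_def unp_def)

lemma card_insert_top: "finite {x. x \<in> X \<and> x < t} \<Longrightarrow>
    card (X \<inter> {u..<Suc t}) = card (X \<inter> {u..<t}) + of_bool (u \<le> t \<and> t \<in> (X::nat set))"
proof -
  have "X \<inter> {u..<Suc t} = (if u \<le> t \<and> t \<in> X then insert t (X \<inter> {u..<t}) else X \<inter> {u..<t})"
    by (auto simp: less_Suc_eq)
  then show ?thesis by simp
qed

text \<open>Over all \<open>u <= t\<close>, \<open>pool A B t\<close> is the largest surplus of
  letters of \<open>B\<close> in \<open>[u, t)\<close> over letters of \<open>A\<close> strictly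
  between \<open>u\<close> and \<open>t\<close>. This is the upper estimate of each surplus;
  \<open>pool_attain\<close> says that one of them is attained.\<close>

lemma pool_lb: "u \<le> t \<Longrightarrow> card (B \<inter> {u..<t}) \<le> pool A B t + card (A \<inter> {Suc u..<t})"
proof (induct t)
  case (Suc t)
  then show ?case
    by (cases "u = Suc t"; cases "u = t") (auto simp: card_insert_top)
qed simp

lemma pool_eq: "u \<le> t \<Longrightarrow> (\<And>x. x \<in> A \<Longrightarrow> u \<le> x \<Longrightarrow> x < t \<Longrightarrow> 0 < pool A B x) \<Longrightarrow>
    pool A B t + card (A \<inter> {u..<t}) = pool A B u + card (B \<inter> {u..<t})"
proof (induct t)
  case (Suc t)
  show ?case
  proof (cases "u = Suc t")
    case False
    then have "pool A B t + card (A \<inter> {u..<t}) = pool A B u + card (B \<inter> {u..<t})"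
      and "t \<in> A \<Longrightarrow> 0 < pool A B t" using Suc by auto
    then show ?thesis using False Suc(2) by (auto simp: card_insert_top)
  qed simp
qed simp

lemma pool_total: "card (B \<inter> {..<t}) = card (pairedL A B \<inter> {..<t}) + pool A B t"
proof (induct t)
  case (Suc t)
  then show ?case
    using card_insert_top[of B t 0] card_insert_top[of "pairedL A B" t 0]
    by (auto simp: atLeast0LessThan pairedL_def)
qed simp

lemma pool_mono: "B \<subseteq> B' \<Longrightarrow> pool A B t \<le> pool A B' t"
proof (induct t)
  case (Suc t)
  then show ?case by (auto intro: add_mono diff_le_mono)
qed simp

lemma card_pairedL_le: "finite B \<Longrightarrow> finite A \<Longrightarrow> card (pairedL A B) \<le> card B"
proof -
  assume f: "finite B" "finite A"
  obtain N where N: "\<forall>x\<in>A \<union> B. x < N" using f finite_nat_set_iff_bounded[of "A \<union> B"] by blast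
  have "B \<inter> {..<N} = B" "pairedL A B \<inter> {..<N} = pairedL A B" using N by (auto simp: pairedL_def)
  then show ?thesis using pool_total[of B N A] by simp
qed

section \<open>Inserting one component after another\<close>

lemma above_slI:
  assumes "finite X" "finite Y" "\<And>x. x \<in> X \<Longrightarrow> card (X \<inter> {..<x}) < card (Y \<inter> {..<x})"
  shows "above (sl X) (sl Y)"
proof -
  have *: "i < length (sl Y) \<and> sl Y ! i < sl X ! i" if i: "i < length (sl X)" for i
  proof -
    let ?x = "sl X ! i"
    have x: "?x \<in> X" using i assms(1) nth_mem[of i "sl X"] by simp
    \<comment> \<open>The letter at position \<open>i\<close> has at least \<open>i\<close> letters
      of \<open>X\<close> below it, hence more than \<open>i\<close> letters of
      \<open>Y\<close>.\<close>
    have "set (take i (sl X)) \<subseteq> X \<inter> {..<?x}"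
    proof
      fix z assume "z \<in> set (take i (sl X))"
      then obtain j where j: "j < i" "z = sl X ! j" using i by (auto simp: in_set_conv_nth)
      then have "z < ?x" using sorted_wrt_nth_less[OF incr_sl[of X]] i by simp
      moreover have "z \<in> X" using j i assms(1) nth_mem[of j "sl X"] by auto
      ultimately show "z \<in> X \<inter> {..<?x}" by simp
    qed
    then have "card (set (take i (sl X))) \<le> card (X \<inter> {..<?x})"
      using assms(1) by (intro card_mono) auto
    moreover have "card (set (take i (sl X))) = i"
      using i by (subst distinct_card) (auto intro: distinct_take)
    ultimately have ic: "i < card (Y \<inter> {..<?x})" using assms(3)[OF x] by simp
    have Y: "(Y \<inter> {..<?x}) \<union> (Y \<inter> {?x..}) = Y" by auto
    have "sl ((Y \<inter> {..<?x}) \<union> (Y \<inter> {?x..})) = sl (Y \<inter> {..<?x}) @ sl (Y \<inter> {?x..})"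
      by (rule sl_Un) (use assms(2) in auto)
    then have s: "sl Y = sl (Y \<inter> {..<?x}) @ sl (Y \<inter> {?x..})" unfolding Y .
    have "sl Y ! i = sl (Y \<inter> {..<?x}) ! i" using ic by (subst s) (simp add: nth_append)
    then have "sl Y ! i \<in> set (sl (Y \<inter> {..<?x}))"
      using ic nth_mem[of i "sl (Y \<inter> {..<?x})"] by simp
    then have "sl Y ! i < ?x" using assms(2) by simp
    moreover have "i < length (sl Y)" using ic arg_cong[OF s, of length] by simp
    ultimately show ?thesis by simp
  qed
  have "length (sl X) \<le> length (sl Y)"
  proof (rule ccontr)
    assume "\<not> length (sl X) \<le> length (sl Y)"
    then have "length (sl Y) < length (sl X)" by simp
    from *[OF this] show False by simp
  qed
  then show ?thesis using * unfolding above_def by blast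
qed

text \<open>If every letter of \<open>A\<close> is matched, counting up to a letter of
  \<open>A\<close> finds more letters of \<open>B\<close> than of \<open>A\<close>. Pairs with
  \<open>unp A B = {}\<close> are thus two-row tableaux; they are the highest weight pairs, whence
  the prefix \<open>hw\<close>.\<close>

lemma hw_above:
  assumes "finite A" "finite B" "unp A B = {}"
  shows "above (sl A) (sl B)"
proof (rule above_slI[OF assms(1,2)])
  fix x assume x: "x \<in> A"
  have p: "0 < pool A B a" if "a \<in> A" for a using assms(3) that by (auto simp: unp_def)
  have "pool A B x + card (A \<inter> {0..<x}) = pool A B 0 + card (B \<inter> {0..<x})"
    by (rule pool_eq) (use p in auto)
  then show "card (A \<inter> {..<x}) < card (B \<inter> {..<x})" using p[OF x] by (simp add: atLeast0LessThan)
qed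

lemma length_filter_sl: "finite X \<Longrightarrow> length (filter Q (sl X)) = card {x \<in> X. Q x}"
proof -
  assume f: "finite X"
  have "length (filter Q (sl X)) = card (set (filter Q (sl X)))"
    by (rule distinct_card[symmetric]) simp
  moreover have "set (filter Q (sl X)) = {x \<in> X. Q x}" using f by auto
  ultimately show ?thesis by simp
qed

lemma rowins_prefix: "snd (rowins P s) \<noteq> [] \<Longrightarrow> rowins (P @ X) s = (fst (rowins P s) @ X, snd (rowins P s))"
  by (induct P) auto

lemma roww_snd_le: "length (snd (roww R u)) \<le> length u"
proof (induct u arbitrary: R)
  case (Cons b u)
  show ?case using Cons[of "fst (rowins R b)"] rowins_snd[of R b] by auto
qed simp

lemma roww_prefix:
  "length (snd (roww P S)) = length S \<Longrightarrow> roww (P @ X) S = (fst (roww P S) @ X, snd (roww P S))"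
proof (induct S arbitrary: P)
  case (Cons s S)
  have "length (snd (rowins P s)) \<le> 1" using rowins_snd[of P s] by auto
  then have "snd (rowins P s) \<noteq> []" "length (snd (roww (fst (rowins P s)) S)) = length S"
    using Cons.prems roww_snd_le[of "fst (rowins P s)" S] by auto
  then show ?case using Cons.hyps rowins_prefix by simp
qed simp

lemma rowins_count1:
  "length (filter ((<) t) P) \<le> Suc (length (filter ((<) t) (fst (rowins P s))))"
  by (induct P) auto

lemma rowins_count2:
  "incr P \<Longrightarrow> p \<in> set P \<Longrightarrow> s < p \<Longrightarrow> p \<le> t \<Longrightarrow>
    length (filter ((<) t) P) = length (filter ((<) t) (fst (rowins P s)))"
  by (induct P) auto

text \<open>A Hall condition: above \<open>s\<close> the row offers as many letters as are still to
  be inserted from \<open>s\<close> on. One insertion costs at most one of them, and none above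
  \<open>s'\<close> if some letter of the row lies in \<open>(s, s']\<close>.\<close>

lemma roww_bump_all:
  "incr P \<Longrightarrow> incr S \<Longrightarrow> (\<forall>s\<in>set S. length (filter ((\<le>) s) S) \<le> length (filter ((<) s) P)) \<Longrightarrow>
    length (snd (roww P S)) = length S"
proof (induct S arbitrary: P)
  case (Cons s S)
  have all: "filter ((\<le>) s) (s # S) = s # S"
    using Cons.prems(2) by (auto simp: filter_id_conv)
  then have n: "Suc (length S) \<le> length (filter ((<) s) P)"
    using Cons.prems(3) by simp
  then have "filter ((<) s) P \<noteq> []" by auto
  then obtain p where p: "p \<in> set P" "s < p" by (auto simp: filter_empty_conv)
  have b: "length (snd (rowins P s)) = 1" using rowins_bump_le[OF Cons.prems(1) p] by auto
  have "length (snd (roww (fst (rowins P s)) S)) = length S"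
  proof (rule Cons.hyps)
    show "\<forall>s'\<in>set S. length (filter ((\<le>) s') S) \<le> length (filter ((<) s') (fst (rowins P s)))"
    proof
      fix s' assume s': "s' \<in> set S"
      then have lt: "s < s'" using Cons.prems(2) by simp
      show "length (filter ((\<le>) s') S) \<le> length (filter ((<) s') (fst (rowins P s)))"
      proof (cases "\<exists>p\<in>set P. s < p \<and> p \<le> s'")
        case True
        then obtain p' where "p' \<in> set P" "s < p'" "p' \<le> s'" by blast
        then have "length (filter ((<) s') P) = length (filter ((<) s') (fst (rowins P s)))"
          using rowins_count2 Cons.prems(1) by blast
        moreover have "length (filter ((\<le>) s') (s # S)) \<le> length (filter ((<) s') P)"
          using Cons.prems(3) s' by simp
        ultimately show ?thesis using lt by simp
      next
        case False
        then have "filter ((<) s) P = filter ((<) s') P"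
          using lt by (intro filter_cong) (auto simp: not_le dest: less_trans)
        then have "length S \<le> length (filter ((<) s') (fst (rowins P s)))"
          using n rowins_count1[of s' P s] by simp
        then show ?thesis using length_filter_le[of "(\<le>) s'" S] by linarith
      qed
    qed
  qed (use Cons.prems rowins_incr in auto)
  then show ?case using b by simp
qed simp

lemma roww_pass_list:
  "\<forall>x\<in>set V. \<forall>p\<in>set P. p < x \<Longrightarrow> roww (P @ U) V = (P @ fst (roww U V), snd (roww U V))"
proof (induct P)
  case (Cons p P)
  then show ?case using roww_pass[of V p "P @ U"] by simp
qed simp

text \<open>Each inserted letter meets its equal, so the special rule keeps the row and passes the
  letter on increased by one.\<close>

lemma roww_run: "a \<le> c \<Longrightarrow> roww ([a..<Suc c] @ Q) [a..<c] = ([a..<Suc c] @ Q, [Suc a..<Suc c])"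
proof (induct "c - a" arbitrary: a)
  case (Suc n)
  then have ac: "a < c" by simp
  have 1: "[a..<Suc c] = a # [Suc a..<Suc c]" "[a..<c] = a # [Suc a..<c]"
    "[Suc a..<Suc c] = Suc a # [Suc (Suc a)..<Suc c]"
    using ac upt_conv_Cons by auto
  have IH: "roww ([Suc a..<Suc c] @ Q) [Suc a..<c] = ([Suc a..<Suc c] @ Q, [Suc (Suc a)..<Suc c])"
    by (rule Suc(1)) (use Suc(2) ac in auto)
  have "roww (a # [Suc a..<Suc c] @ Q) [Suc a..<c]
      = (a # fst (roww ([Suc a..<Suc c] @ Q) [Suc a..<c]), snd (roww ([Suc a..<Suc c] @ Q) [Suc a..<c]))"
    by (rule roww_pass) auto
  then have "roww (a # [Suc a..<Suc c] @ Q) [Suc a..<c] = (a # [Suc a..<Suc c] @ Q, [Suc (Suc a)..<Suc c])"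
    unfolding IH by simp
  then have "roww (a # [Suc a..<Suc c] @ Q) (a # [Suc a..<c])
      = (a # [Suc a..<Suc c] @ Q, Suc a # [Suc (Suc a)..<Suc c])"
    by (simp del: upt_Suc)
  then show ?case unfolding 1(1,2) using 1(3) by (metis append_Cons)
qed simp

lemma above_append: "length X = length Y \<Longrightarrow> above X Y \<Longrightarrow> above Q W \<Longrightarrow> above (X @ Q) (Y @ W)"
  unfolding above_def by (auto simp: nth_append)

lemma above_shift: "incr Q \<Longrightarrow> above Q V \<Longrightarrow> \<forall>q\<in>set Q. c < q \<Longrightarrow> above Q (c # V)"
  unfolding above_def
proof (intro conjI allI impI)
  fix i assume q: "incr Q" "length Q \<le> length V \<and> (\<forall>i<length Q. V ! i < Q ! i)" "\<forall>q\<in>set Q. c < q"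
    and i: "i < length Q"
  show "(c # V) ! i < Q ! i"
  proof (cases i)
    case (Suc k)
    then have "V ! k < Q ! k" "Q ! k < Q ! i" using q i sorted_wrt_nth_less[OF q(1), of k i] by auto
    then show ?thesis using Suc by simp
  qed (use q i in auto)
qed simp

text \<open>The word identity behind a raising: the first run loses its lowest letter
  \<open>a\<close>, the second gains the top letter \<open>c\<close>.\<close>

lemma tits_run: "a \<le> c \<Longrightarrow> tits ([a..<Suc c] @ [a..<c]) ([Suc a..<Suc c] @ [a..<Suc c])"
proof (induct c rule: dec_induct)
  case (step c)
  let ?X = "[a..<c]" and ?Y = "[a..<Suc c]" and ?Z = "[Suc a..<Suc c]"
  have e: "[a..<Suc (Suc c)] = ?Y @ [Suc c]" "?Y = ?X @ [c]" "[Suc a..<Suc (Suc c)] = ?Z @ [Suc c]"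
    using step(1) by auto
  have c1: "tits (?X @ [Suc c]) ([Suc c] @ ?X)" by (rule tits_commute) auto
  have b: "tits [c, Suc c, c] [Suc c, c, Suc c]" using tits_step[OF tstep.braid[of "[]" c "[]"]] by simp
  have "tits (?Y @ ([Suc c] @ ?X) @ [c]) (?Y @ (?X @ [Suc c]) @ [c])"
    by (rule tits_cong[OF tits_sym[OF c1]])
  also have "tits \<dots> ([] @ (?Z @ ?Y) @ [Suc c, c])"
    using tits_cong[OF step(3), of "[]" "[Suc c, c]"] by simp
  also have "[] @ (?Z @ ?Y) @ [Suc c, c] = (?Z @ ?X) @ [c, Suc c, c] @ []" using e(2) by simp
  also have "tits \<dots> ((?Z @ ?X) @ [Suc c, c, Suc c] @ [])" by (rule tits_cong[OF b])
  also have "(?Z @ ?X) @ [Suc c, c, Suc c] @ [] = ?Z @ (?X @ [Suc c]) @ [c, Suc c]" by simp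
  also have "tits \<dots> (?Z @ ([Suc c] @ ?X) @ [c, Suc c])" by (rule tits_cong[OF c1])
  finally show ?case unfolding e(1,3) using e(2) by simp
qed simp

text \<open>\<open>raise_fact\<close> on a pair of sets, made total. For an empty set of unmatched
  letters \<open>Max\<close> is unspecified, so the lemmas below assume a nonempty one.\<close>

definition raise :: "nat set \<times> nat set \<Rightarrow> nat set \<times> nat set" where
  "raise p = (let a = Max (unp (fst p) (snd p)) in
     (fst p - {a}, insert (a + (LEAST t. a + t + 1 \<notin> fst p)) (snd p)))"

text \<open>Everything rests on the decompositions of \<open>A\<close> into \<open>P\<close>, the
  run \<open>a..c\<close> and \<open>Q\<close>, and of \<open>B\<close> into \<open>S\<close>, the
  run \<open>a..c-1\<close> and \<open>V\<close>. Inserting \<open>B\<close> into \<open>A\<close>,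
  the letters of \<open>S\<close> bump inside \<open>P\<close>, the run is shifted and
  \<open>V\<close> replaces \<open>Q\<close>. The raised pair yields the same row and bumped word,
  so the two words have the same tableau.\<close>

lemma raise_data:
  assumes fin: "finite A" "finite B" and ne: "unp A B \<noteq> {}" and red: "red (sl A @ sl B)"
  obtains a c where "raise (A, B) = (A - {a}, insert c B)" "a \<in> unp A B"
    "\<And>x. x \<in> A \<Longrightarrow> a < x \<Longrightarrow> 0 < pool A B x"
    "a \<le> c" "{a..c} \<subseteq> A" "Suc c \<notin> A" "{a..<c} \<subseteq> B" "c \<notin> B" "\<And>x. x \<in> B \<Longrightarrow> Suc x \<noteq> a"
    "\<And>t. pool (A - {a}) (insert c B) t = pool A B t + of_bool (c < t)"
    "pool A B c - of_bool (c \<in> A - {a}) = 0"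
    "sl A @ sl B \<approx> sl (A - {a}) @ sl (insert c B)"
proof -
  define a where "a = Max (unp A B)"
  define s where "s = (LEAST t. a + t + 1 \<notin> A)"
  define c where "c = a + s"
  have fu: "finite (unp A B)" using fin by (simp add: unp_def)
  have au: "a \<in> unp A B" unfolding a_def using fu ne by simp
  have a: "a \<in> A" "pool A B a = 0" using au by (auto simp: unp_def)
  have gt: "0 < pool A B x" if "x \<in> A" "a < x" for x
    using that Max_ge[OF fu, of x] unfolding a_def[symmetric] by (fastforce simp: unp_def)
  obtain N where N: "\<forall>x\<in>A. x < N" using fin finite_nat_set_iff_bounded by blast
  have "a + N + 1 \<notin> A" using N by fastforce
  then have cA: "Suc c \<notin> A" unfolding c_def s_def using LeastI[of "\<lambda>t. a + t + 1 \<notin> A"] by simp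
  have ac: "a \<le> c" by (simp add: c_def)
  have run: "{a..c} \<subseteq> A"
  proof
    fix x assume x: "x \<in> {a..c}"
    show "x \<in> A"
    proof (cases "x = a")
      case False
      then have "x - a - 1 < s" using x c_def by auto
      then have "a + (x - a - 1) + 1 \<in> A" using not_less_Least[of "x - a - 1"] s_def by blast
      then show ?thesis using x False by auto
    qed (use a in simp)
  qed
  \<comment> \<open>The pool is empty at the unmatched letter \<open>a\<close>, but positive at
    every later letter of \<open>A\<close>. Inside the run it must therefore be refilled at each
    step, by a letter of \<open>B\<close>.\<close>
  have runB: "x \<in> B \<and> pool A B (Suc x) = 1" if "a \<le> x" "x < c" for x
    using that
  proof (induct x rule: dec_induct)
    case base
    then have "Suc a \<in> A" using run by auto
    then have "0 < pool A B (Suc a)" by (rule gt) simp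
    then show ?case using a by (simp split: if_splits)
  next
    case (step x)
    then have "Suc (Suc x) \<in> A" using run by auto
    then have "0 < pool A B (Suc (Suc x))" by (rule gt) (use step in simp)
    moreover have "Suc x \<in> A" "pool A B (Suc x) = 1" using step run by auto
    ultimately show ?case by (auto split: if_splits)
  qed
  have MB: "{a..<c} \<subseteq> B" using runB by auto
  \<comment> \<open>A letter \<open>a - 1\<close> of \<open>B\<close> would still be in the pool at
    \<open>a\<close>.\<close>
  have nB: "Suc x \<noteq> a" if "x \<in> B" for x using a(2) that by (cases a) auto
  have pc: "pool A B c - 1 = 0"
  proof (cases "a = c")
    case False
    then have x: "a \<le> c - 1" "c - 1 < c" "Suc (c - 1) = c" using c_def by auto
    show ?thesis using runB[OF x(1,2)] unfolding x(3) by simp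
  qed (use a in simp)
  define P where "P = A \<inter> {..<a}"
  define Q where "Q = A \<inter> {Suc c<..}"
  define S where "S = B \<inter> {..<a}"
  define V where "V = B \<inter> {c<..}"
  note PQ = P_def Q_def S_def V_def
  have f: "finite P" "finite Q" "finite S" "finite V" using fin PQ by auto
  have three: "sl X = sl X1 @ sl X2 @ sl X3"
    if "X = X1 \<union> X2 \<union> X3" "finite X1" "finite X2" "finite X3"
      "\<And>x y. x \<in> X1 \<Longrightarrow> y \<in> X2 \<union> X3 \<Longrightarrow> x < y" "\<And>x y. x \<in> X2 \<Longrightarrow> y \<in> X3 \<Longrightarrow> x < y" for X X1 X2 X3
    using sl_Un[of X1 "X2 \<union> X3"] sl_Un[of X2 X3] that by (simp add: Un_assoc)
  have slA: "sl A = sl P @ [a..<Suc c] @ sl Q"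
  proof -
    have "A = P \<union> {a..<Suc c} \<union> Q"
      using run cA by (auto simp: PQ)
    then show ?thesis unfolding sl_run[symmetric] by (rule three) (use f ac in \<open>auto simp: PQ\<close>)
  qed
  have slA': "sl (A - {a}) = sl P @ [Suc a..<Suc c] @ sl Q"
  proof -
    have "A - {a} = P \<union> {Suc a..<Suc c} \<union> Q"
      using run cA a ac by (auto simp: PQ)
    then show ?thesis unfolding sl_run[symmetric] by (rule three) (use f ac in \<open>auto simp: PQ\<close>)
  qed
  have Bsub: "insert c B = S \<union> {a..<Suc c} \<union> V"
    using MB ac by (auto simp: PQ less_Suc_eq)
  have slB': "sl (insert c B) = sl S @ [a..<Suc c] @ sl V"
    unfolding sl_run[symmetric] by (rule three[OF Bsub]) (use f ac in \<open>auto simp: PQ\<close>)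
  let ?P = "sl P" and ?Q = "sl Q" and ?S = "sl S" and ?V = "sl V"
  let ?C = "[a..<Suc c]" and ?M = "[a..<c]" and ?C' = "[Suc a..<Suc c]"
  have S1: "x + 1 < a" if "x \<in> S" for x using that nB[of x] by (auto simp: PQ)
  have cSC: "tits (?S @ ?C) (?C @ ?S)" by (rule tits_commute) (use S1 f in fastforce)
  have cSC': "tits (?S @ ?C') (?C' @ ?S)" by (rule tits_commute) (use S1 f in fastforce)
  have cQ: "tits ((?S @ ?M) @ ?Q) (?Q @ ?S @ ?M)"
    by (rule tits_commute) (use S1 f ac in \<open>fastforce simp: PQ\<close>)
  have cQ': "tits ((?S @ ?C) @ ?Q) (?Q @ ?S @ ?C)"
    by (rule tits_commute) (use S1 f ac in \<open>fastforce simp: PQ\<close>)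
  \<comment> \<open>With \<open>c\<close> in \<open>B\<close>, commutations bring two full runs
    \<open>a..c\<close> together, and \<open>tits_run\<close> then produces the square
    \<open>c, c\<close>.\<close>
  have cB: "c \<notin> B"
  proof
    assume "c \<in> B"
    then have "sl A @ sl B = (?P @ ?C) @ (?Q @ ?S @ ?C) @ ?V" using slA slB' by (simp add: insert_absorb)
    also have "tits \<dots> ((?P @ ?C) @ ((?S @ ?C) @ ?Q) @ ?V)" by (rule tits_cong[OF tits_sym[OF cQ']])
    also have "\<dots> = ?P @ (?C @ ?S) @ (?C @ ?Q @ ?V)" by simp
    also have "tits \<dots> (?P @ (?S @ ?C) @ (?C @ ?Q @ ?V))" by (rule tits_cong[OF tits_sym[OF cSC]])
    also have "\<dots> = (?P @ ?S) @ (?C @ ?M) @ ([c] @ ?Q @ ?V)" using ac by simp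
    also have "tits \<dots> ((?P @ ?S) @ (?C' @ ?C) @ ([c] @ ?Q @ ?V))" by (rule tits_cong[OF tits_run[OF ac]])
    also have "\<dots> = (?P @ ?S @ ?C' @ ?M) @ [c, c] @ (?Q @ ?V)" using ac by simp
    finally show False using red_tits[OF red] not_red_double by blast
  qed
  have slB: "sl B = ?S @ ?M @ ?V"
  proof -
    have "B = S \<union> {a..<c} \<union> V"
      using MB cB ac by (auto simp: PQ)
    then show ?thesis unfolding sl_run[symmetric] by (rule three) (use f ac in \<open>auto simp: PQ\<close>)
  qed
  \<comment> \<open>Commutations and one use of \<open>tits_run\<close> lead to the raised word.
    This shows that it is reduced, which the comparison of tableaux presupposes.\<close>
  have "sl A @ sl B = (?P @ ?C) @ (?Q @ ?S @ ?M) @ ?V" using slA slB by simp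
  also have "tits \<dots> ((?P @ ?C) @ ((?S @ ?M) @ ?Q) @ ?V)" by (rule tits_cong[OF tits_sym[OF cQ]])
  also have "\<dots> = ?P @ (?C @ ?S) @ (?M @ ?Q @ ?V)" by simp
  also have "tits \<dots> (?P @ (?S @ ?C) @ (?M @ ?Q @ ?V))" by (rule tits_cong[OF tits_sym[OF cSC]])
  also have "\<dots> = (?P @ ?S) @ (?C @ ?M) @ (?Q @ ?V)" by simp
  also have "tits \<dots> ((?P @ ?S) @ (?C' @ ?C) @ (?Q @ ?V))" by (rule tits_cong[OF tits_run[OF ac]])
  also have "\<dots> = ?P @ (?S @ ?C') @ (?C @ ?Q @ ?V)" by simp
  also have "tits \<dots> (?P @ (?C' @ ?S) @ (?C @ ?Q @ ?V))" by (rule tits_cong[OF cSC'])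
  also have "\<dots> = (?P @ ?C') @ ((?S @ ?C) @ ?Q) @ ?V" by simp
  also have "tits \<dots> ((?P @ ?C') @ (?Q @ ?S @ ?C) @ ?V)" by (rule tits_cong[OF cQ'])
  also have "\<dots> = sl (A - {a}) @ sl (insert c B)" using slA' slB' by simp
  finally have red': "red (sl (A - {a}) @ sl (insert c B))" using red_tits[OF red] by blast
  \<comment> \<open>At \<open>a\<close> the pool is 0, so by truncated subtraction deleting
    \<open>a\<close> changes nothing there; the new letter \<open>c\<close> adds one from
    \<open>c + 1\<close> on, where all letters of \<open>A\<close> were matched already.\<close>
  have pool': "pool (A - {a}) (insert c B) t = pool A B t + of_bool (c < t)" for t
  proof (induct t)
    case (Suc t)
    consider "t < c" "t \<noteq> a" | "t < c" "t = a" | "t = c" | "c < t" by linarith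
    then show ?case
    proof cases
      case 2
      then show ?thesis using Suc a by simp
    next
      case 3
      then show ?thesis using Suc pc cB run ac a by (cases "a = c") auto
    next
      case 4
      then show ?thesis using Suc gt[of t] ac by auto
    qed (use Suc in auto)
  qed simp
  have aQV: "above ?Q ?V"
  proof (rule above_slI)
    fix x assume x: "x \<in> Q"
    have p0: "pool A B (Suc c) = 0" using pc cB run ac by auto
    have "pool A B x + card (A \<inter> {Suc c..<x}) = pool A B (Suc c) + card (B \<inter> {Suc c..<x})"
      by (rule pool_eq) (use x gt ac in \<open>auto simp: PQ\<close>)
    moreover have "A \<inter> {Suc c..<x} = Q \<inter> {..<x}" "B \<inter> {Suc c..<x} = V \<inter> {..<x}"
      using cA by (auto simp: PQ Suc_le_eq) (metis Suc_lessI)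
    moreover have "0 < pool A B x" using x gt[of x] ac by (auto simp: PQ)
    ultimately show "card (Q \<inter> {..<x}) < card (V \<inter> {..<x})" using p0 by simp
  qed (use f in auto)
  \<comment> \<open>The pool vanishes at \<open>a\<close>, so \<open>pool_lb\<close> at
    \<open>a\<close> is the Hall condition of \<open>roww_bump_all\<close>.\<close>
  have all: "length (snd (roww ?P ?S)) = length ?S"
  proof (rule roww_bump_all)
    show "\<forall>s\<in>set ?S. length (filter ((\<le>) s) ?S) \<le> length (filter ((<) s) ?P)"
    proof
      fix s assume "s \<in> set ?S"
      then have "s < a" using f by (auto simp: PQ)
      then have "card (B \<inter> {s..<a}) \<le> card (A \<inter> {Suc s..<a})" using pool_lb[of s a B A] a by simp
      moreover have "B \<inter> {s..<a} = {x \<in> S. s \<le> x}" "A \<inter> {Suc s..<a} = {x \<in> P. s < x}"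
        by (auto simp: PQ)
      ultimately show "length (filter ((\<le>) s) ?S) \<le> length (filter ((<) s) ?P)"
        using f by (simp add: length_filter_sl)
    qed
  qed auto
  define P1 where "P1 = fst (roww ?P ?S)"
  have P1: "p < a" if "p \<in> set P1" for p
  proof -
    have sub: "set (fst (roww R u)) \<subseteq> set R \<union> set u" for R u
    proof (induct u arbitrary: R)
      case (Cons b u)
      then show ?case using Cons[of "fst (rowins R b)"] rowins_set[of _ R b] by fastforce
    qed simp
    then have "p \<in> P \<union> S" using that f unfolding P1_def by fastforce
    then show ?thesis by (auto simp: PQ)
  qed
  have rw: "roww (?P @ X) (?S @ Y) = (P1 @ fst (roww X Y), snd (roww ?P ?S) @ snd (roww X Y))"
    if "\<forall>y\<in>set Y. a \<le> y" for X Y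
  proof -
    have "roww (P1 @ X) Y = (P1 @ fst (roww X Y), snd (roww X Y))"
      by (rule roww_pass_list) (use that P1 in fastforce)
    then show ?thesis using roww_prefix[OF all, of X] unfolding P1_def by (simp add: roww_append)
  qed
  have VV: "\<forall>x\<in>set ?V. \<forall>p\<in>set ?C. p < x" using f by (auto simp: PQ)
  have r1: "roww (?C @ ?Q) (?M @ ?V) = (?C @ ?V, ?C' @ ?Q)"
    using roww_run[OF ac, of ?Q] roww_pass_list[OF VV, of ?Q] roww_above[OF incr_sl aQV]
    by (simp add: roww_append del: upt_Suc)
  have ab: "above (?C' @ ?Q) (?C @ ?V)"
  proof -
    have "above ?Q (c # ?V)" by (rule above_shift) (use aQV f in \<open>auto simp: PQ\<close>)
    moreover have "above ?C' ?M" unfolding above_def using ac by (simp del: upt_Suc)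
    ultimately have "above (?C' @ ?Q) (?M @ c # ?V)" by (intro above_append) auto
    then show ?thesis using ac by simp
  qed
  have "incr (?C @ ?V)" using f by (auto simp: sorted_wrt_append PQ)
  then have r2: "roww (?C' @ ?Q) (?C @ ?V) = (?C @ ?V, ?C' @ ?Q)" using roww_above ab by blast
  have g: "\<forall>y\<in>set (?M @ ?V). a \<le> y" "\<forall>y\<in>set (?C @ ?V). a \<le> y" using f ac by (auto simp: PQ)
  have "roww (sl A) (sl B) = roww (sl (A - {a})) (sl (insert c B))"
    unfolding slA slB slA' slB'
    using rw[OF g(1), of "?C @ ?Q"] rw[OF g(2), of "?C' @ ?Q"] r1 r2
    by (simp del: upt_Suc)
  then have "roww [] (sl A @ sl B) = roww [] (sl (A - {a}) @ sl (insert c B))"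
    by (simp add: roww_append roww_Nil_incr)
  moreover have "sl A \<noteq> []" using a(1) fin(1) by (metis empty_iff set_empty set_sorted_list_of_set)
  moreover have "sl (insert c B) \<noteq> []" using fin(2) by (metis insert_not_empty finite_insert sorted_list_of_set_eq_Nil_iff)
  ultimately have "tab (sl A @ sl B) = tab (sl (A - {a}) @ sl (insert c B))"
    by (subst (1 2) tab.simps) simp
  then have ck: "sl A @ sl B \<approx> sl (A - {a}) @ sl (insert c B)"
    using tab_eq_ck[OF red red'] by simp
  show thesis
  proof (rule that[of a c])
    show "raise (A, B) = (A - {a}, insert c B)" by (simp add: raise_def Let_def a_def c_def s_def)
    show "pool A B c - of_bool (c \<in> A - {a}) = 0" using pc a run ac by (cases "a = c") auto
  qed (use au gt ac run cA MB cB nB pool' ck in auto)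
qed

section \<open>Strings of raisings\<close>

definition gp :: "nat set \<times> nat set \<Rightarrow> bool" where
  "gp p \<longleftrightarrow> finite (fst p) \<and> finite (snd p) \<and> red (sl (fst p) @ sl (snd p))"

abbreviation wp :: "nat set \<times> nat set \<Rightarrow> nat list" where
  "wp p \<equiv> sl (fst p) @ sl (snd p)"

abbreviation up :: "nat set \<times> nat set \<Rightarrow> nat set" where
  "up p \<equiv> unp (fst p) (snd p)"

lemma finite_up: "gp p \<Longrightarrow> finite (up p)"
  by (simp add: gp_def unp_def)

lemma raise_step:
  assumes "gp p" "up p \<noteq> {}"
  shows "gp (raise p)" "wp p \<approx> wp (raise p)" "card (fst p) = Suc (card (fst (raise p)))"
    "card (snd (raise p)) = Suc (card (snd p))" "fst (raise p) \<subseteq> fst p" "snd p \<subseteq> snd (raise p)"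
    "up (raise p) = up p - {Max (up p)}" "pairedL (fst (raise p)) (snd (raise p)) = pairedL (fst p) (snd p)"
proof -
  obtain A B where p: "p = (A, B)" by fastforce
  have f: "finite A" "finite B" "red (sl A @ sl B)" and ne: "unp A B \<noteq> {}"
    using assms p by (auto simp: gp_def)
  obtain a c where d: "raise (A, B) = (A - {a}, insert c B)" "a \<in> unp A B"
    "\<And>x. x \<in> A \<Longrightarrow> a < x \<Longrightarrow> 0 < pool A B x" "a \<le> c" "c \<notin> B"
    "\<And>t. pool (A - {a}) (insert c B) t = pool A B t + of_bool (c < t)"
    "sl A @ sl B \<approx> sl (A - {a}) @ sl (insert c B)"
    by (rule raise_data[OF f(1,2) ne f(3)]) (rule that; assumption)
  have aA: "a \<in> A" "pool A B a = 0" using d(2) by (auto simp: unp_def)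
  have le: "x \<le> a" if "x \<in> A" "pool A B x = 0" for x
    using d(3)[of x] that by force
  then have M: "Max (unp A B) = a" using d(2) f(1) by (intro Max_eqI) (auto simp: unp_def)
  show "wp p \<approx> wp (raise p)" using d p by simp
  then show "gp (raise p)" using red_ck[OF f(3)] f d p by (simp add: gp_def)
  show "card (fst p) = Suc (card (fst (raise p)))" using d p f aA card_Suc_Diff1[of A a] by simp
  show "card (snd (raise p)) = Suc (card (snd p))" using d p f by simp
  show "fst (raise p) \<subseteq> fst p" "snd p \<subseteq> snd (raise p)" using d p by auto
  show u: "up (raise p) = up p - {Max (up p)}"
  proof -
    have le': "\<not> c < x" if "x \<in> A" "pool A B x = 0" for x using le[OF that] d(4) by simp
    have "unp (A - {a}) (insert c B) = unp A B - {a}"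
      using le' unfolding unp_def d(6) by auto
    then show ?thesis using p M d(1) by simp
  qed
  have "pairedL (fst (raise p)) (snd (raise p)) = (A - {a}) - (unp A B - {a})"
    using u M p d by (simp add: pairedL_unp)
  then show "pairedL (fst (raise p)) (snd (raise p)) = pairedL (fst p) (snd p)"
    using p d(2) by (auto simp: pairedL_unp)
qed

text \<open>Both letters can be read off the result: \<open>c\<close> is the last zero of
  \<open>Z\<close>, the pool after the letter of the first component has been served, and
  \<open>a\<close> is the lower end of the run of letters of \<open>B\<close> directly below
  \<open>c\<close>.\<close>

lemma raise_inj:
  assumes "gp p" "gp q" "up p \<noteq> {}" "up q \<noteq> {}" "raise p = raise q"
  shows "p = q"
proof -
  obtain A B A2 B2 where p: "p = (A, B)" "q = (A2, B2)" by fastforce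
  have f: "finite A" "finite B" "red (sl A @ sl B)" and ne: "unp A B \<noteq> {}"
    and f2: "finite A2" "finite B2" "red (sl A2 @ sl B2)" and ne2: "unp A2 B2 \<noteq> {}"
    using assms p by (auto simp: gp_def)
  obtain a c where d: "raise (A, B) = (A - {a}, insert c B)" "a \<in> unp A B"
    "\<And>x. x \<in> A \<Longrightarrow> a < x \<Longrightarrow> 0 < pool A B x" "a \<le> c" "{a..<c} \<subseteq> B" "c \<notin> B"
    "\<And>x. x \<in> B \<Longrightarrow> Suc x \<noteq> a"
    "\<And>t. pool (A - {a}) (insert c B) t = pool A B t + of_bool (c < t)"
    "pool A B c - of_bool (c \<in> A - {a}) = 0"
    by (rule raise_data[OF f(1,2) ne f(3)]) (rule that; assumption)
  obtain a2 c2 where d2: "raise (A2, B2) = (A2 - {a2}, insert c2 B2)" "a2 \<in> unp A2 B2"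
    "\<And>x. x \<in> A2 \<Longrightarrow> a2 < x \<Longrightarrow> 0 < pool A2 B2 x" "a2 \<le> c2" "{a2..<c2} \<subseteq> B2" "c2 \<notin> B2"
    "\<And>x. x \<in> B2 \<Longrightarrow> Suc x \<noteq> a2"
    "\<And>t. pool (A2 - {a2}) (insert c2 B2) t = pool A2 B2 t + of_bool (c2 < t)"
    "pool A2 B2 c2 - of_bool (c2 \<in> A2 - {a2}) = 0"
    by (rule raise_data[OF f2(1,2) ne2 f2(3)]) (rule that; assumption)
  define A' where "A' = A - {a}"
  define B' where "B' = insert c B"
  have e: "A' = A2 - {a2}" "B' = insert c2 B2" using assms(5) p d(1) d2(1) by (auto simp: A'_def B'_def)
  define Z where "Z t = pool A' B' t - of_bool (t \<in> A')" for t
  have Zc: "Z c = 0" using d(8)[of c] d(9) by (simp add: Z_def A'_def B'_def)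
  have Zc2: "Z c2 = 0" using d2(8)[of c2] d2(9) by (simp add: Z_def e)
  have Zgt: "0 < Z t" if "c < t" for t
    using that d(8)[of t] d(3)[of t] d(4) by (auto simp: Z_def A'_def B'_def)
  have Zgt2: "0 < Z t" if "c2 < t" for t
    using that d2(8)[of t] d2(3)[of t] d2(4) by (auto simp: Z_def e)
  have cc: "c = c2" using Zgt[of c2] Zgt2[of c] Zc Zc2 by (metis less_irrefl linorder_neqE_nat)
  then have BB: "B = B2" using d(6) d2(6) e B'_def by auto
  have "\<not> a < a2"
  proof
    assume "a < a2"
    then have "a2 - 1 \<in> {a..<c}" using d2(4) cc by auto
    then have "a2 - 1 \<in> B2" using d(5) BB by blast
    then show False using d2(7)[of "a2 - 1"] \<open>a < a2\<close> by simp
  qed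
  moreover have "\<not> a2 < a"
  proof
    assume "a2 < a"
    then have "a - 1 \<in> {a2..<c2}" using d(4) cc by auto
    then have "a - 1 \<in> B" using d2(5) BB by blast
    then show False using d(7)[of "a - 1"] \<open>a2 < a\<close> by simp
  qed
  ultimately have "a = a2" by simp
  then have "A = A2" using e(1) A'_def d(2) d2(2) by (auto simp: unp_def)
  then show ?thesis using p BB by simp
qed

text \<open>Raising leaves the matched letters in place and consumes the unmatched ones from the
  largest down; the invariants of the whole string follow from this.\<close>

lemma raise_iter:
  assumes "gp p" "k \<le> card (up p)" "q = (raise ^^ k) p"
  shows "gp q \<and> wp p \<approx> wp q \<and> card (fst p) = card (fst q) + k \<and> card (snd q) = card (snd p) + k
    \<and> fst q \<subseteq> fst p \<and> snd p \<subseteq> snd q \<and> up q \<subseteq> up p \<and> card (up p) = card (up q) + k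
    \<and> pairedL (fst q) (snd q) = pairedL (fst p) (snd p) \<and> (\<forall>x\<in>up q. \<forall>y\<in>up p - up q. x < y)"
  using assms(2,3)
proof (induct k arbitrary: q)
  case 0
  then show ?case using assms(1) by simp
next
  case (Suc k)
  define r where "r = (raise ^^ k) p"
  have r: "gp r" "wp p \<approx> wp r" "card (fst p) = card (fst r) + k" "card (snd r) = card (snd p) + k"
    "fst r \<subseteq> fst p" "snd p \<subseteq> snd r" "up r \<subseteq> up p" "card (up p) = card (up r) + k"
    "pairedL (fst r) (snd r) = pairedL (fst p) (snd p)" "\<forall>x\<in>up r. \<forall>y\<in>up p - up r. x < y"
    using Suc(1)[of r] Suc(2) by (auto simp: r_def)
  have q: "q = raise r" using Suc(3) by (simp add: r_def)
  have ne: "up r \<noteq> {}" using r(8) Suc(2) by auto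
  note s = raise_step[OF r(1) ne]
  have fr: "finite (up r)" by (rule finite_up[OF r(1)])
  have m: "Max (up r) \<in> up r" using ne fr by simp
  have lt: "x < Max (up r)" if "x \<in> up r" "x \<noteq> Max (up r)" for x
    using Max_ge[OF fr that(1)] that(2) by simp
  have "card (up r) = Suc (card (up q))"
    using s(7) q m fr card_Suc_Diff1[of "up r" "Max (up r)"] by simp
  moreover have "\<forall>x\<in>up q. \<forall>y\<in>up p - up q. x < y"
    using s(7) q r(10) lt by (metis Diff_iff empty_iff insert_iff)
  moreover have "wp p \<approx> wp q" using ck_trans[OF r(2) s(2)] q by simp
  ultimately show ?case using s r q by auto
qed

definition topp :: "nat set \<times> nat set \<Rightarrow> nat set \<times> nat set" where
  "topp p = (raise ^^ card (up p)) p"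

lemma topp:
  assumes "gp p"
  shows "gp (topp p)" "wp p \<approx> wp (topp p)" "up (topp p) = {}" "fst (topp p) = pairedL (fst p) (snd p)"
    "snd p \<subseteq> snd (topp p)" "card (fst p) + card (snd p) = card (fst (topp p)) + card (snd (topp p))"
proof -
  note i = raise_iter[OF assms order_refl topp_def]
  show "gp (topp p)" "wp p \<approx> wp (topp p)" "snd p \<subseteq> snd (topp p)"
    "card (fst p) + card (snd p) = card (fst (topp p)) + card (snd (topp p))" using i by auto
  show u: "up (topp p) = {}" using i finite_up[of "topp p"] by simp
  then show "fst (topp p) = pairedL (fst p) (snd p)"
    using i pairedL_unp(1)[of "fst (topp p)" "snd (topp p)"] by auto
qed

lemma roww_hw: "gp p \<Longrightarrow> up p = {} \<Longrightarrow> roww [] (wp p) = (sl (snd p), sl (fst p))"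
  using hw_above[of "fst p" "snd p"] by (simp add: gp_def roww_append roww_Nil_incr roww_above)

lemma sl_inj: "finite X \<Longrightarrow> finite Y \<Longrightarrow> sl X = sl Y \<Longrightarrow> X = Y"
  by (metis set_sorted_list_of_set)

lemma incr_ck_eq: "red u \<Longrightarrow> u \<approx> v \<Longrightarrow> incr u \<Longrightarrow> incr v \<Longrightarrow> u = v"
  using roww_ck[of u v "[]"] by (simp add: roww_Nil_incr)

lemma hw_unique:
  assumes "gp p" "gp q" "up p = {}" "up q = {}" "wp p \<approx> wp q"
  shows "p = q"
proof -
  have "fst (roww [] (wp p)) = fst (roww [] (wp q)) \<and> snd (roww [] (wp p)) \<approx> snd (roww [] (wp q))"
    by (rule roww_ck[OF assms(5)]) (use assms(1) in \<open>auto simp: gp_def\<close>)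
  then have s: "sl (snd p) = sl (snd q)" "sl (fst p) \<approx> sl (fst q)" using assms roww_hw by auto
  have "red (sl (fst p))" using assms(1) red_appendD1 by (auto simp: gp_def)
  then have "sl (fst p) = sl (fst q)" using incr_ck_eq s(2) by simp
  then show ?thesis using s(1) sl_inj assms(1,2) by (auto simp: gp_def intro: prod_eqI)
qed

lemma topp_ck: "gp p \<Longrightarrow> gp q \<Longrightarrow> wp p \<approx> wp q \<Longrightarrow> topp p = topp q"
proof -
  assume a: "gp p" "gp q" "wp p \<approx> wp q"
  have "wp (topp p) \<approx> wp q" by (rule ck_trans[OF ck_sym[OF topp(2)[OF a(1)]] a(3)])
  then have "wp (topp p) \<approx> wp (topp q)" by (rule ck_trans[OF _ topp(2)[OF a(2)]])
  then show ?thesis using hw_unique topp a by metis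
qed

lemma pairedL_ck: "gp p \<Longrightarrow> gp q \<Longrightarrow> wp p \<approx> wp q \<Longrightarrow> pairedL (fst p) (snd p) = pairedL (fst q) (snd q)"
  using topp_ck topp(4) by metis

lemma card_up: "gp p \<Longrightarrow> card (fst p) = card (pairedL (fst p) (snd p)) + card (up p)"
  using pairedL_unp(2,3)[of "fst p" "snd p"] card_Un_disjoint[of "pairedL (fst p) (snd p)" "up p"]
    finite_up[of p] by (auto simp: gp_def pairedL_def)

text \<open>Equivalent pairs have the same top, and equal lengths put them at the same distance from
  it; \<open>raise_inj\<close> leads back down.\<close>

lemma pair_unique:
  assumes "gp p" "gp q" "wp p \<approx> wp q" "card (fst p) = card (fst q)"
  shows "p = q"
proof -
  have k: "card (up p) = card (up q)"
    using card_up[OF assms(1)] card_up[OF assms(2)] pairedL_ck[OF assms(1-3)] assms(4) by simp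
  have "p = q" if "gp p" "gp q" "k \<le> card (up p)" "k \<le> card (up q)" "(raise ^^ k) p = (raise ^^ k) q" for k p q
    using that
  proof (induct k)
    case (Suc k)
    note i = raise_iter[OF Suc(2), of k "(raise ^^ k) p"] raise_iter[OF Suc(3), of k "(raise ^^ k) q"]
    have "up ((raise ^^ k) p) \<noteq> {}" "up ((raise ^^ k) q) \<noteq> {}" using i Suc by auto
    moreover have "gp ((raise ^^ k) p)" "gp ((raise ^^ k) q)" using i Suc by auto
    ultimately have "(raise ^^ k) p = (raise ^^ k) q" using raise_inj Suc(6) by simp
    then show ?case using Suc by simp
  qed simp
  then show ?thesis using topp_ck[OF assms(1-3)] k assms(1,2) unfolding topp_def by (metis order_refl)
qed

lemma raise_to:
  assumes "gp p" "gp q" "wp p \<approx> wp q" "card (fst q) \<le> card (fst p)"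
  shows "card (fst p) - card (fst q) \<le> card (up p)" "q = (raise ^^ (card (fst p) - card (fst q))) p"
proof -
  have "card (pairedL (fst q) (snd q)) \<le> card (fst q)" using card_up[OF assms(2)] by simp
  then show k: "card (fst p) - card (fst q) \<le> card (up p)"
    using card_up[OF assms(1)] pairedL_ck[OF assms(1-3)] by simp
  define r where "r = (raise ^^ (card (fst p) - card (fst q))) p"
  note i = raise_iter[OF assms(1) k r_def]
  have "wp p \<approx> wp r" using i by blast
  then have "wp q \<approx> wp r" by (rule ck_trans[OF ck_sym[OF assms(3)]])
  moreover have "gp r" "card (fst q) = card (fst r)" using i assms(4) by auto
  ultimately show "q = (raise ^^ (card (fst p) - card (fst q))) p"
    unfolding r_def[symmetric] by (intro pair_unique[OF assms(2)])
qed

section \<open>Lowering, by reversal and complementation\<close>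

definition cpl :: "nat \<Rightarrow> nat set \<times> nat set \<Rightarrow> nat set \<times> nat set" where
  "cpl K p = ((-) K ` snd p, (-) K ` fst p)"

lemma sl_compl: "finite X \<Longrightarrow> X \<subseteq> {..K} \<Longrightarrow> sl ((-) K ` X) = rev (map ((-) K) (sl X))"
proof (rule sl_eqI)
  assume f: "finite X" "X \<subseteq> {..K}"
  have "incr (rev (map ((-) K) xs))" if "incr xs" "set xs \<subseteq> {..K}" for xs
    using that
  proof (induct xs)
    case (Cons a xs)
    have "K - x < K - a" if "x \<in> set xs" for x
    proof -
      have "a < x" "x \<le> K" using that Cons.prems by auto
      then show ?thesis by simp
    qed
    then show ?case using Cons by (auto simp: sorted_wrt_append)
  qed simp
  then show "incr (rev (map ((-) K) (sl X)))" using f by simp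
qed simp

lemma wp_cpl: "gp p \<Longrightarrow> fst p \<union> snd p \<subseteq> {..K} \<Longrightarrow> wp (cpl K p) = rev (map ((-) K) (wp p))"
  by (simp add: cpl_def sl_compl gp_def)

lemma gp_cpl: "gp p \<Longrightarrow> fst p \<union> snd p \<subseteq> {..<K} \<Longrightarrow> gp (cpl K p)"
proof -
  assume a: "gp p" "fst p \<union> snd p \<subseteq> {..<K}"
  have "red (rev (map ((-) K) (wp p)))"
    by (rule red_rev[OF red_compl]) (use a in \<open>auto simp: gp_def\<close>)
  moreover have "fst p \<union> snd p \<subseteq> {..K}" using a by auto
  ultimately have "red (wp (cpl K p))" using wp_cpl a by metis
  then show ?thesis using a by (simp add: gp_def cpl_def)
qed

lemma image_compl_compl: "X \<subseteq> {..K} \<Longrightarrow> (-) K ` (-) K ` X = (X::nat set)"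
  by (force simp: image_iff)

lemma card_compl: "X \<subseteq> {..K} \<Longrightarrow> card ((-) K ` X) = card (X::nat set)"
  by (rule card_image, rule inj_onI) (metis atMost_iff diff_diff_cancel subsetD)

lemma gp_letters: "gp p \<Longrightarrow> fst p \<union> snd p = set (wp p)" "gp p \<Longrightarrow> 0 \<notin> fst p \<union> snd p"
  using red_pos[of "wp p" 0] by (auto simp: gp_def)

lemma cpl_bound': "gp p \<Longrightarrow> 0 < K \<Longrightarrow> fst (cpl K p) \<union> snd (cpl K p) \<subseteq> {..<K}"
proof -
  assume a: "gp p" "0 < K"
  have "K - y < K" if "y \<in> fst p \<union> snd p" for y
  proof -
    have "y \<noteq> 0" using that gp_letters(2)[OF a(1)] by metis
    then show ?thesis using a(2) by simp
  qed
  then show ?thesis by (auto simp: cpl_def)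
qed

text \<open>\<open>k\<close> raisings of the reversed complement. The second component is also given
  explicitly, since at the end of the string it becomes \<open>pairedR\<close>.\<close>

lemma lower_iter:
  assumes p: "gp p" "fst p \<union> snd p \<subseteq> {..<K}" and k: "k \<le> card (up (cpl K p))"
    and q: "q = cpl K ((raise ^^ k) (cpl K p))"
  shows "gp q" "wp p \<approx> wp q" "card (fst q) = card (fst p) + k" "card (snd p) = card (snd q) + k"
    "snd q = (-) K ` fst ((raise ^^ k) (cpl K p))" "snd q \<subseteq> snd p" "fst q \<union> snd q \<subseteq> {..<K}"
proof -
  define r where "r = (raise ^^ k) (cpl K p)"
  note i = raise_iter[OF gp_cpl[OF p] k r_def]
  have pK: "fst p \<union> snd p \<subseteq> {..K}" using p by auto
  have r: "gp r" "wp (cpl K p) \<approx> wp r" using i by auto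
  have lr: "fst r \<union> snd r = fst (cpl K p) \<union> snd (cpl K p)"
    using gp_letters(1)[OF r(1)] gp_letters(1)[OF gp_cpl[OF p]] ck_set[OF r(2)] by simp
  have rK: "fst r \<union> snd r \<subseteq> {..<K}"
  proof (cases "K = 0")
    case True
    then show ?thesis using lr p by (auto simp: cpl_def)
  next
    case False
    then show ?thesis using lr cpl_bound'[OF p(1)] by simp
  qed
  then have rK': "fst r \<union> snd r \<subseteq> {..K}" by auto
  show "gp q" using gp_cpl[OF r(1) rK] q r_def by simp
  have "rev (map ((-) K) (wp p)) \<approx> wp r" using r(2) wp_cpl[OF p(1) pK] by simp
  then have "map ((-) K) (rev (rev (map ((-) K) (wp p)))) \<approx> map ((-) K) (rev (wp r))"
    by (intro ck_map_compl ck_rev) auto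
  moreover have "map ((-) K) (rev (rev (map ((-) K) (wp p)))) = wp p"
    unfolding rev_rev_ident by (rule map_compl_compl) (use gp_letters(1)[OF p(1)] pK in simp)
  ultimately show "wp p \<approx> wp q" using wp_cpl[OF r(1) rK'] q r_def by (simp add: rev_map)
  show s: "snd q = (-) K ` fst ((raise ^^ k) (cpl K p))" using q by (simp add: cpl_def)
  have "fst r \<subseteq> (-) K ` snd p" using i by (simp add: cpl_def)
  then have "snd q \<subseteq> (-) K ` (-) K ` snd p" using s r_def by blast
  then show "snd q \<subseteq> snd p" using image_compl_compl[of "snd p" K] pK by auto
  show "card (fst q) = card (fst p) + k" "card (snd p) = card (snd q) + k"
    using i q r_def pK rK' by (auto simp: cpl_def card_compl)
  show "fst q \<union> snd q \<subseteq> {..<K}"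
    using gp_letters(1)[OF p(1)] gp_letters(1)[OF \<open>gp q\<close>] ck_set[OF \<open>wp p \<approx> wp q\<close>] p(2) by simp
qed

lemma pair_bound: "gp p \<Longrightarrow> \<exists>K. fst p \<union> snd p \<subseteq> {..<K}"
  using finite_nat_set_iff_bounded[of "fst p \<union> snd p"] by (auto simp: gp_def)

text \<open>The crystal reflection: move along the string by the difference of the lengths. The
  string is long enough, as the matched letters of either component number at most the length of the
  other.\<close>

lemma reflect:
  assumes "gp p"
  obtains q where "gp q" "wp p \<approx> wp q" "card (fst q) = card (snd p)" "card (snd q) = card (fst p)"
proof (cases "card (snd p) \<le> card (fst p)")
  case True
  define k where "k = card (fst p) - card (snd p)"
  have "card (pairedL (fst p) (snd p)) \<le> card (snd p)" using assms card_pairedL_le by (simp add: gp_def)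
  then have "k \<le> card (up p)" using card_up[OF assms] k_def by simp
  from raise_iter[OF assms this refl] show ?thesis
    by (intro that[of "(raise ^^ k) p"]) (use True k_def in auto)
next
  case False
  define k where "k = card (snd p) - card (fst p)"
  obtain K where K: "fst p \<union> snd p \<subseteq> {..<K}" using pair_bound[OF assms] by blast
  then have K': "fst p \<union> snd p \<subseteq> {..K}" by auto
  note g = gp_cpl[OF assms K]
  have "card (pairedL (fst (cpl K p)) (snd (cpl K p))) \<le> card (snd (cpl K p))"
    using g card_pairedL_le by (simp add: gp_def)
  then have "k \<le> card (up (cpl K p))"
    using card_up[OF g] k_def K' by (simp add: cpl_def card_compl)
  note l = lower_iter[OF assms K this refl]
  show ?thesis
    by (rule that[OF l(1,2)]) (use l(3,4) False k_def in linarith)+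
qed

text \<open>Converse of \<open>pool_lb\<close>: a positive pool has been filling up since its last
  empty moment, and \<open>t\<close> marks the letter of \<open>B\<close> that started it.\<close>

lemma pool_attain: "pool A B n = 0 \<or> (\<exists>t<n. pool A B n + card (A \<inter> {Suc t..<n}) = card (B \<inter> {t..<n}))"
proof (induct n)
  case (Suc n)
  show ?case
  proof (cases "pool A B n - of_bool (n \<in> A) = 0")
    case True
    show ?thesis
    proof (cases "n \<in> B")
      case T: True
      have "B \<inter> {n..<Suc n} = {n}" "A \<inter> {Suc n..<Suc n} = {}" using T by auto
      then show ?thesis using True T by (intro disjI2 exI[of _ n]) simp
    qed (use True in simp)
  next
    case False
    then obtain t where t: "t < n" "pool A B n + card (A \<inter> {Suc t..<n}) = card (B \<inter> {t..<n})"
      using Suc by auto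
    then show ?thesis using False
      by (intro disjI2 exI[of _ t]) (auto simp: card_insert_top)
  qed
qed simp

text \<open>The letters of \<open>L\<close> matched to \<open>Y\<close> when the pairing runs in the
  opposite direction, that is, the second component after lowering as far as possible.\<close>

definition pairedR :: "nat \<Rightarrow> nat set \<Rightarrow> nat set \<Rightarrow> nat set" where
  "pairedR K Y L = (-) K ` pairedL ((-) K ` L) ((-) K ` Y)"

lemma hw_count:
  assumes "finite Y" "unp Y L = {}" "finite L"
  shows "card (Y \<inter> {..u}) \<le> card (L \<inter> {..<u})"
proof (cases "Y \<inter> {..u} = {}")
  case False
  define y where "y = Max (Y \<inter> {..u})"
  have y: "y \<in> Y" "y \<le> u" "\<And>x. x \<in> Y \<Longrightarrow> x \<le> u \<Longrightarrow> x \<le> y"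
    using Max_in[of "Y \<inter> {..u}"] False by (auto simp: y_def)
  have p: "0 < pool Y L a" if "a \<in> Y" for a using assms(2) that by (auto simp: unp_def)
  have "pool Y L y + card (Y \<inter> {0..<y}) = pool Y L 0 + card (L \<inter> {0..<y})"
    by (rule pool_eq) (use p in auto)
  then have "card (Y \<inter> {..<y}) < card (L \<inter> {..<y})" using p[OF y(1)] by (simp add: atLeast0LessThan)
  moreover have "Y \<inter> {..u} = insert y (Y \<inter> {..<y})" using y by force
  then have "card (Y \<inter> {..u}) = Suc (card (Y \<inter> {..<y}))" by simp
  moreover have "card (L \<inter> {..<y}) \<le> card (L \<inter> {..<u})" using y(2) by (intro card_mono) auto
  ultimately show ?thesis by simp
qed simp

text \<open>From a pair without unmatched letters, lowering to the end of the string is exactly the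
  reflection; so the second component of the reflected pair is known, and it is a part of
  \<open>L\<close>.\<close>

lemma reflect_hw:
  assumes g: "gp (Y, L)" and u: "unp Y L = {}" and K: "Y \<union> L \<subseteq> {..<K}"
  obtains Y' where "gp (Y', pairedR K Y L)" "sl Y @ sl L \<approx> sl Y' @ sl (pairedR K Y L)" "card Y' = card L"
    "card (pairedR K Y L) = card Y" "pairedR K Y L \<subseteq> L"
proof -
  define p where "p = (Y, L)"
  have gp: "gp p" "fst p \<union> snd p \<subseteq> {..<K}" using g K p_def by auto
  have K': "Y \<subseteq> {..K}" "L \<subseteq> {..K}" using K by auto
  have f: "finite Y" "finite L" using g by (auto simp: gp_def)
  define q where "q = cpl K (topp (cpl K p))"
  note gc = gp_cpl[OF gp]
  note l = lower_iter[OF gp order_refl, folded topp_def, OF q_def]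
  have sq: "snd q = pairedR K Y L"
    using l(5) topp(4)[OF gc] by (simp add: pairedR_def cpl_def p_def)
  let ?A = "(-) K ` L" and ?B = "(-) K ` Y"
  \<comment> \<open>A positive final pool would be attained on a final window, which after
    complementation compares initial segments of \<open>Y\<close> and \<open>L\<close> and
    contradicts \<open>hw_count\<close>.\<close>
  have "pool ?A ?B (Suc K) = 0"
  proof (rule ccontr)
    assume n: "pool ?A ?B (Suc K) \<noteq> 0"
    then obtain t where t: "t < Suc K" "pool ?A ?B (Suc K) + card (?A \<inter> {Suc t..<Suc K}) = card (?B \<inter> {t..<Suc K})"
      using pool_attain[of ?A ?B "Suc K"] by auto
    have "?B \<inter> {t..<Suc K} = (-) K ` (Y \<inter> {..K - t})" "?A \<inter> {Suc t..<Suc K} = (-) K ` (L \<inter> {..<K - t})"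
      using K K' t(1) by fastforce+
    moreover have "Y \<inter> {..K - t} \<subseteq> {..K}" "L \<inter> {..<K - t} \<subseteq> {..K}" using K' by auto
    ultimately have "card (?B \<inter> {t..<Suc K}) = card (Y \<inter> {..K - t})" "card (?A \<inter> {Suc t..<Suc K}) = card (L \<inter> {..<K - t})"
      using card_compl[of "Y \<inter> {..K - t}" K] card_compl[of "L \<inter> {..<K - t}" K] by auto
    then show False using t(2) hw_count[OF f(1) u f(2), of "K - t"] n by simp
  qed
  moreover have "?B \<inter> {..<Suc K} = ?B" "pairedL ?A ?B \<inter> {..<Suc K} = pairedL ?A ?B"
    by (auto simp: pairedL_def)
  ultimately have "card (pairedL ?A ?B) = card Y"
    using pool_total[of ?B "Suc K" ?A] card_compl[OF K'(1)] by simp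
  moreover have "pairedL ?A ?B \<subseteq> {..K}" by (auto simp: pairedL_def)
  ultimately have c: "card (pairedR K Y L) = card Y" by (simp add: pairedR_def card_compl)
  have "card (fst q) + card (snd q) = card Y + card L" using l(3,4) by (simp add: p_def)
  then have "card (fst q) = card L" using sq c by simp
  moreover have "gp (fst q, pairedR K Y L)" using l(1) sq by (metis prod.collapse)
  ultimately show ?thesis using that[of "fst q"] l sq c by (auto simp: p_def)
qed

section \<open>Extremal factorizations\<close>

text \<open>Here a factorization is a list of sets whose head is component number 1, so its word is read
  from the last set to the first.\<close>

definition wd :: "nat set list \<Rightarrow> nat list" where
  "wd Fs = concat (map sl (rev Fs))"

definition gf :: "nat set list \<Rightarrow> bool" where
  "gf Fs \<longleftrightarrow> (\<forall>X\<in>set Fs. finite X) \<and> red (wd Fs)"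

definition sq :: "nat set list \<Rightarrow> nat" where
  "sq Fs = sum_list (map (\<lambda>X. (card X)\<^sup>2) Fs)"

text \<open>Termination measure: letters weigh more the later their component stands in the list.
  Raising, and swapping two lengths into decreasing order, both lower it.\<close>

fun mu :: "nat \<Rightarrow> nat list \<Rightarrow> nat" where
  "mu n [] = 0"
| "mu n (x # xs) = n * x + mu (Suc n) xs"

fun hwF :: "nat set list \<Rightarrow> bool" where
  "hwF [] = True"
| "hwF [X] = True"
| "hwF (B # A # Fs) = (unp A B = {} \<and> hwF (A # Fs))"

definition sqr :: "nat list \<Rightarrow> nat" where
  "sqr u = sum_list (map (\<lambda>R. (length R)\<^sup>2) (tab u))"

text \<open>The right-hand side is the maximum of \<open>sq\<close> over the class
  (\<open>sq_le\<close>). Equality holds exactly if the component lengths are a permutation of the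
  row lengths, padded by zeros (\<open>ext_mset\<close>, \<open>extI\<close>).\<close>

definition ext :: "nat set list \<Rightarrow> bool" where
  "ext Fs \<longleftrightarrow> gf Fs \<and> sq Fs = sqr (wd Fs)"

lemma wd_simps [simp]: "wd [] = []" "wd (X # Fs) = wd Fs @ sl X" "wd (Fs @ Gs) = wd Gs @ wd Fs"
  by (simp_all add: wd_def)

lemma sq_simps [simp]: "sq [] = 0" "sq (X # Fs) = (card X)\<^sup>2 + sq Fs" "sq (Fs @ Gs) = sq Fs + sq Gs"
  by (simp_all add: sq_def)

lemma mu_append: "mu n (xs @ ys) = mu n xs + mu (n + length xs) ys"
  by (induct xs arbitrary: n) auto

lemma gf_block: "gf (Xs @ Zs @ Ys) \<Longrightarrow> gf Zs"
  unfolding gf_def using red_factor[of "wd Ys" "wd Zs" "wd Xs"] by auto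

lemma gf_append1: "gf (Xs @ Ys) \<Longrightarrow> gf Xs"
  using gf_block[of "[]" Xs Ys] by simp

lemma gf_append2: "gf (Xs @ Ys) \<Longrightarrow> gf Ys"
  using gf_block[of Xs Ys "[]"] by simp

lemma gf_pair: "gf (Xs @ [B, A] @ Ys) \<Longrightarrow> gp (A, B)"
  using gf_block[of Xs "[B, A]" Ys] by (simp add: gf_def gp_def)

lemma wd_replace: "wd Zs \<approx> wd Zs' \<Longrightarrow> wd (Xs @ Zs @ Ys) \<approx> wd (Xs @ Zs' @ Ys)"
  using ck_cong[of "wd Zs" "wd Zs'" "wd Ys" "wd Xs"] by simp

lemma gf_replace: "gf (Xs @ Zs @ Ys) \<Longrightarrow> gf Zs' \<Longrightarrow> wd Zs \<approx> wd Zs' \<Longrightarrow> gf (Xs @ Zs' @ Ys)"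
  unfolding gf_def using red_ck[OF _ wd_replace[of Zs Zs' Xs Ys]] by auto

lemma pair_gf: "gp q \<Longrightarrow> gf [snd q, fst q]"
  by (simp add: gf_def gp_def)

lemma set_wd: "gf Fs \<Longrightarrow> set (wd Fs) = \<Union>(set Fs)"
  by (induct Fs) (auto simp: gf_def dest: red_appendD1)

lemma not_hwF: "\<not> hwF Fs \<Longrightarrow> \<exists>Xs B A Ys. Fs = Xs @ [B, A] @ Ys \<and> unp A B \<noteq> {}"
proof (induct Fs rule: hwF.induct)
  case (3 B A Fs)
  show ?case
  proof (cases "unp A B = {}")
    case True
    then have "\<not> hwF (A # Fs)" using 3(2) by simp
    then obtain Xs B' A' Ys where "A # Fs = Xs @ [B', A'] @ Ys" "unp A' B' \<noteq> {}" using 3(1) by blast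
    then show ?thesis by (metis append_Cons)
  next
    case False
    then show ?thesis by (metis append_Cons append_Nil)
  qed
qed auto

text \<open>With \<open>a = p + k\<close> and \<open>b = p + l\<close> the two sums of squares
  differ by \<open>2 k l\<close>.\<close>

lemma two_squares:
  fixes a b p q :: nat
  assumes "a + b = p + q" "p \<le> a" "p \<le> b"
  shows "a\<^sup>2 + b\<^sup>2 \<le> p\<^sup>2 + q\<^sup>2" "a\<^sup>2 + b\<^sup>2 = p\<^sup>2 + q\<^sup>2 \<Longrightarrow> a = p \<or> b = p"
proof -
  obtain k l where kl: "a = p + k" "b = p + l" using assms by (metis le_iff_add)
  then have q: "q = p + k + l" using assms by simp
  show "a\<^sup>2 + b\<^sup>2 \<le> p\<^sup>2 + q\<^sup>2" using kl q by (simp add: power2_eq_square algebra_simps)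
  assume "a\<^sup>2 + b\<^sup>2 = p\<^sup>2 + q\<^sup>2"
  then have "k * l = 0" using kl q by (simp add: power2_eq_square algebra_simps)
  then show "a = p \<or> b = p" using kl by auto
qed

lemma topp_sq:
  assumes "gp p"
  shows "(card (snd p))\<^sup>2 + (card (fst p))\<^sup>2 \<le> (card (snd (topp p)))\<^sup>2 + (card (fst (topp p)))\<^sup>2"
    and "(card (snd p))\<^sup>2 + (card (fst p))\<^sup>2 = (card (snd (topp p)))\<^sup>2 + (card (fst (topp p)))\<^sup>2 \<Longrightarrow>
      mset [card (snd p), card (fst p)] = mset [card (snd (topp p)), card (fst (topp p))]"
proof -
  have c: "card (fst (topp p)) = card (pairedL (fst p) (snd p))" using topp(4)[OF assms] by simp
  have le: "card (fst (topp p)) \<le> card (fst p)" "card (fst (topp p)) \<le> card (snd p)"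
    using c card_up[OF assms] card_pairedL_le[of "snd p" "fst p"] assms by (auto simp: gp_def)
  have s: "card (fst p) + card (snd p) = card (fst (topp p)) + card (snd (topp p))" using topp(6)[OF assms] .
  note t = two_squares[OF s le]
  show "(card (snd p))\<^sup>2 + (card (fst p))\<^sup>2 \<le> (card (snd (topp p)))\<^sup>2 + (card (fst (topp p)))\<^sup>2"
    using t(1) by simp
  assume "(card (snd p))\<^sup>2 + (card (fst p))\<^sup>2 = (card (snd (topp p)))\<^sup>2 + (card (fst (topp p)))\<^sup>2"
  then have "card (fst p) = card (fst (topp p)) \<or> card (snd p) = card (fst (topp p))" using t(2) by simp
  then show "mset [card (snd p), card (fst p)] = mset [card (snd (topp p)), card (fst (topp p))]"
    using s by auto
qed

lemma mu_swap: "a + b = a' + b' \<Longrightarrow> a' < a \<Longrightarrow> mu 0 (xs @ [b', a'] @ ys) < mu 0 (xs @ [b, a] @ ys)"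
proof -
  assume s: "a + b = a' + b'" "a' < a"
  then obtain k where k: "a = a' + Suc k" by (metis less_iff_Suc_add add_Suc_right)
  then have "b' = b + Suc k" using s by simp
  then show ?thesis using k by (simp add: mu_append algebra_simps)
qed

text \<open>Replace a pair that still has unmatched letters by its top and repeat. Each replacement
  keeps the class, lowers \<open>mu\<close>, does not lower \<open>sq\<close>, and can only enlarge
  the head.\<close>

lemma rectify:
  "gf Fs \<Longrightarrow> \<exists>Gs. gf Gs \<and> length Gs = length Fs \<and> wd Fs \<approx> wd Gs \<and> hwF Gs \<and> sq Fs \<le> sq Gs
    \<and> (sq Fs = sq Gs \<longrightarrow> mset (map card Fs) = mset (map card Gs)) \<and> (Fs \<noteq> [] \<longrightarrow> hd Fs \<subseteq> hd Gs)"
proof (induct "mu 0 (map card Fs)" arbitrary: Fs rule: less_induct)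
  case less
  show ?case
  proof (cases "hwF Fs")
    case True
    then show ?thesis using less(2) by (intro exI[of _ Fs]) auto
  next
    case False
    then obtain Xs B A Ys where F: "Fs = Xs @ [B, A] @ Ys" and ne: "unp A B \<noteq> {}" using not_hwF by blast
    define t where "t = topp (A, B)"
    have g: "gp (A, B)" using less(2) F gf_pair by blast
    note T = topp[OF g, folded t_def]
    note S = topp_sq[OF g, folded t_def]
    define Fs' where "Fs' = Xs @ [snd t, fst t] @ Ys"
    have w: "wd Fs \<approx> wd Fs'" unfolding F Fs'_def by (rule wd_replace) (use T(2) in simp)
    have g': "gf Fs'" unfolding Fs'_def
      by (rule gf_replace[of Xs "[B, A]" Ys]) (use less(2) F T(1,2) pair_gf in auto)
    have "card (fst t) < card A"
      using T(4) card_up[OF g] finite_up[OF g] ne card_gt_0_iff[of "unp A B"] by auto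
    then have "mu 0 (map card Fs') < mu 0 (map card Fs)"
      using mu_swap[of "card A" "card B" "card (fst t)" "card (snd t)" "map card Xs" "map card Ys"] T(6)
      by (simp add: F Fs'_def)
    from less(1)[OF this g'] obtain Gs where G: "gf Gs" "length Gs = length Fs'" "wd Fs' \<approx> wd Gs"
      "hwF Gs" "sq Fs' \<le> sq Gs" "sq Fs' = sq Gs \<longrightarrow> mset (map card Fs') = mset (map card Gs)"
      "Fs' \<noteq> [] \<longrightarrow> hd Fs' \<subseteq> hd Gs" by blast
    have s: "sq Fs \<le> sq Fs'" using S(1) by (simp add: F Fs'_def)
    moreover have "mset (map card Fs) = mset (map card Fs')" if "sq Fs = sq Fs'"
      using S(2) that by (simp add: F Fs'_def)
    moreover have "hd Fs \<subseteq> hd Fs'" using T(5) by (cases Xs) (auto simp: F Fs'_def)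
    moreover have "length Fs = length Fs'" "Fs' \<noteq> []" by (auto simp: F Fs'_def)
    moreover have "wd Fs \<approx> wd Gs" by (rule ck_trans[OF w G(3)])
    ultimately show ?thesis using G by (intro exI[of _ Gs]) auto
  qed
qed

lemma unp_empty: "unp A {} = A" "unp {} B = {}"
proof -
  have "pool A {} t = 0" for t by (induct t) auto
  then show "unp A {} = A" by (simp add: unp_def)
qed (simp add: unp_def)

lemma hwF_form:
  "hwF Gs \<Longrightarrow> \<forall>X\<in>set Gs. finite X \<Longrightarrow>
    \<exists>Ss n. Gs = Ss @ replicate n {} \<and> tableau (map sl Ss) \<and> hwF Ss"
proof (induct Gs rule: hwF.induct)
  case 1
  then show ?case by auto
next
  case (2 X)
  show ?case
  proof (cases "X = {}")
    case True
    then show ?thesis by (intro exI[of _ "[]"] exI[of _ 1]) auto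
  next
    case False
    then show ?thesis using 2 by (intro exI[of _ "[X]"] exI[of _ 0]) auto
  qed
next
  case (3 B A Fs)
  then obtain Ss n where S: "A # Fs = Ss @ replicate n {}" "tableau (map sl Ss)" "hwF Ss" by auto
  show ?case
  proof (cases Ss)
    case Nil
    then have A: "A = {}" using S(1) by (cases n) auto
    show ?thesis
    proof (cases "B = {}")
      case True
      then show ?thesis using Nil S by (intro exI[of _ "[]"] exI[of _ "Suc n"]) auto
    next
      case False
      then show ?thesis using Nil S 3(3) by (intro exI[of _ "[B]"] exI[of _ n]) auto
    qed
  next
    case (Cons A' Ss')
    then have "A' = A" using S(1) by simp
    moreover have "above (sl A) (sl B)" using hw_above[of A B] 3(2,3) by simp
    ultimately have "tableau (map sl (B # Ss))" using Cons S(2) by simp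
    moreover have "hwF (B # Ss)" using S(3) 3(2) Cons \<open>A' = A\<close> by simp
    ultimately show ?thesis using S(1) by (intro exI[of _ "B # Ss"] exI[of _ n]) auto
  qed
qed

lemma wd_replicate [simp]: "wd (replicate n {}) = []"
  by (induct n) auto

lemma hwF_replicate: "hwF Ss \<Longrightarrow> hwF (Ss @ replicate n {})"
proof (induct Ss rule: hwF.induct)
  case 1
  show ?case
  proof (induct n)
    case (Suc n)
    then show ?case by (cases n) (auto simp: unp_empty)
  qed simp
next
  case (2 X)
  show ?case
  proof (induct n arbitrary: X)
    case (Suc n)
    then show ?case by (simp add: unp_empty)
  qed simp
qed auto

lemma hw_tab:
  assumes "gf Gs" "hwF Gs"
  shows "tableau (tab (wd Gs)) \<and> length (tab (wd Gs)) \<le> length Gs \<and> hwF (map set (tab (wd Gs)))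
    \<and> Gs = map set (tab (wd Gs)) @ replicate (length Gs - length (tab (wd Gs))) {}"
proof -
  have f: "\<forall>X\<in>set Gs. finite X" using assms(1) by (simp add: gf_def)
  then obtain Ss n where S: "Gs = Ss @ replicate n {}" "tableau (map sl Ss)" "hwF Ss"
    using hwF_form[OF assms(2)] by blast
  have "wd Gs = concat (rev (map sl Ss))" using S(1) by (simp add: wd_def rev_map)
  then have t: "tab (wd Gs) = map sl Ss" using tab_tableau[OF S(2)] by simp
  have "map set (map sl Ss) = Ss" using f S(1) by (simp add: map_idI)
  then show ?thesis using t S by simp
qed

lemma tab_factors: "red u \<Longrightarrow> \<exists>Gs. gf Gs \<and> hwF Gs \<and> u \<approx> wd Gs"
proof -
  assume r: "red u"
  define Fs where "Fs = map (\<lambda>x. {x}) (rev u)"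
  have "wd Fs = u" unfolding Fs_def by (induct u) (auto simp: wd_def rev_map)
  moreover have "\<forall>X\<in>set Fs. finite X" by (auto simp: Fs_def)
  ultimately have "gf Fs" using r by (simp add: gf_def)
  then show ?thesis using rectify[of Fs] \<open>wd Fs = u\<close> by auto
qed

lemma tableau_tab: "red u \<Longrightarrow> tableau (tab u) \<and> hwF (map set (tab u))"
  using tab_factors[of u] hw_tab tab_ck[of u] by metis

lemma tableau_incr: "tableau Rs \<Longrightarrow> R \<in> set Rs \<Longrightarrow> incr R \<and> R \<noteq> []"
proof (induct Rs)
  case (Cons S Rs)
  then show ?case using tableau_Cons[of S Rs] by auto
qed simp

lemma tableau_len: "tableau Rs \<Longrightarrow> Suc i < length Rs \<Longrightarrow> length (Rs ! Suc i) \<le> length (Rs ! i)"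
proof (induct Rs arbitrary: i rule: tableau.induct)
  case (3 R S Rs)
  then show ?case by (cases i) (auto simp: above_def)
qed auto

lemma rlen_antimono_Suc: "red u \<Longrightarrow> rlen u (Suc i) \<le> rlen u i"
  using tableau_tab[of u] tableau_len[of "tab u" i] by (simp add: rlen_def)

lemma rlen_antimono: "red u \<Longrightarrow> i \<le> j \<Longrightarrow> rlen u j \<le> rlen u i"
  using lift_Suc_antimono_le[of "rlen u" i j] rlen_antimono_Suc by blast

lemma tab_pad:
  assumes "red u" "length (tab u) \<le> n"
  defines "Gs \<equiv> map set (tab u) @ replicate (n - length (tab u)) {}"
  shows "gf Gs" "hwF Gs" "u \<approx> wd Gs" "length Gs = n" "map card Gs = map (rlen u) [0..<n]" "sq Gs = sqr u"
proof -
  have t: "tableau (tab u)" "hwF (map set (tab u))" using tableau_tab[OF assms(1)] by auto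
  have m: "map sl (map set (tab u)) = tab u"
    using tableau_incr[OF t(1)] by (auto simp: map_idI sl_set)
  have "wd Gs = concat (rev (map sl (map set (tab u))))" unfolding Gs_def by (simp add: wd_def rev_map)
  then have "wd Gs = concat (rev (tab u))" using m by simp
  then show w: "u \<approx> wd Gs" using tab_equiv[OF assms(1)] by simp
  then show "gf Gs" using red_ck[OF assms(1)] by (auto simp: gf_def Gs_def)
  show "hwF Gs" unfolding Gs_def by (rule hwF_replicate[OF t(2)])
  show l: "length Gs = n" using assms(2) by (simp add: Gs_def)
  have c: "card (set R) = length R" if "R \<in> set (tab u)" for R
    using tableau_incr[OF t(1) that] by (simp add: distinct_card strict_sorted_iff)
  show "map card Gs = map (rlen u) [0..<n]"
    by (rule nth_equalityI) (use l assms(2) c in \<open>auto simp: Gs_def rlen_def nth_append\<close>)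
  have "sum_list (map (\<lambda>X. (card X)\<^sup>2) (map set (tab u))) = sqr u"
    unfolding sqr_def by (simp add: comp_def c cong: map_cong)
  moreover have "sq (replicate k {}) = 0" for k by (induct k) auto
  ultimately show "sq Gs = sqr u" unfolding Gs_def by (simp add: sq_def)
qed

lemma hw_pad:
  assumes "gf Gs" "hwF Gs"
  shows "map card Gs = map (rlen (wd Gs)) [0..<length Gs]" "sq Gs = sqr (wd Gs)" "length (tab (wd Gs)) \<le> length Gs"
proof -
  have r: "red (wd Gs)" using assms(1) by (simp add: gf_def)
  show l: "length (tab (wd Gs)) \<le> length Gs" using hw_tab[OF assms] by simp
  have "map set (tab (wd Gs)) @ replicate (length Gs - length (tab (wd Gs))) {} = Gs"
    using hw_tab[OF assms] by simp
  then show "map card Gs = map (rlen (wd Gs)) [0..<length Gs]" "sq Gs = sqr (wd Gs)"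
    using tab_pad[OF r l] by auto
qed

lemma sqr_ck: "red u \<Longrightarrow> u \<approx> v \<Longrightarrow> sqr u = sqr v"
  using tab_ck by (simp add: sqr_def)

lemma rectify_tab:
  assumes "gf Fs"
  obtains Gs where "gf Gs" "length Gs = length Fs" "wd Fs \<approx> wd Gs" "hwF Gs" "sq Fs \<le> sq Gs"
    "sq Fs = sq Gs \<longrightarrow> mset (map card Fs) = mset (map card Gs)" "Fs \<noteq> [] \<longrightarrow> hd Fs \<subseteq> hd Gs"
    "sq Gs = sqr (wd Fs)" "length (tab (wd Fs)) \<le> length Fs" "tab (wd Gs) = tab (wd Fs)"
proof -
  obtain Gs where G: "gf Gs" "length Gs = length Fs" "wd Fs \<approx> wd Gs" "hwF Gs" "sq Fs \<le> sq Gs"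
    "sq Fs = sq Gs \<longrightarrow> mset (map card Fs) = mset (map card Gs)" "Fs \<noteq> [] \<longrightarrow> hd Fs \<subseteq> hd Gs"
    using rectify[OF assms] by blast
  have r: "red (wd Fs)" using assms by (simp add: gf_def)
  show thesis
    by (rule that[OF G]) (use hw_pad(2,3)[OF G(1,4)] sqr_ck[OF r G(3)] tab_ck[OF r G(3)] G(2) in auto)
qed

lemma sq_le: "gf Fs \<Longrightarrow> sq Fs \<le> sqr (wd Fs)"
  by (erule rectify_tab) simp

lemma tab_length_le: "gf Fs \<Longrightarrow> length (tab (wd Fs)) \<le> length Fs"
  by (erule rectify_tab) simp

section \<open>Existence and uniqueness of extremal factorizations\<close>

lemma ext_mset: "ext Fs \<Longrightarrow> mset (map card Fs) = mset (map (rlen (wd Fs)) [0..<length Fs])"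
proof -
  assume e: "ext Fs"
  then have g: "gf Fs" "red (wd Fs)" by (auto simp: ext_def gf_def)
  obtain Gs where G: "gf Gs" "length Gs = length Fs" "wd Fs \<approx> wd Gs" "hwF Gs"
    "sq Fs = sq Gs \<longrightarrow> mset (map card Fs) = mset (map card Gs)" using rectify[OF g(1)] by blast
  have "sq Fs = sq Gs" using e hw_pad(2)[OF G(1,4)] sqr_ck[OF g(2) G(3)] by (simp add: ext_def)
  then show ?thesis using G hw_pad(1)[OF G(1,4)] rlen_ck[OF g(2) G(3)] by simp
qed

lemma sq_mset: "mset (map card Fs) = mset (map card Gs) \<Longrightarrow> sq Fs = sq Gs"
proof -
  assume "mset (map card Fs) = mset (map card Gs)"
  then have "sum_mset (image_mset (\<lambda>x. x\<^sup>2) (mset (map card Fs))) = sum_mset (image_mset (\<lambda>x. x\<^sup>2) (mset (map card Gs)))"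
    by simp
  moreover have "sq Hs = sum_mset (image_mset (\<lambda>x. x\<^sup>2) (mset (map card Hs)))" for Hs
    by (induct Hs) auto
  ultimately show ?thesis by simp
qed

lemma ext_ck: "ext Fs \<Longrightarrow> gf Gs \<Longrightarrow> wd Fs \<approx> wd Gs \<Longrightarrow> mset (map card Fs) = mset (map card Gs) \<Longrightarrow> ext Gs"
  using sq_mset[of Fs Gs] sqr_ck[of "wd Fs" "wd Gs"] by (simp add: ext_def gf_def)

lemma extI:
  assumes "gf Fs" "mset (map card Fs) = mset (map (rlen (wd Fs)) [0..<length Fs])"
  shows "ext Fs"
proof -
  have r: "red (wd Fs)" using assms(1) by (simp add: gf_def)
  define Gs where "Gs = map set (tab (wd Fs)) @ replicate (length Fs - length (tab (wd Fs))) {}"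
  note t = tab_pad[OF r tab_length_le[OF assms(1)], folded Gs_def]
  have "sq Fs = sq Gs" by (rule sq_mset) (use assms(2) t(5) in simp)
  then show ?thesis using t(6) assms(1) by (simp add: ext_def)
qed

text \<open>Rectifying the block inside the whole factorization could otherwise raise the sum of
  squares above its maximum.\<close>

lemma ext_block: "ext (Xs @ Zs @ Ys) \<Longrightarrow> ext Zs"
proof -
  assume e: "ext (Xs @ Zs @ Ys)"
  then have g: "gf (Xs @ Zs @ Ys)" by (simp add: ext_def)
  then have gz: "gf Zs" "red (wd Zs)" using gf_block by (auto simp: gf_def)
  obtain Zs' where Z: "gf Zs'" "wd Zs \<approx> wd Zs'" "hwF Zs'" "sq Zs \<le> sq Zs'"
    using rectify[OF gz(1)] by blast
  have "sq (Xs @ Zs' @ Ys) \<le> sqr (wd (Xs @ Zs' @ Ys))" by (rule sq_le[OF gf_replace[OF g Z(1,2)]])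
  also have "\<dots> = sqr (wd (Xs @ Zs @ Ys))"
    using sqr_ck[OF _ wd_replace[OF Z(2), of Xs Ys]] g by (simp add: gf_def)
  also have "\<dots> = sq (Xs @ Zs @ Ys)" using e by (simp add: ext_def)
  finally have "sq Zs' \<le> sq Zs" by simp
  then have "sq Zs = sqr (wd Zs)" using Z(4) hw_pad(2)[OF Z(1,3)] sqr_ck[OF gz(2) Z(2)] by simp
  then show ?thesis using gz by (simp add: ext_def)
qed

lemma ext_replace:
  assumes "ext (Xs @ Zs @ Ys)" "gf Zs'" "wd Zs \<approx> wd Zs'" "mset (map card Zs) = mset (map card Zs')"
  shows "ext (Xs @ Zs' @ Ys)" "wd (Xs @ Zs @ Ys) \<approx> wd (Xs @ Zs' @ Ys)"
proof -
  show w: "wd (Xs @ Zs @ Ys) \<approx> wd (Xs @ Zs' @ Ys)" by (rule wd_replace[OF assms(3)])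
  show "ext (Xs @ Zs' @ Ys)"
    by (rule ext_ck[OF assms(1) _ w]) (use assms gf_replace in \<open>auto simp: ext_def\<close>)
qed

text \<open>Passing to the top cannot increase the sum of squares, so it only permutes the two
  lengths; since the first component does not grow, no letter of it is unmatched.\<close>

lemma ext_pair_hw: "ext (Xs @ [B, A] @ Ys) \<Longrightarrow> card A \<le> card B \<Longrightarrow> unp A B = {}"
proof -
  assume e: "ext (Xs @ [B, A] @ Ys)" and le: "card A \<le> card B"
  have e2: "ext [B, A]" by (rule ext_block[OF e])
  have g: "gp (A, B)" using e gf_pair by (auto simp: ext_def)
  define t where "t = topp (A, B)"
  note T = topp[OF g, folded t_def] and S = topp_sq[OF g, folded t_def]
  have "gf [snd t, fst t]" using pair_gf[OF T(1)] .
  then have "sq [snd t, fst t] \<le> sqr (wd [snd t, fst t])" by (rule sq_le)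
  also have "\<dots> = sqr (wd [B, A])"
    using sqr_ck[of "wd [B, A]" "wd [snd t, fst t]"] T(2) e2 by (simp add: ext_def gf_def)
  also have "\<dots> = sq [B, A]" using e2 by (simp add: ext_def)
  finally have "mset [card B, card A] = mset [card (snd t), card (fst t)]" using S by simp
  moreover have "card (fst t) \<le> card A" using T(4) card_up[OF g] by simp
  moreover have "card A + card B = card (fst t) + card (snd t)" using T(6) by simp
  ultimately have "card (fst t) = card A" using le by (auto simp: add_eq_conv_ex)
  then have "card (unp A B) = 0" using T(4) card_up[OF g] by simp
  then show ?thesis using finite_up[OF g] by simp
qed

lemma ext_sorted_hw: "ext Fs \<Longrightarrow> sorted_wrt (\<ge>) (map card Fs) \<Longrightarrow> hwF Fs"
proof (induct Fs rule: hwF.induct)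
  case (3 B A Fs)
  have "unp A B = {}" by (rule ext_pair_hw[of "[]" B A Fs]) (use 3(2,3) in auto)
  moreover have "ext (A # Fs)" using ext_block[of "[B]" "A # Fs" "[]"] 3(2) by simp
  ultimately show ?case using 3 by simp
qed auto

lemma hw_unique_list: "gf Fs \<Longrightarrow> gf Gs \<Longrightarrow> hwF Fs \<Longrightarrow> hwF Gs \<Longrightarrow> wd Fs \<approx> wd Gs \<Longrightarrow> length Fs = length Gs \<Longrightarrow> Fs = Gs"
  using hw_tab[of Fs] hw_tab[of Gs] tab_ck[of "wd Fs" "wd Gs"] by (metis gf_def)

lemma not_sorted_adj: "\<not> sorted_wrt (\<ge>) xs \<Longrightarrow> \<exists>ys b a zs. xs = ys @ [b, a] @ zs \<and> b < (a::nat)"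
proof (induct xs)
  case (Cons x xs)
  show ?case
  proof (cases "sorted_wrt (\<ge>) xs")
    case True
    then obtain y where "y \<in> set xs" "x < y" using Cons.prems by auto
    then obtain z zs where xs: "xs = z # zs" by (cases xs) auto
    then have "x < z" using True \<open>y \<in> set xs\<close> \<open>x < y\<close> by auto
    then show ?thesis using xs by (metis append_Cons append_Nil)
  next
    case False
    then show ?thesis using Cons.hyps by (metis append_Cons)
  qed
qed simp

lemma reflect_list:
  assumes "ext (Xs @ [B, A] @ Ys)"
  obtains q where "gp q" "sl A @ sl B \<approx> wp q" "card (fst q) = card B" "card (snd q) = card A"
    "ext (Xs @ [snd q, fst q] @ Ys)" "wd (Xs @ [B, A] @ Ys) \<approx> wd (Xs @ [snd q, fst q] @ Ys)"
proof -
  have "gp (A, B)" using assms gf_pair by (auto simp: ext_def)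
  then obtain q where q: "gp q" "sl A @ sl B \<approx> wp q" "card (fst q) = card B" "card (snd q) = card A"
    by (rule reflect) auto
  have "wd [B, A] \<approx> wd [snd q, fst q]" using q by simp
  note r = ext_replace[OF assms pair_gf[OF q(1)] this]
  show thesis by (rule that[OF q]) (use r q in auto)
qed

text \<open>For weakly decreasing lengths the factorization is the padded tableau. Otherwise reflect
  the first ascent of both factorizations, apply induction, and undo the reflection by
  \<open>pair_unique\<close>.\<close>

lemma ext_unique:
  "ext Fs \<Longrightarrow> ext Gs \<Longrightarrow> map card Fs = map card Gs \<Longrightarrow> wd Fs \<approx> wd Gs \<Longrightarrow> Fs = Gs"
proof (induct "mu 0 (map card Fs)" arbitrary: Fs Gs rule: less_induct)
  case less
  have len: "length Fs = length Gs" using less(4) map_eq_imp_length_eq by blast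
  show ?case
  proof (cases "sorted_wrt (\<ge>) (map card Fs)")
    case True
    then have "hwF Fs" "hwF Gs" using ext_sorted_hw less by auto
    then show ?thesis using hw_unique_list[OF _ _ _ _ less(5) len] less(2,3) by (simp add: ext_def)
  next
    case False
    then obtain ys b a zs where s: "map card Fs = ys @ [b, a] @ zs" "b < a" using not_sorted_adj by blast
    have split: "\<exists>Xs B A Ys. Hs = Xs @ [B, A] @ Ys \<and> map card Xs = ys \<and> map card Ys = zs \<and> card B = b \<and> card A = a"
      if "map card Hs = ys @ [b, a] @ zs" for Hs
      using that by (auto simp: map_eq_append_conv)
    obtain Xs B A Ys where F: "Fs = Xs @ [B, A] @ Ys" "map card Xs = ys" "map card Ys = zs" "card B = b" "card A = a"
      using split[OF s(1)] by blast
    obtain Xs' B' A' Ys' where G: "Gs = Xs' @ [B', A'] @ Ys'" "map card Xs' = ys" "map card Ys' = zs"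
      "card B' = b" "card A' = a"
      using split[of Gs] s(1) less(4) by auto
    obtain q where q: "gp q" "sl A @ sl B \<approx> wp q" "card (fst q) = card B" "card (snd q) = card A"
      "ext (Xs @ [snd q, fst q] @ Ys)" "wd (Xs @ [B, A] @ Ys) \<approx> wd (Xs @ [snd q, fst q] @ Ys)"
      using reflect_list less(2) F(1) by blast
    obtain q' where q': "gp q'" "sl A' @ sl B' \<approx> wp q'" "card (fst q') = card B'" "card (snd q') = card A'"
      "ext (Xs' @ [snd q', fst q'] @ Ys')" "wd (Xs' @ [B', A'] @ Ys') \<approx> wd (Xs' @ [snd q', fst q'] @ Ys')"
      using reflect_list less(3) G(1) by blast
    have w: "wd (Xs @ [snd q, fst q] @ Ys) \<approx> wd (Xs' @ [snd q', fst q'] @ Ys')"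
      by (rule ck_trans[OF ck_sym[OF q(6)] ck_trans[OF _ q'(6)]]) (use less(5) F(1) G(1) in simp)
    have "Xs @ [snd q, fst q] @ Ys = Xs' @ [snd q', fst q'] @ Ys'"
    proof (rule less(1)[OF _ q(5) q'(5) _ w])
      show "mu 0 (map card (Xs @ [snd q, fst q] @ Ys)) < mu 0 (map card Fs)"
        using mu_swap[of a b b a ys zs] s F q by simp
    qed (use F G q q' in auto)
    moreover have "length Xs = length Xs'" using F G map_eq_imp_length_eq by metis
    ultimately have e: "Xs = Xs'" "Ys = Ys'" "q = q'" by (auto intro: prod_eqI)
    have "sl A @ sl B \<approx> sl A' @ sl B'" using ck_trans[OF q(2) ck_sym] q'(2) e by simp
    then have "(A, B) = (A', B')"
      by (intro pair_unique) (use less(2,3) F G gf_pair in \<open>auto simp: ext_def\<close>)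
    then show ?thesis using e F G by simp
  qed
qed

lemma sorted_ge_mset_eq: "sorted_wrt (\<ge>) xs \<Longrightarrow> sorted_wrt (\<ge>) ys \<Longrightarrow> mset xs = mset ys \<Longrightarrow> xs = (ys::nat list)"
proof -
  assume a: "sorted_wrt (\<ge>) xs" "sorted_wrt (\<ge>) ys" "mset xs = mset ys"
  have "sorted (rev xs)" "sorted (rev ys)" using a by (simp_all add: sorted_wrt_rev)
  then have "rev xs = rev ys" using a(3) by (metis mset_rev properties_for_sort)
  then show ?thesis by simp
qed

lemma sorted_rlen: "red u \<Longrightarrow> sorted_wrt (\<ge>) (map (rlen u) [0..<n])"
  by (auto simp: sorted_wrt_iff_nth_less rlen_antimono)

text \<open>Starting from the padded tableau, every arrangement of the lengths is reached by
  reflecting adjacent components.\<close>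

lemma ext_exists:
  "red u \<Longrightarrow> mset \<beta> = mset (map (rlen u) [0..<length \<beta>]) \<Longrightarrow> length (tab u) \<le> length \<beta> \<Longrightarrow>
    \<exists>Fs. ext Fs \<and> u \<approx> wd Fs \<and> map card Fs = \<beta>"
proof (induct "mu 0 \<beta>" arbitrary: \<beta> rule: less_induct)
  case less
  show ?case
  proof (cases "sorted_wrt (\<ge>) \<beta>")
    case True
    have b: "\<beta> = map (rlen u) [0..<length \<beta>]"
      by (rule sorted_ge_mset_eq[OF True sorted_rlen[OF less(2)] less(3)])
    define Gs where "Gs = map set (tab u) @ replicate (length \<beta> - length (tab u)) {}"
    note t = tab_pad[OF less(2,4), folded Gs_def]
    have "ext Gs" using t sqr_ck[OF less(2) t(3)] by (simp add: ext_def)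
    then show ?thesis using t b by auto
  next
    case False
    then obtain ys b a zs where s: "\<beta> = ys @ [b, a] @ zs" "b < a" using not_sorted_adj by blast
    have m: "mset (ys @ [a, b] @ zs) = mset \<beta>" "length (ys @ [a, b] @ zs) = length \<beta>" using s by auto
    have lt: "mu 0 (ys @ [a, b] @ zs) < mu 0 \<beta>" using mu_swap[of a b b a ys zs] s by simp
    have "\<exists>Fs. ext Fs \<and> u \<approx> wd Fs \<and> map card Fs = ys @ [a, b] @ zs"
      by (rule less(1)[OF lt less(2)], unfold m, rule less(3), rule less(4))
    then obtain Fs where F: "ext Fs" "u \<approx> wd Fs" "map card Fs = ys @ [a, b] @ zs" by blast
    then obtain Xs B A Ys where X: "Fs = Xs @ [B, A] @ Ys" "map card Xs = ys" "map card Ys = zs" "card B = a" "card A = b"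
      by (auto simp: map_eq_append_conv)
    obtain q where q: "gp q" "sl A @ sl B \<approx> wp q" "card (fst q) = card B" "card (snd q) = card A"
      "ext (Xs @ [snd q, fst q] @ Ys)" "wd (Xs @ [B, A] @ Ys) \<approx> wd (Xs @ [snd q, fst q] @ Ys)"
      using reflect_list F(1) X(1) by blast
    have "u \<approx> wd (Xs @ [snd q, fst q] @ Ys)" using ck_trans[OF F(2)] q(6) X(1) by simp
    then show ?thesis using q X s by (intro exI[of _ "Xs @ [snd q, fst q] @ Ys"]) auto
  qed
qed

section \<open>Columns\<close>

text \<open>Transposition, one column at a time. The guard makes the recursion terminate on
  arbitrary lists; a tableau meets it only when no row is left.\<close>

function cols :: "nat list list \<Rightarrow> nat list list" where
  "cols T = (if T = [] \<or> [] \<in> set T then [] else map hd T # cols (filter (\<lambda>R. R \<noteq> []) (map tl T)))"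
  by auto
termination
proof (relation "measure (\<lambda>T. sum_list (map length T))")
  fix T :: "nat list list" assume T: "\<not> (T = [] \<or> [] \<in> set T)"
  have "sum_list (map length (filter (\<lambda>R. R \<noteq> []) (map tl T))) = sum_list (map length (map tl T))"
  proof (induct T)
    case (Cons R T)
    have "length (tl R) = 0" if "tl R = []" using that by simp
    then show ?case using Cons by (cases "tl R = []") (simp_all del: length_tl)
  qed simp
  moreover have "sum_list (map length (map tl T)) < sum_list (map length T)"
    using T
  proof (induct T)
    case (Cons R T)
    have "length (tl R) < length R" using Cons.prems by (cases R) auto
    then show ?case using Cons by (cases "T = []") auto
  qed simp
  ultimately show "(filter (\<lambda>R. R \<noteq> []) (map tl T), T) \<in> measure (\<lambda>T. sum_list (map length T))"
    by simp
qed simp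

declare cols.simps [simp del]

lemma tableau_no_Nil: "tableau T \<Longrightarrow> [] \<notin> set T"
  using tableau_incr[of T "[]"] by auto

lemma above_tl: "above S R \<Longrightarrow> above (tl S) (tl R)"
  by (cases S; cases R) (auto simp: above_Cons)

lemma tableau_tl: "tableau T \<Longrightarrow> tableau (filter (\<lambda>R. R \<noteq> []) (map tl T))
    \<and> (\<exists>n. map tl T = filter (\<lambda>R. R \<noteq> []) (map tl T) @ replicate n [])"
proof (induct T rule: tableau.induct)
  case (2 R)
  have "incr (tl R)" using 2 by (cases R) auto
  then show ?case by (cases "tl R = []") (auto intro: exI[of _ 0] exI[of _ 1])
next
  case (3 R S Rs)
  then obtain n where IH: "tableau (filter (\<lambda>R. R \<noteq> []) (map tl (S # Rs)))"
    "map tl (S # Rs) = filter (\<lambda>R. R \<noteq> []) (map tl (S # Rs)) @ replicate n []" by auto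
  have ab: "above (tl S) (tl R)" using 3 above_tl by simp
  have i: "incr (tl R)" using 3 by (cases R) auto
  show ?case
  proof (cases "tl S = []")
    case True
    have e: "filter (\<lambda>R. R \<noteq> []) (map tl (S # Rs)) = []"
    proof (rule ccontr)
      let ?X = "filter (\<lambda>R. R \<noteq> []) (map tl (S # Rs))"
      assume "?X \<noteq> []"
      then have "hd ?X \<in> set ?X" "hd (map tl (S # Rs)) = hd ?X" using IH(2) by (metis hd_in_set, metis hd_append2)
      then show False using True by auto
    qed
    then have m: "map tl (S # Rs) = replicate n []" using IH(2) by simp
    show ?thesis
    proof (cases "tl R = []")
      case True
      then show ?thesis using e m by (auto intro!: exI[of _ "Suc n"])
    next
      case False
      then show ?thesis using e m i by (auto intro!: exI[of _ "n"])
    qed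
  next
    case False
    then have "tl R \<noteq> []" using ab by (cases "tl S") (auto simp: above_Cons)
    then show ?thesis using False IH ab i by (auto intro!: exI[of _ n])
  qed
qed (auto intro: exI[of _ 0])

text \<open>The letters of the column are carried to the left end of the row one after the other,
  each by \<open>ck_slide\<close>; the letter just placed becomes the new head of the row.\<close>

lemma slide_column:
  "sorted_wrt (>) C \<Longrightarrow> \<forall>c\<in>set C. c < x \<Longrightarrow> incr (x # R) \<Longrightarrow> x # R @ C \<approx> x # C @ R"
proof (induct C arbitrary: x)
  case (Cons c C)
  have "(x # R) @ [c] \<approx> x # c # R" using ck_slide[OF Cons.prems(3), of c] Cons.prems by simp
  then have 1: "x # R @ c # C \<approx> x # c # R @ C" using ck_append[of "(x # R) @ [c]" "x # c # R" C C] by simp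
  have "c # R @ C \<approx> c # C @ R" by (rule Cons.hyps) (use Cons.prems in auto)
  then have "x # c # R @ C \<approx> x # (c # C) @ R" using ck_Cons by simp
  then show ?case using ck_trans[OF 1] by simp
qed simp

lemma tableau_snoc: "tableau (T @ [R]) \<Longrightarrow> tableau T \<and> incr R \<and> R \<noteq> [] \<and> (\<forall>S\<in>set T. hd S < hd R)"
proof (induct T rule: tableau.induct)
  case (2 S)
  then show ?case by (cases S; cases R) (auto simp: above_Cons)
next
  case (3 S S' T)
  then have IH: "tableau (S' # T)" "incr R" "R \<noteq> []" "\<forall>S\<in>set (S' # T). hd S < hd R" by auto
  have "S' \<noteq> []" using tableau_Cons[OF IH(1)] by simp
  then have "hd S < hd S'" using 3(2) by (cases S; cases S') (auto simp: above_Cons)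
  then show ?case using IH 3(2) by auto
qed simp

lemma tableau_heads: "tableau T \<Longrightarrow> incr (map hd T)"
proof (induct T rule: rev_induct)
  case (snoc R T)
  then show ?case using tableau_snoc[OF snoc(2)] by (auto simp: sorted_wrt_append)
qed simp

lemma peel_column: "tableau T \<Longrightarrow> concat (rev T) \<approx> rev (map hd T) @ concat (rev (map tl T))"
proof (induct T rule: rev_induct)
  case (snoc R T)
  note s = tableau_snoc[OF snoc(2)]
  let ?C = "rev (map hd T)" and ?V = "concat (rev (map tl T))"
  have R: "R = hd R # tl R" using s by simp
  have "sorted_wrt (>) ?C" using tableau_heads[of T] s by (simp add: sorted_wrt_rev)
  then have "hd R # tl R @ ?C \<approx> hd R # ?C @ tl R"
    by (rule slide_column) (use s R in auto)
  then have 1: "(hd R # tl R @ ?C) @ ?V \<approx> (hd R # ?C @ tl R) @ ?V" by (rule ck_append[OF _ ck_refl])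
  have "R @ concat (rev T) \<approx> R @ ?C @ ?V" by (rule ck_append[OF ck_refl snoc(1)]) (use s in simp)
  also have "R @ ?C @ ?V = (hd R # tl R @ ?C) @ ?V" using s by simp
  finally show ?case using ck_trans[OF _ 1] by simp
qed simp

lemma concat_filter: "concat (rev (filter (\<lambda>R. R \<noteq> []) T)) = concat (rev T)"
  by (induct T) auto

lemma cols_ck: "tableau T \<Longrightarrow> concat (rev T) \<approx> concat (map rev (cols T))"
proof (induct T rule: cols.induct)
  case (1 T)
  show ?case
  proof (cases "T = []")
    case True
    then show ?thesis by (simp add: cols.simps)
  next
    case False
    let ?T = "filter (\<lambda>R. R \<noteq> []) (map tl T)"
    have n: "\<not> (T = [] \<or> [] \<in> set T)" using False tableau_no_Nil 1(2) by simp
    have "concat (rev ?T) \<approx> concat (map rev (cols ?T))"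
      by (rule 1(1)[OF n]) (use tableau_tl[OF 1(2)] in simp)
    then have "rev (map hd T) @ concat (rev ?T) \<approx> rev (map hd T) @ concat (map rev (cols ?T))"
      by (rule ck_append[OF ck_refl])
    then have "rev (map hd T) @ concat (rev (map tl T)) \<approx> concat (map rev (cols T))"
      using n by (subst cols.simps) (simp add: concat_filter)
    then show ?thesis by (rule ck_trans[OF peel_column[OF 1(2)]])
  qed
qed

lemma cols_tableau: "tableau T \<Longrightarrow> tableau (cols T)"
proof (induct T rule: cols.induct)
  case (1 T)
  show ?case
  proof (cases "T = []")
    case True
    then show ?thesis by (simp add: cols.simps)
  next
    case False
    let ?T = "filter (\<lambda>R. R \<noteq> []) (map tl T)"
    have n: "\<not> (T = [] \<or> [] \<in> set T)" using False tableau_no_Nil 1(2) by simp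
    obtain k where k: "map tl T = ?T @ replicate k []" "tableau ?T" using tableau_tl[OF 1(2)] by blast
    have IH: "tableau (cols ?T)" by (rule 1(1)[OF n k(2)])
    have c: "cols T = map hd T # cols ?T" using n by (subst cols.simps) simp
    have i: "incr (map hd T)" by (rule tableau_heads[OF 1(2)])
    show ?thesis
    proof (cases "?T = []")
      case True
      then have "cols ?T = []" by (subst cols.simps) simp
      then show ?thesis using c i n by simp
    next
      case F: False
      have n': "\<not> (?T = [] \<or> [] \<in> set ?T)" using F by simp
      then obtain Cs where Cs: "cols ?T = map hd ?T # Cs" by (subst (asm) cols.simps | subst cols.simps) simp
      have len: "length ?T \<le> length T" using arg_cong[OF k(1), of length] by simp
      have "above (map hd ?T) (map hd T)"
        unfolding above_def
      proof (intro conjI allI impI)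
        show "length (map hd ?T) \<le> length (map hd T)" using len by simp
        fix j assume j: "j < length (map hd ?T)"
        then have jT: "j < length T" using len by (simp only: length_map)
        have "?T ! j = map tl T ! j" using j k(1) by (metis length_map nth_append)
        then have e: "?T ! j = tl (T ! j)" using jT by simp
        have "?T ! j \<in> set ?T" by (rule nth_mem) (use j in \<open>simp only: length_map\<close>)
        then have ne: "tl (T ! j) \<noteq> []" using e n' by metis
        have "incr (T ! j)" using tableau_incr[OF 1(2)] jT nth_mem by blast
        then have "hd (T ! j) < hd (tl (T ! j))" using ne by (cases "T ! j"; cases "tl (T ! j)") auto
        then show "map hd T ! j < map hd ?T ! j" using e j jT by simp
      qed
      then show ?thesis using c Cs IH i by simp
    qed
  qed
qed

lemma cols_length:
  "[] \<notin> set T \<Longrightarrow> (if j < length (cols T) then length (cols T ! j) else 0) = length (filter (\<lambda>R. j < length R) T)"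
proof (induct T arbitrary: j rule: cols.induct)
  case (1 T)
  show ?case
  proof (cases "T = []")
    case True
    then show ?thesis by (simp add: cols.simps)
  next
    case False
    let ?T = "filter (\<lambda>R. R \<noteq> []) (map tl T)"
    have n: "\<not> (T = [] \<or> [] \<in> set T)" using False 1(2) by simp
    have c: "cols T = map hd T # cols ?T" using n by (subst cols.simps) simp
    show ?thesis
    proof (cases j)
      case 0
      have "filter (\<lambda>R. 0 < length R) T = T" using n by (auto simp: filter_id_conv)
      then show ?thesis using c 0 by simp
    next
      case (Suc k)
      have "(if k < length (cols ?T) then length (cols ?T ! k) else 0) = length (filter (\<lambda>R. k < length R) ?T)"
        by (rule 1(1)[OF n]) simp
      also have "\<dots> = length (filter (\<lambda>R. Suc k < length R) T)"
        using n
      proof (induct T)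
        case (Cons R T)
        then show ?case by (cases R; cases "T = []") auto
      qed simp
      finally have "(if k < length (cols ?T) then length (cols ?T ! k) else 0) = length (filter (\<lambda>R. Suc k < length R) T)" .
      moreover have "(if j < length (cols T) then length (cols T ! j) else 0)
          = (if k < length (cols ?T) then length (cols ?T ! k) else 0)" using c Suc by simp
      ultimately show ?thesis using Suc by (simp only:)
    qed
  qed
qed

text \<open>The column reading word of a tableau, reversed, is the row reading word of the
  transposed tableau. This is why column lengths may be taken as row lengths of the reversed
  word.\<close>

lemma tab_rev: "red u \<Longrightarrow> tab (rev u) = cols (tab u)"
proof -
  assume r: "red u"
  have t: "tableau (tab u)" using tableau_tab[OF r] by simp
  have "u \<approx> concat (map rev (cols (tab u)))" by (rule ck_trans[OF tab_equiv[OF r] cols_ck[OF t]])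
  then have "rev u \<approx> rev (concat (map rev (cols (tab u))))" by (rule ck_rev)
  moreover have "rev (concat (map rev Cs)) = concat (rev Cs)" for Cs :: "nat list list"
    by (induct Cs) auto
  ultimately have "rev u \<approx> concat (rev (cols (tab u)))" by simp
  then have "tab (rev u) = tab (concat (rev (cols (tab u))))" by (rule tab_ck[OF red_rev[OF r]])
  then show ?thesis using tab_tableau[OF cols_tableau[OF t]] by simp
qed

section \<open>Column lengths and their growth\<close>

definition clen :: "nat list \<Rightarrow> nat \<Rightarrow> nat" where
  "clen u j = rlen (rev u) j"

lemma clen_card:
  assumes "red u"
  shows "clen u j = card {i. j < rlen u i}"
proof -
  have "clen u j = length (filter (\<lambda>R. j < length R) (tab u))"
    unfolding clen_def rlen_def tab_rev[OF assms]
    by (rule cols_length[OF tableau_no_Nil]) (use tableau_tab[OF assms] in simp)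
  also have "\<dots> = card {i. i < length (tab u) \<and> j < length (tab u ! i)}" by (rule length_filter_conv_card)
  also have "{i. i < length (tab u) \<and> j < length (tab u ! i)} = {i. j < rlen u i}"
    by (auto simp: rlen_def split: if_splits)
  finally show ?thesis .
qed

lemma finite_rlen: "finite {i. j < rlen u i}"
  by (rule finite_subset[of _ "{..<length (tab u)}"]) (auto simp: rlen_def split: if_splits)

lemma clen_ck: "red u \<Longrightarrow> u \<approx> v \<Longrightarrow> clen u = clen v"
  using rlen_ck[OF red_rev ck_rev] by (simp add: clen_def fun_eq_iff)

lemma rlen_eqI: "red u \<Longrightarrow> red v \<Longrightarrow> clen u = clen v \<Longrightarrow> rlen u = rlen v"
proof -
  assume a: "red u" "red v" "clen u = clen v"
  have "rlen w i = card {j. i < clen w j}" if "red w" for w i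
    using clen_card[OF red_rev[OF that], of i] by (simp add: clen_def)
  then show ?thesis using a by (simp add: fun_eq_iff)
qed

lemma clen_antimono: "red u \<Longrightarrow> i \<le> j \<Longrightarrow> clen u j \<le> clen u i"
  unfolding clen_def by (rule rlen_antimono[OF red_rev])

lemma clen_upd:
  assumes "red u" "red v" "rlen v = (rlen u)(i := Suc (rlen u i))"
  shows "clen v = (clen u)(rlen u i := Suc (clen u (rlen u i)))"
proof
  fix j
  have "{k. j < rlen v k} = (if j = rlen u i then insert i {k. j < rlen u k} else {k. j < rlen u k})"
    using assms(3) by (auto split: if_splits)
  then show "clen v j = ((clen u)(rlen u i := Suc (clen u (rlen u i)))) j"
    using clen_card[OF assms(1)] clen_card[OF assms(2)] finite_rlen by simp
qed

text \<open>\<open>rlen_two\<close> in terms of columns: row lengths decrease weakly, so a box in a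
  weakly earlier row lies strictly further right, and a box in a later row weakly further
  left.\<close>

lemma clen_two:
  assumes "red (u @ [x, y])"
  obtains c d where "clen (u @ [x]) = (clen u)(c := Suc (clen u c))"
    "clen (u @ [x, y]) = (clen (u @ [x]))(d := Suc (clen (u @ [x]) d))"
    "x < y \<Longrightarrow> c < d" "y < x \<Longrightarrow> d \<le> c"
proof -
  have r: "red (u @ [x])" "red u"
    using assms red_appendD1[of "u @ [x]" "[y]"] red_appendD1[of u "[x, y]"] by auto
  obtain i j where ij: "rlen (u @ [x]) = (rlen u)(i := Suc (rlen u i))"
    "rlen (u @ [x, y]) = (rlen (u @ [x]))(j := Suc (rlen (u @ [x]) j))"
    "x < y \<longrightarrow> j \<le> i" "y < x \<longrightarrow> i < j" using rlen_two[of u x y] by blast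
  show thesis
  proof (rule that)
    show "clen (u @ [x]) = (clen u)(rlen u i := Suc (clen u (rlen u i)))"
      by (rule clen_upd[OF r(2,1) ij(1)])
    show "clen (u @ [x, y]) = (clen (u @ [x]))(rlen (u @ [x]) j := Suc (clen (u @ [x]) (rlen (u @ [x]) j)))"
      by (rule clen_upd[OF r(1) assms ij(2)])
    show "rlen u i < rlen (u @ [x]) j" if "x < y"
      using rlen_antimono[OF r(1), of j i] ij(1,3) that by (auto simp: fun_upd_def split: if_splits)
    show "rlen (u @ [x]) j \<le> rlen u i" if "y < x"
      using rlen_antimono[OF r(2), of i j] ij(1,4) that by auto
  qed
qed

lemma clen_one:
  assumes "red (u @ [x])"
  obtains c where "clen (u @ [x]) = (clen u)(c := Suc (clen u c))"
  using rlen_one[of u x] clen_upd[OF red_appendD1[OF assms] assms] by blast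

text \<open>The boxes of a decreasing word move weakly to the left, so the last one lies in the
  leftmost column that changes at all.\<close>

lemma dec_chain:
  "sorted_wrt (>) e \<Longrightarrow> e \<noteq> [] \<Longrightarrow> red (s @ e) \<Longrightarrow>
    \<exists>c. clen (s @ e) = (clen (s @ butlast e))(c := Suc (clen (s @ butlast e) c))
      \<and> (\<forall>t<c. clen (s @ e) t = clen s t) \<and> clen s c < clen (s @ e) c \<and> (\<forall>t. clen s t \<le> clen (s @ e) t)"
proof (induct e rule: rev_induct)
  case (snoc z e)
  show ?case
  proof (cases "e = []")
    case True
    obtain c where "clen (s @ [z]) = (clen s)(c := Suc (clen s c))"
      by (rule clen_one) (use snoc.prems True in auto)
    then show ?thesis using True by (intro exI[of _ c]) auto
  next
    case False
    have re: "red (s @ e)" using red_appendD1[of "s @ e" "[z]"] snoc.prems by simp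
    obtain c where c: "clen (s @ e) = (clen (s @ butlast e))(c := Suc (clen (s @ butlast e) c))"
      "\<forall>t<c. clen (s @ e) t = clen s t" "clen s c < clen (s @ e) c" "\<forall>t. clen s t \<le> clen (s @ e) t"
      using snoc.hyps[OF _ False re] snoc.prems(1) unfolding sorted_wrt_append by blast
    define y where "y = last e"
    have e: "e = butlast e @ [y]" using False by (simp add: y_def)
    have zy: "z < y" using snoc.prems False by (simp add: sorted_wrt_append y_def)
    have "red ((s @ butlast e) @ [y, z])" using snoc.prems e by (metis append.assoc append_Cons append_Nil)
    then obtain c1 d where d: "clen ((s @ butlast e) @ [y]) = (clen (s @ butlast e))(c1 := Suc (clen (s @ butlast e) c1))"
      "clen ((s @ butlast e) @ [y, z]) = (clen ((s @ butlast e) @ [y]))(d := Suc (clen ((s @ butlast e) @ [y]) d))"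
      "z < y \<Longrightarrow> d \<le> c1" by (rule clen_two) blast
    have e1: "(s @ butlast e) @ [y] = s @ e" "(s @ butlast e) @ [y, z] = s @ e @ [z]"
      using e by (metis append.assoc, metis append.assoc append_Cons append_Nil)
    note d' = d[unfolded e1]
    have "c1 = c" using d'(1) c(1) by (metis fun_upd_apply n_not_Suc_n)
    then have dc: "d \<le> c" using d'(3) zy by simp
    have "clen s d < clen (s @ e @ [z]) d" using d'(2) c(4) by (simp add: le_imp_less_Suc)
    moreover have "\<forall>t<d. clen (s @ e @ [z]) t = clen s t" using d'(2) c(2) dc by simp
    moreover have "\<forall>t. clen s t \<le> clen (s @ e @ [z]) t" using d'(2) c(4) by (simp add: le_SucI)
    ultimately show ?thesis using d'(2) by (intro exI[of _ d]) simp
  qed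
qed simp

section \<open>The left key and its growth\<close>

lemma upt_split: "c < n \<Longrightarrow> [0..<n] = [0..<c] @ [c] @ [Suc c..<n]"
  using upt_add_eq_append[of 0 c "n - c"] upt_conv_Cons[of c n] by simp

lemma ext_pad: "ext Fs \<Longrightarrow> ext (Fs @ replicate n {})"
proof -
  have "sq (replicate n {}) = 0" by (induct n) auto
  then show "ext Fs \<Longrightarrow> ?thesis" by (auto simp: ext_def gf_def)
qed

lemma ext_reorder:
  assumes "ext (Xs @ Zs @ Ys)" "mset \<beta> = mset (map card Zs)"
  obtains Zs' where "ext (Xs @ Zs' @ Ys)" "wd (Xs @ Zs @ Ys) \<approx> wd (Xs @ Zs' @ Ys)" "map card Zs' = \<beta>"
    "wd Zs \<approx> wd Zs'" "ext Zs'"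
proof -
  have e: "ext Zs" by (rule ext_block[OF assms(1)])
  then have g: "gf Zs" "red (wd Zs)" by (auto simp: ext_def gf_def)
  have l: "length \<beta> = length Zs" using arg_cong[OF assms(2), of size] by simp
  have "mset \<beta> = mset (map (rlen (wd Zs)) [0..<length \<beta>])" using ext_mset[OF e] assms(2) l by simp
  from ext_exists[OF g(2) this] tab_length_le[OF g(1)] l
  obtain Zs' where Z: "ext Zs'" "wd Zs \<approx> wd Zs'" "map card Zs' = \<beta>" by auto
  then have gz: "gf Zs'" by (simp add: ext_def)
  have "mset (map card Zs) = mset (map card Zs')" using Z(3) assms(2) by simp
  note r = ext_replace[OF assms(1) gz Z(2) this]
  show thesis by (rule that[OF r Z(3,2,1)])
qed

text \<open>Pad both factorizations to the same length and rearrange one tail so that all lengths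
  agree; then \<open>ext_unique\<close> applies.\<close>

lemma ext_hd_unique:
  assumes "ext Fs" "ext Gs" "wd Fs \<approx> wd Gs" "Fs \<noteq> []" "Gs \<noteq> []" "card (hd Fs) = card (hd Gs)"
  shows "hd Fs = hd Gs"
proof -
  define n where "n = max (length Fs) (length Gs)"
  define Fp where "Fp = Fs @ replicate (n - length Fs) {}"
  define Gp where "Gp = Gs @ replicate (n - length Gs) {}"
  obtain X Fs' where F: "Fp = X # Fs'" "hd Fs = X" using assms(4) Fp_def by (cases Fs) auto
  obtain Y Gs' where G: "Gp = Y # Gs'" "hd Gs = Y" using assms(5) Gp_def by (cases Gs) auto
  have e: "ext Fp" "ext Gp" using ext_pad assms by (auto simp: Fp_def Gp_def)
  have w: "wd Fp \<approx> wd Gp" using assms(3) by (simp add: Fp_def Gp_def)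
  have l: "length Fp = length Gp" by (simp add: Fp_def Gp_def n_def)
  have "rlen (wd Fp) = rlen (wd Gp)" using rlen_ck[OF _ w] e by (simp add: ext_def gf_def)
  then have "mset (map card Fp) = mset (map card Gp)" using ext_mset[OF e(1)] ext_mset[OF e(2)] l by simp
  then have m: "mset (map card Fs') = mset (map card Gs')" using F G assms(6) by simp
  have "ext ([Y] @ Gs' @ [])" using e G by simp
  then obtain Hs where H: "ext ([Y] @ Hs @ [])" "wd ([Y] @ Gs' @ []) \<approx> wd ([Y] @ Hs @ [])" "map card Hs = map card Fs'"
    by (rule ext_reorder[OF _ m])
  have w2: "wd Gp \<approx> wd (Y # Hs)" using H(2) G(1) by simp
  have "Fp = Y # Hs"
    by (rule ext_unique[OF e(1) _ _ ck_trans[OF w w2]]) (use H F G assms(6) in auto)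
  then show ?thesis using F G by simp
qed

text \<open>The head of an extremal factorization is determined by the class and its length
  (\<open>ext_hd_unique\<close>), so the description is definite. Equal column lengths give equal
  sets, as for the columns of a key. Columns are numbered from 0.\<close>

definition kset :: "nat list \<Rightarrow> nat \<Rightarrow> nat set" where
  "kset u j = (THE S. \<exists>Ds. ext Ds \<and> rev u \<approx> wd Ds \<and> Ds \<noteq> [] \<and> hd Ds = S \<and> card S = clen u j)"

lemma kset_eq:
  assumes "ext Ds" "rev u \<approx> wd Ds" "Ds \<noteq> []" "card (hd Ds) = clen u j"
  shows "kset u j = hd Ds"
  unfolding kset_def
proof (rule the_equality)
  show "\<exists>Ds'. ext Ds' \<and> rev u \<approx> wd Ds' \<and> Ds' \<noteq> [] \<and> hd Ds' = hd Ds \<and> card (hd Ds) = clen u j"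
    using assms by blast
  fix S assume "\<exists>Ds'. ext Ds' \<and> rev u \<approx> wd Ds' \<and> Ds' \<noteq> [] \<and> hd Ds' = S \<and> card S = clen u j"
  then obtain Ds' where D: "ext Ds'" "rev u \<approx> wd Ds'" "Ds' \<noteq> []" "hd Ds' = S" "card S = clen u j" by blast
  have "wd Ds' \<approx> wd Ds" by (rule ck_trans[OF ck_sym[OF D(2)] assms(2)])
  then show "S = hd Ds" using ext_hd_unique[OF D(1) assms(1)] D assms by simp
qed

lemma clen_0: "length (tab (rev u)) \<le> j \<Longrightarrow> clen u j = 0"
  by (simp add: clen_def rlen_def)

lemma col_exists:
  assumes "red u" "mset js = mset [0..<n]" "length (tab (rev u)) \<le> n"
  obtains Ds where "ext Ds" "rev u \<approx> wd Ds" "map card Ds = map (clen u) js" "length Ds = n"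
proof -
  have l: "length js = n" using arg_cong[OF assms(2), of size] by simp
  have "mset (map (clen u) js) = image_mset (clen u) (mset js)" by simp
  also have "\<dots> = mset (map (clen u) [0..<n])" unfolding assms(2) by simp
  also have "map (clen u) [0..<n] = map (rlen (rev u)) [0..<length (map (clen u) js)]"
    using l by (simp add: clen_def)
  finally have "\<exists>Fs. ext Fs \<and> rev u \<approx> wd Fs \<and> map card Fs = map (clen u) js"
    by (rule ext_exists[OF red_rev[OF assms(1)]]) (use assms(3) l in simp)
  then obtain Fs where F: "ext Fs" "rev u \<approx> wd Fs" "map card Fs = map (clen u) js" by blast
  have "length Fs = n" using arg_cong[OF F(3), of length] l by simp
  then show thesis using that F by blast
qed

lemma kset_exists:
  assumes "red u"
  obtains Ds where "ext Ds" "rev u \<approx> wd Ds" "Ds \<noteq> []" "kset u j = hd Ds" "card (hd Ds) = clen u j"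
proof -
  define n where "n = Suc (length (tab (rev u)) + j)"
  have jn: "j < n" by (simp add: n_def)
  have "[0..<n] = [0..<j] @ [j] @ [Suc j..<n]"
    by (rule upt_split[OF jn])
  then have "mset ([j] @ [0..<j] @ [Suc j..<n]) = mset [0..<n]" by simp
  then obtain Ds where D: "ext Ds" "rev u \<approx> wd Ds" "map card Ds = map (clen u) ([j] @ [0..<j] @ [Suc j..<n])" "length Ds = n"
    by (rule col_exists[OF assms]) (auto simp: n_def)
  have ne: "Ds \<noteq> []" "card (hd Ds) = clen u j" using D(3) by (cases Ds; auto)+
  show thesis by (rule that[OF D(1,2) ne(1) kset_eq[OF D(1,2) ne] ne(2)])
qed

lemma kset_card: "red u \<Longrightarrow> card (kset u j) = clen u j"
  by (rule kset_exists[of u j]) auto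

lemma kset_finite: "red u \<Longrightarrow> finite (kset u j)"
proof -
  assume r: "red u"
  obtain Ds where D: "ext Ds" "Ds \<noteq> []" "kset u j = hd Ds" by (rule kset_exists[OF r, of j])
  then show ?thesis using hd_in_set[OF D(2)] by (auto simp: ext_def gf_def)
qed

lemma kset_letters: "red u \<Longrightarrow> kset u j \<subseteq> set u"
proof -
  assume r: "red u"
  obtain Ds where D: "ext Ds" "rev u \<approx> wd Ds" "Ds \<noteq> []" "kset u j = hd Ds" by (rule kset_exists[OF r, of j])
  have "set (wd Ds) = set u" using ck_set[OF D(2)] by simp
  moreover have "set (wd Ds) = \<Union>(set Ds)" using D(1) set_wd by (simp add: ext_def)
  ultimately show ?thesis using D hd_in_set[OF D(3)] by auto
qed

lemma kset_ck: "red u \<Longrightarrow> u \<approx> v \<Longrightarrow> kset u = kset v"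
proof
  fix j assume a: "red u" "u \<approx> v"
  obtain Ds where D: "ext Ds" "rev u \<approx> wd Ds" "Ds \<noteq> []" "kset u j = hd Ds" "card (hd Ds) = clen u j"
    by (rule kset_exists[OF a(1), of j])
  have "rev v \<approx> wd Ds" by (rule ck_trans[OF ck_sym[OF ck_rev[OF a(2)]] D(2)])
  then have "kset v j = hd Ds" by (rule kset_eq[OF D(1) _ D(3)]) (use D(5) clen_ck[OF a] in simp)
  then show "kset u j = kset v j" using D(4) by simp
qed

lemma kset_empty: "red u \<Longrightarrow> clen u j = 0 \<Longrightarrow> kset u j = {}"
  using kset_card[of u j] kset_finite[of u j] by simp

text \<open>In extremal position a shorter component behind a longer one leaves nothing unmatched,
  so \<open>reflect_hw\<close> brings its length to the front as a part of the longer one.\<close>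

lemma move_front:
  assumes e: "ext (Xs @ [L, Y] @ Ys)" and le: "card Y \<le> card L" and K: "Y \<union> L \<subseteq> {..<K}"
  obtains Y' where "ext (Xs @ [pairedR K Y L, Y'] @ Ys)" "wd (Xs @ [L, Y] @ Ys) \<approx> wd (Xs @ [pairedR K Y L, Y'] @ Ys)"
    "card (pairedR K Y L) = card Y" "pairedR K Y L \<subseteq> L" "card Y' = card L"
proof -
  have g: "gp (Y, L)" using e gf_pair by (auto simp: ext_def)
  have u: "unp Y L = {}" by (rule ext_pair_hw[OF e le])
  obtain Y' where Y: "gp (Y', pairedR K Y L)" "sl Y @ sl L \<approx> sl Y' @ sl (pairedR K Y L)" "card Y' = card L"
    "card (pairedR K Y L) = card Y" "pairedR K Y L \<subseteq> L" by (rule reflect_hw[OF g u K])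
  have "gf [pairedR K Y L, Y']" using pair_gf[OF Y(1)] by simp
  moreover have "wd [L, Y] \<approx> wd [pairedR K Y L, Y']" using Y(2) by simp
  moreover have "mset (map card [L, Y]) = mset (map card [pairedR K Y L, Y'])" using Y by simp
  ultimately have "ext (Xs @ [pairedR K Y L, Y'] @ Ys)" "wd (Xs @ [L, Y] @ Ys) \<approx> wd (Xs @ [pairedR K Y L, Y'] @ Ys)"
    using ext_replace[OF e] by blast+
  then show thesis using that Y by blast
qed

text \<open>Let columns \<open>j\<close> and \<open>j + 1\<close> come first and exchange them; the
  new head is a part of the old one.\<close>

lemma kset_nested: "red u \<Longrightarrow> kset u (Suc j) \<subseteq> kset u j"
proof -
  assume r: "red u"
  define n where "n = Suc (Suc (length (tab (rev u)) + j))"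
  have "[0..<n] = [0..<j] @ [j, Suc j] @ [Suc (Suc j)..<n]"
    using upt_split[of j n] upt_conv_Cons[of "Suc j" n] by (simp add: n_def del: upt_Suc)
  then have "mset ([j, Suc j] @ [0..<j] @ [Suc (Suc j)..<n]) = mset [0..<n]" by simp
  then obtain Ds where D: "ext Ds" "rev u \<approx> wd Ds"
    "map card Ds = map (clen u) ([j, Suc j] @ [0..<j] @ [Suc (Suc j)..<n])" "length Ds = n"
    by (rule col_exists[OF r]) (auto simp: n_def)
  obtain D1 D2 Ys where Ds: "Ds = [] @ [D1, D2] @ Ys" "card D1 = clen u j" "card D2 = clen u (Suc j)"
    using D(3) by (auto simp: map_eq_Cons_conv)
  have f: "finite (D2 \<union> D1)" using D(1) Ds(1) by (auto simp: ext_def gf_def)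
  then obtain K where "\<forall>x\<in>D2 \<union> D1. x < K" using finite_nat_set_iff_bounded by blast
  then have K: "D2 \<union> D1 \<subseteq> {..<K}" by auto
  have le: "card D2 \<le> card D1" using Ds clen_antimono[OF r, of j "Suc j"] by simp
  have e: "ext ([] @ [D1, D2] @ Ys)" using D(1) Ds(1) by simp
  obtain Y' where Y: "ext ([] @ [pairedR K D2 D1, Y'] @ Ys)"
    "wd ([] @ [D1, D2] @ Ys) \<approx> wd ([] @ [pairedR K D2 D1, Y'] @ Ys)"
    "card (pairedR K D2 D1) = card D2" "pairedR K D2 D1 \<subseteq> D1" by (rule move_front[OF e le K])
  have "kset u j = D1" using kset_eq[OF D(1,2)] Ds by simp
  moreover have "rev u \<approx> wd ([] @ [pairedR K D2 D1, Y'] @ Ys)" using ck_trans[OF D(2)] Y(2) Ds(1) by simp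
  then have "kset u (Suc j) = pairedR K D2 D1" using kset_eq[OF Y(1)] Y(3) Ds(3) by simp
  ultimately show ?thesis using Y(4) by simp
qed

lemma kset_mono: "red u \<Longrightarrow> i \<le> j \<Longrightarrow> kset u j \<subseteq> kset u i"
  using lift_Suc_antimono_le[of "kset u" i j] kset_nested by blast

section \<open>The first column, and the place of a new letter\<close>

lemma rowins_keep: "m \<in> set R \<Longrightarrow> m \<le> b \<Longrightarrow> m \<in> set (fst (rowins R b))"
  by (induct R) auto

lemma roww_min: "m \<in> set R \<or> m \<in> set u \<Longrightarrow> \<forall>x\<in>set u. m \<le> x \<Longrightarrow> m \<in> set (fst (roww R u))"
proof (induct u arbitrary: R)
  case (Cons b u)
  have "m \<in> set (fst (rowins R b)) \<or> m \<in> set u"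
    using Cons.prems rowins_keep[of m R b] rowins_mem[of b R] by auto
  then show ?case using Cons.hyps Cons.prems by simp
qed simp

lemma kset_0: "red u \<Longrightarrow> kset u 0 = set (fst (roww [] (rev u)))"
proof -
  assume r: "red u"
  define n where "n = Suc (length (tab (rev u)))"
  define Gs where "Gs = map set (tab (rev u)) @ replicate (n - length (tab (rev u))) {}"
  have "length (tab (rev u)) \<le> n" by (simp add: n_def)
  note t = tab_pad[OF red_rev[OF r] this, folded Gs_def]
  have e: "ext Gs" using t(1,6) sqr_ck[OF red_rev[OF r] t(3)] by (simp add: ext_def)
  have ne: "Gs \<noteq> []" using t(4) by (auto simp: n_def)
  have c: "card (hd Gs) = clen u 0"
  proof -
    have "hd (map card Gs) = rlen (rev u) 0" unfolding t(5) n_def by (simp add: upt_rec del: upt_Suc)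
    then show ?thesis using ne by (simp add: hd_map clen_def)
  qed
  have "hd Gs = set (fst (roww [] (rev u)))"
    by (cases "u = []") (auto simp: Gs_def n_def tab.simps[of "rev u"])
  then show ?thesis using kset_eq[OF e t(3) ne c] by simp
qed

lemma Min_kset: "red u \<Longrightarrow> u \<noteq> [] \<Longrightarrow> Min (set u) \<in> kset u 0"
  using kset_0[of u] roww_min[of "Min (set u)" "[]" "rev u"] by simp

text \<open>Arrange the columns of \<open>u @ [x]\<close> so that the growing column
  \<open>c\<close> is the factor read last. Removing the last letter of that factor takes the box
  away from column \<open>c\<close> again, and reverse insertion identifies this letter with
  \<open>x\<close> and the remaining word with the class of \<open>u\<close>.\<close>

lemma append_last:
  assumes r: "red (u @ [x])" and c: "clen (u @ [x]) = (clen u)(c := Suc (clen u c))"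
    and js: "mset (js @ [c]) = mset [0..<n]" and n: "length (tab (rev (u @ [x]))) \<le> n"
  obtains Ds D where "ext (Ds @ [D])" "rev u \<approx> wd (Ds @ [D])" "ext (Ds @ [insert x D])"
    "rev (u @ [x]) \<approx> wd (Ds @ [insert x D])" "x \<notin> D" "map card Ds = map (clen u) js" "card D = clen u c"
    "length Ds = length js" "\<And>d. d \<in> D \<Longrightarrow> x < d"
proof -
  let ?v = "clen (u @ [x])"
  have ru: "red u" using r red_appendD1 by blast
  have "c \<in> set [0..<n]" using arg_cong[OF js, of set_mset] by (metis in_set_conv_decomp set_mset_mset)
  then have cn: "c < n" by simp
  have cis: "c \<notin> set js"
  proof -
    have "distinct (js @ [c])" using js mset_eq_imp_distinct_iff[of "js @ [c]" "[0..<n]"] by simp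
    then show ?thesis by simp
  qed
  obtain Fs where F: "ext Fs" "rev (u @ [x]) \<approx> wd Fs" "map card Fs = map ?v (js @ [c])" "length Fs = n"
    by (rule col_exists[OF r js n])
  obtain Ds D' where Fs: "Fs = Ds @ [D']" using F(4) cn by (cases Fs rule: rev_cases) auto
  have cD: "map card Ds = map (clen u) js" "card D' = Suc (clen u c)"
    using F(3) Fs c cis by (auto intro: map_cong simp: fun_upd_def)
  have lDs: "length Ds = length js" using cD(1) map_eq_imp_length_eq by metis
  have ln: "length js = n - 1" using arg_cong[OF js, of size] by simp
  have fD: "finite D'" using cD(2) card_ge_0_finite[of D'] by simp
  have "D' \<noteq> {}" using cD(2) by auto
  define x' where "x' = Min D'"
  define D where "D = D' - {x'}"
  have x': "x' \<in> D'" "\<And>d. d \<in> D \<Longrightarrow> x' < d"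
    using fD \<open>D' \<noteq> {}\<close> Min_in[of D'] Min_le[of D'] by (auto simp: x'_def D_def order.strict_iff_order)
  have D': "D' = insert x' D" "x' \<notin> D" "finite D" using x'(1) fD by (auto simp: D_def)
  have cDc: "card D = clen u c" using cD(2) D' by simp
  have slD: "sl D' = x' # sl D"
    unfolding D'(1) by (rule sl_eqI) (use x' D' in auto)
  define s where "s = rev (wd Ds)"
  define e where "e = rev (sl D')"
  define v where "v = s @ butlast e"
  have "sorted_wrt (>) e" by (simp add: e_def sorted_wrt_rev)
  then have e: "sorted_wrt (>) e" "e \<noteq> []" "e = butlast e @ [x']" "butlast e = rev (sl D)"
    by (simp_all add: e_def slD)
  have se: "s @ e = rev (wd Fs)" unfolding s_def e_def Fs by simp
  have uxse: "u @ [x] \<approx> s @ e" using ck_rev[OF F(2)] se by simp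
  have rse: "red (s @ e)" by (rule red_ck[OF r uxse])
  have vx: "v @ [x'] = s @ e" using e(3) v_def by simp
  have rv: "red v" using rse vx red_appendD1 by metis
  have nu: "?v = clen (s @ e)" by (rule clen_ck[OF r uxse])
  obtain cl where cl: "clen (s @ e) = (clen v)(cl := Suc (clen v cl))" "\<forall>t<cl. clen (s @ e) t = clen s t"
    "clen s cl < clen (s @ e) cl" using dec_chain[OF e(1,2) rse] v_def by auto
  have rs: "red s" using rse red_appendD1 by blast
  have eDs: "ext Ds" using ext_block[of "[]" Ds "[D']"] F(1) Fs by simp
  have ms: "mset (map (clen u) js) = mset (map (clen s) [0..<n - 1])"
    using ext_mset[OF eDs] cD(1) lDs ln by (simp add: clen_def[abs_def] s_def)
  have isc: "mset js = mset ([0..<c] @ [Suc c..<n])"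
  proof -
    have "[0..<n] = [0..<c] @ [c] @ [Suc c..<n]"
      by (rule upt_split[OF cn])
    then show ?thesis using js by simp
  qed
  have "mset (map (clen s) [0..<n - 1]) = image_mset (clen u) (mset js)" using ms by simp
  also have "\<dots> = mset (map (clen u) ([0..<c] @ [Suc c..<n]))" unfolding isc by simp
  finally have ms': "mset (map (clen s) [0..<n - 1]) = mset (map (clen u) ([0..<c] @ [Suc c..<n]))" .
  \<comment> \<open>The columns other than \<open>c\<close> form an extremal factorization by
    themselves, so \<open>s\<close> has the column lengths of \<open>u\<close> with the one at
    \<open>c\<close> left out.\<close>
  have lists: "map (clen s) [0..<n - 1] = map (clen u) ([0..<c] @ [Suc c..<n])"
  proof (rule sorted_ge_mset_eq[OF _ _ ms'])
    show "sorted_wrt (\<ge>) (map (clen s) [0..<n - 1])"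
      using sorted_rlen[OF red_rev[OF rs]] by (simp add: clen_def[abs_def])
    show "sorted_wrt (\<ge>) (map (clen u) ([0..<c] @ [Suc c..<n]))"
    proof -
      have "sorted_wrt (<) ([0..<c] @ [Suc c..<n])" by (auto simp: sorted_wrt_append)
      then have "sorted_wrt (\<lambda>i j. clen u j \<le> clen u i) ([0..<c] @ [Suc c..<n])"
        by (rule sorted_wrt_mono_rel[rotated]) (simp add: clen_antimono[OF ru])
      then show ?thesis by (simp only: sorted_wrt_map)
    qed
  qed
  have lt: "clen s t = clen u t" if "t < c" for t
    using arg_cong[OF lists, of "\<lambda>l. l ! t"] that cn by (simp add: nth_append)
  have at: "clen s c \<le> clen u c"
  proof (cases "c < n - 1")
    case True
    then have "clen s c = clen u (Suc c)"
      using arg_cong[OF lists, of "\<lambda>l. l ! c"] by (simp add: nth_append)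
    then show ?thesis using clen_antimono[OF ru, of c "Suc c"] by simp
  next
    case False
    have "length (tab (wd Ds)) \<le> n - 1" using tab_length_le[of Ds] eDs lDs ln by (simp add: ext_def)
    then show ?thesis using clen_0[of s c] False by (simp add: s_def)
  qed
  have nt: "clen (s @ e) t = (if t = c then Suc (clen u c) else clen u t)" for t
    using fun_cong[OF nu, of t] fun_cong[OF c, of t] by simp
  \<comment> \<open>Left of \<open>c\<close> nothing changes between \<open>s\<close> and
    \<open>s @ e\<close>, while column \<open>c\<close> does become longer; \<open>cl\<close> is the
    leftmost column that changes.\<close>
  have "cl = c"
  proof (rule ccontr)
    assume "cl \<noteq> c"
    then consider "cl < c" | "c < cl" by linarith
    then show False
    proof cases
      case 1
      then show False using cl(3) lt[of cl] nt[of cl] by simp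
    next
      case 2
      then show False using cl(2) at nt[of c] by simp
    qed
  qed
  have "clen v = clen u"
  proof
    fix t show "clen v t = clen u t"
      using fun_cong[OF cl(1), of t] nt[of t] \<open>cl = c\<close> by (simp split: if_splits)
  qed
  then have "rlen u = rlen v" using rlen_eqI[OF ru rv] by simp
  moreover have "tab (u @ [x]) = tab (v @ [x'])" using tab_ck[OF r uxse] vx by simp
  ultimately have tc: "tab u = tab v" "x = x'" using tab_cancel[OF r, of v x'] rse vx by auto
  then have uv: "u \<approx> v" using tab_eq_ck ru rv by blast
  have wv: "rev v = wd (Ds @ [D])" unfolding v_def e(4) s_def by simp
  have w: "rev u \<approx> wd (Ds @ [D])" using ck_rev[OF uv] wv by simp
  have g: "gf (Ds @ [D])"
    using F(1) Fs D'(3) red_ck[OF red_rev[OF ru] w] by (auto simp: ext_def gf_def)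
  have "ext (Ds @ [D])"
  proof (rule extI[OF g])
    have "rlen (wd (Ds @ [D])) = clen u" using rlen_ck[OF red_rev[OF ru] w] by (simp add: clen_def fun_eq_iff)
    moreover have "length (Ds @ [D]) = n" using lDs ln cn by simp
    moreover have "mset (map (clen u) (js @ [c])) = image_mset (clen u) (mset (js @ [c]))" by simp
    then have "mset (map (clen u) (js @ [c])) = mset (map (clen u) [0..<n])" unfolding js by simp
    ultimately show "mset (map card (Ds @ [D])) = mset (map (rlen (wd (Ds @ [D]))) [0..<length (Ds @ [D])])"
      using cD(1) cDc by simp
  qed
  then show thesis
    by (rule that[of Ds D]) (use w F(1,2) Fs D' tc cD cDc lDs x'(2) in auto)
qed

text \<open>With column \<open>j\<close> in front and the growing column last, the new letter enters
  the last factor and the front factor stays as it is.\<close>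

lemma kset_other:
  assumes r: "red (u @ [x])" and c: "clen (u @ [x]) = (clen u)(c := Suc (clen u c))" and j: "j \<noteq> c"
  shows "kset (u @ [x]) j = kset u j"
proof -
  define n where "n = Suc (length (tab (rev (u @ [x]))) + j + c)"
  define js where "js = j # filter (\<lambda>i. i \<noteq> j \<and> i \<noteq> c) [0..<n]"
  have "distinct (js @ [c])" "set (js @ [c]) = set [0..<n]" using j by (auto simp: js_def n_def)
  then have m: "mset (js @ [c]) = mset [0..<n]" by (metis distinct_upt set_eq_iff_mset_eq_distinct)
  obtain Ds D where D: "ext (Ds @ [D])" "rev u \<approx> wd (Ds @ [D])" "ext (Ds @ [insert x D])"
    "rev (u @ [x]) \<approx> wd (Ds @ [insert x D])" "map card Ds = map (clen u) js"
    by (rule append_last[OF r c m]) (auto simp: n_def)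
  obtain X Ds' where X: "Ds = X # Ds'" "card X = clen u j" using D(5) by (auto simp: js_def map_eq_Cons_conv)
  have "kset u j = X" using kset_eq[OF D(1,2)] X by simp
  moreover have "kset (u @ [x]) j = X" using kset_eq[OF D(3,4)] X c j by simp
  ultimately show ?thesis by simp
qed

section \<open>Growth inside the column that receives the box\<close>

lemma pool_antimono: "A \<subseteq> A' \<Longrightarrow> pool A' B t \<le> pool A B t"
proof (induct t)
  case (Suc t)
  then show ?case by (auto simp: subset_iff intro: diff_le_mono order_trans[OF diff_le_self])
qed simp

text \<open>Adding one letter \<open>b\<close> to the pool changes the matching in exactly one place: the first unmatched
  letter above \<open>b\<close> becomes matched.\<close>

lemma pool_insert:
  assumes "b \<notin> B" "a \<in> A" "b < a" "pool A B a = 0" "\<And>x. x \<in> A \<Longrightarrow> b < x \<Longrightarrow> x < a \<Longrightarrow> 0 < pool A B x"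
  shows "pool A (insert b B) t = pool A B t + of_bool (b < t \<and> t \<le> a)"
proof (induct t)
  case (Suc t)
  consider "t < b" | "t = b" | "b < t" "t < a" | "t = a" | "a < t" by linarith
  then show ?case
  proof cases
    case 3
    then show ?thesis using Suc assms(5)[of t] by auto
  next
    case 4
    then show ?thesis using Suc assms by auto
  qed (use Suc assms in auto)
qed simp

text \<open>One exchange with a longer column \<open>L\<close> preserves the pattern "below the new
  letter, \<open>Y\<close> is contained in \<open>A\<close>". The extra letter \<open>y\<close> gets
  one more letter \<open>l\<close> of \<open>L\<close> matched. In complemented order the matching
  of \<open>Y\<close> has an empty pool at that place, and beyond it \<open>Y\<close> and
  \<open>A\<close> supply the same letters, so both match the same letters of \<open>L\<close> below
  \<open>l\<close>.\<close>

lemma greedy: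
  assumes K: "Y' \<union> L \<subseteq> {..<K}" and Y': "Y' = insert y Y" "y \<notin> Y" and A: "A \<subseteq> Y"
    and key: "\<And>z. z \<in> Y \<Longrightarrow> z < y \<Longrightarrow> z \<in> A"
    and c: "card (pairedR K Y' L) = Suc (card (pairedR K Y L))" and fL: "finite L"
  shows "\<exists>l. pairedR K Y' L = insert l (pairedR K Y L) \<and> l \<notin> pairedR K Y L \<and> pairedR K A L \<subseteq> pairedR K Y L
    \<and> (\<forall>z\<in>pairedR K Y L. z < l \<longrightarrow> z \<in> pairedR K A L)"
proof -
  let ?k = "(-) K"
  define M where "M = ?k ` L"
  define B where "B = ?k ` Y"
  define C where "C = ?k ` A"
  define b where "b = K - y"
  have yK: "y < K" "\<And>z. z \<in> Y \<Longrightarrow> z < K" using K Y' by auto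
  have B': "?k ` Y' = insert b B" using Y' by (simp add: B_def b_def)
  have bB: "b \<notin> B"
  proof
    assume "b \<in> B"
    then obtain z where "z \<in> Y" "K - y = K - z" by (auto simp: B_def b_def)
    then show False using yK Y'(2) by (metis diff_diff_cancel less_imp_le)
  qed
  have CB: "C \<subseteq> B" using A by (auto simp: C_def B_def)
  have fM: "finite M" using fL by (simp add: M_def)
  have MK: "pairedL M X \<subseteq> {..K}" for X by (auto simp: pairedL_def M_def)
  have card: "card (pairedR K X L) = card (pairedL M (?k ` X))" for X
    unfolding pairedR_def M_def[symmetric] by (rule card_compl[OF MK])
  define P where "P = {a \<in> M. b < a \<and> pool M B a = 0}"
  have Pne: "P \<noteq> {}"
  proof
    assume P: "P = {}"
    have "pool M (insert b B) t = pool M B t + of_bool (b < t)" for t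
    proof (induct t)
      case (Suc t)
      consider "t < b" | "t = b" | "b < t" by linarith
      then show ?case
      proof cases
        case 3
        then have "t \<in> M \<Longrightarrow> 0 < pool M B t" using P by (auto simp: P_def)
        then show ?thesis using 3 Suc by auto
      qed (use Suc bB in auto)
    qed simp
    then have "pairedL M (insert b B) = pairedL M B" using P by (auto simp: pairedL_def P_def)
    then show False using c card[of Y'] card[of Y] B' by (simp add: B_def)
  qed
  define a where "a = Min P"
  have fP: "finite P" using fM by (simp add: P_def)
  have aP: "a \<in> P" using Min_in[OF fP Pne] by (simp add: a_def)
  have a: "a \<in> M" "b < a" "pool M B a = 0" using aP by (auto simp: P_def)
  have am: "0 < pool M B x" if "x \<in> M" "b < x" "x < a" for x
    using Min_le[OF fP, of x] that by (fastforce simp: a_def P_def)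
  have pi: "pool M (insert b B) t = pool M B t + of_bool (b < t \<and> t \<le> a)" for t
    by (rule pool_insert[OF bB a am])
  have pl: "pairedL M (insert b B) = insert a (pairedL M B)"
  proof
    show "pairedL M (insert b B) \<subseteq> insert a (pairedL M B)"
    proof
      fix t assume t: "t \<in> pairedL M (insert b B)"
      show "t \<in> insert a (pairedL M B)"
      proof (cases "b < t \<and> t < a")
        case True
        then show ?thesis using t am[of t] by (auto simp: pairedL_def)
      next
        case False
        then show ?thesis using t pi[of t] by (auto simp: pairedL_def)
      qed
    qed
    show "insert a (pairedL M B) \<subseteq> pairedL M (insert b B)" using a pi by (auto simp: pairedL_def)
  qed
  have aK: "a \<le> K" using a(1) by (auto simp: M_def)
  define l where "l = K - a"
  have 1: "pairedR K Y' L = insert l (pairedR K Y L)"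
    using pl B' by (simp add: pairedR_def M_def B_def l_def)
  have 2: "l \<notin> pairedR K Y L"
  proof
    assume "l \<in> pairedR K Y L"
    then have "pairedR K Y' L = pairedR K Y L" using 1 by auto
    then show False using c by simp
  qed
  have 3: "pairedR K A L \<subseteq> pairedR K Y L"
    using pool_mono[OF CB, of M] unfolding pairedR_def M_def[symmetric] B_def[symmetric] C_def[symmetric]
    by (auto simp: pairedL_def) (metis (mono_tags, lifting) image_eqI less_le_trans mem_Collect_eq)
  have eqp: "pool M C t = pool M B t" if "a \<le> t" for t
    using that
  proof (induct t rule: dec_induct)
    case base
    then show ?case using pool_mono[OF CB, of M a] a(3) by simp
  next
    case (step t)
    have "t \<in> C \<longleftrightarrow> t \<in> B"
    proof
      assume "t \<in> B"
      then obtain z where z: "z \<in> Y" "t = K - z" by (auto simp: B_def)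
      have "K - y < K - z" using step a(2) z b_def by simp
      then have "z < y" using yK by linarith
      then show "t \<in> C" using key z by (auto simp: C_def)
    qed (use CB in auto)
    then show ?case using step by simp
  qed
  have 4: "z \<in> pairedR K A L" if z: "z \<in> pairedR K Y L" "z < l" for z
  proof -
    obtain t where t: "t \<in> pairedL M B" "z = K - t" using z by (auto simp: pairedR_def M_def B_def)
    have "a \<le> t" using t z(2) l_def by (metis diff_le_mono2 leI le_less_trans less_imp_le less_irrefl)
    then have "t \<in> pairedL M C" using t eqp[of t] by (auto simp: pairedL_def)
    then show ?thesis using t(2) by (auto simp: pairedR_def M_def C_def)
  qed
  show ?thesis using 1 2 3 4 by blast
qed

lemma hw_hd: "gf Gs \<Longrightarrow> hwF Gs \<Longrightarrow> Gs \<noteq> [] \<Longrightarrow> hd Gs = set (fst (roww [] (wd Gs)))"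
proof -
  assume g: "gf Gs" "hwF Gs" "Gs \<noteq> []"
  note t = hw_tab[OF g(1,2)]
  show ?thesis
  proof (cases "wd Gs = []")
    case True
    then have "Gs = replicate (length Gs) {}" using t by simp
    then have "hd Gs = {}" using g(3) by (metis hd_replicate length_greater_0_conv not_gr_zero replicate_empty)
    then show ?thesis using True by simp
  next
    case False
    then have "tab (wd Gs) = fst (roww [] (wd Gs)) # tab (snd (roww [] (wd Gs)))" by (subst tab.simps) simp
    then have "hd (map set (tab (wd Gs)) @ replicate (length Gs - length (tab (wd Gs))) {}) = set (fst (roww [] (wd Gs)))"
      by simp
    then show ?thesis using t by simp
  qed
qed

text \<open>Rectification only enlarges the head and ends in the first row of the tableau.\<close>

lemma hd_sub_roww: "gf Fs \<Longrightarrow> Fs \<noteq> [] \<Longrightarrow> hd Fs \<subseteq> set (fst (roww [] (wd Fs)))"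
proof -
  assume g: "gf Fs" "Fs \<noteq> []"
  obtain Gs where G: "gf Gs" "length Gs = length Fs" "wd Fs \<approx> wd Gs" "hwF Gs" "Fs \<noteq> [] \<longrightarrow> hd Fs \<subseteq> hd Gs"
    by (rule rectify_tab[OF g(1)])
  have "Gs \<noteq> []" using G(2) g(2) by auto
  then have "hd Gs = set (fst (roww [] (wd Gs)))" using hw_hd G by blast
  moreover have "fst (roww [] (wd Fs)) = fst (roww [] (wd Gs))"
    using roww_ck[OF G(3), of "[]"] g(1) by (simp add: gf_def)
  ultimately show ?thesis using G(5) g(2) by simp
qed

lemma length_first_row: "red w \<Longrightarrow> card (set (fst (roww [] w))) = rlen w 0"
  using distinct_card[of "fst (roww [] w)"] roww_incr[of "[]" w] by (simp add: rlen_0 strict_sorted_iff)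

text \<open>Absorb \<open>x\<close> first into the rows behind \<open>Y\<close>: then
  \<open>E\<close> becomes some \<open>P\<close> with at most one letter more. Not all of
  \<open>P\<close> can be matched to \<open>Y\<close>, or the first row would remain
  \<open>Y\<close>. One raising of \<open>(P, Y)\<close> moves a letter over, and this letter
  \<open>c\<close> is the new one.\<close>

lemma first_column_growth:
  assumes r: "red (x # wd (Y # E # Es))" and g: "gf (Y # E # Es)" and h: "hwF (Y # E # Es)"
    and Y': "Y' = set (fst (roww [] (x # wd (Y # E # Es))))" and cY: "card Y' = Suc (card Y)"
    and K: "set (x # wd (Y # E # Es)) \<subseteq> {..<K}"
  shows "\<exists>y. Y' = insert y Y \<and> y \<notin> Y \<and> (\<forall>z\<in>Y. z < y \<longrightarrow> z \<in> pairedR K E Y)"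
proof -
  let ?w = "wd (E # Es)"
  have gE: "gf (E # Es)" using gf_append2[of "[Y]" "E # Es"] g by simp
  have hE: "hwF (E # Es)" and uE: "unp E Y = {}" using h by auto
  have f: "finite Y" "finite E" using g by (auto simp: gf_def)
  have gEx: "gf (E # Es @ [{x}])"
    using g r red_appendD1[of "x # ?w" "sl Y"] by (auto simp: gf_def)
  obtain Gs where G: "gf Gs" "length Gs = length (E # Es @ [{x}])" "wd (E # Es @ [{x}]) \<approx> wd Gs" "hwF Gs"
    "E # Es @ [{x}] \<noteq> [] \<longrightarrow> hd (E # Es @ [{x}]) \<subseteq> hd Gs" by (rule rectify_tab[OF gEx])
  obtain P Rs where P: "Gs = P # Rs" using G(2) by (cases Gs) auto
  have EP: "E \<subseteq> P" using G(5) P by simp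
  have wE: "wd (E # Es @ [{x}]) = x # ?w" by simp
  have rxw: "red (x # ?w)" using gEx by (simp add: gf_def)
  have gY: "gf ([Y] @ (E # Es @ [{x}]) @ [])" using g r by (auto simp: gf_def)
  have gYP: "gf (Y # P # Rs)" using gf_replace[OF gY G(1,3)] P by simp
  have wYP: "x # wd (Y # E # Es) \<approx> wd (Y # P # Rs)" using wd_replace[OF G(3), of "[Y]" "[]"] P by simp
  have row: "set (fst (roww [] (wd (Y # P # Rs)))) = Y'"
    using roww_ck[OF wYP, of "[]"] r Y' by simp
  have cP: "card P \<le> Suc (card E)"
  proof -
    have p: "P = set (fst (roww [] (wd Gs)))" using hw_hd[OF G(1,4)] P by simp
    have e: "E = set (fst (roww [] ?w))" using hw_hd[OF gE hE] by simp
    have "card P = rlen (wd Gs) 0" using p length_first_row G(1) by (simp add: gf_def)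
    also have "\<dots> = rlen (x # ?w) 0" using rlen_ck[OF rxw] G(3) wE by simp
    also have "\<dots> = clen (rev ?w @ [x]) 0" by (simp add: clen_def)
    finally have 1: "card P = clen (rev ?w @ [x]) 0" .
    have "card (set (fst (roww [] ?w))) = rlen ?w 0" by (rule length_first_row) (use gE in \<open>simp add: gf_def\<close>)
    then have "card E = rlen ?w 0" unfolding e[symmetric] .
    then have 2: "card E = clen (rev ?w) 0" by (simp add: clen_def)
    have "red (rev ?w @ [x])" using red_rev[OF rxw] by simp
    then obtain c where "clen (rev ?w @ [x]) = (clen (rev ?w))(c := Suc (clen (rev ?w) c))" by (rule clen_one)
    then show ?thesis using 1 2 by simp
  qed
  have uP: "unp P Y \<noteq> {}"
  proof
    assume "unp P Y = {}"
    then have "hwF (Y # P # Rs)" using G(4) P by simp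
    then have "Y = Y'" using hw_hd[OF gYP] row by simp
    then show False using cY by simp
  qed
  have gp: "gp (P, Y)" using gf_pair[of "[]" Y P Rs] gYP by simp
  have fP: "finite P" using gp by (simp add: gp_def)
  obtain N where N: "\<forall>z\<in>P \<union> Y. z < N" using fP f finite_nat_set_iff_bounded[of "P \<union> Y"] by blast
  have tot: "card Y = card (pairedL X Y) + pool X Y N" if "X \<subseteq> P" for X
  proof -
    have "Y \<inter> {..<N} = Y" "pairedL X Y \<inter> {..<N} = pairedL X Y" using N that by (auto simp: pairedL_def)
    then show ?thesis using pool_total[of Y N X] by simp
  qed
  have pE: "card (pairedL E Y) = card E" using uE by (simp add: pairedL_unp)
  have ge: "card E \<le> card (pairedL P Y)" using tot[OF EP] tot[of P] pool_antimono[OF EP, of Y N] pE by simp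
  have rPY: "red (sl P @ sl Y)" using gp by (simp add: gp_def)
  obtain a c where d: "raise (P, Y) = (P - {a}, insert c Y)" "a \<in> unp P Y" "a \<le> c" "{a..c} \<subseteq> P" "c \<notin> Y"
    by (rule raise_data[OF fP f(1) uP rPY]) (rule that; assumption)
  have aP: "a \<in> P" "pool P Y a = 0" using d(2) by (auto simp: unp_def)
  note st = raise_step[OF gp, unfolded fst_conv snd_conv, OF uP]
  have Yc: "Y' = insert c Y"
  proof -
    have w: "wd [Y, P] \<approx> wd [insert c Y, P - {a}]" using st(2) d(1) by simp
    have gg: "gf [insert c Y, P - {a}]" using pair_gf[OF st(1)] d(1) by simp
    have g3: "gf ([] @ [Y, P] @ Rs)" using gYP by simp
    have "gf ([] @ [insert c Y, P - {a}] @ Rs)" by (rule gf_replace[OF g3 gg w])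
    then have "insert c Y \<subseteq> set (fst (roww [] (wd ([] @ [insert c Y, P - {a}] @ Rs))))"
      using hd_sub_roww by fastforce
    moreover have "wd (Y # P # Rs) \<approx> wd ([] @ [insert c Y, P - {a}] @ Rs)"
      using wd_replace[OF w, of "[]" Rs] by simp
    then have "fst (roww [] (wd (Y # P # Rs))) = fst (roww [] (wd ([] @ [insert c Y, P - {a}] @ Rs)))"
      using roww_ck[of "wd (Y # P # Rs)" _ "[]"] gYP by (simp add: gf_def)
    ultimately have "insert c Y \<subseteq> Y'" using row by simp
    moreover have "card (insert c Y) = card Y'" using cY f d(5) by simp
    moreover have "finite Y'" using Y' by simp
    ultimately show ?thesis using card_subset_eq by metis
  qed
  have bK: "P \<union> Y \<subseteq> {..<K}"
  proof -
    have "set (wd (Y # P # Rs)) \<subseteq> {..<K}" using ck_set[OF wYP] K by simp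
    then show ?thesis using fP f by auto
  qed
  let ?k = "(-) K"
  have im: "?k ` X \<inter> S = ?k ` (X \<inter> R)" if "\<And>p. p \<in> X \<Longrightarrow> K - p \<in> S \<longleftrightarrow> p \<in> R" for X S R
    using that by auto
  have cd: "card (?k ` (X \<inter> R)) = card (X \<inter> R)" if "X \<subseteq> {..<K}" for X R
    by (rule card_compl) (use that in auto)
  have PY: "P \<subseteq> {..<K}" "Y \<subseteq> {..<K}" using bK by auto
  have lb: "card (P \<inter> {z<..t}) \<le> pool (?k ` Y) (?k ` P) (K - z) + card (Y \<inter> {z<..<t})"
    if "z < t" "t < K" for z t
  proof -
    have 1: "?k ` P \<inter> {K - t..<K - z} = ?k ` (P \<inter> {z<..t})" by (rule im) (use PY that in fastforce)
    have 2: "?k ` Y \<inter> {Suc (K - t)..<K - z} = ?k ` (Y \<inter> {z<..<t})" by (rule im) (use PY that in fastforce)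
    have "K - t \<le> K - z" using that by simp
    from pool_lb[OF this, of "?k ` P" "?k ` Y"] show ?thesis unfolding 1 2 cd[OF PY(1)] cd[OF PY(2)] .
  qed
  have aK: "a < K" using aP PY by auto
  \<comment> \<open>For \<open>z < a\<close> the empty pool at the unmatched letter
    \<open>a\<close>, together with \<open>a\<close> itself, leaves a surplus of \<open>P\<close>
    above \<open>z\<close>, so \<open>z\<close> is matched in the opposite direction. For
    \<open>a <= z < c\<close> the run provides \<open>Suc z\<close> in \<open>P\<close>.\<close>
  have key: "z \<in> pairedR K P Y" if z: "z \<in> Y" "z < c" for z
  proof -
    have "0 < pool (?k ` Y) (?k ` P) (K - z)"
    proof (cases "z < a")
      case True
      have 1: "P \<inter> {z<..a} = insert a (P \<inter> {Suc z..<a})" using aP(1) True by auto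
      have 2: "Y \<inter> {z..<a} = insert z (Y \<inter> {z<..<a})" using z True by auto
      have "card (Y \<inter> {z..<a}) \<le> card (P \<inter> {Suc z..<a})" using pool_lb[of z a Y P] aP(2) True by simp
      then have "Suc (card (Y \<inter> {z<..<a})) \<le> card (P \<inter> {Suc z..<a})" unfolding 2 using f by simp
      moreover have "card (P \<inter> {z<..a}) = Suc (card (P \<inter> {Suc z..<a}))" unfolding 1 using fP by simp
      ultimately show ?thesis using lb[OF True aK] by simp
    next
      case False
      then have "Suc z \<in> P" using d(4) z(2) by auto
      then have "P \<inter> {z<..Suc z} = {Suc z}" "Y \<inter> {z<..<Suc z} = {}" "Suc z < K" using PY by auto
      then show ?thesis using lb[of z "Suc z"] by simp
    qed
    then have "K - z \<in> pairedL (?k ` Y) (?k ` P)" using z by (simp add: pairedL_def)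
    then have "K - (K - z) \<in> pairedR K P Y" by (auto simp: pairedR_def)
    moreover have "z < K" using z PY by auto
    ultimately show ?thesis by simp
  qed
  have "pairedR K E Y = pairedR K P Y"
  proof (rule card_seteq)
    show "finite (pairedR K P Y)" using f by (simp add: pairedR_def pairedL_def)
    have "?k ` E \<subseteq> ?k ` P" using EP by auto
    from pool_mono[OF this, of "?k ` Y"] have "pairedL (?k ` Y) (?k ` E) \<subseteq> pairedL (?k ` Y) (?k ` P)"
      by (auto simp: pairedL_def intro: less_le_trans)
    then show "pairedR K E Y \<subseteq> pairedR K P Y" by (auto simp: pairedR_def)
    have 1: "?k ` P \<inter> {K - a..<Suc K} = ?k ` (P \<inter> {..a})" by (rule im) (use PY aK in fastforce)
    have 2: "?k ` Y \<inter> {Suc (K - a)..<Suc K} = ?k ` (Y \<inter> {..<a})" by (rule im) (use PY aK in fastforce)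
    have "K - a \<le> Suc K" by simp
    from pool_lb[OF this, of "?k ` P" "?k ` Y"]
    have "card (P \<inter> {..a}) \<le> pool (?k ` Y) (?k ` P) (Suc K) + card (Y \<inter> {..<a})"
      unfolding 1 2 cd[OF PY(1)] cd[OF PY(2)] .
    moreover have "P \<inter> {..a} = insert a (P \<inter> {..<a})" using aP(1) by auto
    then have "card (P \<inter> {..a}) = Suc (card (P \<inter> {..<a}))" using fP by simp
    moreover have "card (Y \<inter> {..<a}) \<le> card (P \<inter> {Suc 0..<a})"
      using pool_lb[of 0 a Y P] aP(2) by (simp add: atLeast0LessThan)
    moreover have "card (P \<inter> {Suc 0..<a}) \<le> card (P \<inter> {..<a})" by (rule card_mono) auto
    ultimately have "0 < pool (?k ` Y) (?k ` P) (Suc K)" by linarith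
    moreover have "?k ` P \<inter> {..<Suc K} = ?k ` P" "pairedL (?k ` Y) (?k ` P) \<inter> {..<Suc K} = pairedL (?k ` Y) (?k ` P)"
      by (auto simp: pairedL_def)
    then have "card (?k ` P) = card (pairedL (?k ` Y) (?k ` P)) + pool (?k ` Y) (?k ` P) (Suc K)"
      using pool_total[of "?k ` P" "Suc K" "?k ` Y"] by simp
    moreover have "card (?k ` P) = card P" using cd[OF PY(1), of UNIV] by simp
    moreover have "card (pairedR K P Y) = card (pairedL (?k ` Y) (?k ` P))"
      unfolding pairedR_def by (rule card_compl) (auto simp: pairedL_def)
    moreover have "card (pairedR K E Y) = card E"
    proof -
      have "gp (E, Y)" using gf_pair[of "[]" Y E Es] g by simp
      moreover have "E \<union> Y \<subseteq> {..<K}" using EP bK by auto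
      ultimately show ?thesis by (rule reflect_hw[OF _ uE]) assumption
    qed
    ultimately show "card (pairedR K P Y) \<le> card (pairedR K E Y)" using cP by linarith
  qed
  then show ?thesis using Yc d(5) key by auto
qed

text \<open>The new box may be added last to any arrangement of the columns in which its column is the
  leftmost factor; passing that column through the longer ones transports the growth of a first
  column to the general case.\<close>

lemma pass_columns:
  assumes "ext (Ls @ [Y] @ Ys)" "ext (Ls @ [Y'] @ Ys')" "ext (Ls @ [A] @ Zs)"
    and "Y' = insert y Y" "y \<notin> Y" "A \<subseteq> Y" "\<forall>z\<in>Y. z < y \<longrightarrow> z \<in> A"
    and "\<forall>L\<in>set Ls. card Y' \<le> card L" and "\<Union>(set Ls) \<union> Y' \<subseteq> {..<K}"
  shows "\<exists>Y1 Y1' A1 Ws Ws' Vs y1. ext (Y1 # Ws) \<and> ext (Y1' # Ws') \<and> ext (A1 # Vs)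
    \<and> wd (Ls @ [Y] @ Ys) \<approx> wd (Y1 # Ws) \<and> wd (Ls @ [Y'] @ Ys') \<approx> wd (Y1' # Ws')
    \<and> wd (Ls @ [A] @ Zs) \<approx> wd (A1 # Vs) \<and> card Y1 = card Y \<and> card Y1' = card Y' \<and> card A1 = card A
    \<and> Y1' = insert y1 Y1 \<and> y1 \<notin> Y1 \<and> A1 \<subseteq> Y1 \<and> (\<forall>z\<in>Y1. z < y1 \<longrightarrow> z \<in> A1)"
  using assms
proof (induct Ls arbitrary: Y Y' A y Ys Ys' Zs rule: rev_induct)
  case Nil
  then show ?case
    by (rule_tac exI[of _ Y], rule_tac exI[of _ Y'], rule_tac exI[of _ A], rule_tac exI[of _ Ys],
        rule_tac exI[of _ Ys'], rule_tac exI[of _ Zs], rule_tac exI[of _ y]) simp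
next
  case (snoc L Ls)
  note p = snoc.prems
  have fY': "finite Y'" using p(2) by (auto simp: ext_def gf_def)
  have fL: "finite L" using p(1) by (auto simp: ext_def gf_def)
  have cA: "card A \<le> card Y'" using p(4,6) fY' by (intro card_mono) auto
  have cY: "card Y \<le> card Y'" using p(4) fY' by (intro card_mono) auto
  have cL: "card Y' \<le> card L" using p(8) by simp
  have KL: "Y' \<union> L \<subseteq> {..<K}" "Y \<union> L \<subseteq> {..<K}" "A \<union> L \<subseteq> {..<K}" using p(4,6,9) by auto
  have e: "ext (Ls @ [L, Y] @ Ys)" "ext (Ls @ [L, Y'] @ Ys')" "ext (Ls @ [L, A] @ Zs)" using p(1-3) by auto
  obtain V where V: "ext (Ls @ [pairedR K Y L, V] @ Ys)" "wd (Ls @ [L, Y] @ Ys) \<approx> wd (Ls @ [pairedR K Y L, V] @ Ys)"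
    "card (pairedR K Y L) = card Y"
    by (rule move_front[OF e(1) order_trans[OF cY cL] KL(2)]) (rule that; assumption)
  obtain V' where V': "ext (Ls @ [pairedR K Y' L, V'] @ Ys')" "wd (Ls @ [L, Y'] @ Ys') \<approx> wd (Ls @ [pairedR K Y' L, V'] @ Ys')"
    "card (pairedR K Y' L) = card Y'" "pairedR K Y' L \<subseteq> L"
    by (rule move_front[OF e(2) cL KL(1)]) (rule that; assumption)
  obtain U where U: "ext (Ls @ [pairedR K A L, U] @ Zs)" "wd (Ls @ [L, A] @ Zs) \<approx> wd (Ls @ [pairedR K A L, U] @ Zs)"
    "card (pairedR K A L) = card A"
    by (rule move_front[OF e(3) order_trans[OF cA cL] KL(3)]) (rule that; assumption)
  have "card Y' = Suc (card Y)" using p(4,5) fY' by simp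
  then have cs: "card (pairedR K Y' L) = Suc (card (pairedR K Y L))" using V(3) V'(3) by simp
  have key: "\<And>z. z \<in> Y \<Longrightarrow> z < y \<Longrightarrow> z \<in> A" using p(7) by blast
  obtain l where l: "pairedR K Y' L = insert l (pairedR K Y L)" "l \<notin> pairedR K Y L"
    "pairedR K A L \<subseteq> pairedR K Y L" "\<forall>z\<in>pairedR K Y L. z < l \<longrightarrow> z \<in> pairedR K A L"
    using greedy[OF KL(1) p(4,5,6) key cs fL] by blast
  have e2: "ext (Ls @ [pairedR K Y L] @ V # Ys)" "ext (Ls @ [pairedR K Y' L] @ V' # Ys')"
    "ext (Ls @ [pairedR K A L] @ U # Zs)" using V(1) V'(1) U(1) by auto
  have c2: "\<forall>L\<in>set Ls. card (pairedR K Y' L') \<le> card L" if "card (pairedR K Y' L') = card Y'" for L'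
    using p(8) that by simp
  have K2: "\<Union>(set Ls) \<union> pairedR K Y' L \<subseteq> {..<K}" using p(9) V'(4) by auto
  have "\<exists>Y1 Y1' A1 Ws Ws' Vs y1. ext (Y1 # Ws) \<and> ext (Y1' # Ws') \<and> ext (A1 # Vs)
    \<and> wd (Ls @ [pairedR K Y L] @ V # Ys) \<approx> wd (Y1 # Ws) \<and> wd (Ls @ [pairedR K Y' L] @ V' # Ys') \<approx> wd (Y1' # Ws')
    \<and> wd (Ls @ [pairedR K A L] @ U # Zs) \<approx> wd (A1 # Vs) \<and> card Y1 = card (pairedR K Y L)
    \<and> card Y1' = card (pairedR K Y' L) \<and> card A1 = card (pairedR K A L)
    \<and> Y1' = insert y1 Y1 \<and> y1 \<notin> Y1 \<and> A1 \<subseteq> Y1 \<and> (\<forall>z\<in>Y1. z < y1 \<longrightarrow> z \<in> A1)"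
    by (rule snoc.hyps[OF e2 l c2[OF V'(3)] K2])
  then obtain Y1 Y1' A1 Ws Ws' Vs y1 where R: "ext (Y1 # Ws)" "ext (Y1' # Ws')" "ext (A1 # Vs)"
    "wd (Ls @ [pairedR K Y L] @ V # Ys) \<approx> wd (Y1 # Ws)" "wd (Ls @ [pairedR K Y' L] @ V' # Ys') \<approx> wd (Y1' # Ws')"
    "wd (Ls @ [pairedR K A L] @ U # Zs) \<approx> wd (A1 # Vs)" "card Y1 = card (pairedR K Y L)"
    "card Y1' = card (pairedR K Y' L)" "card A1 = card (pairedR K A L)"
    "Y1' = insert y1 Y1" "y1 \<notin> Y1" "A1 \<subseteq> Y1" "\<forall>z\<in>Y1. z < y1 \<longrightarrow> z \<in> A1" by blast
  have w: "wd ((Ls @ [L]) @ [Y] @ Ys) \<approx> wd (Y1 # Ws)" "wd ((Ls @ [L]) @ [Y'] @ Ys') \<approx> wd (Y1' # Ws')"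
    "wd ((Ls @ [L]) @ [A] @ Zs) \<approx> wd (A1 # Vs)"
    using ck_trans[OF V(2), of "wd (Y1 # Ws)"] ck_trans[OF V'(2), of "wd (Y1' # Ws')"]
      ck_trans[OF U(2), of "wd (A1 # Vs)"] R(4-6) by auto
  show ?case
    by (rule exI[of _ Y1], rule exI[of _ Y1'], rule exI[of _ A1], rule exI[of _ Ws], rule exI[of _ Ws'],
        rule exI[of _ Vs], rule exI[of _ y1]) (use R w V(3) V'(3) U(3) in simp)
qed

text \<open>Split the columns into the longer ones \<open>Ls\<close> and a tail in which column
  \<open>c\<close> comes first. In the tail it is a first column, where
  \<open>first_column_growth\<close> applies; \<open>pass_columns\<close> carries the result to the
  front.\<close>

lemma kset_same:
  assumes r: "red (u @ [x])" and c: "clen (u @ [x]) = (clen u)(c := Suc (clen u c))"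
  shows "\<exists>y. kset (u @ [x]) c = insert y (kset u c) \<and> y \<notin> kset u c
    \<and> (\<forall>z\<in>kset u c. z < y \<longrightarrow> z \<in> kset u (Suc c))"
proof -
  have ru: "red u" using r red_appendD1 by blast
  \<comment> \<open>Large enough to cover all columns, and to make \<open>Suc c\<close> an index of
    the list as well.\<close>
  define n where "n = Suc (Suc (length (tab (rev (u @ [x]))) + c))"
  define js where "js = [0..<c] @ [Suc c..<n]"
  have cn: "c < n" "Suc c < n" by (auto simp: n_def)
  have m: "mset (js @ [c]) = mset [0..<n]" using upt_split[OF cn(1)] by (simp add: js_def)
  obtain Ds D where D: "ext (Ds @ [D])" "rev u \<approx> wd (Ds @ [D])" "ext (Ds @ [insert x D])"
    "rev (u @ [x]) \<approx> wd (Ds @ [insert x D])" "x \<notin> D" "map card Ds = map (clen u) js" "card D = clen u c"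
    "length Ds = length js" "\<And>d. d \<in> D \<Longrightarrow> x < d" by (rule append_last[OF r c m]) (auto simp: n_def)
  define Ls where "Ls = take c Ds"
  define Ss where "Ss = drop c Ds"
  have Ds: "Ds = Ls @ Ss" by (simp add: Ls_def Ss_def)
  have cLs: "map card Ls = map (clen u) [0..<c]" "map card Ss = map (clen u) [Suc c..<n]"
    using D(6) by (simp_all add: Ls_def Ss_def js_def take_map[symmetric] drop_map[symmetric])
  have fD: "finite D" using D(1) by (auto simp: ext_def gf_def)
  have eW: "ext (Ls @ (Ss @ [D]) @ [])" "ext (Ls @ (Ss @ [insert x D]) @ [])" using D(1,3) Ds by auto
  define b where "b = clen u c # map (clen u) [Suc c..<n]"
  define b' where "b' = Suc (clen u c) # map (clen u) [Suc c..<n]"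
  have mb: "mset b = mset (map card (Ss @ [D]))" "mset b' = mset (map card (Ss @ [insert x D]))"
    using cLs(2) D(5,7) fD by (auto simp: b_def b'_def)
  obtain Gs where G: "ext (Ls @ Gs @ [])" "wd (Ls @ (Ss @ [D]) @ []) \<approx> wd (Ls @ Gs @ [])" "map card Gs = b"
    "wd (Ss @ [D]) \<approx> wd Gs" "ext Gs" by (rule ext_reorder[OF eW(1) mb(1)])
  obtain Hs where H: "ext (Ls @ Hs @ [])" "wd (Ls @ (Ss @ [insert x D]) @ []) \<approx> wd (Ls @ Hs @ [])" "map card Hs = b'"
    "wd (Ss @ [insert x D]) \<approx> wd Hs" "ext Hs" by (rule ext_reorder[OF eW(2) mb(2)])
  have nS: "[Suc c..<n] = Suc c # [Suc (Suc c)..<n]" using cn(2) by (rule upt_conv_Cons)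
  obtain Y E Es where Y: "Gs = Y # E # Es" "card Y = clen u c" "card E = clen u (Suc c)"
    using G(3) unfolding b_def nS by (auto simp: map_eq_Cons_conv simp del: upt_Suc)
  obtain Y' Hs' where Y': "Hs = Y' # Hs'" "card Y' = Suc (clen u c)"
    using H(3) unfolding b'_def by (auto simp: map_eq_Cons_conv simp del: upt_Suc)
  have sorted: "sorted_wrt (\<ge>) b" "sorted_wrt (\<ge>) b'"
  proof -
    have "sorted_wrt (<) (c # [Suc c..<n])" by auto
    then have "sorted_wrt (\<lambda>i j. clen u j \<le> clen u i) (c # [Suc c..<n])"
      by (rule sorted_wrt_mono_rel[rotated]) (simp add: clen_antimono[OF ru])
    then show "sorted_wrt (\<ge>) b" by (simp add: b_def sorted_wrt_map)
    then show "sorted_wrt (\<ge>) b'" by (auto simp: b_def b'_def)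
  qed
  have hG: "hwF Gs" "hwF Hs" using ext_sorted_hw G H sorted by auto
  have gG: "gf Gs" "gf Hs" using G H by (auto simp: ext_def)
  have slx: "sl (insert x D) = x # sl D" by (rule sl_eqI) (use D(9) fD in auto)
  have "x # wd Gs \<approx> x # wd (Ss @ [D])" by (rule ck_Cons[OF ck_sym[OF G(4)]])
  also have "x # wd (Ss @ [D]) = wd (Ss @ [insert x D])" using slx by simp
  finally have xw: "x # wd Gs \<approx> wd Hs" using ck_trans[OF _ H(4)] by simp
  have rx: "red (x # wd (Y # E # Es))" using red_ck[OF _ ck_sym[OF xw]] gG(2) Y(1) by (simp add: gf_def)
  have YH: "Y' = set (fst (roww [] (x # wd (Y # E # Es))))"
    using hw_hd[OF gG(2) hG(2)] Y'(1) roww_ck[OF xw, of "[]"] rx Y(1) by simp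
  obtain K where K: "\<forall>z\<in>set (u @ [x]). z < K" using finite_nat_set_iff_bounded[of "set (u @ [x])"] by blast
  have w2: "rev (u @ [x]) \<approx> wd (Ls @ [Y'] @ Hs')"
    using ck_trans[OF D(4), of "wd (Ls @ Hs @ [])"] H(2) Ds Y'(1) by simp
  have w1: "rev u \<approx> wd (Ls @ [Y] @ E # Es)"
    using ck_trans[OF D(2), of "wd (Ls @ Gs @ [])"] G(2) Ds Y(1) by simp
  have Kall: "\<Union>(set (Ls @ Hs)) \<subseteq> {..<K}"
    using set_wd[of "Ls @ Hs"] ck_set[OF w2] H(1) K Y'(1) by (fastforce simp: ext_def)
  have KH: "set (x # wd (Y # E # Es)) \<subseteq> {..<K}"
    using ck_set[OF xw] set_wd[OF gG(2)] Kall Y(1) by auto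
  obtain y where y: "Y' = insert y Y" "y \<notin> Y" "\<forall>z\<in>Y. z < y \<longrightarrow> z \<in> pairedR K E Y"
    using first_column_growth[OF rx _ _ YH _ KH] gG(1) hG(1) Y Y' by auto
  define A where "A = pairedR K E Y"
  have eY: "ext (Ls @ [Y, E] @ Es)" using G(1) Y(1) by simp
  have "card E \<le> card Y" using Y clen_antimono[OF ru, of c "Suc c"] by simp
  moreover have "E \<union> Y \<subseteq> {..<K}" using set_wd[OF gG(1)] KH Y(1) by auto
  ultimately obtain E' where "ext (Ls @ [pairedR K E Y, E'] @ Es)"
    "wd (Ls @ [Y, E] @ Es) \<approx> wd (Ls @ [pairedR K E Y, E'] @ Es)"
    "card (pairedR K E Y) = card E" "pairedR K E Y \<subseteq> Y" by (rule move_front[OF eY]) (rule that; assumption)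
  note A = this[folded A_def]
  have cL: "\<forall>L\<in>set Ls. card Y' \<le> card L"
  proof
    fix L assume "L \<in> set Ls"
    then have "card L \<in> set (map card Ls)" by simp
    then obtain t where t: "t < c" "card L = clen u t" unfolding cLs(1) by auto
    have "clen (u @ [x]) c \<le> clen (u @ [x]) t" using clen_antimono[OF r, of t c] t by simp
    then show "card Y' \<le> card L" using c t Y' by simp
  qed
  have e3: "ext (Ls @ [Y] @ E # Es)" "ext (Ls @ [Y'] @ Hs')" "ext (Ls @ [A] @ E' # Es)"
    using G(1) H(1) Y(1) Y'(1) A(1) by auto
  have K3: "\<Union>(set Ls) \<union> Y' \<subseteq> {..<K}" using Kall Y'(1) by auto
  obtain Y1 Y1' A1 Ws Ws' Vs y1 where R: "ext (Y1 # Ws)" "ext (Y1' # Ws')" "ext (A1 # Vs)"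
    "wd (Ls @ [Y] @ E # Es) \<approx> wd (Y1 # Ws)" "wd (Ls @ [Y'] @ Hs') \<approx> wd (Y1' # Ws')"
    "wd (Ls @ [A] @ E' # Es) \<approx> wd (A1 # Vs)" "card Y1 = card Y" "card Y1' = card Y'" "card A1 = card A"
    "Y1' = insert y1 Y1" "y1 \<notin> Y1" "A1 \<subseteq> Y1" "\<forall>z\<in>Y1. z < y1 \<longrightarrow> z \<in> A1"
    using pass_columns[OF e3 y(1,2) A(4) y(3)[folded A_def] cL K3] by blast
  have "kset u c = Y1" using kset_eq[OF R(1) ck_trans[OF w1 R(4)]] R(7) Y(2) by simp
  moreover have "kset (u @ [x]) c = Y1'" using kset_eq[OF R(2) ck_trans[OF w2 R(5)]] R(8) Y'(2) c by simp
  moreover have "rev u \<approx> wd (Ls @ [A] @ E' # Es)" using ck_trans[OF w1, of "wd (Ls @ [A, E'] @ Es)"] A(2) by simp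
  then have "kset u (Suc c) = A1" using kset_eq[OF R(3) ck_trans[OF _ R(6)]] R(9) A(3) Y(3) by simp
  ultimately show ?thesis using R(10-13) by blast
qed

section \<open>The weak composition of a Coxeter-Knuth class\<close>

definition krow :: "nat list \<Rightarrow> nat \<Rightarrow> nat" where
  "krow u r = card {j. r \<in> kset u j}"

lemma kset_levels: "red u \<Longrightarrow> {j. r \<in> kset u j} = {..<krow u r}"
proof -
  assume r: "red u"
  let ?J = "{j. r \<in> kset u j}"
  have "j < length (tab (rev u))" if "j \<in> ?J" for j
  proof (rule ccontr)
    assume "\<not> j < length (tab (rev u))"
    then have "kset u j = {}" using kset_empty[OF r clen_0] by simp
    then show False using that by simp
  qed
  then have "?J \<subseteq> {..<length (tab (rev u))}" by auto
  then have fin: "finite ?J" using finite_subset by blast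
  have down: "i \<in> ?J" if "j \<in> ?J" "i \<le> j" for i j using kset_mono[OF r that(2)] that(1) by auto
  have "?J = {..<card ?J}"
  proof (cases "?J = {}")
    case False
    define M where "M = Max ?J"
    have "M \<in> ?J" unfolding M_def by (rule Max_in[OF fin False])
    then have "?J = {..M}" using down[of M] Max_ge[OF fin] by (auto simp: M_def[symmetric])
    then show ?thesis by (simp add: lessThan_Suc_atMost)
  qed simp
  then show ?thesis by (simp add: krow_def)
qed

lemma kset_iff: "red u \<Longrightarrow> r \<in> kset u j \<longleftrightarrow> j < krow u r"
  using kset_levels[of u r] by auto

lemma krow_ck: "red u \<Longrightarrow> u \<approx> v \<Longrightarrow> krow u = krow v"
  using kset_ck[of u v] by (simp add: krow_def fun_eq_iff)

lemma krow_pos_letter: "red u \<Longrightarrow> 0 < krow u r \<Longrightarrow> r \<in> set u"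
  using kset_iff[of u r 0] kset_letters[of u 0] by auto

text \<open>The last clause is the key condition. With columns numbered from 0 the new box is in
  column \<open>c\<close>, and \<open>krow u z = Suc c\<close> would mean that the lower row
  \<open>z\<close> ends exactly there.\<close>

lemma grow:
  assumes r: "red (u @ [x])"
  obtains p c where "clen (u @ [x]) = (clen u)(c := Suc (clen u c))" "krow (u @ [x]) = (krow u)(p := Suc (krow u p))"
    "krow u p = c" "\<And>z. z < p \<Longrightarrow> krow u z \<noteq> Suc c"
proof -
  have ru: "red u" using r red_appendD1 by blast
  obtain c where c: "clen (u @ [x]) = (clen u)(c := Suc (clen u c))" by (rule clen_one[OF r])
  obtain y where y: "kset (u @ [x]) c = insert y (kset u c)" "y \<notin> kset u c"
    "\<forall>z\<in>kset u c. z < y \<longrightarrow> z \<in> kset u (Suc c)" using kset_same[OF r c] by blast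
  have o: "kset (u @ [x]) j = kset u j" if "j \<noteq> c" for j by (rule kset_other[OF r c that])
  have "krow u y \<le> c" using y(2) kset_iff[OF ru] by (meson not_le)
  moreover have "c \<le> krow u y"
  proof (rule ccontr)
    assume n: "\<not> c \<le> krow u y"
    have "y \<in> kset (u @ [x]) (krow u y)"
      using y(1) kset_mono[OF r, of "krow u y" c] n by auto
    then have "y \<in> kset u (krow u y)" using o[of "krow u y"] n by simp
    then show False using kset_iff[OF ru] by simp
  qed
  ultimately have yc: "krow u y = c" by simp
  have k: "krow (u @ [x]) = (krow u)(y := Suc (krow u y))"
  proof
    fix z
    show "krow (u @ [x]) z = ((krow u)(y := Suc (krow u y))) z"
    proof (cases "z = y")
      case True
      have "y \<in> kset (u @ [x]) j \<longleftrightarrow> j = c \<or> y \<in> kset u j" for j using y(1) o[of j] by (cases "j = c") auto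
      then have "{j. y \<in> kset (u @ [x]) j} = insert c {j. y \<in> kset u j}" by auto
      then have "krow (u @ [x]) y = card (insert c {..<krow u y})"
        unfolding krow_def[of "u @ [x]"] kset_levels[OF ru, of y] by simp
      then show ?thesis using True yc by simp
    next
      case False
      have "z \<in> kset (u @ [x]) j \<longleftrightarrow> z \<in> kset u j" for j using y(1) o[of j] False by (cases "j = c") auto
      then show ?thesis using False by (simp add: krow_def)
    qed
  qed
  show thesis
  proof (rule that[OF c k yc])
    fix z assume z: "z < y"
    show "krow u z \<noteq> Suc c"
    proof
      assume e: "krow u z = Suc c"
      then have "z \<in> kset u c" using kset_iff[OF ru] by simp
      then have "z \<in> kset u (Suc c)" using y(3) z by blast
      then show False using kset_iff[OF ru] e by simp
    qed
  qed
qed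

lemma krow_prefix: "red (u @ v) \<Longrightarrow> krow u r \<le> krow (u @ v) r"
proof (induct v rule: rev_induct)
  case (snoc x v)
  have "red ((u @ v) @ [x])" using snoc(2) by simp
  then obtain p where "krow ((u @ v) @ [x]) = (krow (u @ v))(p := Suc (krow (u @ v) p))" by (rule grow)
  moreover have "krow u r \<le> krow (u @ v) r" using snoc red_appendD1[of "u @ v" "[x]"] by simp
  ultimately show ?case by (auto intro: le_SucI)
qed simp

lemma mset_levels:
  assumes "length xs = length ys" "\<And>j. length (filter ((<) j) xs) = length (filter ((<) j) ys)"
  shows "mset xs = mset (ys :: nat list)"
proof (rule multiset_eqI)
  fix k
  have *: "length (filter (\<lambda>x. k \<le> x) zs) = count (mset zs) k + length (filter ((<) k) zs)" for zs :: "nat list"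
    by (induct zs) auto
  have "length (filter (\<lambda>x. k \<le> x) xs) = length (filter (\<lambda>x. k \<le> x) ys)"
  proof (cases k)
    case (Suc j)
    have "(\<lambda>x. k \<le> x) = (<) j" using Suc by auto
    then show ?thesis using assms(2)[of j] by simp
  qed (use assms(1) in simp)
  then show "count (mset xs) k = count (mset ys) k" using *[of xs] *[of ys] assms(2)[of k] by simp
qed

lemma length_filter_upt: "length (filter P (map f [a..<b])) = card {i. a \<le> i \<and> i < b \<and> P (f i)}"
proof -
  have "length (filter P (map f [a..<b])) = length (filter (P \<circ> f) [a..<b])" by (simp add: filter_map)
  also have "\<dots> = card (set (filter (P \<circ> f) [a..<b]))" by (rule distinct_card[symmetric]) simp
  also have "set (filter (P \<circ> f) [a..<b]) = {i. a \<le> i \<and> i < b \<and> P (f i)}" by auto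
  finally show ?thesis .
qed

text \<open>The rows of the left key are a permutation of those of the insertion tableau: in both
  lists the entries above \<open>j\<close> number \<open>clen u j\<close>.\<close>

lemma krow_mset:
  assumes r: "red u" and N: "set u \<subseteq> {..<N}"
  shows "mset (map (krow u) [1..<N]) = mset (map (rlen u) [0..<N - 1])" "length (tab u) \<le> N - 1"
proof -
  have pos: "0 \<notin> set u" using red_pos[OF r] by blast
  have "card (set u) \<le> card {1..<N}"
    by (rule card_mono) (use N pos in \<open>auto simp: Suc_le_eq intro: gr0I\<close>)
  then have "card (kset u 0) \<le> N - 1"
    using card_mono[OF _ kset_letters[OF r, of 0]] by simp
  moreover have "{i. 0 < rlen u i} = {..<length (tab u)}"
    using tableau_incr[of "tab u"] tableau_tab[OF r] by (fastforce simp: rlen_def split: if_splits)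
  then have "clen u 0 = length (tab u)" using clen_card[OF r, of 0] by simp
  ultimately show l: "length (tab u) \<le> N - 1" using kset_card[OF r, of 0] by simp
  show "mset (map (krow u) [1..<N]) = mset (map (rlen u) [0..<N - 1])"
  proof (rule mset_levels)
    fix j
    have "{i. 1 \<le> i \<and> i < N \<and> j < krow u i} = kset u j"
    proof
      show "kset u j \<subseteq> {i. 1 \<le> i \<and> i < N \<and> j < krow u i}"
        using kset_letters[OF r, of j] N pos kset_iff[OF r] by (force simp: Suc_le_eq intro: gr0I)
    qed (use kset_iff[OF r] in auto)
    then have 1: "length (filter ((<) j) (map (krow u) [1..<N])) = clen u j"
      unfolding length_filter_upt using kset_card[OF r] by simp
    have "{i. 0 \<le> i \<and> i < N - 1 \<and> j < rlen u i} = {i. j < rlen u i}"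
      using l by (auto simp: rlen_def split: if_splits)
    then have "length (filter ((<) j) (map (rlen u) [0..<N - 1])) = clen u j"
      unfolding length_filter_upt using clen_card[OF r] by simp
    then show "length (filter ((<) j) (map (krow u) [1..<N])) = length (filter ((<) j) (map (rlen u) [0..<N - 1]))"
      using 1 by simp
  qed simp
qed

text \<open>Counterpart of \<open>dec_chain\<close>: the boxes of an increasing word move strictly
  to the right, so the last one lies in the rightmost column that changes.\<close>

lemma inc_chain:
  "incr e \<Longrightarrow> e \<noteq> [] \<Longrightarrow> red (s @ e) \<Longrightarrow>
    \<exists>c. clen (s @ e) = (clen (s @ butlast e))(c := Suc (clen (s @ butlast e) c))
      \<and> (\<forall>t>c. clen (s @ e) t = clen s t) \<and> clen s c < clen (s @ e) c \<and> (\<forall>t. clen s t \<le> clen (s @ e) t)"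
proof (induct e rule: rev_induct)
  case (snoc z e)
  show ?case
  proof (cases "e = []")
    case True
    obtain c where "clen (s @ [z]) = (clen s)(c := Suc (clen s c))"
      by (rule clen_one) (use snoc.prems True in auto)
    then show ?thesis using True by (intro exI[of _ c]) auto
  next
    case False
    have re: "red (s @ e)" using red_appendD1[of "s @ e" "[z]"] snoc.prems by simp
    obtain c where c: "clen (s @ e) = (clen (s @ butlast e))(c := Suc (clen (s @ butlast e) c))"
      "\<forall>t>c. clen (s @ e) t = clen s t" "clen s c < clen (s @ e) c" "\<forall>t. clen s t \<le> clen (s @ e) t"
      using snoc.hyps[OF _ False re] snoc.prems(1) unfolding sorted_wrt_append by blast
    define y where "y = last e"
    have e: "e = butlast e @ [y]" using False by (simp add: y_def)
    have zy: "y < z" using snoc.prems False by (simp add: sorted_wrt_append y_def)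
    have "red ((s @ butlast e) @ [y, z])" using snoc.prems e by (metis append.assoc append_Cons append_Nil)
    then obtain c1 d where d: "clen ((s @ butlast e) @ [y]) = (clen (s @ butlast e))(c1 := Suc (clen (s @ butlast e) c1))"
      "clen ((s @ butlast e) @ [y, z]) = (clen ((s @ butlast e) @ [y]))(d := Suc (clen ((s @ butlast e) @ [y]) d))"
      "y < z \<Longrightarrow> c1 < d" by (rule clen_two) blast
    have e1: "(s @ butlast e) @ [y] = s @ e" "(s @ butlast e) @ [y, z] = s @ e @ [z]"
      using e by (metis append.assoc, metis append.assoc append_Cons append_Nil)
    note d' = d[unfolded e1]
    have "c1 = c" using d'(1) c(1) by (metis fun_upd_apply n_not_Suc_n)
    then have dc: "c < d" using d'(3) zy by simp
    have "clen s d < clen (s @ e @ [z]) d" using d'(2) c(4) by (simp add: le_imp_less_Suc)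
    moreover have "\<forall>t>d. clen (s @ e @ [z]) t = clen s t" using d'(2) c(2) dc by simp
    moreover have "\<forall>t. clen s t \<le> clen (s @ e @ [z]) t" using d'(2) c(4) by (simp add: le_SucI)
    ultimately show ?thesis using d'(2) by (intro exI[of _ d]) simp
  qed
qed simp

section \<open>The flagged extremal factorization\<close>

lemma sl_Max: "finite X \<Longrightarrow> X \<noteq> {} \<Longrightarrow> sl X = sl (X - {Max X}) @ [Max X]"
proof (rule sl_eqI)
  assume f: "finite X" "X \<noteq> {}"
  have "z < Max X" if "z \<in> X - {Max X}" for z using Max_ge[OF f(1), of z] that by (simp add: order.strict_iff_order)
  then show "incr (sl (X - {Max X}) @ [Max X])" using f by (auto simp: sorted_wrt_append)
  show "set (sl (X - {Max X}) @ [Max X]) = X" using f by (simp add: insert_absorb)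
qed

lemma ext_clen: "ext Fs \<Longrightarrow> clen (wd Fs) t = length (filter ((<) t) (map card Fs))"
proof -
  assume e: "ext Fs"
  then have r: "red (wd Fs)" "gf Fs" by (auto simp: ext_def gf_def)
  have "length (filter ((<) t) (map card Fs)) = size (filter_mset ((<) t) (mset (map card Fs)))"
    by (metis mset_filter size_mset)
  also have "\<dots> = length (filter ((<) t) (map (rlen (wd Fs)) [0..<length Fs]))"
    unfolding ext_mset[OF e] by (metis mset_filter size_mset)
  also have "\<dots> = card {i. 0 \<le> i \<and> i < length Fs \<and> t < rlen (wd Fs) i}" by (rule length_filter_upt)
  also have "{i. 0 \<le> i \<and> i < length Fs \<and> t < rlen (wd Fs) i} = {i. t < rlen (wd Fs) i}"
    using tab_length_le[OF r(2)] by (auto simp: rlen_def split: if_splits)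
  finally show ?thesis using clen_card[OF r(1)] by simp
qed

lemma wd_empty: "\<forall>X\<in>set Xs. X = {} \<Longrightarrow> wd Xs = []"
  by (induct Xs) auto

text \<open>Take the extremal factorization with lengths \<open>krow u\<close> and remove the
  largest letter of its lowest nonempty component, number \<open>k\<close>. By the key condition the
  diagram loses a box in row \<open>k\<close>, so what remains is the corresponding factorization of
  the shorter word and is flagged by induction. Component \<open>k\<close> is flagged because the
  least letter of \<open>u\<close> starts a nonempty row, so \<open>k\<close> is at most that
  letter.\<close>

lemma flagged_exists:
  "red u \<Longrightarrow> set u \<subseteq> {..<N} \<Longrightarrow> \<exists>Gs. ext Gs \<and> u \<approx> wd Gs \<and> map card Gs = map (krow u) [1..<N]
    \<and> (\<forall>i<length Gs. \<forall>x\<in>Gs ! i. Suc i \<le> x)"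
proof (induct "length u" arbitrary: u rule: less_induct)
  case less
  note r = less(2) and N = less(3)
  note km = krow_mset[OF r N]
  obtain Gs where G: "ext Gs" "u \<approx> wd Gs" "map card Gs = map (krow u) [1..<N]"
    using ext_exists[OF r, of "map (krow u) [1..<N]"] km by auto
  have gG: "gf Gs" using G(1) by (simp add: ext_def)
  have fG: "finite X" if "X \<in> set Gs" for X using gG that by (simp add: gf_def)
  have lG: "length Gs = N - 1" using arg_cong[OF G(3), of length] by simp
  have cG: "card (Gs ! i) = krow u (Suc i)" if "i < length Gs" for i
    using arg_cong[OF G(3), of "\<lambda>l. l ! i"] that lG by simp
  have sG: "set u = \<Union>(set Gs)" using ck_set[OF G(2)] set_wd[OF gG] by simp
  show ?case
  proof (cases "u = []")
    case True
    then have "\<forall>i<length Gs. \<forall>x\<in>Gs ! i. Suc i \<le> x" using sG by auto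
    then show ?thesis using G by blast
  next
    case False
    define m where "m = Min (set u)"
    have mu: "m \<in> set u" "\<And>x. x \<in> set u \<Longrightarrow> m \<le> x" using False by (auto simp: m_def)
    have km0: "0 < krow u m" using Min_kset[OF r False] kset_iff[OF r] by (simp add: m_def)
    define k where "k = (LEAST k. 0 < krow u k)"
    have k: "0 < krow u k" "k \<le> m" "\<And>z. 0 < krow u z \<Longrightarrow> k \<le> z"
      unfolding k_def using km0 by (auto intro: LeastI Least_le)
    have kset: "k \<in> set u" using krow_pos_letter[OF r k(1)] .
    then have k1: "0 < k" "k < N" using red_pos[OF r] N by auto
    define i where "i = k - 1"
    have i: "Suc i = k" "i < length Gs" using k1 lG by (auto simp: i_def)
    define X where "X = Gs ! i"
    have Gsplit: "Gs = take i Gs @ X # drop (Suc i) Gs" using i(2) by (simp add: X_def id_take_nth_drop)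
    have cX: "card X = krow u k" using cG[OF i(2)] i(1) by (simp add: X_def)
    have fX: "finite X" "X \<noteq> {}" using cX k(1) fG i(2) by (auto simp: X_def)
    have lowempty: "\<forall>Z\<in>set (take i Gs). Z = {}"
    proof
      fix Z assume Zt: "Z \<in> set (take i Gs)"
      then obtain l where l: "l < i" "l < length Gs" "Z = Gs ! l" using i(2) by (auto simp: in_set_conv_nth)
      have "krow u (Suc l) = 0" using k(3)[of "Suc l"] l i(1) by (meson Suc_mono gr0I not_le)
      then show "Z = {}" using cG[OF l(2)] l fG[of Z] by simp
    qed
    define s where "s = wd (drop (Suc i) Gs)"
    define x where "x = Max X"
    define Gs0 where "Gs0 = take i Gs @ (X - {x}) # drop (Suc i) Gs"
    define u0 where "u0 = s @ sl (X - {x})"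
    have slX: "sl X = sl (X - {x}) @ [x]" unfolding x_def by (rule sl_Max[OF fX])
    have wG: "wd Gs = s @ sl X" by (subst Gsplit) (simp add: s_def wd_empty[OF lowempty])
    have wG0: "wd Gs0 = u0" by (simp add: Gs0_def u0_def s_def wd_empty[OF lowempty])
    have ux: "wd Gs = u0 @ [x]" using wG slX by (simp add: u0_def)
    have rux: "red (u0 @ [x])" using gG ux by (simp add: gf_def)
    then have ru0: "red u0" using red_appendD1 by blast
    have ku: "krow u = krow (u0 @ [x])" using krow_ck[OF r G(2)] ux by simp
    obtain p c where g: "clen (u0 @ [x]) = (clen u0)(c := Suc (clen u0 c))"
      "krow (u0 @ [x]) = (krow u0)(p := Suc (krow u0 p))" "krow u0 p = c" "\<And>z. z < p \<Longrightarrow> krow u0 z \<noteq> Suc c"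
      using grow[OF rux] by metis
    have es: "ext (drop (Suc i) Gs)" using ext_block[of "take i Gs @ [X]" "drop (Suc i) Gs" "[]"] G(1) Gsplit by simp
    have cl: "clen (s @ sl X) t = clen s t + of_bool (t < krow u k)" for t
    proof -
      have "map card (take i Gs) = map (\<lambda>_. 0) (take i Gs)" using lowempty by (intro map_cong) auto
      then have "map card (take i Gs) = replicate i 0" using i(2) by (simp add: map_replicate_const)
      then have "length (filter ((<) t) (map card Gs)) = of_bool (t < card X) + length (filter ((<) t) (map card (drop (Suc i) Gs)))"
        by (subst Gsplit) (simp add: filter_replicate)
      then show ?thesis using ext_clen[OF G(1), of t] ext_clen[OF es, of t] wG cX by (simp add: s_def)
    qed
    have neX: "sl X \<noteq> []" using slX by simp
    have rsX: "red (s @ sl X)" using rux ux wG by simp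
    obtain d where d: "clen (s @ sl X) = (clen (s @ butlast (sl X)))(d := Suc (clen (s @ butlast (sl X)) d))"
      "\<forall>t>d. clen (s @ sl X) t = clen s t" "clen s d < clen (s @ sl X) d"
      using inc_chain[OF incr_sl neX rsX] by blast
    have "s @ butlast (sl X) = u0" using slX by (simp add: u0_def)
    \<comment> \<open>Component \<open>k\<close> adds one box to each of the first
      \<open>krow u k\<close> columns, so the last changed column \<open>c\<close> is the one at
      which row \<open>k\<close> ends.\<close>
    then have "d = c" using d(1) g(1) ux wG by (metis fun_upd_apply n_not_Suc_n)
    moreover have "d < krow u k" using d(3) cl[of d] by (cases "d < krow u k") auto
    moreover have "\<not> Suc d < krow u k" using d(2) cl[of "Suc d"] by auto
    ultimately have ck: "krow u k = Suc c" by simp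
    \<comment> \<open>The enlarged row \<open>p\<close> also ends in column \<open>c\<close>. Were
      it above row \<open>k\<close>, the lower row \<open>k\<close> would end in that column before
      the step, against the key condition.\<close>
    have pk: "p = k"
    proof (rule ccontr)
      assume n: "p \<noteq> k"
      have "krow u p = Suc c" using ku g(2,3) by simp
      then have "k \<le> p" using k(3) by simp
      then have "krow u0 k \<noteq> Suc c" using g(4) n by simp
      then show False using ku g(2) n ck by simp
    qed
    have ku0: "map card Gs0 = map (krow u0) [1..<N]"
    proof (rule nth_equalityI)
      show l0: "length (map card Gs0) = length (map (krow u0) [1..<N])" using lG i(2) by (simp add: Gs0_def)
      fix l assume "l < length (map card Gs0)"
      then have l: "l < length Gs" using l0 lG by simp
      have "map card Gs0 ! l = (if l = i then card X - 1 else card (Gs ! l))"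
        using l i(2) fX Max_in[OF fX] by (auto simp: Gs0_def nth_append nth_Cons' x_def)
      also have "\<dots> = krow u0 (Suc l)"
      proof (cases "l = i")
        case True
        then show ?thesis using cX ck g(3) pk i(1) by simp
      next
        case False
        then have "Suc l \<noteq> k" using i(1) by auto
        then show ?thesis using cG[OF l] ku g(2) pk False by simp
      qed
      finally show "map card Gs0 ! l = map (krow u0) [1..<N] ! l" using l lG by simp
    qed
    have N0: "set u0 \<subseteq> {..<N}" using N ck_set[OF G(2)] ux by auto
    have g0: "gf Gs0" using fG ru0 wG0 fX by (auto simp: gf_def Gs0_def dest: in_set_takeD in_set_dropD)
    have e0: "ext Gs0"
    proof (rule extI[OF g0])
      have "length Gs0 = N - 1" using arg_cong[OF ku0, of length] by simp
      then show "mset (map card Gs0) = mset (map (rlen (wd Gs0)) [0..<length Gs0])"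
        using krow_mset(1)[OF ru0 N0] ku0 wG0 by simp
    qed
    have "length u0 < length u" using ck_length[OF G(2)] ux by simp
    from less(1)[OF this ru0 N0] obtain Gs1 where G1: "ext Gs1" "u0 \<approx> wd Gs1"
      "map card Gs1 = map (krow u0) [1..<N]" "\<forall>i<length Gs1. \<forall>x\<in>Gs1 ! i. Suc i \<le> x" by blast
    have "Gs1 = Gs0" by (rule ext_unique[OF G1(1) e0]) (use G1 ku0 ck_sym[OF G1(2)] wG0 in auto)
    then have fl: "\<forall>i<length Gs0. \<forall>x\<in>Gs0 ! i. Suc i \<le> x" using G1(4) by simp
    have "Suc l \<le> z" if l: "l < length Gs" and z: "z \<in> Gs ! l" for l z
    proof (cases "l = i")
      case True
      have "z \<in> set u" using sG l z by auto
      then show ?thesis using mu(2) k(2) i(1) True by force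
    next
      case False
      have "Gs0 ! l = Gs ! l" using l i(2) False by (auto simp: Gs0_def nth_append nth_Cons')
      moreover have "length Gs0 = length Gs" using i(2) by (simp add: Gs0_def)
      ultimately show ?thesis using fl l z by auto
    qed
    then show ?thesis using G by blast
  qed
qed

lemma sum_card_wd: "gf Fs \<Longrightarrow> sum_list (map card Fs) = length (wd Fs)"
proof (induct Fs)
  case (Cons X Fs)
  then show ?case using gf_append2[of "[X]" Fs] by simp
qed simp

lemma sum_krow: "red u \<Longrightarrow> set u \<subseteq> {..<N} \<Longrightarrow> (\<Sum>r=1..<N. krow u r) = length u"
proof -
  assume a: "red u" "set u \<subseteq> {..<N}"
  obtain Gs where G: "ext Gs" "u \<approx> wd Gs" "map card Gs = map (krow u) [1..<N]"
    using flagged_exists[OF a] by blast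
  have "sum_list (map (krow u) [1..<N]) = length (wd Gs)"
    using sum_card_wd[of Gs] G by (simp add: ext_def)
  then show ?thesis using ck_length[OF G(2)] by (simp add: sum_list_distinct_conv_sum_set)
qed

section \<open>Weak descent tableaux\<close>

lemma runs_Cons: "\<exists>h t. runs (y # zs) = (y # h) # t"
proof (induct zs arbitrary: y)
  case (Cons z zs)
  then show ?case by (cases "y < z") auto
qed simp

lemma concat_runs: "concat (runs w) = w"
proof (induct w rule: runs.induct)
  case (3 x y zs)
  obtain h t where "runs (y # zs) = (y # h) # t" using runs_Cons by blast
  then show ?case using 3 by (auto split: if_splits)
qed auto

lemma runs_incr: "s \<in> set (runs w) \<Longrightarrow> incr s \<and> s \<noteq> []"
proof (induct w arbitrary: s rule: runs.induct)
  case (3 x y zs)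
  obtain h t where r: "runs (y # zs) = (y # h) # t" using runs_Cons by blast
  show ?case
  proof (cases "x < y")
    case True
    have "incr (y # h)" using 3(1)[OF True, of "y # h"] r by simp
    then have "incr (x # y # h)" using True by auto
    moreover have "s = x # y # h \<or> s \<in> set (runs (y # zs))" using 3(4) True r by auto
    ultimately show ?thesis using 3(1)[OF True, of s] by auto
  next
    case False
    then have "s = [x] \<or> s \<in> set (runs (y # zs))" using 3(4) by auto
    then show ?thesis using 3(3)[OF False, of s] by auto
  qed
qed auto

lemma runs_append: "incr s \<Longrightarrow> s \<noteq> [] \<Longrightarrow> w = [] \<or> hd w \<le> last s \<Longrightarrow> runs (s @ w) = s # runs w"
proof (induct s)
  case (Cons x s)
  show ?case
  proof (cases s)
    case Nil
    then show ?thesis using Cons.prems by (cases w) auto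
  next
    case (Cons y s')
    have "runs (s @ w) = s # runs w" using Cons.hyps Cons.prems Cons by auto
    then show ?thesis using Cons Cons.prems by simp
  qed
qed simp

fun dsc :: "nat list list \<Rightarrow> bool" where
  "dsc (s # t # ss) = (hd t \<le> last s \<and> dsc (t # ss))"
| "dsc ss = True"

lemma runs_concat: "\<forall>s\<in>set ss. incr s \<and> s \<noteq> [] \<Longrightarrow> dsc ss \<Longrightarrow> runs (concat ss) = ss"
proof (induct ss rule: dsc.induct)
  case (1 s t ss)
  have IH: "runs (concat (t # ss)) = t # ss" using 1 by simp
  have "hd (concat (t # ss)) = hd t" using 1(2) by simp
  then have "runs (s @ concat (t # ss)) = s # runs (concat (t # ss))"
    using 1(2,3) by (intro runs_append) auto
  then show ?case using IH by simp
next
  case ("2_2" s)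
  then show ?case using runs_append[of s "[]"] by simp
qed simp

lemma rows_below_length [simp]: "length (rows_below p ss) = length ss"
  by (induct ss arbitrary: p) (auto simp: Let_def)

lemma run_rows_length [simp]: "length (run_rows ss) = length ss"
  by (cases ss) auto

lemma rows_below_dec: "sorted_wrt (>) (rows_below p ss) \<and> (\<forall>q\<in>set (rows_below p ss). q < p)"
proof (induct ss arbitrary: p)
  case (Cons s ss)
  define q where "q = (if int (hd s) < p then int (hd s) else p - 1)"
  have "q < p" by (simp add: q_def)
  then show ?case using Cons[of q] by (auto simp: Let_def q_def[symmetric])
qed simp

lemma run_rows_dec: "sorted_wrt (>) (run_rows ss)"
  using rows_below_dec by (cases ss) auto

lemma rows_below_le: "(q, s) \<in> set (zip (rows_below p ss) ss) \<Longrightarrow> q \<le> int (hd s)"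
  by (induct ss arbitrary: p) (auto simp: Let_def split: if_splits)

lemma run_rows_le: "(q, s) \<in> set (zip (run_rows ss) ss) \<Longrightarrow> q \<le> int (hd s)"
  using rows_below_le by (cases ss) auto

text \<open>The placement is greedy: every run gets the highest row permitted by its first letter
  and by the run above. Any other decreasing choice with rows at most the first letters stays weakly
  below.\<close>

lemma rows_below_ge:
  "length rs = length ss \<Longrightarrow> sorted_wrt (>) rs \<Longrightarrow> \<forall>r\<in>set rs. int r < p \<Longrightarrow>
    \<forall>(r, s)\<in>set (zip rs ss). r \<le> hd s \<Longrightarrow> list_all2 (\<lambda>q r. int r \<le> q) (rows_below p ss) rs"
proof (induct ss arbitrary: p rs)
  case (Cons s ss)
  then obtain r rs' where rs: "rs = r # rs'" by (cases rs) auto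
  define q where "q = (if int (hd s) < p then int (hd s) else p - 1)"
  have rq: "int r \<le> q" using Cons.prems rs by (auto simp: q_def)
  have "list_all2 (\<lambda>q r. int r \<le> q) (rows_below q ss) rs'"
    by (rule Cons.hyps) (use Cons.prems rs rq in auto)
  then show ?case using rq rs by (simp add: Let_def q_def[symmetric])
qed simp

lemma run_rows_ge:
  assumes "length rs = length ss" "sorted_wrt (>) rs" "\<forall>(r, s)\<in>set (zip rs ss). r \<le> hd s"
  shows "list_all2 (\<lambda>q r. int r \<le> q) (run_rows ss) rs"
proof (cases ss)
  case (Cons s ss')
  then obtain r rs' where rs: "rs = r # rs'" using assms(1) by (cases rs) auto
  have "list_all2 (\<lambda>q r. int r \<le> q) (rows_below (int (hd s)) ss') rs'"
    by (rule rows_below_ge) (use assms rs Cons in auto)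
  then show ?thesis using assms rs Cons by simp
qed (use assms in simp)

section \<open>Rows of the weak descent tableau as components\<close>

definition prs :: "nat list \<Rightarrow> (int \<times> nat list) list" where
  "prs w = zip (run_rows (runs w)) (runs w)"

definition rowset :: "(int \<times> nat list) list \<Rightarrow> nat \<Rightarrow> nat list" where
  "rowset ps i = (case map_of ps (int i) of None \<Rightarrow> [] | Some s \<Rightarrow> s)"

lemma prs_fst: "map fst (prs w) = run_rows (runs w)" and prs_snd: "map snd (prs w) = runs w"
  by (simp_all add: prs_def)

lemma prs_dec: "sorted_wrt (>) (map fst (prs w))"
  using run_rows_dec by (simp add: prs_fst)

lemma dec_distinct: "sorted_wrt (>) xs \<Longrightarrow> distinct (xs :: int list)"
  by (induct xs) auto

lemma prs_mem: "(q, s) \<in> set (prs w) \<Longrightarrow> incr s \<and> s \<noteq> [] \<and> q \<le> int (hd s) \<and> set s \<subseteq> set w"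
proof -
  assume a: "(q, s) \<in> set (prs w)"
  then have "s \<in> set (runs w)" unfolding prs_def by (rule set_zip_rightD)
  then have "set s \<subseteq> set (concat (runs w))" by auto
  then show ?thesis using a run_rows_le[of q s "runs w"] runs_incr[OF \<open>s \<in> set (runs w)\<close>]
    by (auto simp: concat_runs prs_def)
qed

lemma dom_wdt: "dom (weak_des_tab w) = {(q, c). \<exists>s. map_of (prs w) q = Some s \<and> 1 \<le> c \<and> c \<le> length s}"
  by (auto simp: weak_des_tab_def prs_def split: option.splits if_splits)

lemma map_of_prs: "map_of (prs w) q = Some s \<longleftrightarrow> (q, s) \<in> set (prs w)"
  using dec_distinct[OF prs_dec] map_of_eq_Some_iff by force

lemma virtual_iff: "virtual w \<longleftrightarrow> (\<exists>(q, s)\<in>set (prs w). q \<le> 0)"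
proof
  assume "virtual w"
  then show "\<exists>(q, s)\<in>set (prs w). q \<le> 0" unfolding virtual_def dom_wdt map_of_prs by auto
next
  assume "\<exists>(q, s)\<in>set (prs w). q \<le> 0"
  then obtain q s where q: "(q, s) \<in> set (prs w)" "q \<le> 0" by auto
  have "1 \<le> length s" using prs_mem[OF q(1)] by (cases s) auto
  then have "(q, 1) \<in> dom (weak_des_tab w)" using q unfolding dom_wdt map_of_prs by auto
  then show "virtual w" using q(2) unfolding virtual_def by auto
qed

lemma row_boxes: "{c. (int i, c) \<in> dom (weak_des_tab w)} = {1..length (rowset (prs w) i)}"
  by (auto simp: dom_wdt rowset_def split: option.splits)

lemma des_rowset: "des w i = length (rowset (prs w) i)"
  by (simp add: des_def row_boxes)

lemma wd_pairs:
  "sorted_wrt (>) (map fst ps) \<Longrightarrow> \<forall>(q, s)\<in>set ps. 1 \<le> q \<and> q < int N \<and> incr s \<Longrightarrow>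
    wd (map (\<lambda>i. set (rowset ps i)) [1..<N]) = concat (map snd ps)"
proof (induct ps arbitrary: N)
  case Nil
  have "wd (map (\<lambda>i. set (rowset [] i)) [1..<N]) = []" by (rule wd_empty) (auto simp: rowset_def)
  then show ?case by simp
next
  case (Cons p ps)
  obtain q s where p: "p = (q, s)" by fastforce
  define k where "k = nat q"
  have k: "q = int k" "1 \<le> k" "k < N" using Cons.prems(2) p by (auto simp: k_def)
  have keys: "\<forall>q'\<in>set (map fst ps). q' < q" using Cons.prems(1) p by simp
  have low: "rowset (p # ps) i = rowset ps i" if "i < k" for i
    using that k p by (simp add: rowset_def)
  have high: "rowset (p # ps) i = []" if "k < i" for i
  proof -
    have "int i \<notin> set (map fst ps)" using keys k that by force
    then have "map_of ps (int i) = None" by (simp add: map_of_eq_None_iff)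
    then show ?thesis using that k p by (simp add: rowset_def)
  qed
  have at: "rowset (p # ps) k = s" using p k by (simp add: rowset_def)
  have split: "[1..<N] = [1..<k] @ [k] @ [Suc k..<N]"
    using upt_add_eq_append[of 1 k "N - k"] upt_conv_Cons[of k N] k by simp
  have "wd (map (\<lambda>i. set (rowset (p # ps) i)) [Suc k..<N]) = []" by (rule wd_empty) (auto simp: high)
  moreover have e: "map (\<lambda>i. set (rowset (p # ps) i)) [1..<k] = map (\<lambda>i. set (rowset ps i)) [1..<k]"
    by (rule map_cong) (auto simp: low)
  have "wd (map (\<lambda>i. set (rowset (p # ps) i)) [1..<k]) = concat (map snd ps)"
    unfolding e by (rule Cons.hyps) (use Cons.prems keys k in \<open>auto split: prod.splits\<close>)
  moreover have "sl (set s) = s" using Cons.prems(2) p sl_set by auto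
  ultimately show ?case unfolding split using at p by simp
qed

definition rowfact :: "nat list \<Rightarrow> nat \<Rightarrow> nat set list" where
  "rowfact w N = map (\<lambda>i. set (rowset (prs w) i)) [1..<N]"

lemma rowset_incr: "incr (rowset (prs w) i)" and rowset_le: "x \<in> set (rowset (prs w) i) \<Longrightarrow> i \<le> x"
proof -
  show "incr (rowset (prs w) i)"
    using prs_mem[of "int i" _ w] map_of_prs[of w "int i"] by (auto simp: rowset_def split: option.splits)
  assume x: "x \<in> set (rowset (prs w) i)"
  then obtain s where s: "map_of (prs w) (int i) = Some s" "x \<in> set s"
    by (cases "map_of (prs w) (int i)") (auto simp: rowset_def)
  then have "incr s" "int i \<le> int (hd s)" "s \<noteq> []" using prs_mem map_of_prs by blast+
  moreover have "hd s \<le> x" using \<open>incr s\<close> s(2) by (cases s) auto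
  ultimately show "i \<le> x" by simp
qed

lemma rowfact:
  assumes r: "red w" and N: "set w \<subseteq> {..<N}" and v: "\<not> virtual w"
  shows "wd (rowfact w N) = w" "gf (rowfact w N)" "map card (rowfact w N) = map (des w) [1..<N]"
proof -
  have "\<forall>(q, s)\<in>set (prs w). 1 \<le> q \<and> q < int N \<and> incr s"
  proof (clarify)
    fix q s assume a: "(q, s) \<in> set (prs w)"
    note m = prs_mem[OF a]
    have "hd s \<in> set w" using m hd_in_set by blast
    then have "int (hd s) < int N" using N by auto
    moreover have "1 \<le> q" using v a unfolding virtual_iff by fastforce
    ultimately show "1 \<le> q \<and> q < int N \<and> incr s" using m by auto
  qed
  then show w: "wd (rowfact w N) = w"
    using wd_pairs[OF prs_dec] by (simp add: rowfact_def prs_snd concat_runs)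
  then show "gf (rowfact w N)" using r by (auto simp: gf_def rowfact_def)
  have "card (set (rowset (prs w) i)) = des w i" for i
    using rowset_incr[of w i] by (simp add: des_rowset distinct_card strict_sorted_iff)
  then show "map card (rowfact w N) = map (des w) [1..<N]" by (simp add: rowfact_def)
qed

text \<open>Cut \<open>w\<close> behind its rows above \<open>k\<close>. The first part
  \<open>s\<close> has only letters larger than \<open>k\<close>, so all rows of its left key lie
  above \<open>k\<close>; they are contained in those of \<open>u\<close>. Hence the rows above
  \<open>k\<close> hold no more boxes in \<open>des w\<close> than in \<open>krow u\<close>, and the
  totals agree.\<close>

lemma comp_le_krow:
  assumes r: "red u" and w: "u \<approx> w" and v: "\<not> virtual w"
  shows "comp_le (krow u) (des w)"
  unfolding comp_le_def
proof
  fix k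
  obtain M where M: "\<forall>x\<in>set u. x < M" using finite_nat_set_iff_bounded[of "set u"] by blast
  define N where "N = Suc (M + k)"
  have N: "set u \<subseteq> {..<N}" "set w \<subseteq> {..<N}" using M ck_set[OF w] by (auto simp: N_def)
  have rw: "red w" by (rule red_ck[OF r w])
  note F = rowfact[OF rw N(2) v]
  define Fs where "Fs = rowfact w N"
  define s where "s = wd (drop k Fs)"
  have split: "w = s @ wd (take k Fs)" using F(1) wd_simps(3)[of "take k Fs" "drop k Fs"] by (simp add: Fs_def s_def)
  have rs: "red (s @ wd (take k Fs))" using rw split by simp
  then have rs': "red s" using red_appendD1 by blast
  have gs: "gf (drop k Fs)" using gf_append2[of "take k Fs" "drop k Fs"] F(2) by (simp add: Fs_def)
  \<comment> \<open>A run is placed in a row at most its first letter.\<close>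
  have big: "k < x" if "x \<in> set s" for x
  proof -
    have "x \<in> \<Union>(set (drop k Fs))" using that set_wd[OF gs] by (simp add: s_def)
    then obtain Z where Z: "Z \<in> set (drop k Fs)" "x \<in> Z" by blast
    obtain i where "i < length (drop k Fs)" "drop k Fs ! i = Z" using Z(1) in_set_conv_nth[of Z] by metis
    then have "k + i < length Fs" "x \<in> Fs ! (k + i)" using Z by auto
    then have "x \<in> set (rowset (prs w) (Suc (k + i)))" by (simp add: Fs_def rowfact_def del: upt_Suc)
    then show ?thesis using rowset_le by fastforce
  qed
  have z: "krow s i = 0" if "i \<le> k" for i using krow_pos_letter[OF rs', of i] big[of i] that by (metis gr0I not_le)
  have lek: "krow s i \<le> krow u i" for i
    using krow_prefix[OF rs, of i] split krow_ck[OF r w] by simp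
  have sN: "set s \<subseteq> {..<N}" using N(2) split by auto
  have sp: "(\<Sum>i=1..<N. f i) = (\<Sum>i=1..k. f i) + (\<Sum>i=Suc k..<N. f i)" for f :: "nat \<Rightarrow> nat"
    using sum.atLeastLessThan_concat[of 1 "Suc k" N f] by (simp add: N_def atLeastLessThanSuc_atLeastAtMost)
  have "length s = (\<Sum>i=1..<N. krow s i)" using sum_krow[OF rs' sN] by simp
  also have "\<dots> = (\<Sum>i=Suc k..<N. krow s i)" unfolding sp using z by simp
  also have "\<dots> \<le> (\<Sum>i=Suc k..<N. krow u i)" by (rule sum_mono) (simp add: lek)
  finally have "length s + (\<Sum>i=1..k. krow u i) \<le> length u" using sum_krow[OF r N(1)] sp[of "krow u"] by simp
  moreover have "length (wd (take k Fs)) = (\<Sum>i=1..k. des w i)"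
  proof -
    have g: "gf (take k Fs)" using gf_append1[of "take k Fs" "drop k Fs"] F(2) by (simp add: Fs_def)
    have "map card (take k Fs) = map (des w) (take k [1..<N])"
      using F(3) by (simp add: Fs_def take_map[symmetric])
    also have "take k [1..<N] = [1..<Suc k]" by (simp add: N_def del: upt_Suc)
    finally have "sum_list (map card (take k Fs)) = (\<Sum>i=1..<Suc k. des w i)"
      by (simp add: sum_list_distinct_conv_sum_set del: upt_Suc)
    then show ?thesis using sum_card_wd[OF g] by (simp add: atLeastLessThanSuc_atLeastAtMost)
  qed
  moreover have "length u = length s + length (wd (take k Fs))" using ck_length[OF w] split by (metis length_append)
  ultimately show "(\<Sum>i=1..k. krow u i) \<le> (\<Sum>i=1..k. des w i)" by simp
qed

lemma sum_rowset:
  assumes "distinct (map fst ps)" "\<forall>(q, s)\<in>set ps. 1 \<le> q"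
  shows "(\<Sum>i=1..k. length (rowset ps i)) = sum_list (map (\<lambda>(q, s). if q \<le> int k then length s else 0) ps)"
  using assms
proof (induct ps)
  case Nil
  then show ?case by (simp add: rowset_def)
next
  case (Cons p ps)
  obtain q s where p: "p = (q, s)" by fastforce
  define j where "j = nat q"
  have j: "q = int j" "1 \<le> j" using Cons.prems p by (auto simp: j_def)
  have "map_of ps q = None" using Cons.prems(1) p by (simp add: map_of_eq_None_iff)
  then have "length (rowset (p # ps) i) = length (rowset ps i) + (if i = j then length s else 0)" for i
    using p j by (auto simp: rowset_def)
  then have "(\<Sum>i=1..k. length (rowset (p # ps) i)) = (\<Sum>i=1..k. length (rowset ps i)) + (\<Sum>i=1..k. if i = j then length s else 0)"
    by (simp add: sum.distrib)
  also have "(\<Sum>i=1..k. if i = j then length s else 0) = (if q \<le> int k then length s else 0)"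
    using j by (simp add: sum.delta')
  also have "(\<Sum>i=1..k. length (rowset ps i)) = sum_list (map (\<lambda>(q, s). if q \<le> int k then length s else 0) ps)"
    using Cons by auto
  finally show ?case using p by simp
qed

text \<open>Without a descent the two components could be merged into one, and a square of a sum
  exceeds the sum of the squares.\<close>

lemma ext_descent:
  assumes e: "ext (Xs @ [B, A] @ Ys)" and ne: "A \<noteq> {}" "B \<noteq> {}"
  shows "hd (sl B) \<le> last (sl A)"
proof (rule ccontr)
  assume n: "\<not> hd (sl B) \<le> last (sl A)"
  have e2: "ext [B, A]" by (rule ext_block[OF e])
  then have f: "finite A" "finite B" "red (sl A @ sl B)" by (auto simp: ext_def gf_def)
  have "x < y" if "x \<in> A" "y \<in> B" for x y
  proof -
    have "last (sl A) = Max A" using sl_Max[OF f(1) ne(1)] by (metis last_snoc)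
    then have "x \<le> last (sl A)" using that f by simp
    moreover have "y \<in> set (sl B)" using that f by simp
    then have "hd (sl B) \<le> y" using incr_sl[of B] by (cases "sl B") (auto simp del: incr_sl)
    ultimately show ?thesis using n by simp
  qed
  then have s: "sl (A \<union> B) = sl A @ sl B" using f by (intro sl_Un) auto
  have "A \<inter> B = {}" using \<open>\<And>y x. x \<in> A \<Longrightarrow> y \<in> B \<Longrightarrow> x < y\<close> by fastforce
  then have c: "card (A \<union> B) = card A + card B" using f by (simp add: card_Un_disjoint)
  have "gf [A \<union> B]" using f s by (simp add: gf_def)
  then have "sq [A \<union> B] \<le> sqr (wd [A \<union> B])" by (rule sq_le)
  also have "\<dots> = sq [B, A]" using e2 s by (simp add: ext_def)
  finally have "card A * card B = 0" using c by (simp add: power2_eq_square algebra_simps)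
  then show False using ne f by simp
qed

lemma ext_filter: "ext Gs \<Longrightarrow> ext (filter (\<lambda>X. X \<noteq> {}) Gs) \<and> wd (filter (\<lambda>X. X \<noteq> {}) Gs) = wd Gs"
proof -
  assume e: "ext Gs"
  have w: "wd (filter (\<lambda>X. X \<noteq> {}) Gs) = wd Gs" by (induct Gs) auto
  have "sq (filter (\<lambda>X. X \<noteq> {}) Gs) = sq Gs" by (induct Gs) auto
  then show ?thesis using e w by (auto simp: ext_def gf_def)
qed

lemma ext_dsc: "ext Hs \<Longrightarrow> \<forall>X\<in>set Hs. X \<noteq> {} \<Longrightarrow> dsc (map sl (rev Hs))"
proof -
  assume a: "ext Hs" "\<forall>X\<in>set Hs. X \<noteq> {}"
  have "dsc ss" if "\<And>P s t Q. ss = P @ [s, t] @ Q \<Longrightarrow> hd t \<le> last s" for ss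
    using that
  proof (induct ss rule: dsc.induct)
    case (1 s t ss)
    have "hd t \<le> last s" using 1(2)[of "[]" s t ss] by simp
    moreover have "dsc (t # ss)" by (rule 1(1)) (use 1(2)[of "s # _"] in auto)
    ultimately show ?case by simp
  qed auto
  moreover have "hd t \<le> last s" if "map sl (rev Hs) = P @ [s, t] @ Q" for P s t Q
  proof -
    obtain P' A B Q' where R: "rev Hs = P' @ [A, B] @ Q'" "s = sl A" "t = sl B"
      using \<open>map sl (rev Hs) = P @ [s, t] @ Q\<close> by (auto simp: map_eq_append_conv)
    then have H: "Hs = rev Q' @ [B, A] @ rev P'" by (metis append.assoc append_Cons append_Nil rev_append rev_rev_ident rev.simps(2) rev.simps(1))
    then show ?thesis using ext_descent[of "rev Q'" B A "rev P'"] a R by auto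
  qed
  ultimately show ?thesis by blast
qed

section \<open>The minimal word of a class\<close>

lemma map_of_int: "map_of (map (\<lambda>r. (int r, f r)) rs) (int i) = (if i \<in> set rs then Some (f i) else None)"
  by (induct rs) auto

lemma sum_rows_le:
  "list_all2 (\<lambda>q r. int r \<le> q) qs rs \<Longrightarrow>
    sum_list (map (\<lambda>(q, s). if q \<le> int k then length s else 0) (zip qs ss))
    \<le> sum_list (map (\<lambda>(q, s). if q \<le> int k then length s else 0) (zip (map int rs) ss))"
proof (induct qs rs arbitrary: ss rule: list_all2_induct)
  case (Cons q qs r rs)
  show ?case
  proof (cases ss)
    case (Cons s ss')
    then show ?thesis using Cons.hyps Cons by (simp add: add_mono)
  qed simp
qed simp

lemma partial_sums_eq:
  fixes f g :: "nat \<Rightarrow> nat"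
  assumes "\<And>k. (\<Sum>i=1..k. f i) = (\<Sum>i=1..k. g i)" "1 \<le> i"
  shows "f i = g i"
proof -
  obtain j where "i = Suc j" using assms(2) by (cases i) auto
  then show ?thesis using assms(1)[of i] assms(1)[of j] by simp
qed

lemma comp_le_antisym: "comp_le f g \<Longrightarrow> comp_le g f \<Longrightarrow> 1 \<le> i \<Longrightarrow> f i = g i"
  by (rule partial_sums_eq) (auto simp: comp_le_def intro: antisym)

text \<open>Let \<open>w\<close> be the word of the flagged extremal factorization. By
  \<open>ext_descent\<close> its nonempty components are its runs, and the tableau places them
  weakly above their component numbers. So \<open>w\<close> is not virtual and \<open>des w\<close>
  is at most \<open>krow u\<close>; \<open>comp_le_krow\<close> gives the converse.\<close>

lemma hat_word:
  assumes r: "red u"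
  shows "u \<approx> hat u \<and> \<not> virtual (hat u) \<and> (\<forall>i\<ge>1. des (hat u) i = krow u i)"
proof -
  obtain N where "\<forall>x\<in>set u. x < N" using finite_nat_set_iff_bounded[of "set u"] by blast
  then have N: "set u \<subseteq> {..<N}" by auto
  obtain Gs where G: "ext Gs" "u \<approx> wd Gs" "map card Gs = map (krow u) [1..<N]"
    "\<forall>i<length Gs. \<forall>x\<in>Gs ! i. Suc i \<le> x" using flagged_exists[OF r N] by blast
  have gG: "gf Gs" using G(1) by (simp add: ext_def)
  have fG: "finite X" if "X \<in> set Gs" for X using gG that by (simp add: gf_def)
  have lG: "length Gs = N - 1" using arg_cong[OF G(3), of length] by simp
  define w where "w = wd Gs"
  have rw: "red w" using gG by (simp add: gf_def w_def)
  have wN: "set w \<subseteq> {..<N}" using N ck_set[OF G(2)] by (simp add: w_def)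
  define f where "f i = sl (Gs ! (i - 1))" for i
  define rs where "rs = filter (\<lambda>i. Gs ! (i - 1) \<noteq> {}) (rev [1..<N])"
  define ss where "ss = map f rs"
  define Hs where "Hs = filter (\<lambda>X. X \<noteq> {}) Gs"
  have H: "ext Hs" "wd Hs = w" using ext_filter[OF G(1)] by (auto simp: Hs_def w_def)
  have "Gs = map (\<lambda>i. Gs ! (i - 1)) [1..<N]"
    by (rule nth_equalityI) (use lG in auto)
  then have "Hs = filter (\<lambda>X. X \<noteq> {}) (map (\<lambda>i. Gs ! (i - 1)) [1..<N])" unfolding Hs_def by simp
  then have "map sl (rev Hs) = map sl (rev (filter (\<lambda>X. X \<noteq> {}) (map (\<lambda>i. Gs ! (i - 1)) [1..<N])))" by simp
  also have "\<dots> = ss" by (simp add: ss_def rs_def f_def filter_map rev_map rev_filter comp_def)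
  finally have ss: "map sl (rev Hs) = ss" .
  have mem: "i \<in> set rs \<longleftrightarrow> 1 \<le> i \<and> i < N \<and> Gs ! (i - 1) \<noteq> {}" for i by (auto simp: rs_def)
  have fin: "finite (Gs ! (i - 1))" if "i \<in> set rs" for i using that mem fG lG by (auto intro!: nth_mem)
  have fr: "f i \<noteq> [] \<and> i \<le> hd (f i)" if i: "i \<in> set rs" for i
  proof -
    have ne: "f i \<noteq> []" using i mem[of i] fin[OF i] by (simp add: f_def)
    have "set (f i) = Gs ! (i - 1)" using fin[OF i] by (simp add: f_def)
    then have "hd (f i) \<in> Gs ! (i - 1)" using hd_in_set[OF ne] by blast
    moreover have "i - 1 < length Gs" "Suc (i - 1) = i" using i mem[of i] lG by auto
    ultimately show ?thesis using G(4) ne by metis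
  qed
  have runs: "runs w = ss"
  proof -
    have "runs (concat ss) = ss"
      by (rule runs_concat) (use fr ext_dsc[OF H(1)] ss in \<open>auto simp: ss_def f_def Hs_def\<close>)
    moreover have "concat ss = w" using ss H(2) by (simp add: wd_def)
    ultimately show ?thesis by simp
  qed
  have dec: "sorted_wrt (>) rs" unfolding rs_def by (rule sorted_wrt_filter) (simp add: sorted_wrt_rev)
  have zs: "zip rs ss = map (\<lambda>i. (i, f i)) rs" by (simp add: ss_def zip_map2 zip_same_conv_map)
  have ge: "list_all2 (\<lambda>q r. int r \<le> q) (run_rows ss) rs"
    by (rule run_rows_ge) (use dec zs fr in \<open>auto simp: ss_def\<close>)
  have nv: "\<not> virtual w"
  proof
    assume "virtual w"
    then obtain q s where q: "(q, s) \<in> set (prs w)" "q \<le> 0" unfolding virtual_iff by auto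
    then have "q \<in> set (run_rows ss)" unfolding prs_def runs by (metis set_zip_leftD)
    then obtain i where "i < length (run_rows ss)" "q = run_rows ss ! i" by (auto simp: in_set_conv_nth)
    then have "int (rs ! i) \<le> q" "rs ! i \<in> set rs" using ge by (auto simp: list_all2_conv_all_nth)
    then show False using q(2) mem[of "rs ! i"] by auto
  qed
  note le = comp_le_krow[OF r]
  have wle: "comp_le (krow u) (des w)" using le G(2) nv by (simp add: w_def)
  have "comp_le (des w) (krow u)"
    unfolding comp_le_def
  proof
    fix k
    let ?c = "\<lambda>(q, s). if q \<le> int k then length s else 0"
    define ps where "ps = map (\<lambda>i. (int i, f i)) rs"
    have zps: "zip (map int rs) ss = ps" by (simp add: ps_def ss_def zip_map_map zip_same_conv_map)
    have "(\<Sum>i=1..k. des w i) = sum_list (map ?c (prs w))"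
      unfolding des_rowset
      by (rule sum_rowset) (use dec_distinct[OF prs_dec] nv in \<open>fastforce simp: virtual_iff\<close>)+
    \<comment> \<open>Runs placed higher contribute to fewer of the partial sums.\<close>
    also have "\<dots> \<le> sum_list (map ?c ps)"
      using sum_rows_le[OF ge, of k ss] unfolding prs_def runs zps .
    also have "\<dots> = (\<Sum>i=1..k. length (rowset ps i))"
      by (rule sum_rowset[symmetric])
        (use mem in \<open>auto simp: ps_def comp_def rs_def distinct_map inj_on_def\<close>)
    also have "\<dots> = (\<Sum>i=1..k. krow u i)"
    proof (rule sum.cong)
      fix i assume "i \<in> {1..k}"
      then have i1: "1 \<le> i" by simp
      have "rowset ps i = (if i \<in> set rs then f i else [])" by (simp add: rowset_def ps_def map_of_int)
      moreover have "length (if i \<in> set rs then f i else []) = krow u i"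
      proof (cases "i < N")
        case True
        have "card (Gs ! (i - 1)) = krow u i"
          using arg_cong[OF G(3), of "\<lambda>l. l ! (i - 1)"] True i1 lG by simp
        then show ?thesis using True i1 mem[of i] by (auto simp: f_def)
      next
        case False
        then have "krow u i = 0" using krow_pos_letter[OF r, of i] N by (metis gr0I lessThan_iff subsetD)
        then show ?thesis using False mem[of i] by simp
      qed
      ultimately show "length (rowset ps i) = krow u i" by simp
    qed simp
    finally show "(\<Sum>i=1..k. des w i) \<le> (\<Sum>i=1..k. krow u i)" .
  qed
  then have dw: "des w i = krow u i" if "1 \<le> i" for i using comp_le_antisym[OF wle] that by simp
  \<comment> \<open>A competitor has the same row lengths, so its rows form an extremal
    factorization with the lengths of \<open>Gs\<close>.\<close>
  have uniq: "t = w" if t: "u \<approx> t" "\<not> virtual t" "comp_le (des t) (des w)" for t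
  proof -
    have rt: "red t" by (rule red_ck[OF r t(1)])
    have tN: "set t \<subseteq> {..<N}" using N ck_set[OF t(1)] by simp
    note F = rowfact[OF rt tN t(2)]
    have "comp_le (des t) (krow u)"
      using t(3) dw unfolding comp_le_def by simp
    then have "des t i = krow u i" if "1 \<le> i" for i using comp_le_antisym[OF le[OF t(1,2)]] that by simp
    then have c: "map card (rowfact t N) = map card Gs" using F(3) G(3) by simp
    have wt: "wd Gs \<approx> wd (rowfact t N)" using ck_trans[OF ck_sym[OF G(2)] t(1)] F(1) by simp
    have "ext (rowfact t N)" by (rule ext_ck[OF G(1) F(2) wt]) (simp only: c)
    then have "Gs = rowfact t N" using ext_unique[OF G(1) _ _ wt] c by simp
    then show ?thesis using F(1) by (simp add: w_def)
  qed
  have uw: "u \<approx> w" using G(2) by (simp add: w_def)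
  have min: "minimal_in_class u w"
    unfolding minimal_in_class_def word_le_def using uw nv uniq by blast
  have "hat u = w"
    unfolding hat_def
  proof (rule the_equality[where a = w])
    show "minimal_in_class u w" by (rule min)
    fix s assume s: "minimal_in_class u s"
    then have s1: "u \<approx> s" "\<not> virtual s" by (auto simp: minimal_in_class_def)
    have "comp_le (des w) (des s)" using le[OF s1] dw unfolding comp_le_def by simp
    moreover have "w \<approx> s" by (rule ck_trans[OF ck_sym[OF uw] s1(1)])
    ultimately have "word_le w s" by (simp add: word_le_def)
    then show "s = w" using s uw nv unfolding minimal_in_class_def by blast
  qed
  then show ?thesis using uw nv dw by simp
qed

lemma dom_P_word:
  assumes r: "red u"
  shows "dom (P_word u) = {(int p, c) | p c. 1 \<le> c \<and> c \<le> krow u p}"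
proof -
  note h = hat_word[OF r]
  have z: "krow u 0 = 0" using krow_pos_letter[OF r, of 0] red_pos[OF r, of 0] by auto
  have row: "(int p, c) \<in> dom (weak_des_tab (hat u)) \<longleftrightarrow> 1 \<le> c \<and> c \<le> des (hat u) p" for p c
    using row_boxes[of p "hat u"] by (auto simp: des_rowset set_eq_iff)
  have pos: "1 \<le> q" if "(q, c) \<in> dom (weak_des_tab (hat u))" for q c
  proof (rule ccontr)
    assume "\<not> 1 \<le> q"
    then have "virtual (hat u)" unfolding virtual_def by (intro bexI[OF _ that]) simp
    then show False using h by blast
  qed
  show ?thesis
    unfolding P_word_def
  proof (intro equalityI subsetI)
    fix b assume b: "b \<in> dom (weak_des_tab (hat u))"
    obtain q c where qc: "b = (q, c)" by fastforce
    define p where "p = nat q"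
    have p: "q = int p" "1 \<le> p" using pos[of q c] b qc by (auto simp: p_def)
    then show "b \<in> {(int p, c) | p c. 1 \<le> c \<and> c \<le> krow u p}" using row[of p c] b qc h by auto
  next
    fix b assume "b \<in> {(int p, c) | p c. 1 \<le> c \<and> c \<le> krow u p}"
    then obtain p c where b: "b = (int p, c)" "1 \<le> c" "c \<le> krow u p" by blast
    then have "1 \<le> p" using z by (cases p) auto
    then show "b \<in> dom (weak_des_tab (hat u))" using row[of p c] b h by simp
  qed
qed

lemma P_word_ck:
  assumes "u \<approx> v"
  shows "P_word u = P_word v"
proof -
  have "u \<approx> s \<longleftrightarrow> v \<approx> s" for s using assms ck_sym ck_trans by metis
  then show ?thesis by (simp add: P_word_def hat_def minimal_in_class_def)
qed

section \<open>Raising two components after a fixed prefix\<close>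

lemma roww_bump_incr:
  "incr R \<Longrightarrow> incr (b # bs) \<Longrightarrow>
    (\<forall>w\<in>set (snd (roww (fst (rowins R b)) bs)). \<exists>v. snd (rowins R b) = [v] \<and> v < w)
    \<and> incr (snd (roww R (b # bs)))"
proof (induct bs arbitrary: R b)
  case Nil
  then show ?case using rowins_snd[of R b] by auto
next
  case (Cons d bs)
  let ?R = "fst (rowins R b)"
  have IH: "\<forall>w\<in>set (snd (roww (fst (rowins ?R d)) bs)). \<exists>v. snd (rowins ?R d) = [v] \<and> v < w"
    "incr (snd (roww ?R (d # bs)))"
    using Cons.hyps[of ?R d] Cons.prems rowins_incr by auto
  have up: "\<exists>v. snd (rowins R b) = [v] \<and> v < w" if "snd (rowins ?R d) = [w]" for w
    using rowins_up[OF Cons.prems(1) _ that] Cons.prems(2) by simp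
  have all: "\<exists>v. snd (rowins R b) = [v] \<and> v < w" if w: "w \<in> set (snd (roww ?R (d # bs)))" for w
  proof (cases "w \<in> set (snd (rowins ?R d))")
    case True
    then show ?thesis using rowins_snd[of ?R d] up by auto
  next
    case False
    then have "w \<in> set (snd (roww (fst (rowins ?R d)) bs))" using w by simp
    then obtain v where v: "snd (rowins ?R d) = [v]" "v < w" using IH(1) by blast
    then show ?thesis using up[OF v(1)] by (meson less_trans)
  qed
  have "incr (snd (rowins R b))" using rowins_snd[of R b] by auto
  moreover have "\<forall>v\<in>set (snd (rowins R b)). \<forall>w\<in>set (snd (roww ?R (d # bs))). v < w"
    using all by fastforce
  ultimately have "incr (snd (rowins R b) @ snd (roww ?R (d # bs)))"
    using IH(2) unfolding sorted_wrt_append by blast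
  then show ?case using all by auto
qed

text \<open>The row and the increasing word form a pair; its top is equivalent to it and is a
  two-row tableau, on which insertion can be read off (\<open>roww_hw\<close>).\<close>

lemma roww_topp:
  assumes i: "incr R" and f: "finite x" and r: "red (R @ sl x)"
  shows "roww R (sl x) = (sl (snd (topp (set R, x))), sl (fst (topp (set R, x))))" "gp (set R, x)"
proof -
  define t where "t = topp (set R, x)"
  show g: "gp (set R, x)" using i f r by (simp add: gp_def sl_set)
  note T = topp[OF g, folded t_def]
  have w: "wp (set R, x) = R @ sl x" using i by (simp add: sl_set)
  have e: "roww [] (R @ sl x) = roww R (sl x)" using i by (simp add: roww_append roww_Nil_incr)
  have "fst (roww [] (R @ sl x)) = fst (roww [] (wp t)) \<and> snd (roww [] (R @ sl x)) \<approx> snd (roww [] (wp t))"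
    by (rule roww_ck) (use T(2) w r in auto)
  then have 1: "fst (roww R (sl x)) = sl (snd t)" "snd (roww R (sl x)) \<approx> sl (fst t)"
    using roww_hw[OF T(1,3)] e by auto
  have "incr (snd (roww R (sl x)))"
  proof (cases "sl x")
    case (Cons b bs)
    then have "incr (b # bs)" using incr_sl[of x] by simp
    then show ?thesis using roww_bump_incr[OF i, of b bs] Cons by simp
  qed simp
  moreover have "red (snd (roww R (sl x)))"
    using red_appendD1[OF red_ck[OF r roww_equiv[OF i r]]] .
  ultimately have "snd (roww R (sl x)) = sl (fst t)" using incr_ck_eq[OF _ 1(2)] by simp
  then show "roww R (sl x) = (sl (snd t), sl (fst t))" using 1(1) by (metis prod.collapse)
qed

lemma unp_emptyI:
  assumes "\<And>a. a \<in> A \<Longrightarrow> card (A \<inter> {..<a}) < card (B \<inter> {..<a})"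
  shows "unp A B = {}"
proof -
  have "0 < pool A B a" if "a \<in> A" for a
  proof -
    have "card (B \<inter> {0..<a}) \<le> pool A B a + card (A \<inter> {Suc 0..<a})" by (rule pool_lb) simp
    moreover have "card (A \<inter> {Suc 0..<a}) \<le> card (A \<inter> {..<a})" by (rule card_mono) auto
    ultimately show ?thesis using assms[OF that] by (simp add: atLeast0LessThan)
  qed
  then show ?thesis by (auto simp: unp_def)
qed

lemma pool_remove: "pool A B t \<le> Suc (pool A (B - {b}) t)"
proof -
  have "pool A B t \<le> pool A (B - {b}) t + of_bool (b < t)"
  proof (induct t)
    case (Suc t)
    then show ?case by (cases "t = b"; cases "b < t") auto
  qed simp
  then show ?thesis by (cases "b < t") auto
qed

lemma pool_card:
  assumes "A \<union> B \<subseteq> {..<N}"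
  shows "card B = card (pairedL A B) + pool A B N"
proof -
  have "B \<inter> {..<N} = B" "pairedL A B \<inter> {..<N} = pairedL A B" using assms by (auto simp: pairedL_def)
  then show ?thesis using pool_total[of B N A] by simp
qed

text \<open>Along a string of raisings, the number of letters that enlarge a row \<open>R\<close> on insertion is a
  convex function: it is constant and then has slope 1.\<close>

lemma pool_raise_drop:
  assumes g: "gp p" and ne: "up p \<noteq> {}" and n: "pool R (fst (topp p)) N < pool R (fst p) N"
    and N: "fst p \<subseteq> {..<N}"
  shows "pool R (fst p) N = Suc (pool R (fst (raise p)) N)"
proof (rule ccontr)
  let ?x = "fst p" and ?z = "fst (topp p)" and ?x' = "fst (raise p)"
  assume c: "\<not> ?thesis"
  have x': "?x' = ?x - {Max (up p)}" by (simp add: raise_def Let_def)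
  define a where "a = Max (up p)"
  have xa: "?x' = ?x - {a}" unfolding x' a_def ..
  have "pool R ?x' N \<le> pool R ?x N" by (rule pool_mono) (auto simp: x')
  moreover have "pool R ?x N \<le> Suc (pool R ?x' N)" unfolding x' by (rule pool_remove)
  ultimately have e: "pool R ?x' N = pool R ?x N" using c by simp
  \<comment> \<open>\<open>t\<close> is a window in which the pool of the raised component is
    attained. If the removed letter \<open>a\<close> lies in it, putting \<open>a\<close> back
    increases the pool. If not, the window contains only letters that survive to the top, so the top
    has the same pool.\<close>
  then obtain t where t: "t < N" "pool R ?x' N + card (R \<inter> {Suc t..<N}) = card (?x' \<inter> {t..<N})"
    using pool_attain[of R ?x' N] n by auto
  have lb: "card (X \<inter> {t..<N}) \<le> pool R X N + card (R \<inter> {Suc t..<N})" for X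
    by (rule pool_lb) (use t in simp)
  have fu: "finite (up p)" by (rule finite_up[OF g])
  have au: "a \<in> up p" unfolding a_def using fu ne by simp
  then have ax: "a \<in> ?x" "a < N" using N by (auto simp: unp_def)
  show False
  proof (cases "t \<le> a")
    case True
    then have "?x \<inter> {t..<N} = insert a (?x' \<inter> {t..<N})" unfolding xa using ax by auto
    moreover have "a \<notin> ?x' \<inter> {t..<N}" unfolding xa by simp
    ultimately have "card (?x \<inter> {t..<N}) = Suc (card (?x' \<inter> {t..<N}))" by simp
    then show False using lb[of ?x] t(2) e by simp
  next
    case False
    have "z \<in> ?z" if "z \<in> ?x'" "t \<le> z" for z
    proof (rule ccontr)
      assume "z \<notin> ?z"
      then have "z \<in> up p" using that topp(4)[OF g] unfolding xa by (auto simp: pairedL_unp)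
      then have "z \<le> a" using fu by (simp add: a_def)
      then show False using that False by simp
    qed
    then have "card (?x' \<inter> {t..<N}) \<le> card (?z \<inter> {t..<N})" by (intro card_mono) auto
    then show False using lb[of ?z] t(2) e n by simp
  qed
qed

text \<open>The pair of components that the first row \<open>R\<close> passes on to the rest of the
  tableau.\<close>

definition bmp :: "nat list \<Rightarrow> nat set \<times> nat set \<Rightarrow> nat set \<times> nat set" where
  "bmp R p = (fst (topp (set R, fst p)), fst (topp (snd (topp (set R, fst p)), snd p)))"

lemma bmp_facts:
  assumes i: "incr R" and g: "gp p" and r: "red (R @ wp p)"
    and N: "set R \<union> fst p \<union> snd p \<subseteq> {..<N}"
  defines "R1 \<equiv> snd (topp (set R, fst p))"
  defines "R2 \<equiv> snd (topp (R1, snd p))"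
  shows "roww R (sl (fst p)) = (sl R1, sl (fst (bmp R p)))"
    "roww R (wp p) = (sl R2, wp (bmp R p))" "gp (bmp R p)"
    "card R1 = length R + pool (set R) (fst p) N" "card (fst p) = card (fst (bmp R p)) + pool (set R) (fst p) N"
    "card R2 + card (snd (bmp R p)) = card R1 + card (snd p)" "fst p \<subseteq> R1" "finite R1" "finite R2"
    "snd (bmp R p) = pairedL R1 (snd p)" "R1 \<subseteq> {..<N}" "card R1 \<le> card R2"
    "card (snd (bmp R p)) \<le> card (snd p)"
proof -
  let ?x = "fst p" and ?y = "snd p"
  have f: "finite ?x" "finite ?y" using g by (auto simp: gp_def)
  have rx: "red (R @ sl ?x)" using red_appendD1[of "R @ sl ?x" "sl ?y"] r by simp
  note t = roww_topp[OF i f(1) rx]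
  note T = topp[OF t(2)]
  have X2: "fst (bmp R p) = fst (topp (set R, ?x))" and Y2: "snd (bmp R p) = fst (topp (R1, ?y))"
    by (simp_all add: bmp_def R1_def)
  show 1: "roww R (sl ?x) = (sl R1, sl (fst (bmp R p)))" using t(1) by (simp add: R1_def X2)
  show f1: "finite R1" using T(1) by (simp add: gp_def R1_def)
  have "R @ sl ?x \<approx> sl (fst (bmp R p)) @ sl R1" using roww_equiv[OF i rx] 1 by simp
  then have "(R @ sl ?x) @ sl ?y \<approx> (sl (fst (bmp R p)) @ sl R1) @ sl ?y" by (rule ck_append[OF _ ck_refl])
  then have "red (sl (fst (bmp R p)) @ (sl R1 @ sl ?y))" using red_ck[OF r] by simp
  then have r1: "red (sl R1 @ sl ?y)" by (rule red_appendD2)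
  note t2 = roww_topp[OF incr_sl f(2) r1]
  have s1: "set (sl R1) = R1" using f1 by simp
  note T2 = topp[OF t2(2)[unfolded s1]]
  have 2: "roww (sl R1) (sl ?y) = (sl R2, sl (snd (bmp R p)))" using t2(1) unfolding s1 by (simp add: R2_def Y2)
  show rw: "roww R (wp p) = (sl R2, wp (bmp R p))" using 1 2 by (simp add: roww_append)
  have "red (wp (bmp R p) @ sl R2)" using red_ck[OF r roww_equiv[OF i r]] rw by simp
  then have "red (wp (bmp R p))" by (rule red_appendD1)
  then show "gp (bmp R p)" using T(1) T2(1) X2 Y2 by (simp add: gp_def)
  have X2p: "fst (bmp R p) = pairedL (set R) ?x" using T(4) X2 by simp
  show c: "card ?x = card (fst (bmp R p)) + pool (set R) ?x N"
    unfolding X2p by (rule pool_card) (use N in auto)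
  have lR: "card (set R) = length R" using i by (simp add: distinct_card strict_sorted_iff)
  show "card R1 = length R + pool (set R) ?x N" using T(6) c lR by (simp add: R1_def X2)
  show c6: "card R2 + card (snd (bmp R p)) = card R1 + card ?y" using T2(6) by (simp add: R2_def Y2)
  show "?x \<subseteq> R1" using T(5) by (simp add: R1_def)
  show "finite R2" using T2(1) by (simp add: gp_def R2_def)
  show y2: "snd (bmp R p) = pairedL R1 ?y" using T2(4) Y2 by simp
  have "set R \<union> ?x = fst (topp (set R, ?x)) \<union> R1"
    using gp_letters(1)[OF t(2)] gp_letters(1)[OF T(1)] ck_set[OF T(2)] by (simp add: R1_def)
  then show "R1 \<subseteq> {..<N}" using N by auto
  show "card (snd (bmp R p)) \<le> card ?y" unfolding y2 using card_pairedL_le f f1 by blast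
  then show "card R1 \<le> card R2" using c6 by simp
qed

lemma bmp_ck:
  assumes i: "incr R" and g: "gp p" "gp q" and r: "red (R @ wp p)" and w: "wp p \<approx> wp q"
    and N: "set R \<union> fst p \<union> snd p \<subseteq> {..<N}"
  shows "wp (bmp R p) \<approx> wp (bmp R q)" "red (R @ wp q)" "set R \<union> fst q \<union> snd q \<subseteq> {..<N}"
    "card (snd (topp (snd (topp (set R, fst p)), snd p))) = card (snd (topp (snd (topp (set R, fst q)), snd q)))"
proof -
  show rq: "red (R @ wp q)" by (rule red_ck[OF r ck_append[OF ck_refl w]])
  show Nq: "set R \<union> fst q \<union> snd q \<subseteq> {..<N}"
    using N gp_letters(1)[OF g(1)] gp_letters(1)[OF g(2)] ck_set[OF w] by auto
  note c = roww_ck[OF w i r]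
  note F = bmp_facts[OF i g(1) r N] and F' = bmp_facts[OF i g(2) rq Nq]
  show "wp (bmp R p) \<approx> wp (bmp R q)" using c F(2) F'(2) by simp
  have "sl (snd (topp (snd (topp (set R, fst p)), snd p))) = sl (snd (topp (snd (topp (set R, fst q)), snd q)))"
    using c F(2) F'(2) by simp
  then show "card (snd (topp (snd (topp (set R, fst p)), snd p))) = card (snd (topp (snd (topp (set R, fst q)), snd q)))"
    using sl_inj[OF F(9) F'(9)] by simp
qed

text \<open>Below \<open>a\<close>, fewer letters of the first component are bumped than it has. Of
  the second component at least as many are bumped as the first has: the intermediate row contains
  the whole first component and so uses up no fewer letters than that would.\<close>

lemma bmp_hw:
  assumes i: "incr R" and g: "gp p" and r: "red (R @ wp p)" and u: "up p = {}"
    and N: "set R \<union> fst p \<union> snd p \<subseteq> {..<N}"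
  shows "up (bmp R p) = {}"
proof (rule unp_emptyI)
  note F = bmp_facts[OF i g r N]
  let ?x = "fst p" and ?y = "snd p" and ?R1 = "snd (topp (set R, fst p))"
  have X2: "fst (bmp R p) = pairedL (set R) ?x"
    using topp(4)[OF roww_topp(2)[OF i]] g r red_appendD1[of "R @ sl ?x" "sl ?y"] by (simp add: bmp_def gp_def)
  fix a assume a: "a \<in> fst (bmp R p)"
  then have "0 < pool (set R) ?x a" by (simp add: X2 pairedL_def)
  then have "card (fst (bmp R p) \<inter> {..<a}) < card (?x \<inter> {..<a})"
    using pool_total[of ?x a "set R"] by (simp add: X2)
  moreover have "card (?x \<inter> {..<a}) \<le> card (snd (bmp R p) \<inter> {..<a})"
  proof -
    have "pairedL ?x ?y = ?x" using u by (simp add: pairedL_unp)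
    then have "card (?y \<inter> {..<a}) = card (?x \<inter> {..<a}) + pool ?x ?y a" using pool_total[of ?y a ?x] by simp
    moreover have "card (?y \<inter> {..<a}) = card (snd (bmp R p) \<inter> {..<a}) + pool ?R1 ?y a"
      using pool_total[of ?y a ?R1] F(10) by simp
    moreover have "pool ?R1 ?y a \<le> pool ?x ?y a" by (rule pool_antimono[OF F(7)])
    ultimately show ?thesis by simp
  qed
  ultimately show "card (fst (bmp R p) \<inter> {..<a}) < card (snd (bmp R p) \<inter> {..<a})" by simp
qed

text \<open>If the count still exceeds its value at the top when \<open>p\<close> is reached, it did
  so throughout, so every earlier raising has lowered it by one.\<close>

lemma pool_string:
  assumes g: "gp q" and k: "k \<le> card (up q)" and p: "p = (raise ^^ k) q" and N: "fst q \<subseteq> {..<N}"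
    and n: "pool R (fst (topp p)) N < pool R (fst p) N"
  shows "pool R (fst q) N = pool R (fst p) N + k"
  using k p n
proof (induct k arbitrary: p)
  case (Suc k)
  define s where "s = (raise ^^ k) q"
  note I = raise_iter[OF g Suc_leD[OF Suc(2)] s_def]
  have ps: "p = raise s" using Suc(3) by (simp add: s_def)
  have gs: "gp s" and ne: "up s \<noteq> {}" using I Suc(2) by auto
  have T: "topp s = topp p" using topp_ck[OF gs, of p] raise_step(1,2)[OF gs ne] ps by simp
  have "pool R (fst p) N \<le> pool R (fst s) N" using pool_mono[OF raise_step(5)[OF gs ne]] ps by simp
  then have n': "pool R (fst (topp s)) N < pool R (fst s) N" using Suc(4) T by simp
  have "pool R (fst q) N = pool R (fst s) N + k" by (rule Suc(1)[OF Suc_leD[OF Suc(2)] s_def n'])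
  moreover have "pool R (fst s) N = Suc (pool R (fst p) N)"
    using pool_raise_drop[OF gs ne n'] I N ps by auto
  ultimately show ?case by simp
qed simp

text \<open>\<open>n\<close> counts the letters of the first component that enlarge the row. If it
  has its final value already, raising leaves the row alone and commutes with \<open>bmp\<close>.
  Otherwise raising shortens the row by one and leaves the bumped pair unchanged, by uniqueness of
  pairs.\<close>

lemma bmp_step:
  assumes i: "incr R" and g: "gp p" and r: "red (R @ wp p)"
    and N: "set R \<union> fst p \<union> snd p \<subseteq> {..<N}"
  defines "n \<equiv> pool (set R) (fst p) N"
  shows "(card (up (bmp R p)) = card (up p) \<and> card (fst p) \<le> card (up p) + card (snd (bmp R p))
      \<and> (up p \<noteq> {} \<longrightarrow> pool (set R) (fst (raise p)) N = n \<and> up (bmp R p) \<noteq> {} \<and> bmp R (raise p) = raise (bmp R p)))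
    \<or> (card (up (bmp R p)) < card (up p) \<and> card (fst p) = card (up p) + card (snd (bmp R p))
      \<and> up p \<noteq> {} \<and> Suc (pool (set R) (fst (raise p)) N) = n \<and> bmp R (raise p) = bmp R p)"
proof -
  note F = bmp_facts[OF i g r N]
  let ?x = "fst p" and ?y = "snd p" and ?n0 = "pool (set R) (fst (topp p)) N"
  define p0 where "p0 = topp p"
  note T = topp[OF g, folded p0_def]
  note C = bmp_ck[OF i g T(1) r T(2) N]
  note F0 = bmp_facts[OF i T(1) C(2,3)]
  have u0: "up (bmp R p0) = {}" by (rule bmp_hw[OF i T(1) C(2) T(3) C(3)])
  have pl: "pairedL (fst (bmp R p)) (snd (bmp R p)) = fst (bmp R p0)"
    using pairedL_ck[OF F(3) F0(3) C(1)] u0 by (simp add: pairedL_unp)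
  have x0: "fst p0 = pairedL ?x ?y" by (rule T(4))
  have cx: "card ?x = card (fst p0) + card (up p)" using card_up[OF g] x0 by simp
  have cX: "card (fst (bmp R p)) = card (fst (bmp R p0)) + card (up (bmp R p))"
    using card_up[OF F(3)] pl by simp
  have e: "card (up (bmp R p)) + n = card (up p) + ?n0"
    using cx cX F(5) F0(5) by (simp add: n_def p0_def)
  have x0x: "fst p0 \<subseteq> ?x" using x0 by (auto simp: pairedL_def)
  have n0n: "?n0 \<le> n" unfolding n_def p0_def[symmetric] by (rule pool_mono[OF x0x])
  have alpha: "card (fst p0) \<le> card (snd (bmp R p))"
  proof -
    let ?R1 = "snd (topp (set R, fst p))"
    have "card ?y = card (pairedL ?x ?y) + pool ?x ?y N" by (rule pool_card) (use N in auto)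
    moreover have "card ?y = card (pairedL ?R1 ?y) + pool ?R1 ?y N" by (rule pool_card) (use N F(11) in auto)
    moreover have "pool ?R1 ?y N \<le> pool ?x ?y N" by (rule pool_antimono[OF F(7)])
    ultimately show ?thesis using x0 F(10) by simp
  qed
  have raise: "gp (raise p)" "wp p \<approx> wp (raise p)" "fst p0 \<subseteq> fst (raise p)" "fst (raise p) \<subseteq> ?x"
      "card ?x = Suc (card (fst (raise p)))" if ne: "up p \<noteq> {}"
  proof -
    note s = raise_step[OF g ne]
    show "gp (raise p)" "wp p \<approx> wp (raise p)" "fst (raise p) \<subseteq> ?x" "card ?x = Suc (card (fst (raise p)))"
      using s by auto
    show "fst p0 \<subseteq> fst (raise p)" using s(8) x0 by (auto simp: pairedL_def)
  qed
  show ?thesis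
  proof (cases "n = ?n0")
    case True
    then have c1: "card (up (bmp R p)) = card (up p)" using e by simp
    moreover have "card ?x \<le> card (up p) + card (snd (bmp R p))" using cx alpha by simp
    moreover have "pool (set R) (fst (raise p)) N = n \<and> up (bmp R p) \<noteq> {} \<and> bmp R (raise p) = raise (bmp R p)"
      if ne: "up p \<noteq> {}"
    proof (intro conjI)
      note ra = raise[OF ne]
      have "n \<le> pool (set R) (fst (raise p)) N" using True pool_mono[OF ra(3)] by (simp add: p0_def)
      then show nn: "pool (set R) (fst (raise p)) N = n" using pool_mono[OF ra(4), of "set R" N] by (simp add: n_def)
      have "card (up p) \<noteq> 0" using ne finite_up[OF g] by simp
      then show ub: "up (bmp R p) \<noteq> {}" using c1 by auto
      note C' = bmp_ck[OF i g ra(1) r ra(2) N]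
      note F' = bmp_facts[OF i ra(1) C'(2,3)]
      note s = raise_step[OF F(3) ub]
      have "wp (raise (bmp R p)) \<approx> wp (bmp R (raise p))" by (rule ck_trans[OF ck_sym[OF s(2)] C'(1)])
      then have "raise (bmp R p) = bmp R (raise p)"
        by (rule pair_unique[OF s(1) F'(3)]) (use s(3) F(5) F'(5) nn ra(5) in \<open>simp add: n_def\<close>)
      then show "bmp R (raise p) = raise (bmp R p)" by simp
    qed
    ultimately show ?thesis by blast
  next
    case False
    then have lt: "?n0 < n" using n0n by simp
    then have c1: "card (up (bmp R p)) < card (up p)" using e by simp
    then have ne: "up p \<noteq> {}" by auto
    note ra = raise[OF ne]
    have nn: "Suc (pool (set R) (fst (raise p)) N) = n"
      using pool_raise_drop[OF g ne, of "set R" N] lt N by (simp add: n_def)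
    note C' = bmp_ck[OF i g ra(1) r ra(2) N]
    note F' = bmp_facts[OF i ra(1) C'(2,3)]
    have same: "bmp R (raise p) = bmp R p"
      by (rule pair_unique[OF F'(3) F(3) ck_sym[OF C'(1)]]) (use F(5) F'(5) nn ra(5) in \<open>simp add: n_def\<close>)
    \<comment> \<open>Go back to the reflection \<open>q\<close> of the top. From \<open>q\<close>
      to \<open>p\<close> each raising shortens the intermediate row by one and lengthens the second
      component by one, while the final row keeps its length; so the number of letters bumped from
      the second component is constant. At \<open>q\<close> it is at most
      \<open>card (fst p0)\<close>.\<close>
    have "card (snd (bmp R p)) = card (fst p0)"
    proof -
      obtain q where q: "gp q" "wp p0 \<approx> wp q" "card (fst q) = card (snd p0)" "card (snd q) = card (fst p0)"
        by (rule reflect[OF T(1)])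
      have wpq: "wp p \<approx> wp q" by (rule ck_trans[OF T(2) q(2)])
      have "card (fst p0) \<le> card ?y" unfolding x0 using card_pairedL_le g by (simp add: gp_def)
      then have le: "card ?x \<le> card (fst q)" using q(3) T(6) cx by simp
      note k = raise_to[OF q(1) g ck_sym[OF wpq] le]
      note Cq = bmp_ck[OF i g q(1) r wpq N]
      note Fq = bmp_facts[OF i q(1) Cq(2,3)]
      have "pool (set R) (fst q) N = pool (set R) ?x N + (card (fst q) - card ?x)"
        by (rule pool_string[OF q(1) k]) (use Cq(3) lt in \<open>auto simp: n_def\<close>)
      moreover have "card ?x + card ?y = card (fst q) + card (snd q)" using T(6) q(3,4) by simp
      ultimately have "card (snd (bmp R p)) = card (snd (bmp R q))"
        using F(4,6) Fq(4,6) Cq(4) le by simp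
      then have "card (snd (bmp R p)) \<le> card (fst p0)" using Fq(13) q(4) by simp
      then show ?thesis using alpha by simp
    qed
    then have "card ?x = card (up p) + card (snd (bmp R p))" using cx by simp
    then show ?thesis using c1 ne nn same by blast
  qed
qed

section \<open>Horizontal strips and column sums\<close>

lemma inc_strip_aux:
  "incr e \<Longrightarrow> e \<noteq> [] \<Longrightarrow> red (s @ e) \<Longrightarrow>
    \<exists>c. clen (s @ e) = (clen (s @ butlast e))(c := Suc (clen (s @ butlast e) c))
      \<and> (\<forall>t>c. clen (s @ e) t = clen s t) \<and> (\<forall>t. clen (s @ e) t \<le> Suc (clen s t))"
proof (induct e rule: rev_induct)
  case (snoc z e)
  show ?case
  proof (cases "e = []")
    case True
    obtain c where "clen (s @ [z]) = (clen s)(c := Suc (clen s c))"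
      by (rule clen_one) (use snoc.prems True in auto)
    then show ?thesis using True by (intro exI[of _ c]) auto
  next
    case False
    have re: "red (s @ e)" using red_appendD1[of "s @ e" "[z]"] snoc.prems by simp
    obtain c where c: "clen (s @ e) = (clen (s @ butlast e))(c := Suc (clen (s @ butlast e) c))"
      "\<forall>t>c. clen (s @ e) t = clen s t" "\<forall>t. clen (s @ e) t \<le> Suc (clen s t)"
      using snoc.hyps[OF _ False re] snoc.prems(1) unfolding sorted_wrt_append by blast
    define y where "y = last e"
    have e: "e = butlast e @ [y]" using False by (simp add: y_def)
    have zy: "y < z" using snoc.prems False by (simp add: sorted_wrt_append y_def)
    have "red ((s @ butlast e) @ [y, z])" using snoc.prems e by (metis append.assoc append_Cons append_Nil)
    then obtain c1 d where d: "clen ((s @ butlast e) @ [y]) = (clen (s @ butlast e))(c1 := Suc (clen (s @ butlast e) c1))"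
      "clen ((s @ butlast e) @ [y, z]) = (clen ((s @ butlast e) @ [y]))(d := Suc (clen ((s @ butlast e) @ [y]) d))"
      "y < z \<Longrightarrow> c1 < d" by (rule clen_two) blast
    have e1: "(s @ butlast e) @ [y] = s @ e" "(s @ butlast e) @ [y, z] = s @ e @ [z]"
      using e by (metis append.assoc, metis append.assoc append_Cons append_Nil)
    note d' = d[unfolded e1]
    have "c1 = c" using d'(1) c(1) by (metis fun_upd_apply n_not_Suc_n)
    then have dc: "c < d" using d'(3) zy by simp
    then show ?thesis using d'(2) c(2,3) by (intro exI[of _ d]) auto
  qed
qed simp

lemma inc_strip: "incr e \<Longrightarrow> red (s @ e) \<Longrightarrow> clen (s @ e) t \<le> Suc (clen s t)"
  using inc_strip_aux[of e s] by (cases "e = []") auto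

text \<open>Interlacing: a column with two boxes after adding a horizontal strip had a box
  before.\<close>

lemma rlen_1_le:
  assumes "incr e" "red (s @ e)"
  shows "rlen (s @ e) (Suc 0) \<le> rlen s 0"
proof (cases "rlen (s @ e) (Suc 0)")
  case (Suc k)
  have rs: "red s" using assms(2) red_appendD1 by blast
  have "{0, Suc 0} \<subseteq> {i. k < rlen (s @ e) i}" using Suc rlen_antimono[OF assms(2), of 0 "Suc 0"] by auto
  then have "card {0, Suc 0} \<le> clen (s @ e) k"
    unfolding clen_card[OF assms(2)] by (rule card_mono[OF finite_rlen])
  then have "clen s k \<noteq> 0" using inc_strip[OF assms, of k] by simp
  then obtain i where "k < rlen s i" unfolding clen_card[OF rs] by (metis Collect_empty_eq card.empty)
  then show ?thesis using rlen_antimono[OF rs, of 0 i] Suc by simp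
qed simp

lemma clen_split:
  assumes "red u" "red (snd (roww [] u))"
  shows "clen u j = of_bool (j < rlen u 0) + clen (snd (roww [] u)) j"
proof -
  let ?v = "snd (roww [] u)"
  have "{i. j < rlen u i} = (if j < rlen u 0 then {0} else {}) \<union> Suc ` {i. j < rlen ?v i}" (is "_ = ?R")
  proof (rule set_eqI)
    fix i show "i \<in> {i. j < rlen u i} \<longleftrightarrow> i \<in> ?R" by (cases i) (auto simp: rlen_Suc)
  qed
  moreover have "card ?R = of_bool (j < rlen u 0) + card {i. j < rlen ?v i}"
    using finite_rlen[of j ?v] by (subst card_Un_disjoint) (auto simp: card_image)
  ultimately show ?thesis using assms by (simp add: clen_card)
qed

definition csum :: "nat list \<Rightarrow> nat \<Rightarrow> int" where
  "csum u c = (\<Sum>j<c. int (clen u j))"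

lemma csum_Suc: "csum u (Suc c) = csum u c + int (clen u c)"
  by (simp add: csum_def)

lemma csum_split:
  assumes "red u" "red (snd (roww [] u))"
  shows "csum u c = int (min (length (fst (roww [] u))) c) + csum (snd (roww [] u)) c"
proof (induct c)
  case (Suc c)
  then show ?case using clen_split[OF assms, of c] by (simp add: csum_Suc rlen_0 min_def)
qed (simp add: csum_def)

lemma clen_far: "red u \<Longrightarrow> rlen u 0 \<le> c \<Longrightarrow> clen u c = 0"
proof -
  assume a: "red u" "rlen u 0 \<le> c"
  have "\<not> c < rlen u i" for i using rlen_antimono[OF a(1), of 0 i] a(2) by simp
  then show ?thesis by (simp add: clen_card[OF a(1)])
qed

lemma clen_near: "red u \<Longrightarrow> c < rlen u 0 \<Longrightarrow> 0 < clen u c"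
proof -
  assume a: "red u" "c < rlen u 0"
  then have "{i. c < rlen u i} \<noteq> {}" by blast
  then show ?thesis using finite_rlen[of c u] by (simp add: clen_card[OF a(1)] card_gt_0_iff)
qed

lemma csum_const: "red u \<Longrightarrow> rlen u 0 \<le> c \<Longrightarrow> csum u c = csum u (rlen u 0)"
proof (induct c)
  case (Suc c)
  show ?case
  proof (cases "rlen u 0 \<le> c")
    case True
    then show ?thesis using Suc clen_far by (simp add: csum_Suc)
  next
    case False
    then have "rlen u 0 = Suc c" using Suc(3) by simp
    then show ?thesis by simp
  qed
qed simp

lemma csum_total: "red u \<Longrightarrow> rlen u 0 \<le> c \<Longrightarrow> csum u c = int (length u)"
proof (induct u arbitrary: c rule: rev_induct)
  case Nil
  then show ?case by (simp add: csum_def clen_def)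
next
  case (snoc x u)
  let ?v = "u @ [x]" and ?N = "c + rlen u 0"
  have ru: "red u" using snoc(2) red_appendD1 by blast
  obtain d where d: "clen ?v = (clen u)(d := Suc (clen u d))" by (rule clen_one[OF snoc(2)])
  have dn: "d < ?N"
  proof (rule ccontr)
    assume "\<not> d < ?N"
    then have "clen ?v d = 0" using clen_far[OF snoc(2)] snoc(3) by simp
    then show False using d by simp
  qed
  have "csum ?v n = csum u n + of_bool (d < n)" for n
  proof (induct n)
    case (Suc n)
    then show ?case using d by (auto simp: csum_Suc)
  qed (simp add: csum_def)
  then have "csum ?v ?N = csum u ?N + 1" using dn by simp
  also have "csum u ?N = int (length u)" by (rule snoc(1)[OF ru]) simp
  finally have "csum ?v ?N = int (length ?v)" by simp
  moreover have "csum ?v c = csum ?v ?N"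
    using csum_const[OF snoc(2), of c] csum_const[OF snoc(2), of ?N] snoc(3) by simp
  ultimately show ?case by simp
qed

text \<open>The difference between the numbers of boxes added by the two components
  within the first \<open>c\<close> columns.\<close>

definition excess :: "nat list \<Rightarrow> nat set \<times> nat set \<Rightarrow> nat \<Rightarrow> int" where
  "excess \<tau> p c = 2 * csum (\<tau> @ sl (fst p)) c - csum \<tau> c - csum (\<tau> @ wp p) c"

text \<open>From column \<open>A\<close> on, the first two diagrams have no boxes and the third has
  at most one per column, so the partial sums are the totals up to the \<open>C - c\<close> boxes
  still missing.\<close>

lemma excess_tail:
  assumes g: "gp q" and r: "red (s @ wp q)" and A: "rlen s 0 \<le> A" "rlen (s @ sl (fst q)) 0 \<le> A" "A \<le> c"
  shows "excess s q c = int (card (fst q)) - int (card (snd q)) + int (rlen (s @ wp q) 0 - c)"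
proof -
  let ?C = "rlen (s @ wp q) 0"
  have rx: "red (s @ sl (fst q))" using red_appendD1[of "s @ sl (fst q)" "sl (snd q)"] r by simp
  have rs: "red s" using rx red_appendD1 by blast
  have fin: "finite (fst q)" "finite (snd q)" using g by (auto simp: gp_def)
  have l: "length (sl (fst q)) = card (fst q)" "length (sl (snd q)) = card (snd q)"
    by auto
  have st: "clen (s @ wp q) t = of_bool (t < ?C)" if "A \<le> t" for t
  proof (cases "t < ?C")
    case True
    have "clen (s @ wp q) t \<le> Suc (clen (s @ sl (fst q)) t)"
      using inc_strip[of "sl (snd q)" "s @ sl (fst q)" t] r by simp
    also have "clen (s @ sl (fst q)) t = 0" using clen_far[OF rx] A(2) that by simp
    finally show ?thesis using clen_near[OF r True] True by simp
  qed (use clen_far[OF r] in auto)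
  have "csum (s @ wp q) c = int (length (s @ wp q)) - int (?C - c)"
  proof (cases "c \<le> ?C")
    case True
    have "csum (s @ wp q) (c + k) = csum (s @ wp q) c + int k" if "c + k \<le> ?C" for k
      using that
    proof (induct k)
      case (Suc k)
      then show ?case using st[of "c + k"] A(3) by (simp add: csum_Suc)
    qed simp
    from this[of "?C - c"] show ?thesis using csum_total[OF r, of ?C] True by simp
  next
    case False
    then show ?thesis using csum_total[OF r, of c] by simp
  qed
  moreover have "csum (s @ sl (fst q)) c = int (length (s @ sl (fst q)))" "csum s c = int (length s)"
    using csum_total[OF rx, of c] csum_total[OF rs, of c] A by auto
  ultimately show ?thesis unfolding excess_def using l by simp
qed

lemma row_split:
  assumes g: "gp p" and r: "red (\<tau> @ wp p)" and N: "set \<tau> \<union> fst p \<union> snd p \<subseteq> {..<N}"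
  defines "R \<equiv> fst (roww [] \<tau>)" and "s \<equiv> snd (roww [] \<tau>)"
  defines "R1 \<equiv> snd (topp (set R, fst p))"
  defines "R2 \<equiv> snd (topp (R1, snd p))"
  shows "incr R" "red (R @ wp p)" "set R \<union> fst p \<union> snd p \<subseteq> {..<N}" "red (s @ wp (bmp R p))"
    "csum \<tau> c = int (min (length R) c) + csum s c"
    "csum (\<tau> @ sl (fst p)) c = int (min (card R1) c) + csum (s @ sl (fst (bmp R p))) c"
    "csum (\<tau> @ wp p) c = int (min (card R2) c) + csum (s @ wp (bmp R p)) c"
    "rlen s 0 \<le> length R" "rlen (s @ sl (fst (bmp R p))) 0 \<le> length R"
    "rlen (s @ wp (bmp R p)) 0 \<le> card R1"
    "length (s @ wp (bmp R p)) + card R2 = length (\<tau> @ wp p)"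
proof -
  have rt: "red \<tau>" using r red_appendD1 by blast
  have rx: "red (\<tau> @ sl (fst p))" using red_appendD1[of "\<tau> @ sl (fst p)" "sl (snd p)"] r by simp
  show i: "incr R" unfolding R_def by (rule roww_incr) simp
  have eq: "\<tau> \<approx> s @ R" using roww_equiv[of "[]" \<tau>] rt by (simp add: R_def s_def)
  have "\<tau> @ wp p \<approx> (s @ R) @ wp p" by (rule ck_append[OF eq ck_refl])
  then have eq': "\<tau> @ wp p \<approx> s @ (R @ wp p)" by simp
  have rr: "red (s @ (R @ wp p))" by (rule red_ck[OF r eq'])
  then show rR: "red (R @ wp p)" by (rule red_appendD2)
  have "set \<tau> = set s \<union> set R" using ck_set[OF eq] by simp
  then show NR: "set R \<union> fst p \<union> snd p \<subseteq> {..<N}" using N by auto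
  note F = bmp_facts[OF i g rR NR, folded R1_def, folded R2_def]
  have "R @ wp p \<approx> wp (bmp R p) @ sl R2" using roww_equiv[OF i rR] F(2) by simp
  then have e2: "s @ (R @ wp p) \<approx> s @ (wp (bmp R p) @ sl R2)" by (rule ck_append[OF ck_refl])
  have "red ((s @ wp (bmp R p)) @ sl R2)" using red_ck[OF rr e2] by simp
  then show rs: "red (s @ wp (bmp R p))" by (rule red_appendD1)
  then have "red ((s @ sl (fst (bmp R p))) @ sl (snd (bmp R p)))" by simp
  then have rsx: "red (s @ sl (fst (bmp R p)))" by (rule red_appendD1)
  have rss: "red s" using rsx red_appendD1 by blast
  have w1: "roww [] (\<tau> @ sl (fst p)) = (sl R1, s @ sl (fst (bmp R p)))"
    using F(1) by (simp add: roww_append R_def s_def)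
  have w2: "roww [] (\<tau> @ wp p) = (sl R2, s @ wp (bmp R p))"
    using F(2) by (subst roww_append) (simp add: R_def s_def)
  show "csum \<tau> c = int (min (length R) c) + csum s c"
    using csum_split[OF rt, of c] rss by (simp add: R_def s_def)
  show "csum (\<tau> @ sl (fst p)) c = int (min (card R1) c) + csum (s @ sl (fst (bmp R p))) c"
    using csum_split[OF rx, of c] rsx unfolding w1 by simp
  show "csum (\<tau> @ wp p) c = int (min (card R2) c) + csum (s @ wp (bmp R p)) c"
    using csum_split[OF r, of c] rs unfolding w2 by simp
  show "rlen s 0 \<le> length R"
    using rlen_antimono[OF rt, of 0 "Suc 0"] by (simp add: rlen_0 rlen_Suc R_def s_def)
  show "rlen (s @ sl (fst (bmp R p))) 0 \<le> length R"
    using rlen_1_le[OF incr_sl rx] rlen_Suc[of "\<tau> @ sl (fst p)" 0] rlen_0[of \<tau>]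
    unfolding w1 by (simp add: R_def)
  have "red ((\<tau> @ sl (fst p)) @ sl (snd p))" using r by simp
  from rlen_1_le[OF incr_sl this] show "rlen (s @ wp (bmp R p)) 0 \<le> card R1"
    using rlen_Suc[of "\<tau> @ wp p" 0] rlen_0[of "\<tau> @ sl (fst p)"] unfolding w1 w2 by simp
  show "length (s @ wp (bmp R p)) + card R2 = length (\<tau> @ wp p)"
    using ck_length[OF ck_trans[OF eq' e2]] by simp
qed

text \<open>The first row either absorbs the raising, and then it gets shorter by one box, or passes it on
  to the rest of the tableau.\<close>

lemma excess_raise:
  assumes "gp p" "red (\<tau> @ wp p)"
  shows "(\<forall>c. excess \<tau> p c \<le> int (card (up p))) \<and> (up p \<noteq> {} \<longrightarrow>
    (\<exists>d\<ge>1. (\<forall>c. csum (\<tau> @ sl (fst p)) c = csum (\<tau> @ sl (fst (raise p))) c + of_bool (d \<le> c))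
      \<and> excess \<tau> p d = int (card (up p)) \<and> (\<forall>c<d. excess \<tau> p c < int (card (up p)))))"
  using assms
proof (induct "length (\<tau> @ wp p)" arbitrary: \<tau> p rule: less_induct)
  case less
  note g = less(2) and r = less(3)
  show ?case
  proof (cases "\<tau> @ wp p = []")
    case True
    then have "\<tau> = []" "sl (fst p) = []" "sl (snd p) = []" by simp_all
    moreover from this have "fst p = {}" using g by (simp add: gp_def)
    ultimately show ?thesis by (simp add: excess_def csum_def clen_def unp_def)
  next
    case False
    define R where "R = fst (roww [] \<tau>)"
    define s where "s = snd (roww [] \<tau>)"
    define R1 where "R1 = snd (topp (set R, fst p))"
    define R2 where "R2 = snd (topp (R1, snd p))"
    have "finite (set \<tau> \<union> fst p \<union> snd p)" using g by (simp add: gp_def)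
    then obtain N where N: "set \<tau> \<union> fst p \<union> snd p \<subseteq> {..<N}"
      using finite_nat_set_iff_bounded by (metis lessThan_iff subsetI)
    note S = row_split[OF g r N, folded R_def s_def, folded R1_def, folded R2_def]
    note F = bmp_facts[OF S(1) g S(2,3), folded R1_def, folded R2_def]
    define q where "q = bmp R p"
    define A where "A = length R"
    define B where "B = card R1"
    define C where "C = card R2"
    define C2 where "C2 = rlen (s @ wp q) 0"
    define n where "n = pool (set R) (fst p) N"
    define M where "M = card (up p)"
    have BA: "B = A + n" and CB: "B \<le> C" using F(4,12) by (auto simp: A_def B_def C_def n_def)
    have cx: "card (fst p) = card (fst q) + n" using F(5) by (simp add: q_def n_def)
    have C2B: "C2 \<le> B" using S(10) by (simp add: C2_def q_def B_def)
    have rq: "red (s @ wp q)" using S(4) by (simp add: q_def)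
    have gq: "gp q" using F(3) by (simp add: q_def)
    have "R2 \<noteq> {}"
    proof
      assume "R2 = {}"
      then have "card R1 = 0" "length R = 0" using F(12,4) by auto
      then have "R1 = {}" "R = []" using F(8) by auto
      then have "\<tau> = []" using roww_nonempty[of "[]" \<tau>] by (auto simp: R_def)
      have "fst p = {}" using F(7) \<open>R1 = {}\<close> by simp
      have "card (snd (bmp R p)) = 0" using F(10) \<open>R1 = {}\<close> by (simp add: pairedL_def)
      then have "card (snd p) = 0" using F(6) \<open>R1 = {}\<close> \<open>R2 = {}\<close> by simp
      then show False using False \<open>\<tau> = []\<close> \<open>fst p = {}\<close> g by (simp add: gp_def)
    qed
    then have "0 < card R2" using F(9) by (simp add: card_gt_0_iff)
    then have "length (s @ wp q) < length (\<tau> @ wp p)" using S(11) by (simp add: q_def)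
    note IH = less(1)[OF this gq rq]
    \<comment> \<open>\<open>A\<close>, \<open>B\<close>, \<open>C\<close> are the successive
      lengths of the first row, whose share is given by the minima; the rest is the same quantity
      for the smaller tableau and the bumped pair.\<close>
    have ex: "excess \<tau> p c = 2 * int (min B c) - int (min A c) - int (min C c) + excess s q c" for c
      using S(5-7)[of c] by (simp add: excess_def A_def B_def C_def q_def)
    have tail: "excess s q c = int (card (fst q)) - int (card (snd q)) + int (C2 - c)" if "A \<le> c" for c
      using excess_tail[OF gq rq _ _ that] S(8,9) by (simp add: A_def q_def C2_def)
    have low: "excess \<tau> p c = excess s q c" if "c \<le> A" for c
      using ex[of c] that BA CB by simp
    have mid: "excess \<tau> p c = int (max c C2) - int A + int (card (fst q)) - int (card (snd q))" if "A \<le> c" "c \<le> B" for c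
      using ex[of c] that BA CB tail[of c] by (simp add: max_def)
    have atB: "excess \<tau> p B = int (card (fst p)) - int (card (snd q))"
      using mid[of B] BA C2B cx by simp
    \<comment> \<open>Right of column \<open>A\<close> the excess is largest at \<open>B\<close>: up
      to there the first row gains labels of the first component, afterwards only labels of the
      second.\<close>
    have high: "excess \<tau> p c \<le> excess \<tau> p B" if "A \<le> c" for c
    proof (cases "c \<le> B")
      case True
      then show ?thesis using mid[of c] mid[of B] that BA C2B by simp
    next
      case False
      then show ?thesis using ex[of c] ex[of B] tail[of c] tail[of B] that BA CB C2B by simp
    qed
    have dich: "(card (up q) = M \<and> card (fst p) \<le> M + card (snd q)
      \<and> (up p \<noteq> {} \<longrightarrow> pool (set R) (fst (raise p)) N = n \<and> up q \<noteq> {} \<and> bmp R (raise p) = raise q))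
    \<or> (card (up q) < M \<and> card (fst p) = M + card (snd q)
      \<and> up p \<noteq> {} \<and> Suc (pool (set R) (fst (raise p)) N) = n \<and> bmp R (raise p) = q)"
      using bmp_step[OF S(1) g S(2,3)] unfolding M_def q_def n_def .
    have le: "excess \<tau> p c \<le> int M" for c
    proof (cases "c \<le> A")
      case True
      then have "excess \<tau> p c \<le> int (card (up q))" using low[of c] IH by simp
      then show ?thesis using dich by linarith
    next
      case False
      then have "excess \<tau> p c \<le> int (card (fst p)) - int (card (snd q))" using high[of c] atB by simp
      then show ?thesis using dich by linarith
    qed
    have "\<exists>d\<ge>1. (\<forall>c. csum (\<tau> @ sl (fst p)) c = csum (\<tau> @ sl (fst (raise p))) c + of_bool (d \<le> c))
      \<and> excess \<tau> p d = int M \<and> (\<forall>c<d. excess \<tau> p c < int M)" if ne: "up p \<noteq> {}"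
    proof -
      note ra = raise_step[OF g ne]
      have g': "gp (raise p)" by (rule ra(1))
      have r': "red (\<tau> @ wp (raise p))" by (rule red_ck[OF r ck_append[OF ck_refl ra(2)]])
      have N': "set \<tau> \<union> fst (raise p) \<union> snd (raise p) \<subseteq> {..<N}"
        using N ck_set[OF ra(2)] gp_letters(1)[OF g] gp_letters(1)[OF g'] by auto
      define B' where "B' = card (snd (topp (set R, fst (raise p))))"
      note S' = row_split[OF g' r' N', folded R_def s_def, folded B'_def]
      note F' = bmp_facts[OF S'(1) g' S'(2,3), folded B'_def]
      have B': "B' = A + pool (set R) (fst (raise p)) N" using F'(4) by (simp add: A_def)
      have cs: "csum (\<tau> @ sl (fst p)) c = int (min B c) + csum (s @ sl (fst q)) c"
        "csum (\<tau> @ sl (fst (raise p))) c = int (min B' c) + csum (s @ sl (fst (bmp R (raise p)))) c" for c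
        using S(6)[of c] S'(6)[of c] by (simp_all add: B_def q_def)
      from dich show ?thesis
      proof (elim disjE conjE)
        assume a: "card (up q) = M" "up p \<noteq> {} \<longrightarrow> pool (set R) (fst (raise p)) N = n \<and> up q \<noteq> {} \<and> bmp R (raise p) = raise q"
        then have b: "B' = B" "up q \<noteq> {}" "bmp R (raise p) = raise q" using ne B' BA by auto
        obtain d where d: "1 \<le> d" "\<And>c. csum (s @ sl (fst q)) c = csum (s @ sl (fst (raise q))) c + of_bool (d \<le> c)"
          "excess s q d = int M" "\<And>c. c < d \<Longrightarrow> excess s q c < int M"
          using IH b(2) a(1) by auto
        \<comment> \<open>The smaller tableau with the bumped first component has no boxes beyond
          column \<open>A\<close>, so its column sums cannot change there.\<close>
        have dA: "d \<le> A"
        proof (rule ccontr)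
          assume "\<not> d \<le> A"
          then obtain k where k: "d = Suc k" "A \<le> k" using d(1) by (cases d) auto
          have "red ((s @ sl (fst q)) @ sl (snd q))" using rq by simp
          then have "clen (s @ sl (fst q)) k = 0"
            using clen_far[OF red_appendD1, of "s @ sl (fst q)" "sl (snd q)" k] S(9) k(2) by (simp add: A_def q_def)
          then have "csum (s @ sl (fst q)) d = csum (s @ sl (fst q)) k" by (simp add: k csum_Suc)
          moreover have "csum (s @ sl (fst (raise q))) k \<le> csum (s @ sl (fst (raise q))) d" by (simp add: k csum_Suc)
          ultimately show False using d(2)[of d] d(2)[of k] k(1) by simp
        qed
        show ?thesis
        proof (intro exI[of _ d] conjI allI impI)
          show "1 \<le> d" by (rule d(1))
          show "csum (\<tau> @ sl (fst p)) c = csum (\<tau> @ sl (fst (raise p))) c + of_bool (d \<le> c)" for c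
            unfolding cs b(1,3) using d(2)[of c] by simp
          show "excess \<tau> p d = int M" using low[OF dA] d(3) by simp
          show "excess \<tau> p c < int M" if "c < d" for c using low[of c] d(4)[OF that] dA that by simp
        qed
      next
        assume a: "card (up q) < M" "card (fst p) = M + card (snd q)"
          "Suc (pool (set R) (fst (raise p)) N) = n" "bmp R (raise p) = q"
        \<comment> \<open>Here the first row itself loses its box in column \<open>B\<close> and the
          bumped pair stays the same, so \<open>d = B\<close>.\<close>
        have b: "B = Suc B'" using B' BA a(3) by simp
        have C2: "C2 \<le> B'" using S'(10) by (simp add: a(4) C2_def)
        show ?thesis
        proof (intro exI[of _ B] conjI allI impI)
          show "1 \<le> B" using b by simp
          show "csum (\<tau> @ sl (fst p)) c = csum (\<tau> @ sl (fst (raise p))) c + of_bool (B \<le> c)" for c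
            unfolding cs a(4) using b by (auto simp: min_def)
          show eB: "excess \<tau> p B = int M" using atB a(2) by simp
          show "excess \<tau> p c < int M" if c: "c < B" for c
          proof (cases "c \<le> A")
            case True
            then have "excess \<tau> p c \<le> int (card (up q))" using low[of c] IH by simp
            then show ?thesis using a(1) by linarith
          next
            case False
            then have "excess \<tau> p c < excess \<tau> p B" using mid[of c] mid[of B] c C2 b BA by simp
            then show ?thesis using eB by simp
          qed
        qed
      qed
    qed
    then show ?thesis using le unfolding M_def by blast
  qed
qed

section \<open>The raising operator on key tableaux\<close>

text \<open>\<open>later x y\<close> means that \<open>y\<close> is read after \<open>x\<close>:
  columns from right to left, each one downwards.\<close>

definition later :: "int \<times> nat \<Rightarrow> int \<times> nat \<Rightarrow> bool" where
  "later x y \<longleftrightarrow> snd y < snd x \<or> snd y = snd x \<and> fst y < fst x"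

lemma later_irrefl: "\<not> later x x"
  by (simp add: later_def)

lemma later_asym: "later x y \<Longrightarrow> \<not> later y x"
  by (auto simp: later_def)

lemma later_distinct: "sorted_wrt later L \<Longrightarrow> distinct L"
  by (induct L) (auto simp: later_irrefl)

lemma sorted_wrt_concat_map:
  assumes "sorted_wrt (\<lambda>a b. \<forall>x\<in>set (f a). \<forall>y\<in>set (f b). Q x y) cs" "\<And>a. a \<in> set cs \<Longrightarrow> sorted_wrt Q (f a)"
  shows "sorted_wrt Q (concat (map f cs))"
  using assms by (induct cs) (auto simp: sorted_wrt_append)

lemma col_boxes_facts:
  assumes f: "finite (dom T)"
  shows "set (col_boxes T) = dom T" "sorted_wrt later (col_boxes T)" "distinct (col_boxes T)"
proof -
  have ff: "finite {r. (r, c) \<in> dom T}" for c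
    by (rule finite_subset[OF _ finite_imageI[OF f, of fst]]) force
  have fs: "finite (snd ` dom T)" using f by simp
  show "set (col_boxes T) = dom T" using fs ff by (force simp: col_boxes_def)
  show s: "sorted_wrt later (col_boxes T)"
    unfolding col_boxes_def
  proof (rule sorted_wrt_concat_map)
    have "sorted_wrt (>) (rev (sorted_list_of_set (snd ` dom T)))" by (simp add: sorted_wrt_rev)
    then show "sorted_wrt (\<lambda>a b. \<forall>x\<in>set (map (\<lambda>r. (r, a)) (rev (sorted_list_of_set {r. (r, a) \<in> dom T}))).
       \<forall>y\<in>set (map (\<lambda>r. (r, b)) (rev (sorted_list_of_set {r. (r, b) \<in> dom T}))). later x y)
       (rev (sorted_list_of_set (snd ` dom T)))"
      by (rule sorted_wrt_mono_rel[rotated]) (auto simp: later_def)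
    show "sorted_wrt later (map (\<lambda>r. (r, c)) (rev (sorted_list_of_set {r. (r, c) \<in> dom T})))" for c
      by (simp add: sorted_wrt_map later_def sorted_wrt_rev)
  qed
  show "distinct (col_boxes T)"
    using s by (rule later_distinct)
qed

lemma set_drop_sorted:
  assumes "sorted_wrt later L" "j < length L"
  shows "set (drop j L) = {x \<in> set L. x = L ! j \<or> later (L ! j) x}"
proof -
  have d: "drop j L = L ! j # drop (Suc j) L" using assms(2) by (simp add: Cons_nth_drop_Suc)
  have "sorted_wrt later (take j L @ L ! j # drop (Suc j) L)" using assms id_take_nth_drop[of j L] by simp
  then have a: "\<forall>x\<in>set (take j L). later x (L ! j)" "\<forall>x\<in>set (drop (Suc j) L). later (L ! j) x"
    by (auto simp: sorted_wrt_append)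
  have "set L = set (take j L) \<union> set (drop j L)" by (metis append_take_drop_id set_append)
  moreover have "x \<notin> set (take j L)" if "x = L ! j \<or> later (L ! j) x" for x
    using a(1) that later_asym[of x "L ! j"] later_irrefl by blast
  ultimately show ?thesis using a(2) d by auto
qed

lemma count_list_map_distinct: "distinct L \<Longrightarrow> count_list (map f L) v = card {x \<in> set L. f x = v}"
proof (induct L)
  case (Cons a L)
  have "{x \<in> set (a # L). f x = v} = (if f a = v then insert a {x \<in> set L. f x = v} else {x \<in> set L. f x = v})"
    by auto
  then show ?case using Cons by simp
qed simp

lemma m_suffix_col_word:
  assumes f: "finite (dom T)" and j: "j < length (col_boxes T)"
  defines "x \<equiv> col_boxes T ! j"
  shows "m_suffix i (col_word T) j = int (card {y. (y = x \<or> later x y) \<and> T y = Some (Suc i)})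
    - int (card {y. (y = x \<or> later x y) \<and> T y = Some i})"
proof -
  note L = col_boxes_facts[OF f]
  have "count_list (drop j (col_word T)) v = card {y. (y = x \<or> later x y) \<and> T y = Some v}" for v
  proof -
    have "count_list (drop j (col_word T)) v = card {y \<in> set (drop j (col_boxes T)). the (T y) = v}"
      unfolding col_word_def drop_map by (rule count_list_map_distinct) (use L in simp)
    also have "{y \<in> set (drop j (col_boxes T)). the (T y) = v} = {y. (y = x \<or> later x y) \<and> T y = Some v}"
      unfolding set_drop_sorted[OF L(2) j] L(1) x_def by auto
    finally show ?thesis .
  qed
  then show ?thesis by (simp add: m_suffix_def)
qed

text \<open>Replaces positions in the column word by boxes: \<open>m x\<close> is the value of the
  suffix that starts at box \<open>x\<close>, and the largest position becomes the box read
  last.\<close>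

lemma raise_key_eqI:
  fixes i :: nat and T :: tableau
  assumes f: "finite (dom T)" and x: "(r, c) \<in> dom T"
  defines "m \<equiv> \<lambda>x. int (card {y. (y = x \<or> later x y) \<and> T y = Some (Suc i)})
    - int (card {y. (y = x \<or> later x y) \<and> T y = Some i})"
  assumes pos: "0 < m (r, c)" and max: "\<And>y. y \<in> dom T \<Longrightarrow> m y \<le> m (r, c)"
    and last: "\<And>y. y \<in> dom T \<Longrightarrow> later (r, c) y \<Longrightarrow> m y < m (r, c)"
    and X: "X = {(r', c'). r' = r \<and> c \<le> c' \<and> T (r', c') = Some (Suc i)}"
  shows "raise_key i T = Some (\<lambda>x. if x \<in> X then Some i
    else if T x = Some i \<and> snd x \<in> snd ` X then Some (Suc i) else T x)"
proof -
  note L = col_boxes_facts[OF f]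
  let ?L = "col_boxes T" and ?\<rho> = "col_word T"
  obtain q where q: "q < length ?L" "?L ! q = (r, c)" using x L(1) by (metis in_set_conv_nth)
  have len: "length ?\<rho> = length ?L" by (simp add: col_word_def)
  have ms: "m_suffix i ?\<rho> j = m (?L ! j)" if "j < length ?L" for j
    using m_suffix_col_word[OF f that] by (simp add: m_def)
  have dj: "?L ! j \<in> dom T" if "j < length ?L" for j using L(1) that nth_mem by blast
  have mm: "m_max i ?\<rho> = m (r, c)"
    unfolding m_max_def
  proof (rule Max_eqI)
    show "y \<le> m (r, c)" if "y \<in> m_suffix i ?\<rho> ` {..<length ?\<rho>}" for y
    proof -
      from that obtain j where j: "j < length ?L" "y = m_suffix i ?\<rho> j" using len by auto
      then show ?thesis using ms[OF j(1)] max[OF dj[OF j(1)]] by simp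
    qed
    show "m (r, c) \<in> m_suffix i ?\<rho> ` {..<length ?\<rho>}" using ms[OF q(1)] q len by (auto intro: rev_image_eqI)
  qed simp
  have gq: "(GREATEST j. j < length ?\<rho> \<and> m_suffix i ?\<rho> j = m_max i ?\<rho>) = q"
  proof (rule Greatest_equality)
    show "q < length ?\<rho> \<and> m_suffix i ?\<rho> q = m_max i ?\<rho>" using q ms mm len by simp
    show "j \<le> q" if "j < length ?\<rho> \<and> m_suffix i ?\<rho> j = m_max i ?\<rho>" for j
    proof (rule ccontr)
      assume "\<not> j \<le> q"
      then have "later (?L ! q) (?L ! j)" using sorted_wrt_nth_less[OF L(2), of q j] that len by simp
      then have "m (?L ! j) < m (r, c)" using last[of "?L ! j"] dj that len q(2) by simp
      moreover have "m_suffix i ?\<rho> j = m (?L ! j)" by (rule ms) (use that len in simp)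
      ultimately show False using that mm by simp
    qed
  qed
  have ne: "\<not> (?\<rho> = [] \<or> m_max i ?\<rho> \<le> 0)" using mm pos q(1) len by auto
  show ?thesis unfolding raise_key_def Let_def gq X if_not_P[OF ne] q(2) prod.case ..
qed

text \<open>The suffix from a box of column \<open>Suc c\<close> consists of the first
  \<open>c\<close> columns and the part of its own column at or below the box, and each column
  contributes at most one label.\<close>

lemma card_one_per_column:
  assumes f: "finite E" and pos: "\<And>r c. (r, c) \<in> E \<Longrightarrow> 1 \<le> c"
    and one: "\<And>r r' c. (r, c) \<in> E \<Longrightarrow> (r', c) \<in> E \<Longrightarrow> r = r'"
  shows "card {y. (y = (r, Suc c) \<or> later (r, Suc c) y) \<and> y \<in> E}
    = card {j \<in> {1..c}. \<exists>r'. (r', j) \<in> E} + of_bool (\<exists>r'\<le>r. (r', Suc c) \<in> E)"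
proof -
  let ?S = "{y. (y = (r, Suc c) \<or> later (r, Suc c) y) \<and> y \<in> E}"
  let ?J = "{j \<in> {1..c}. \<exists>r'. (r', j) \<in> E}"
  have "inj_on snd ?S" by (rule inj_onI) (use one in \<open>auto simp: prod_eq_iff\<close>)
  then have "card ?S = card (snd ` ?S)" by (rule card_image[symmetric])
  also have "snd ` ?S = ?J \<union> (if \<exists>r'\<le>r. (r', Suc c) \<in> E then {Suc c} else {})"
  proof (rule set_eqI, rule iffI)
    fix j assume "j \<in> snd ` ?S"
    then obtain r' where r': "(r', j) \<in> E" "(r', j) = (r, Suc c) \<or> later (r, Suc c) (r', j)" by auto
    then show "j \<in> ?J \<union> (if \<exists>r'\<le>r. (r', Suc c) \<in> E then {Suc c} else {})"
      using pos[OF r'(1)] by (cases "j = Suc c") (auto simp: later_def intro: less_imp_le)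
  next
    fix j assume "j \<in> ?J \<union> (if \<exists>r'\<le>r. (r', Suc c) \<in> E then {Suc c} else {})"
    then obtain r' where "(r', j) \<in> E" "(r', j) = (r, Suc c) \<or> later (r, Suc c) (r', j)"
      by (auto simp: later_def split: if_splits) (metis order_le_less)
    then show "j \<in> snd ` ?S" by force
  qed
  also have "card \<dots> = card ?J + of_bool (\<exists>r'\<le>r. (r', Suc c) \<in> E)"
    by (subst card_Un_disjoint) auto
  finally show ?thesis .
qed

text \<open>If two boxes of \<open>C - A\<close> lie in the same column, the lower one belongs to \<open>B\<close> exactly if its
  right neighbour does.\<close>

lemma column_determined:
  fixes A B B' C :: "(int \<times> nat) set"
  assumes sub: "B \<subseteq> C" "B' \<subseteq> C"
    and left: "\<And>r. (r, Suc c) \<in> B \<Longrightarrow> (r, c) \<in> B" "\<And>r. (r, Suc c) \<in> B' \<Longrightarrow> (r, c) \<in> B'"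
    and one: "\<And>r r'. (r, c) \<in> B - A \<Longrightarrow> (r', c) \<in> B - A \<Longrightarrow> r = r'"
      "\<And>r r'. (r, c) \<in> B' - A \<Longrightarrow> (r', c) \<in> B' - A \<Longrightarrow> r = r'"
    and key: "\<And>r r'. (r, c) \<in> C - B \<Longrightarrow> r' < r \<Longrightarrow> (r', c) \<in> B \<Longrightarrow> (r', Suc c) \<in> B"
      "\<And>r r'. (r, c) \<in> C - B' \<Longrightarrow> r' < r \<Longrightarrow> (r', c) \<in> B' \<Longrightarrow> (r', Suc c) \<in> B'"
    and ex: "(\<exists>r. (r, c) \<in> B - A) \<Longrightarrow> (\<exists>r. (r, c) \<in> B' - A)" and A: "A \<subseteq> B'"
    and next_column: "\<And>r r'. r < r' \<Longrightarrow> (r, c) \<in> C - A \<Longrightarrow> (r', c) \<in> C - A \<Longrightarrow> (r, Suc c) \<in> B \<longleftrightarrow> (r, Suc c) \<in> B'"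
    and b: "(r, c) \<in> B"
  shows "(r, c) \<in> B'"
proof (rule ccontr)
  assume n: "(r, c) \<notin> B'"
  then have rA: "(r, c) \<in> B - A" using b A by auto
  then obtain r' where r': "(r', c) \<in> B' - A" using ex by blast
  then have nB: "(r', c) \<notin> B" using one(1)[OF rA, of r'] n by auto
  have C: "(r, c) \<in> C - A" "(r', c) \<in> C - A" "r \<noteq> r'" using rA r' sub n by auto
  show False
  proof (cases "r < r'")
    case True
    then have "(r, Suc c) \<in> B" using key(1)[of r' r] nB C b by auto
    then show False using next_column[OF True C(1,2)] left(2) n by auto
  next
    case False
    then have lt: "r' < r" using C(3) by simp
    then have "(r', Suc c) \<in> B'" using key(2)[of r r'] n C r' by auto
    then show False using next_column[OF lt C(2,1)] left(1) nB by auto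
  qed
qed

text \<open>The boxes of \<open>B - A\<close> carry the label \<open>i + 1\<close>, those of \<open>C - B\<close> the label \<open>i\<close>. With \<open>B'\<close> in place
  of \<open>B\<close>, the column \<open>d\<close> has lost its label \<open>i + 1\<close>, and the number of labels in the other columns is
  unchanged.\<close>

locale two_labels =
  fixes T :: tableau and i :: nat and A B B' C :: "(int \<times> nat) set" and d :: nat and g :: "nat \<Rightarrow> int"
  assumes fin: "finite (dom T)" and pos: "\<And>r c. (r, c) \<in> dom T \<Longrightarrow> 1 \<le> c"
    and sub: "A \<subseteq> B" "B \<subseteq> C" "A \<subseteq> B'" "B' \<subseteq> C" "C \<subseteq> dom T"
    and left: "\<And>r c. 1 \<le> c \<Longrightarrow> (r, Suc c) \<in> A \<Longrightarrow> (r, c) \<in> A" "\<And>r c. 1 \<le> c \<Longrightarrow> (r, Suc c) \<in> B \<Longrightarrow> (r, c) \<in> B"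
      "\<And>r c. 1 \<le> c \<Longrightarrow> (r, Suc c) \<in> B' \<Longrightarrow> (r, c) \<in> B'" "\<And>r c. 1 \<le> c \<Longrightarrow> (r, Suc c) \<in> C \<Longrightarrow> (r, c) \<in> C"
    and one: "\<And>r r' c. (r, c) \<in> B - A \<Longrightarrow> (r', c) \<in> B - A \<Longrightarrow> r = r'"
      "\<And>r r' c. (r, c) \<in> C - B \<Longrightarrow> (r', c) \<in> C - B \<Longrightarrow> r = r'"
      "\<And>r r' c. (r, c) \<in> B' - A \<Longrightarrow> (r', c) \<in> B' - A \<Longrightarrow> r = r'"
      "\<And>r r' c. (r, c) \<in> C - B' \<Longrightarrow> (r', c) \<in> C - B' \<Longrightarrow> r = r'"
    and key: "\<And>r r' c. (r, c) \<in> B - A \<Longrightarrow> r' < r \<Longrightarrow> (r', c) \<in> A \<Longrightarrow> (r', Suc c) \<in> A"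
      "\<And>r r' c. (r, c) \<in> C - B \<Longrightarrow> r' < r \<Longrightarrow> (r', c) \<in> B \<Longrightarrow> (r', Suc c) \<in> B"
      "\<And>r r' c. (r, c) \<in> C - B' \<Longrightarrow> r' < r \<Longrightarrow> (r', c) \<in> B' \<Longrightarrow> (r', Suc c) \<in> B'"
    and labels: "\<And>x. T x = Some (Suc i) \<longleftrightarrow> x \<in> B - A" "\<And>x. T x = Some i \<longleftrightarrow> x \<in> C - B"
    and ex: "\<And>c. (\<exists>r. (r, c) \<in> B' - A) \<longleftrightarrow> (\<exists>r. (r, c) \<in> B - A) \<and> c \<noteq> d"
    and g_0: "g 0 = 0"
    and g_Suc: "\<And>c. g (Suc c) = g c + of_bool (\<exists>r. (r, Suc c) \<in> B - A) - of_bool (\<exists>r. (r, Suc c) \<in> C - B)"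
    and g_max: "1 \<le> d" "\<And>c. g c \<le> g d" "\<And>c. c < d \<Longrightarrow> g c < g d"
begin

section \<open>Suffix values and stacked labels\<close>

lemma g_card: "g c = int (card {j \<in> {1..c}. \<exists>r. (r, j) \<in> B - A}) - int (card {j \<in> {1..c}. \<exists>r. (r, j) \<in> C - B})"
proof (induct c)
  case (Suc c)
  have "{j \<in> {1..Suc c}. P j} = {j \<in> {1..c}. P j} \<union> (if P (Suc c) then {Suc c} else {})" for P
    by (auto simp: le_Suc_eq)
  moreover have "card ({j \<in> {1..c}. P j} \<union> (if P (Suc c) then {Suc c} else {})) = card {j \<in> {1..c}. P j} + of_bool (P (Suc c))" for P
    by (subst card_Un_disjoint) auto
  ultimately have "card {j \<in> {1..Suc c}. P j} = card {j \<in> {1..c}. P j} + of_bool (P (Suc c))" for P by simp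
  then show ?case using Suc g_Suc[of c] by simp
qed (simp add: g_0)

lemma suffix_value:
  "int (card {y. (y = (r, Suc c) \<or> later (r, Suc c) y) \<and> T y = Some (Suc i)})
    - int (card {y. (y = (r, Suc c) \<or> later (r, Suc c) y) \<and> T y = Some i})
    = g c + of_bool (\<exists>r'\<le>r. (r', Suc c) \<in> B - A) - of_bool (\<exists>r'\<le>r. (r', Suc c) \<in> C - B)"
proof -
  have f: "finite (B - A)" "finite (C - B)" using sub fin by (meson finite_Diff finite_subset)+
  have p: "1 \<le> c" if "(r, c) \<in> C" for r c using pos that sub(5) by blast
  have "card {y. (y = (r, Suc c) \<or> later (r, Suc c) y) \<and> y \<in> B - A}
    = card {j \<in> {1..c}. \<exists>r'. (r', j) \<in> B - A} + of_bool (\<exists>r'\<le>r. (r', Suc c) \<in> B - A)"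
    by (rule card_one_per_column[OF f(1) _ one(1)]) (use p sub(2) in blast)+
  moreover have "card {y. (y = (r, Suc c) \<or> later (r, Suc c) y) \<and> y \<in> C - B}
    = card {j \<in> {1..c}. \<exists>r'. (r', j) \<in> C - B} + of_bool (\<exists>r'\<le>r. (r', Suc c) \<in> C - B)"
    by (rule card_one_per_column[OF f(2) _ one(2)]) (use p in blast)+
  ultimately show ?thesis unfolding labels g_card[of c] by simp
qed

text \<open>A column in which the label \<open>i\<close> stands above the label
  \<open>i + 1\<close>. It leaves \<open>g\<close> unchanged, yet a suffix starting between the two
  sees only the \<open>i + 1\<close>.\<close>

definition stacked :: "int \<Rightarrow> nat \<Rightarrow> bool" where
  "stacked r c \<longleftrightarrow> (r, c) \<in> B - A \<and> (\<exists>r'>r. (r', c) \<in> C - B)"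

text \<open>The key condition for the label \<open>i\<close> continues row \<open>r\<close> into the
  next column. A label \<open>i\<close> below row \<open>r\<close> in that column is impossible: its
  left neighbour would lie in \<open>A\<close>, and the key condition for \<open>A\<close> would put
  the box itself into \<open>A\<close>.\<close>

lemma stacked_next:
  assumes s: "stacked r c"
  shows "(r, Suc c) \<in> B - A" "stacked r (Suc c) \<or> (\<forall>r'. (r', Suc c) \<notin> C - B)"
proof -
  obtain r2 where r2: "r < r2" "(r2, c) \<in> C - B" and rc: "(r, c) \<in> B - A" using s by (auto simp: stacked_def)
  have c: "1 \<le> c" by (rule pos[of r c]) (use rc sub in blast)
  have "(r, Suc c) \<in> B" using key(2)[OF r2(2,1)] rc by auto
  then show n: "(r, Suc c) \<in> B - A" using left(1)[OF c] rc by auto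
  show "stacked r (Suc c) \<or> (\<forall>r'. (r', Suc c) \<notin> C - B)"
  proof (rule ccontr)
    assume "\<not> ?thesis"
    then obtain r' where r': "(r', Suc c) \<in> C - B" "\<not> r < r'" using n by (auto simp: stacked_def)
    then have lt: "r' < r" using n by (cases "r' = r") auto
    have "(r', c) \<in> C" using left(4)[OF c] r' by auto
    then have "(r', c) \<in> B" using one(2)[OF r2(2), of r'] lt r2(1) by auto
    then have "(r', c) \<in> A" using one(1)[OF rc, of r'] lt by auto
    then have "(r', Suc c) \<in> A" by (rule key(1)[OF rc lt])
    then show False using r' sub by auto
  qed
qed

lemma stacked_g: "stacked r (Suc c) \<Longrightarrow> g (Suc c) = g c"
proof -
  assume "stacked r (Suc c)"
  then have "\<exists>r. (r, Suc c) \<in> B - A" "\<exists>r. (r, Suc c) \<in> C - B" by (auto simp: stacked_def)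
  then show ?thesis using g_Suc[of c] by simp
qed

lemma columns_bound: "\<exists>K. \<forall>r c. (r, c) \<in> dom T \<longrightarrow> c \<le> K"
proof -
  have "finite (snd ` dom T)" using fin by simp
  then obtain K where "\<forall>c\<in>snd ` dom T. c \<le> K" using finite_nat_set_iff_bounded_le by blast
  then have "\<forall>r c. (r, c) \<in> dom T \<longrightarrow> c \<le> K" by (metis imageI snd_conv)
  then show ?thesis ..
qed

text \<open>A stacked run moves right along its row until, the columns being bounded, it ends in a
  column with an \<open>i + 1\<close> and no \<open>i\<close>; there \<open>g\<close> increases by
  one.\<close>

lemma stacked_end:
  assumes "stacked r (Suc c)"
  obtains k where "c < k" "\<And>j. Suc c \<le> j \<Longrightarrow> j \<le> k \<Longrightarrow> stacked r j \<and> g j = g c" "(r, Suc k) \<in> B - A" "\<And>r'. (r', Suc k) \<notin> C - B"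
    "g (Suc k) = g c + 1"
proof -
  obtain K where K: "\<And>r c. (r, c) \<in> dom T \<Longrightarrow> c \<le> K" using columns_bound by blast
  have "\<exists>k>c. (\<forall>j. Suc c \<le> j \<and> j \<le> k \<longrightarrow> stacked r j \<and> g j = g c) \<and> (r, Suc k) \<in> B - A
      \<and> (\<forall>r'. (r', Suc k) \<notin> C - B) \<and> g (Suc k) = g c + 1"
    using assms
  proof (induct "K - c" arbitrary: c rule: less_induct)
    case less
    note n = stacked_next[OF less(2)] and e = stacked_g[OF less(2)]
    show ?case
    proof (cases "stacked r (Suc (Suc c))")
      case True
      have "Suc c \<le> K" using K n(1) sub by (meson DiffD1 Suc_leD subsetD)
      then have "K - Suc c < K - c" by simp
      from less(1)[OF this True] obtain k where k: "k > Suc c"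
        "\<forall>j. Suc (Suc c) \<le> j \<and> j \<le> k \<longrightarrow> stacked r j \<and> g j = g (Suc c)" "(r, Suc k) \<in> B - A"
        "\<forall>r'. (r', Suc k) \<notin> C - B" "g (Suc k) = g (Suc c) + 1" by blast
      have "stacked r j \<and> g j = g c" if "Suc c \<le> j" "j \<le> k" for j
        using k(2) e less(2) that by (cases "j = Suc c") auto
      then show ?thesis using k e by (intro exI[of _ k]) auto
    next
      case False
      then have no: "\<forall>r'. (r', Suc (Suc c)) \<notin> C - B" using n(2) by blast
      then have "\<not> (\<exists>r'. (r', Suc (Suc c)) \<in> C - B)" "\<exists>r'. (r', Suc (Suc c)) \<in> B - A" using n(1) by blast+
      then have "g (Suc (Suc c)) = g c + 1" using g_Suc[of "Suc c"] e by simp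
      moreover have "stacked r j \<and> g j = g c" if "Suc c \<le> j" "j \<le> Suc c" for j
        using that less(2) e by (simp add: le_antisym[OF that(2,1)])
      ultimately show ?thesis using n(1) no by (intro exI[of _ "Suc c"]) auto
    qed
  qed
  then show ?thesis using that by blast
qed

text \<open>A suffix starting inside a stacked column has at most the value \<open>g c + 1\<close>,
  which \<open>g\<close> attains at the end of the stacked run. In other columns the value is at
  most \<open>g c\<close> or \<open>g (Suc c)\<close>.\<close>

lemma suffix_le:
  "g c + of_bool (\<exists>r'\<le>r. (r', Suc c) \<in> B - A) - of_bool (\<exists>r'\<le>r. (r', Suc c) \<in> C - B) \<le> g d"
proof (cases "\<exists>r1. stacked r1 (Suc c)")
  case True
  then obtain r1 where "stacked r1 (Suc c)" by blast
  then obtain k where "g (Suc k) = g c + 1" by (rule stacked_end)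
  then show ?thesis using g_max(2)[of "Suc k"] by (auto simp: of_bool_def)
next
  case False
  have "\<exists>r'\<le>r. (r', Suc c) \<in> C - B" if a: "r1 \<le> r" "(r1, Suc c) \<in> B - A" "(r2, Suc c) \<in> C - B" for r1 r2
  proof -
    have "\<not> r1 < r2" using False a by (auto simp: stacked_def)
    then show ?thesis using a by (intro exI[of _ r2]) auto
  qed
  then show ?thesis using g_max(2)[of c] g_max(2)[of "Suc c"] g_Suc[of c]
    by (cases "\<exists>r'\<le>r. (r', Suc c) \<in> B - A"; cases "\<exists>r'. (r', Suc c) \<in> C - B") (auto simp: of_bool_def split: if_splits)
qed

lemma last_column: obtains r where "(r, d) \<in> B - A" "\<And>r'. (r', d) \<notin> C - B" "g d = g (d - 1) + 1"
proof -
  obtain c where c: "d = Suc c" using g_max(1) by (cases d) auto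
  then have "g c < g (Suc c)" using g_max(3)[of c] by simp
  then have "\<exists>r. (r, Suc c) \<in> B - A" "\<not> (\<exists>r. (r, Suc c) \<in> C - B)" "g (Suc c) = g c + 1"
    using g_Suc[of c] by (auto simp: of_bool_def split: if_splits)
  then show ?thesis using that c by auto
qed

section \<open>The box selected by the key operator\<close>

definition r0 where "r0 = (THE r. (r, d) \<in> B - A)"

lemma r0: "(r0, d) \<in> B - A" "(r', d) \<notin> C - B" "g d = g (d - 1) + 1"
proof -
  obtain r where r: "(r, d) \<in> B - A" "\<And>r'. (r', d) \<notin> C - B" "g d = g (d - 1) + 1"
    by (rule last_column) (rule that; assumption)
  then have "r0 = r" unfolding r0_def using one(1) by blast
  then show "(r0, d) \<in> B - A" "(r', d) \<notin> C - B" "g d = g (d - 1) + 1" using r by auto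
qed

text \<open>The stacked run in row \<open>r0\<close> that ends in column \<open>d\<close>; its first
  column \<open>cq\<close> is the one in which \<open>raise_key\<close> selects its box.\<close>

definition good where "good c \<longleftrightarrow> 1 \<le> c \<and> c \<le> d \<and> (\<forall>j. c \<le> j \<and> j < d \<longrightarrow> stacked r0 j)"

definition cq where "cq = (LEAST c. good c)"

lemma good_d: "good d"
  using g_max(1) by (auto simp: good_def)

lemma cq: "good cq" "good c \<Longrightarrow> cq \<le> c"
  unfolding cq_def using good_d by (auto intro: LeastI Least_le)

lemma cq_bounds: "1 \<le> cq" "cq \<le> d" "cq \<le> j \<Longrightarrow> j < d \<Longrightarrow> stacked r0 j"
  using cq(1) by (auto simp: good_def)

lemma cq_label: "cq \<le> j \<Longrightarrow> j \<le> d \<Longrightarrow> (r0, j) \<in> B - A"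
  using cq_bounds(3)[of j] r0(1) by (cases "j = d") (auto simp: stacked_def)

lemma cq_g: "g d = g (cq - 1) + 1"
proof (cases "cq = d")
  case False
  then have lt: "cq < d" using cq_bounds(2) by simp
  obtain c where c: "cq = Suc c" using cq_bounds(1) by (cases cq) auto
  have "g (c + k) = g c" if "c + k < d" for k
    using that
  proof (induct k)
    case (Suc k)
    then show ?case using stacked_g[of r0 "c + k"] cq_bounds(3)[of "Suc (c + k)"] c by simp
  qed simp
  from this[of "d - 1 - c"] show ?thesis using lt c r0(3) by simp
qed (use r0(3) in simp)

lemma suffix_cq:
  "g (cq - 1) + of_bool (\<exists>r'\<le>r0. (r', cq) \<in> B - A) - of_bool (\<exists>r'\<le>r0. (r', cq) \<in> C - B) = g d"
proof -
  have 1: "\<exists>r'\<le>r0. (r', cq) \<in> B - A" using cq_label[of cq] cq_bounds(2) by auto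
  have 2: "\<not> (\<exists>r'\<le>r0. (r', cq) \<in> C - B)"
  proof
    assume "\<exists>r'\<le>r0. (r', cq) \<in> C - B"
    then obtain r' where r': "r' \<le> r0" "(r', cq) \<in> C - B" by blast
    then have "cq \<noteq> d" using r0(2) by auto
    then have "stacked r0 cq" using cq_bounds by simp
    then obtain r2 where "r0 < r2" "(r2, cq) \<in> C - B" by (auto simp: stacked_def)
    then show False using one(2)[OF r'(2), of r2] r'(1) by simp
  qed
  show ?thesis using 1 2 cq_g by simp
qed

text \<open>A suffix starting later with the same value would begin inside a stacked column or at
  \<open>d\<close>. Its run reaches column \<open>d\<close>, because \<open>g\<close> takes its
  maximum there for the first time, hence lies in row \<open>r0\<close>. Then \<open>Suc c\<close>
  is good, so it equals \<open>cq\<close>, and the box is not below row \<open>r0\<close> after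
  all.\<close>

lemma suffix_less:
  assumes "later (r0, cq) (r, Suc c)"
  shows "g c + of_bool (\<exists>r'\<le>r. (r', Suc c) \<in> B - A) - of_bool (\<exists>r'\<le>r. (r', Suc c) \<in> C - B) < g d"
proof (rule ccontr)
  assume "\<not> ?thesis"
  then have e: "g c + of_bool (\<exists>r'\<le>r. (r', Suc c) \<in> B - A) - of_bool (\<exists>r'\<le>r. (r', Suc c) \<in> C - B) = g d"
    using suffix_le[of c r] by simp
  have cd: "c < d" "Suc c \<le> cq" using assms cq_bounds(2) by (auto simp: later_def)
  then have gc: "g c < g d" using g_max(3) by simp
  then have b: "\<exists>r'\<le>r. (r', Suc c) \<in> B - A" "\<not> (\<exists>r'\<le>r. (r', Suc c) \<in> C - B)" "g d = g c + 1"
    using e by (auto simp: of_bool_def split: if_splits)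
  then obtain r1 where r1: "r1 \<le> r" "(r1, Suc c) \<in> B - A" by blast
  have good: "good (Suc c) \<and> r1 = r0"
  proof (cases "Suc c = d")
    case True
    then show ?thesis using good_d r1(2) one(1)[OF r0(1)] by simp
  next
    case False
    then have "g (Suc c) < g d" using g_max(3)[of "Suc c"] cd by simp
    then have "\<exists>r2. (r2, Suc c) \<in> C - B" using g_Suc[of c] b(1,3) by (auto simp: of_bool_def split: if_splits)
    then obtain r2 where r2: "(r2, Suc c) \<in> C - B" by blast
    then have "\<not> r2 \<le> r" using b(2) by blast
    then have "r1 < r2" using r1 by simp
    then have "stacked r1 (Suc c)" using r1 r2 by (auto simp: stacked_def)
    then obtain k where k: "c < k" "\<And>j. Suc c \<le> j \<Longrightarrow> j \<le> k \<Longrightarrow> stacked r1 j \<and> g j = g c" "(r1, Suc k) \<in> B - A"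
      "g (Suc k) = g c + 1" by (rule stacked_end) blast
    have "d \<le> Suc k" using g_max(3)[of "Suc k"] k(4) b(3) by (cases "Suc k < d") auto
    moreover have "\<not> d \<le> k" using k(2)[of d] cd gc by auto
    ultimately have dk: "d = Suc k" by simp
    then have r: "r1 = r0" using one(1)[OF r0(1)] k(3) by auto
    have "stacked r0 j" if "Suc c \<le> j" "j < d" for j
      using k(2)[of j] that unfolding r dk by simp
    then have "good (Suc c)" unfolding good_def using cd(1) by simp
    then show ?thesis using r by simp
  qed
  then have "cq \<le> Suc c" using cq(2) by blast
  then have "Suc c = cq" using cd by simp
  then show False using assms good r1(1) by (auto simp: later_def)
qed

section \<open>Comparison of the diagrams \<open>B\<close> and \<open>B'\<close>\<close>

lemma agree_step:
  assumes c: "1 \<le> c" "c \<noteq> d"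
    and n: "\<And>r r'. r < r' \<Longrightarrow> (r, c) \<in> C - A \<Longrightarrow> (r', c) \<in> C - A \<Longrightarrow> (r, Suc c) \<in> B \<longleftrightarrow> (r, Suc c) \<in> B'"
  shows "(r, c) \<in> B \<longleftrightarrow> (r, c) \<in> B'"
proof
  assume b: "(r, c) \<in> B"
  show "(r, c) \<in> B'"
    by (rule column_determined[where A = A and B = B and B' = B' and C = C])
      (fact sub | erule left[OF c(1)] | erule (1) one | erule (2) key | erule (2) n | fact b
        | use ex[of c] c(2) in blast)+
next
  assume b: "(r, c) \<in> B'"
  show "(r, c) \<in> B"
    by (rule column_determined[where A = A and B = B' and B' = B and C = C])
      (fact sub | erule left[OF c(1)] | erule (1) one | erule (2) key | erule (2) n[symmetric] | fact b
        | use ex[of c] c(2) in blast)+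
qed

text \<open>Agreement in one column passes to the column on its left; it holds trivially beyond the
  last column.\<close>

lemma agree_right: "d < c \<Longrightarrow> (r, c) \<in> B \<longleftrightarrow> (r, c) \<in> B'"
proof -
  assume dc: "d < c"
  obtain K where K: "\<And>r c. (r, c) \<in> dom T \<Longrightarrow> c \<le> K" using columns_bound by blast
  show ?thesis using dc
  proof (induct "Suc K - c" arbitrary: c r rule: less_induct)
    case less
    show ?case
    proof (cases "c \<le> K")
      case True
      show ?thesis
        by (rule agree_step) (use less(1)[of "Suc c"] less(2) True in auto)
    next
      case False
      then have "(r, c) \<notin> C" using K sub(5) by blast
      then show ?thesis using sub by blast
    qed
  qed
qed

lemma column_d: "(r, d) \<in> B' \<longleftrightarrow> (r, d) \<in> A"
  using ex[of d] sub(3) by blast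

text \<open>Moving left from \<open>d\<close>: if row \<open>r0\<close> kept its box in
  \<open>B'\<close>, the box of row \<open>r2\<close> above would be added after \<open>B'\<close>,
  and the key condition would extend row \<open>r0\<close> in \<open>B'\<close> to the next
  column.\<close>

lemma not_B': "cq \<le> c \<Longrightarrow> c \<le> d \<Longrightarrow> (r0, c) \<notin> B'"
proof (induct "d - c" arbitrary: c rule: less_induct)
  case less
  show ?case
  proof (cases "c = d")
    case True
    then show ?thesis using column_d r0(1) by auto
  next
    case False
    then have cd: "c < d" using less(3) by simp
    have n: "(r0, Suc c) \<notin> B'" by (rule less(1)) (use cd less(2) in auto)
    obtain r2 where r2: "r0 < r2" "(r2, c) \<in> C - B" "(r0, c) \<in> B - A"
      using cq_bounds(3)[OF less(2) cd] by (auto simp: stacked_def)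
    show ?thesis
    proof
      assume b: "(r0, c) \<in> B'"
      have "(r2, c) \<notin> B'" using one(3)[of r0 c r2] b r2 sub(1) by auto
      then show False using key(3)[of r2 c r0] r2 b n by auto
    qed
  qed
qed

lemma stack_B':
  assumes c: "cq \<le> c" "c < d" and r2: "(r2, c) \<in> C - B"
  shows "(r, c) \<in> B' \<longleftrightarrow> (r, c) \<in> A \<or> r = r2"
proof -
  have nr: "(r0, c) \<notin> B'" by (rule not_B') (use c in auto)
  have lab: "(r0, c) \<in> B - A" by (rule cq_label) (use c in auto)
  then obtain r' where r': "(r', c) \<in> B' - A" using ex[of c] c(2) by auto
  have "r' = r2"
  proof (rule ccontr)
    assume ne: "r' \<noteq> r2"
    have "(r', c) \<in> B" using one(2)[OF r2, of r'] ne r' sub(4) by auto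
    then have "r' = r0" using one(1)[OF lab, of r'] r' by auto
    then show False using nr r' by auto
  qed
  then show ?thesis using r' one(3)[OF r', of r] sub(3) by blast
qed

lemma agree_left: "1 \<le> c \<Longrightarrow> c < cq \<Longrightarrow> (r, c) \<in> B \<longleftrightarrow> (r, c) \<in> B'"
proof (induct "cq - c" arbitrary: c r rule: less_induct)
  case less
  show ?case
  proof (rule agree_step)
    show "1 \<le> c" "c \<noteq> d" using less(2,3) cq_bounds(2) by auto
    fix r r' assume a: "r < r'" "(r, c) \<in> C - A" "(r', c) \<in> C - A"
    show "(r, Suc c) \<in> B \<longleftrightarrow> (r, Suc c) \<in> B'"
    proof (cases "Suc c < cq")
      case True
      then show ?thesis using less(1)[of "Suc c" r] less(3) by simp
    next
      case False
      then have sc: "Suc c = cq" using less(3) by simp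
      have lab: "(r0, Suc c) \<in> B - A" using cq_label[of cq] cq_bounds(2) sc by simp
      then have r0c: "(r0, c) \<in> B" using left(2)[OF less(2)] by auto
      \<comment> \<open>Otherwise column \<open>c\<close> would be stacked in row \<open>r0\<close>
        and extend the run beyond \<open>cq\<close>.\<close>
      have r_r0: "r \<noteq> r0"
      proof
        assume r: "r = r0"
        then have b: "(r0, c) \<in> B - A" using r0c a(2) by auto
        then have "(r', c) \<in> C - B" using one(1)[OF b, of r'] a r by auto
        then have "stacked r0 c" using b a(1) r by (auto simp: stacked_def)
        then have "good c" using less(2) cq_bounds sc unfolding good_def by (metis Suc_leD Suc_leI le_neq_implies_less)
        then show False using cq(2) sc by fastforce
      qed
      show ?thesis
      proof (cases "cq = d")
        case True
        then show ?thesis using column_d[of r] sc one(1)[OF lab, of r] r_r0 sub(1) by auto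
      next
        case False
        then have lt: "cq < d" using cq_bounds(2) by simp
        then obtain r2 where r2: "r0 < r2" "(r2, Suc c) \<in> C - B" using cq_bounds(3)[of cq] sc by (auto simp: stacked_def)
        \<comment> \<open>If the lower candidate were in row \<open>r2\<close>, the key condition
          for \<open>i\<close> would make it an \<open>i\<close>. The upper candidate would then be
          the \<open>i + 1\<close>, and the key condition for \<open>A\<close> would put the
          labelled box of row \<open>r0\<close> in column \<open>cq\<close> into
          \<open>A\<close>.\<close>
        have "r \<noteq> r2"
        proof
          assume r: "r = r2"
          have "(r, c) \<notin> B"
          proof
            assume b: "(r, c) \<in> B"
            then have "(r', c) \<in> C - B" using one(1)[of r c r'] a by auto
            then have "(r, Suc c) \<in> B" using key(2)[of r' c r] a(1) b by auto
            then show False using r2 r by auto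
          qed
          then have b: "(r', c) \<in> B - A" using one(2)[of r c r'] a by auto
          have "(r0, c) \<in> A" using one(1)[OF b, of r0] r0c r r2(1) a(1) by auto
          then have "(r0, Suc c) \<in> A" using key(1)[OF b, of r0] r r2(1) a(1) by auto
          then show False using lab by auto
        qed
        then show ?thesis
          using stack_B'[of "Suc c" r2 r] r2(2) lt sc one(1)[OF lab, of r] r_r0 sub(1) by auto
      qed
    qed
  qed
qed

lemma raise_key_labels:
  assumes T': "\<And>x. x \<in> C - A \<Longrightarrow> T' x = Some (if x \<in> B' then Suc i else i)"
    "\<And>x. x \<notin> C - A \<Longrightarrow> T' x = T x"
  shows "raise_key i T = Some T'"
proof -
  define X where "X = {(r', c'). r' = r0 \<and> cq \<le> c' \<and> T (r', c') = Some (Suc i)}"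
  \<comment> \<open>Row \<open>r0\<close> of \<open>B\<close> ends in column \<open>d\<close>: a box
    further right would also belong to \<open>B'\<close>, which has lost row \<open>r0\<close> in
    column \<open>d\<close>.\<close>
  have Xe: "X = {(r', c'). r' = r0 \<and> cq \<le> c' \<and> c' \<le> d}"
  proof -
    have "c' \<le> d" if "cq \<le> c'" "(r0, c') \<in> B" for c'
    proof (rule ccontr)
      assume "\<not> c' \<le> d"
      then have k: "c' = Suc d + (c' - Suc d)" by simp
      have "(r0, Suc d + k) \<in> B \<Longrightarrow> (r0, Suc d) \<in> B" for k
      proof (induct k)
        case (Suc k)
        then show ?case using left(2)[of "Suc d + k" r0] by simp
      qed simp
      then have "(r0, Suc d) \<in> B" using that(2) k by metis
      then have "(r0, Suc d) \<in> B'" using agree_right[of "Suc d" r0] by simp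
      then have "(r0, d) \<in> B'" using left(3)[OF g_max(1)] by simp
      then show False using column_d r0(1) by auto
    qed
    then show ?thesis using cq_label unfolding X_def labels by auto
  qed
  define m where "m = (\<lambda>x. int (card {y. (y = x \<or> later x y) \<and> T y = Some (Suc i)})
    - int (card {y. (y = x \<or> later x y) \<and> T y = Some i}))"
  have mv: "m (r, Suc c) = g c + of_bool (\<exists>r'\<le>r. (r', Suc c) \<in> B - A) - of_bool (\<exists>r'\<le>r. (r', Suc c) \<in> C - B)" for r c
    unfolding m_def by (rule suffix_value)
  obtain k where k: "cq = Suc k" using cq_bounds(1) by (cases cq) auto
  have mq: "m (r0, cq) = g d" using mv[of r0 k] suffix_cq k by simp
  have "(r0, cq) \<in> B" using cq_label[of cq] cq_bounds(2) by auto
  then have inT: "(r0, cq) \<in> dom T" using sub by blast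
  have "0 < g d" using g_max(3)[of 0] g_max(1) g_0 by simp
  have box: "\<exists>r c. y = (r, Suc c)" if "y \<in> dom T" for y
    using pos[of "fst y" "snd y"] that by (cases y; cases "snd y") auto
  have p1: "0 < m (r0, cq)" using mq \<open>0 < g d\<close> by simp
  have p2: "m y \<le> m (r0, cq)" if "y \<in> dom T" for y
    using box[OF that] mv suffix_le mq by auto
  have p3: "m y < m (r0, cq)" if "y \<in> dom T" "later (r0, cq) y" for y
    using box[OF that(1)] that(2) mv suffix_less mq by auto
  have "raise_key i T = Some (\<lambda>x. if x \<in> X then Some i
    else if T x = Some i \<and> snd x \<in> snd ` X then Some (Suc i) else T x)"
    by (rule raise_key_eqI[OF fin inT _ _ _ X_def])
      (fact p1[unfolded m_def] p2[unfolded m_def] p3[unfolded m_def])+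
  also have "(\<lambda>x. if x \<in> X then Some i
    else if T x = Some i \<and> snd x \<in> snd ` X then Some (Suc i) else T x) = T'"
  proof
    fix x :: "int \<times> nat"
    obtain r c where x: "x = (r, c)" by fastforce
    have Xc: "snd x \<in> snd ` X \<longleftrightarrow> cq \<le> c \<and> c \<le> d" using x by (force simp: Xe image_iff)
    show "(if x \<in> X then Some i else if T x = Some i \<and> snd x \<in> snd ` X then Some (Suc i) else T x) = T' x"
    proof (cases "x \<in> C - A")
      case out: False
      then have "x \<notin> X" "T x \<noteq> Some i" using cq_label[of c] x Xe labels sub by auto
      then show ?thesis using T'(2)[OF out] by simp
    next
      case True
      have lab: "T x = Some (if x \<in> B then Suc i else i)" using labels True by auto
      have c1: "1 \<le> c" using pos[of r c] True sub(5) x by blast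
      consider "c < cq" | "d < c" | "c = d" | "cq \<le> c" "c < d" by linarith
      then show ?thesis
      proof cases
        case 1
        then show ?thesis using T'(1)[OF True] lab Xc Xe x agree_left[OF c1 1, of r] by auto
      next
        case 2
        then show ?thesis using T'(1)[OF True] lab Xc Xe x agree_right[OF 2, of r] by auto
      next
        case 3
        then have "x \<in> B" using r0(2)[of r] True x by auto
        then have "r = r0" using one(1)[OF r0(1), of r] True x 3 by auto
        then have "x \<in> X" using 3 x Xe cq_bounds(2) by auto
        moreover have "x \<notin> B'" using column_d[of r] 3 x True by auto
        ultimately show ?thesis using T'(1)[OF True] by simp
      next
        case 4
        then obtain r2 where r2: "r0 < r2" "(r2, c) \<in> C - B" using cq_bounds(3) by (auto simp: stacked_def)
        note s = stack_B'[OF 4 r2(2), of r]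
        have l0: "(r0, c) \<in> B - A" by (rule cq_label) (use 4 in auto)
        show ?thesis
        proof (cases "x \<in> B")
          case True': True
          then have "r = r0" using one(1)[OF l0, of r] True x by auto
          then have "x \<in> X" "x \<notin> B'" using 4 x Xe s r2(1) True by auto
          then show ?thesis using T'(1)[OF True] by simp
        next
          case False
          then have "r = r2" using one(2)[OF r2(2), of r] True x by auto
          then have "x \<notin> X" "x \<in> B'" "T x = Some i" using r2(1) x Xe s lab False by auto
          then show ?thesis using T'(1)[OF True] Xc 4 by simp
        qed
      qed
    qed
  qed
  finally show ?thesis .
qed

end

section \<open>Diagrams along a factorization\<close>

abbreviation diag :: "nat list \<Rightarrow> (int \<times> nat) set" where
  "diag u \<equiv> dom (P_word u)"

text \<open>Columns of diagrams start at 1 and columns of the left key at 0, hence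
  \<open>c - 1\<close>.\<close>

lemma diag_iff: "red u \<Longrightarrow> (r, c) \<in> diag u \<longleftrightarrow> 1 \<le> c \<and> 0 \<le> r \<and> nat r \<in> kset u (c - 1)"
proof -
  assume u: "red u"
  have "(r, c) \<in> diag u \<longleftrightarrow> 1 \<le> c \<and> 0 \<le> r \<and> c \<le> krow u (nat r)"
    unfolding dom_P_word[OF u] by (auto intro!: exI[of _ "nat r"])
  moreover have "1 \<le> c \<Longrightarrow> c \<le> krow u (nat r) \<longleftrightarrow> nat r \<in> kset u (c - 1)"
    unfolding kset_iff[OF u] by auto
  ultimately show ?thesis by blast
qed

lemma red_Nil: "red []"
  unfolding red_def using tits_length[of "[]"] by auto

lemma diag_Nil: "diag [] = {}"
proof -
  have n: "red []" by (rule red_Nil)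
  have "krow [] p = 0" for p using krow_pos_letter[OF n, of p] by auto
  then show ?thesis unfolding dom_P_word[OF n] by auto
qed

lemma diag_finite: "red u \<Longrightarrow> finite (diag u)"
proof -
  assume u: "red u"
  have "diag u \<subseteq> (\<lambda>(p, c). (int p, c)) ` (SIGMA p:set u. {..krow u p})"
  proof
    fix x assume "x \<in> diag u"
    then obtain p c where x: "x = (int p, c)" "1 \<le> c" "c \<le> krow u p" unfolding dom_P_word[OF u] by blast
    then have "p \<in> set u" using krow_pos_letter[OF u, of p] by simp
    then show "x \<in> (\<lambda>(p, c). (int p, c)) ` (SIGMA p:set u. {..krow u p})" using x by force
  qed
  moreover have "finite ((\<lambda>(p, c). (int p, c)) ` (SIGMA p:set u. {..krow u p}))" by (intro finite_imageI finite_SigmaI) auto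
  ultimately show ?thesis by (rule finite_subset)
qed

lemma diag_left: "red u \<Longrightarrow> 1 \<le> c \<Longrightarrow> (r, Suc c) \<in> diag u \<Longrightarrow> (r, c) \<in> diag u"
  using kset_nested[of u "c - 1"] by (auto simp: diag_iff)

lemma kset_prefix: "red (u @ v) \<Longrightarrow> kset u j \<subseteq> kset (u @ v) j"
  using krow_prefix[of u v] kset_iff[of "u @ v"] kset_iff[OF red_appendD1[of u v]]
  by (meson order_less_le_trans subsetI)

lemma diag_prefix: "red (u @ v) \<Longrightarrow> diag u \<subseteq> diag (u @ v)"
proof
  fix x assume r: "red (u @ v)" and x: "x \<in> diag u"
  obtain p c where "x = (p, c)" by fastforce
  then show "x \<in> diag (u @ v)"
    using x kset_prefix[OF r, of "c - 1"] diag_iff[OF r] diag_iff[OF red_appendD1[OF r]] by blast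
qed

lemma diag_strip:
  assumes e: "incr e" "red (u @ e)" and b: "(r, c) \<in> diag (u @ e) - diag u" "(r', c) \<in> diag (u @ e) - diag u"
  shows "r = r'"
proof -
  have u: "red u" using e(2) red_appendD1 by blast
  let ?K = "kset (u @ e) (c - 1) - kset u (c - 1)"
  have m: "nat r \<in> ?K" "nat r' \<in> ?K" "0 \<le> r" "0 \<le> r'" using b diag_iff[OF u] diag_iff[OF e(2)] by auto
  have f: "finite ?K" using kset_finite[OF e(2)] by simp
  have "card ?K = clen (u @ e) (c - 1) - clen u (c - 1)"
    using card_Diff_subset[OF kset_finite[OF u] kset_prefix[OF e(2)]] kset_card[OF u] kset_card[OF e(2)] by simp
  then have "card ?K \<le> Suc 0" using inc_strip[OF e, of "c - 1"] by linarith
  then have "nat r = nat r'" using m(1,2) f card_le_Suc0_iff_eq[OF f] by blast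
  then show ?thesis using m(3,4) by simp
qed

lemma diag_new:
  assumes r: "red (u @ e)"
  shows "(\<exists>r. (r, c) \<in> diag (u @ e) - diag u) \<longleftrightarrow> 1 \<le> c \<and> clen u (c - 1) < clen (u @ e) (c - 1)"
proof -
  have u: "red u" using r red_appendD1 by blast
  let ?K = "kset (u @ e) (c - 1)" and ?L = "kset u (c - 1)"
  have s: "?L \<subseteq> ?K" by (rule kset_prefix[OF r])
  have "clen u (c - 1) < clen (u @ e) (c - 1) \<longleftrightarrow> ?L \<noteq> ?K"
    using psubset_card_mono[OF kset_finite[OF r], of ?L "c - 1"] s kset_card[OF u] kset_card[OF r]
    by (metis less_irrefl psubsetI)
  moreover have "(\<exists>r. (r, c) \<in> diag (u @ e) - diag u) \<longleftrightarrow> 1 \<le> c \<and> (\<exists>p. p \<in> ?K - ?L)"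
  proof
    assume "\<exists>r. (r, c) \<in> diag (u @ e) - diag u"
    then show "1 \<le> c \<and> (\<exists>p. p \<in> ?K - ?L)" using diag_iff[OF u] diag_iff[OF r] by auto
  next
    assume "1 \<le> c \<and> (\<exists>p. p \<in> ?K - ?L)"
    then obtain p where "1 \<le> c" "p \<in> ?K - ?L" by blast
    then have "(int p, c) \<in> diag (u @ e) - diag u" using diag_iff[OF u] diag_iff[OF r] by simp
    then show "\<exists>r. (r, c) \<in> diag (u @ e) - diag u" by blast
  qed
  ultimately show ?thesis using s by blast
qed

text \<open>The key condition for one letter, extended to an increasing word. The last box lies in
  the rightmost column that changes, so the column right of it is the same before and after, and a
  lower row reaching it now reached it already in \<open>u\<close>.\<close>

lemma diag_key:
  "incr e \<Longrightarrow> red (u @ e) \<Longrightarrow> (r, c) \<in> diag (u @ e) - diag u \<Longrightarrow> r' < r \<Longrightarrow> (r', c) \<in> diag u \<Longrightarrow> (r', Suc c) \<in> diag u"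
proof (induct e rule: rev_induct)
  case (snoc z e)
  let ?v = "u @ e @ [z]"
  have rv: "red ?v" using snoc(3) by simp
  have re: "red (u @ e)" using red_appendD1[of "u @ e" "[z]"] rv by simp
  have u: "red u" using re red_appendD1 by blast
  show ?case
  proof (cases "(r, c) \<in> diag (u @ e)")
    case True
    then show ?thesis using snoc.hyps[OF _ re _ snoc.prems(4,5)] snoc.prems(1,3) by (simp add: sorted_wrt_append)
  next
    case False
    have "red ((u @ e) @ [z])" using rv by simp
    then obtain p c0 where p: "clen ((u @ e) @ [z]) = (clen (u @ e))(c0 := Suc (clen (u @ e) c0))"
      "krow ((u @ e) @ [z]) = (krow (u @ e))(p := Suc (krow (u @ e) p))"
      "krow (u @ e) p = c0" "\<And>z. z < p \<Longrightarrow> krow (u @ e) z \<noteq> Suc c0" by (rule grow) blast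
    obtain d where d: "clen ?v = (clen (u @ e))(d := Suc (clen (u @ e) d))" "\<And>t. d < t \<Longrightarrow> clen ?v t = clen u t"
      using inc_chain[OF snoc.prems(1) _ rv] by auto
    have "d = c0" using p(1) d(1) by simp (metis fun_upd_apply n_not_Suc_n)
    have rc: "1 \<le> c" "0 \<le> r" "nat r \<in> kset ?v (c - 1)" "nat r \<notin> kset (u @ e) (c - 1)"
      using snoc.prems(3) False diag_iff[OF rv] diag_iff[OF re] by auto
    have "c - 1 < krow ?v (nat r)" "\<not> c - 1 < krow (u @ e) (nat r)"
      using rc(3,4) kset_iff[OF rv] kset_iff[OF re] by auto
    then have rp: "nat r = p" "c - 1 = c0" using p(2,3) by (auto split: if_splits)
    have r': "0 \<le> r'" "nat r' \<in> kset u (c - 1)" using snoc.prems(5) diag_iff[OF u] by auto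
    have lt: "nat r' < p" using snoc.prems(4) r'(1) rp(1) by auto
    have "nat r' \<in> kset (u @ e) c0" using r'(2) kset_prefix[OF re] rp(2) by blast
    then have "Suc c0 < krow (u @ e) (nat r')" using p(4)[OF lt] kset_iff[OF re] by simp
    then have "nat r' \<in> kset (u @ e) (Suc c0)" using kset_iff[OF re] by blast
    then have "nat r' \<in> kset ?v (Suc c0)" using kset_prefix[of "u @ e" "[z]" "Suc c0"] rv by auto
    moreover have "kset u (Suc c0) = kset ?v (Suc c0)"
      by (rule card_subset_eq[OF kset_finite[OF rv] kset_prefix[OF rv]])
        (use d(2)[of "Suc c0"] \<open>d = c0\<close> kset_card[OF u] kset_card[OF rv] in simp)
    ultimately have "nat r' \<in> kset u (Suc c0)" by simp
    moreover have "Suc c - 1 = Suc c0" using rp(2) rc(1) by simp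
    ultimately show ?thesis using diag_iff[OF u, of r' "Suc c"] r'(1) by simp
  qed
qed simp

text \<open>The diagrams of the prefixes are nested, so each box has exactly one component at which
  it appears; this resolves the definite description.\<close>

lemma Q_hat_iff:
  assumes r: "red (concat F)"
  shows "Q_hat F x = Some v \<longleftrightarrow> 1 \<le> v \<and> v \<le> length F \<and> x \<in> diag (concat (take (Suc (length F) - v) F))
    \<and> x \<notin> diag (concat (take (length F - v) F))"
proof -
  let ?k = "length F"
  define D where "D n = diag (concat (take n F))" for n
  have mono: "D m \<subseteq> D n" if "m \<le> n" for m n
  proof -
    have e: "take n F = take m F @ take (n - m) (drop m F)"
      using that by (metis le_add_diff_inverse take_add)
    have "red (concat (take n F) @ concat (drop n F))" using r by (metis append_take_drop_id concat_append)
    then have "red (concat (take n F))" by (rule red_appendD1)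
    then show ?thesis unfolding D_def e concat_append by (rule diag_prefix)
  qed
  have D0: "D 0 = {}" by (simp add: D_def diag_Nil)
  have Dk: "D ?k = dom (P_hat F)" by (simp add: D_def P_hat_def)
  define W where "W v \<longleftrightarrow> v \<in> {1..?k} \<and> x \<in> left_diagram F v \<and> x \<notin> left_diagram F (Suc v)" for v
  have W: "W v \<longleftrightarrow> 1 \<le> v \<and> v \<le> ?k \<and> x \<in> D (Suc ?k - v) \<and> x \<notin> D (?k - v)" for v
    by (auto simp: W_def left_diagram_def D_def)
  have uniq: "v = v'" if "W v" "W v'" for v v'
  proof (rule ccontr)
    have *: False if "W v" "W v'" "v < v'" for v v'
    proof -
      have "D (Suc ?k - v') \<subseteq> D (?k - v)" by (rule mono) (use that(3) in simp)
      then show False using that(1,2) unfolding W by blast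
    qed
    assume "v \<noteq> v'"
    then show False using *[OF that] *[OF that(2,1)] by linarith
  qed
  have exv: "\<exists>v. W v" if x: "x \<in> D ?k"
  proof -
    define n where "n = (LEAST n. x \<in> D n)"
    have n: "x \<in> D n" "n \<le> ?k" "\<And>m. m < n \<Longrightarrow> x \<notin> D m"
      unfolding n_def using x by (auto intro: LeastI Least_le dest: not_less_Least)
    have n0: "0 < n" using n(1) D0 by (cases n) auto
    have "W (Suc ?k - n)" unfolding W using n n(3)[of "n - 1"] n0 by (auto simp: Suc_diff_le)
    then show ?thesis ..
  qed
  have inD: "x \<in> D ?k" if "W v" for v
  proof -
    have "Suc ?k - v \<le> ?k" "x \<in> D (Suc ?k - v)" using that unfolding W by auto
    then show ?thesis using mono by blast
  qed
  have Q: "Q_hat F x = (if x \<in> D ?k then Some (THE v. W v) else None)"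
    unfolding Q_hat_def Dk W_def ..
  have "Q_hat F x = Some v \<longleftrightarrow> W v"
  proof
    assume q: "Q_hat F x = Some v"
    then have "x \<in> D ?k" "v = (THE v. W v)" using Q by (auto split: if_splits)
    then show "W v" using exv uniq by (metis the_equality)
  next
    assume w: "W v"
    then have "(THE v. W v) = v" using uniq by blast
    then show "Q_hat F x = Some v" using Q inD[OF w] by simp
  qed
  then show ?thesis unfolding W D_def .
qed

lemma Q_hat_dom: "dom (Q_hat F) = diag (concat F)"
  by (auto simp: Q_hat_def P_hat_def dom_def split: if_splits)

section \<open>The raising operator on factorizations\<close>

text \<open>A new smallest letter stays in the pool until the first unmatched letter above it takes
  it. That is the pairing rule for a letter processed last.\<close>

lemma pool_insert_min:
  assumes "\<forall>s\<in>S. b < s"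
  shows "pool A (insert b S) t = pool A S t + of_bool (b < t \<and> (\<forall>a\<in>unp A S. b < a \<longrightarrow> t \<le> a))"
proof (induct t)
  case (Suc t)
  have low: "pool A S u = 0" if "u \<le> b" for u
    using that
  proof (induct u)
    case (Suc u)
    then show ?case using assms by fastforce
  qed simp
  show ?case
  proof (cases "t \<le> b")
    case True
    have tS: "t \<notin> S" using assms True by force
    show ?thesis
    proof (cases "t = b")
      case True
      then show ?thesis using Suc low[of b] tS by (simp add: Suc_le_eq)
    next
      case False
      then have "\<not> b < t" "\<not> b < Suc t" using True by auto
      then show ?thesis using Suc tS False by simp
    qed
  next
    case False
    then have tb: "b < t" "t \<noteq> b" by auto
    show ?thesis
    proof (cases "\<forall>a\<in>unp A S. b < a \<longrightarrow> t \<le> a")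
      case True
      then have p: "pool A (insert b S) t = Suc (pool A S t)" using Suc tb by simp
      have "(\<forall>a\<in>unp A S. b < a \<longrightarrow> Suc t \<le> a) \<longleftrightarrow> t \<notin> unp A S"
        using True tb by (auto simp: Suc_le_eq order_le_less)
      then show ?thesis using p tb by (auto simp: unp_def)
    next
      case False
      then have "\<not> (\<forall>a\<in>unp A S. b < a \<longrightarrow> Suc t \<le> a)" using Suc_leD by blast
      then show ?thesis using Suc False tb by simp
    qed
  qed
qed simp

lemma unp_insert_min:
  assumes A: "finite A" and S: "\<forall>s\<in>S. b < s"
  shows "unp A (insert b S) = (if \<exists>a\<in>unp A S. b < a then unp A S - {Min {a \<in> unp A S. b < a}} else unp A S)"
proof -
  let ?U = "{a \<in> unp A S. b < a}"
  have f: "finite ?U" using A by (simp add: unp_def)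
  have e: "unp A (insert b S) = {a \<in> unp A S. \<not> (b < a \<and> (\<forall>a'\<in>unp A S. b < a' \<longrightarrow> a \<le> a'))}"
    unfolding unp_def[of A "insert b S"] pool_insert_min[OF S] by (auto simp: unp_def)
  show ?thesis
  proof (cases "?U = {}")
    case True
    then show ?thesis using e by auto
  next
    case False
    have "a = Min ?U \<longleftrightarrow> b < a \<and> (\<forall>a'\<in>unp A S. b < a' \<longrightarrow> a \<le> a')" if "a \<in> unp A S" for a
      using Min_in[OF f False] Min_le[OF f] that by (auto intro: antisym)
    then have "unp A (insert b S) = unp A S - {Min ?U}" using e by blast
    then show ?thesis using False by auto
  qed
qed

lemma remaining_append: "remaining A (xs @ ys) = remaining (remaining A xs) ys"
  by (induct xs arbitrary: A) auto

text \<open>The pairing takes the second component in decreasing order, so the head of the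
  increasing list is paired last and \<open>unp_insert_min\<close> is the induction step.\<close>

lemma remaining_unp: "finite A \<Longrightarrow> incr Y \<Longrightarrow> remaining A (rev Y) = unp A (set Y)"
proof (induct Y)
  case Nil
  have "pool A {} t = 0" for t by (induct t) auto
  then show ?case by (simp add: unp_def)
next
  case (Cons b Y)
  then show ?case using unp_insert_min[of A "set Y" b] by (simp add: remaining_append)
qed

lemma raise_fact_split:
  assumes r: "red (concat F)" and inc: "\<forall>s\<in>set F. incr s" and i: "0 < i" and e: "raise_fact i F = Some F'"
  obtains pre post p where "F = pre @ [sl (fst p), sl (snd p)] @ post"
    "F' = pre @ [sl (fst (raise p)), sl (snd (raise p))] @ post" "Suc (length post) = i" "gp p" "up p \<noteq> {}"
proof -
  have ci: "incr (component F j)" for j using inc by (auto simp: component_def)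
  have U: "unpaired i F = unp (set (component F (Suc i))) (set (component F i))"
    unfolding unpaired_def by (rule remaining_unp) (use ci in auto)
  have ne: "unpaired i F \<noteq> {}" using e by (auto simp: raise_fact_def split: if_splits)
  then have "component F (Suc i) \<noteq> []" unfolding U by (auto simp: unp_def)
  then have le: "Suc i \<le> length F" by (auto simp: component_def split: if_splits)
  define l where "l = length F - Suc i"
  have l: "l + Suc i = length F" using le by (simp add: l_def)
  have li: "length F - i = Suc l" using l i by simp
  define pre where "pre = take l F"
  define post where "post = drop (Suc (Suc l)) F"
  define X where "X = F ! l"
  define Y where "Y = F ! Suc l"
  have "drop l F = X # Y # post" unfolding X_def Y_def post_def using l i by (simp add: Cons_nth_drop_Suc)
  then have F: "F = pre @ X # Y # post" unfolding pre_def by (metis append_take_drop_id)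
  have lpre: "length pre = l" unfolding pre_def using l by simp
  have lpost: "Suc (length post) = i" unfolding post_def using l i by simp
  have cX: "component F (Suc i) = X" and cY: "component F i = Y"
    using le i li by (auto simp: component_def X_def Y_def l_def)
  define p where "p = (set X, set Y)"
  have XY: "X = sl (fst p)" "Y = sl (snd p)" using inc unfolding F by (auto simp: p_def sl_set)
  have "red (concat pre @ (X @ Y) @ concat post)" using r unfolding F by simp
  then have rXY: "red (X @ Y)" by (rule red_factor)
  have fin: "finite (fst p)" "finite (snd p)" by (simp_all add: p_def)
  have g: "gp p" unfolding gp_def XY[symmetric] using fin rXY by simp
  have up: "unpaired i F = up p" unfolding U cX cY p_def by simp
  define a where "a = Max (up p)"
  define z where "z = a + (LEAST t. a + t + 1 \<notin> fst p)"
  have ra: "raise p = (fst p - {a}, insert z (snd p))" by (simp add: raise_def Let_def a_def z_def)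
  have une: "up p \<noteq> {}" using ne up by simp
  \<comment> \<open>\<open>insort\<close> would duplicate a letter already present; the growth of
    the second component by one letter excludes this.\<close>
  have z: "z \<notin> snd p" using raise_step(4)[OF g une] ra fin(2) by (auto simp: insert_absorb)
  have "F' = F[l := remove1 a X, Suc l := insort z Y]"
    using e ne unfolding raise_fact_def Let_def up li l_def[symmetric] cX cY
    by (simp add: a_def z_def p_def)
  also have "\<dots> = pre @ [remove1 a X, insort z Y] @ post"
    unfolding F using lpre by (simp add: list_update_append)
  also have "remove1 a X = sl (fst (raise p))"
    unfolding XY(1) ra by (simp add: sorted_list_of_set_remove[OF fin(1)])
  also have "insort z Y = sl (snd (raise p))"
    unfolding XY(2) ra using z fin(2) by simp
  finally have F': "F' = pre @ [sl (fst (raise p)), sl (snd (raise p))] @ post" .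
  have F2: "F = pre @ [sl (fst p), sl (snd p)] @ post" using F XY by simp
  show ?thesis by (rule that[OF F2 F' lpost g une])
qed

lemma raise_Q_hat:
  assumes r: "red (concat F)" and g: "gp p" and ne: "up p \<noteq> {}" and i: "Suc (length post) = i"
    and F: "F = pre @ [sl (fst p), sl (snd p)] @ post"
    and F': "F' = pre @ [sl (fst (raise p)), sl (snd (raise p))] @ post"
  shows "P_hat F' = P_hat F \<and> raise_key i (Q_hat F) = Some (Q_hat F')"
proof -
  define \<tau> where "\<tau> = concat pre"
  define l where "l = length pre"
  let ?x = "sl (fst p)" and ?x' = "sl (fst (raise p))"
  note ra = raise_step[OF g ne]
  have k: "length F = l + Suc i" "length F' = l + Suc i" using F F' i by (auto simp: l_def)
  have eq: "\<tau> @ wp p @ s \<approx> \<tau> @ wp (raise p) @ s" for s by (rule ck_cong[OF ra(2)])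
  have cF: "concat F = \<tau> @ wp p @ concat post" "concat F' = \<tau> @ wp (raise p) @ concat post"
    unfolding F F' \<tau>_def by auto
  have r': "red (concat F')" using red_ck[OF r[unfolded cF] eq] unfolding cF .
  have P: "P_hat F' = P_hat F" unfolding P_hat_def cF by (rule P_word_ck[OF eq, symmetric])
  have rw: "red (\<tau> @ wp p)" "red (\<tau> @ wp (raise p))"
    using red_appendD1[of "\<tau> @ wp p" "concat post"] red_appendD1[of "\<tau> @ wp (raise p)" "concat post"] r r' cF by auto
  have rxy: "red ((\<tau> @ ?x) @ sl (snd p))" "red ((\<tau> @ ?x') @ sl (snd (raise p)))" using rw by auto
  have rx: "red (\<tau> @ ?x)" "red (\<tau> @ ?x')" using red_appendD1[OF rxy(1)] red_appendD1[OF rxy(2)] by auto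
  have rt: "red \<tau>" by (rule red_appendD1[OF rx(1)])
  define A where "A = diag \<tau>"
  define B where "B = diag (\<tau> @ ?x)"
  define B' where "B' = diag (\<tau> @ ?x')"
  define C where "C = diag (\<tau> @ wp p)"
  have C1: "C = diag ((\<tau> @ ?x) @ sl (snd p))" by (simp add: C_def)
  have C2: "C = diag ((\<tau> @ ?x') @ sl (snd (raise p)))" unfolding C_def using P_word_ck[OF eq[of "[]"]] by simp
  have sub: "A \<subseteq> B" "B \<subseteq> C" "A \<subseteq> B'" "B' \<subseteq> C"
    unfolding A_def B_def B'_def using diag_prefix[OF rx(1)] diag_prefix[OF rx(2)]
      diag_prefix[OF rxy(1)] diag_prefix[OF rxy(2)] C1 C2 by auto
  have tF: "take n F = take n pre @ take (n - l) [sl (fst p), sl (snd p)] @ take (n - l - length [sl (fst p), sl (snd p)]) post"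
    and tF': "take n F' = take n pre @ take (n - l) [sl (fst (raise p)), sl (snd (raise p))]
      @ take (n - l - length [sl (fst (raise p)), sl (snd (raise p))]) post" for n
    unfolding F F' l_def by (simp_all only: take_append)
  \<comment> \<open>A prefix that contains both changed components or neither keeps its class; only
    the one of length \<open>Suc l\<close> separates them.\<close>
  have same: "diag (concat (take n F)) = diag (concat (take n F'))" if "n \<noteq> Suc l" for n
  proof (cases "n \<le> l")
    case True
    then show ?thesis unfolding tF tF' by simp
  next
    case False
    define m where "m = n - Suc (Suc l)"
    have m: "n = Suc (Suc l) + m" unfolding m_def using that False by simp
    then have "concat (take n F) = \<tau> @ wp p @ concat (take m post)"
      "concat (take n F') = \<tau> @ wp (raise p) @ concat (take m post)"
      unfolding tF tF' \<tau>_def l_def by auto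
    then show ?thesis using P_word_ck[OF eq] by simp
  qed
  have n0: "diag (concat (take l F)) = A" "diag (concat (take l F')) = A"
    unfolding tF tF' A_def \<tau>_def l_def by auto
  have n1: "diag (concat (take (Suc l) F)) = B" "diag (concat (take (Suc l) F')) = B'"
    unfolding tF tF' B_def B'_def \<tau>_def l_def by auto
  have n2: "diag (concat (take (Suc (Suc l)) F)) = C" "diag (concat (take (Suc (Suc l)) F')) = C"
    using same[of "Suc (Suc l)"] unfolding tF C_def \<tau>_def l_def by auto
  have i1: "1 \<le> i" using i by simp
  have kk: "Suc (length F) - Suc i = Suc l" "length F - Suc i = l" "Suc (length F) - i = Suc (Suc l)" "length F - i = Suc l"
    "Suc (length F') - Suc i = Suc l" "length F' - Suc i = l" "Suc (length F') - i = Suc (Suc l)" "length F' - i = Suc l"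
    "i \<le> length F" "Suc i \<le> length F" "i \<le> length F'" "Suc i \<le> length F'"
    using k by auto
  have Q: "Q_hat F x = Some (Suc i) \<longleftrightarrow> x \<in> B - A" "Q_hat F x = Some i \<longleftrightarrow> x \<in> C - B" for x
    unfolding Q_hat_iff[OF r] kk n0 n1 n2 using kk(9,10) i1 by auto
  have Q': "Q_hat F' x = Some (Suc i) \<longleftrightarrow> x \<in> B' - A" "Q_hat F' x = Some i \<longleftrightarrow> x \<in> C - B'" for x
    unfolding Q_hat_iff[OF r'] kk n0 n1 n2 using kk(11,12) i1 by auto
  have dQ: "dom (Q_hat F) = diag (concat F)" by (rule Q_hat_dom)
  have CF: "C \<subseteq> dom (Q_hat F)"
    unfolding dQ cF C_def using diag_prefix[of "\<tau> @ wp p" "concat post"] r cF by simp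
  note er = excess_raise[OF g rw(1)]
  obtain d where d: "1 \<le> d" "\<And>c. csum (\<tau> @ ?x) c = csum (\<tau> @ ?x') c + of_bool (d \<le> c)"
    "excess \<tau> p d = int (card (up p))" "\<And>c. c < d \<Longrightarrow> excess \<tau> p c < int (card (up p))"
    using er ne by blast
  \<comment> \<open>Differences of consecutive column sums: only the column with index
    \<open>d - 1\<close>, counted from 0, loses a box.\<close>
  have cl: "clen (\<tau> @ ?x) c = clen (\<tau> @ ?x') c + of_bool (d = Suc c)" for c
  proof -
    have "int (clen (\<tau> @ ?x) c) = int (clen (\<tau> @ ?x') c) + of_bool (d = Suc c)"
      using d(2)[of c] d(2)[of "Suc c"] by (auto simp: csum_Suc of_bool_def split: if_splits)
    then show ?thesis by (auto simp: of_bool_def split: if_splits)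
  qed
  note st = inc_strip[OF incr_sl rx(1)] inc_strip[OF incr_sl rxy(1)]
  have mon: "clen \<tau> c \<le> clen (\<tau> @ ?x) c" "clen (\<tau> @ ?x) c \<le> clen ((\<tau> @ ?x) @ sl (snd p)) c"
    "clen \<tau> c \<le> clen (\<tau> @ ?x') c" for c
    using card_mono[OF kset_finite kset_prefix] kset_card rt rx rxy by metis+
  have new: "(\<exists>r. (r, c) \<in> B - A) \<longleftrightarrow> 1 \<le> c \<and> clen \<tau> (c - 1) < clen (\<tau> @ ?x) (c - 1)"
    "(\<exists>r. (r, c) \<in> B' - A) \<longleftrightarrow> 1 \<le> c \<and> clen \<tau> (c - 1) < clen (\<tau> @ ?x') (c - 1)"
    "(\<exists>r. (r, c) \<in> C - B) \<longleftrightarrow> 1 \<le> c \<and> clen (\<tau> @ ?x) (c - 1) < clen ((\<tau> @ ?x) @ sl (snd p)) (c - 1)" for c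
    unfolding A_def B_def B'_def C1 by (rule diag_new[OF rx(1)] diag_new[OF rx(2)] diag_new[OF rxy(1)])+
  \<comment> \<open>\<open>excess\<close> serves as \<open>g\<close>: each component adds at most
    one box per column, so its increments are differences of indicators.\<close>
  interpret two_labels "Q_hat F" i A B B' C d "excess \<tau> p"
  proof
    show "finite (dom (Q_hat F))" unfolding dQ by (rule diag_finite[OF r])
    show "1 \<le> c" if "(r, c) \<in> dom (Q_hat F)" for r c using that diag_iff[OF r] unfolding dQ by blast
    show "A \<subseteq> B" "B \<subseteq> C" "A \<subseteq> B'" "B' \<subseteq> C" by (fact sub)+
    show "C \<subseteq> dom (Q_hat F)" by (fact CF)
    show "(r, c) \<in> A" if "1 \<le> c" "(r, Suc c) \<in> A" for r c
      using that unfolding A_def by (rule diag_left[OF rt])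
    show "(r, c) \<in> B" if "1 \<le> c" "(r, Suc c) \<in> B" for r c
      using that unfolding B_def by (rule diag_left[OF rx(1)])
    show "(r, c) \<in> B'" if "1 \<le> c" "(r, Suc c) \<in> B'" for r c
      using that unfolding B'_def by (rule diag_left[OF rx(2)])
    show "(r, c) \<in> C" if "1 \<le> c" "(r, Suc c) \<in> C" for r c
      using that unfolding C_def by (rule diag_left[OF rw(1)])
    show "r = r'" if "(r, c) \<in> B - A" "(r', c) \<in> B - A" for r r' c
      using that unfolding A_def B_def by (rule diag_strip[OF incr_sl rx(1)])
    show "r = r'" if "(r, c) \<in> C - B" "(r', c) \<in> C - B" for r r' c
      using that unfolding C1 B_def by (rule diag_strip[OF incr_sl rxy(1)])
    show "r = r'" if "(r, c) \<in> B' - A" "(r', c) \<in> B' - A" for r r' c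
      using that unfolding A_def B'_def by (rule diag_strip[OF incr_sl rx(2)])
    show "r = r'" if "(r, c) \<in> C - B'" "(r', c) \<in> C - B'" for r r' c
      using that unfolding C2 B'_def by (rule diag_strip[OF incr_sl rxy(2)])
    show "(r', Suc c) \<in> A" if "(r, c) \<in> B - A" "r' < r" "(r', c) \<in> A" for r r' c
      using that unfolding A_def B_def by (rule diag_key[OF incr_sl rx(1)])
    show "(r', Suc c) \<in> B" if "(r, c) \<in> C - B" "r' < r" "(r', c) \<in> B" for r r' c
      using that unfolding C1 B_def by (rule diag_key[OF incr_sl rxy(1)])
    show "(r', Suc c) \<in> B'" if "(r, c) \<in> C - B'" "r' < r" "(r', c) \<in> B'" for r r' c
      using that unfolding C2 B'_def by (rule diag_key[OF incr_sl rxy(2)])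
    show "Q_hat F x = Some (Suc i) \<longleftrightarrow> x \<in> B - A" "Q_hat F x = Some i \<longleftrightarrow> x \<in> C - B" for x by (fact Q)+
    show "(\<exists>r. (r, c) \<in> B' - A) \<longleftrightarrow> (\<exists>r. (r, c) \<in> B - A) \<and> c \<noteq> d" for c
      unfolding new using cl[of "c - 1"] st(1)[of "c - 1"] mon(3)[of "c - 1"]
      by (cases c) (auto simp: of_bool_def split: if_splits)
    show "excess \<tau> p 0 = 0" by (simp add: excess_def csum_def)
    show "excess \<tau> p (Suc c) = excess \<tau> p c + of_bool (\<exists>r. (r, Suc c) \<in> B - A) - of_bool (\<exists>r. (r, Suc c) \<in> C - B)" for c
    proof -
      define n m :: int where "n = of_bool (\<exists>r. (r, Suc c) \<in> B - A)" and "m = of_bool (\<exists>r. (r, Suc c) \<in> C - B)"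
      have "int (clen (\<tau> @ ?x) c) = int (clen \<tau> c) + n"
        unfolding new n_def using st(1)[of c] mon(1)[of c] by (auto simp: of_bool_def)
      moreover have "int (clen (\<tau> @ wp p) c) = int (clen (\<tau> @ ?x) c) + m"
        unfolding new m_def using st(2)[of c] mon(2)[of c] by (auto simp: of_bool_def)
      ultimately show ?thesis unfolding excess_def csum_Suc n_def[symmetric] m_def[symmetric] by simp
    qed
    show "1 \<le> d" by (fact d(1))
    show "excess \<tau> p c \<le> excess \<tau> p d" for c using er d(3) by simp
    show "excess \<tau> p c < excess \<tau> p d" if "c < d" for c using d(3,4) that by simp
  qed
  have "raise_key i (Q_hat F) = Some (Q_hat F')"
  proof (rule raise_key_labels)
    show "Q_hat F' x = Some (if x \<in> B' then Suc i else i)" if "x \<in> C - A" for x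
      using that Q'[of x] by auto
    fix x assume x: "x \<notin> C - A"
    have "Q_hat F' x = Some v \<longleftrightarrow> Q_hat F x = Some v" for v
    proof (cases "v = i \<or> v = Suc i")
      case True
      then show ?thesis using Q[of x] Q'[of x] x sub by auto
    next
      case False
      show ?thesis
      proof (cases "1 \<le> v \<and> v \<le> length F")
        case True
        then have "Suc (length F) - v \<noteq> Suc l" "length F - v \<noteq> Suc l" using False k by auto
        then show ?thesis unfolding Q_hat_iff[OF r] Q_hat_iff[OF r'] using same k by simp
      qed (auto simp: Q_hat_iff[OF r] Q_hat_iff[OF r'] k)
    qed
    then show "Q_hat F' x = Q_hat F x" by (cases "Q_hat F x") auto
  qed
  then show ?thesis using P by simp
qed

theorem theorem4p12:
  fixes w \<phi> :: "nat \<Rightarrow> nat" and F F' :: factorization and i :: nat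
  assumes "w \<in> S_infty" and "flag \<phi>" and "F \<in> RFC w \<phi>" and "i > 0"
    and "raise_fact i F = Some F'"
  shows "P_hat F' = P_hat F \<and> raise_key i (Q_hat F) = Some (Q_hat F')"
proof -
  obtain s where s: "s \<in> reduced_words w" "increasing_factorization F s" using assms(3) by (auto simp: RFC_def)
  then have r: "red (concat F)" and inc: "\<forall>s\<in>set F. incr s"
    using reduced_words_red by (auto simp: increasing_factorization_def)
  obtain pre post p where "F = pre @ [sl (fst p), sl (snd p)] @ post"
    "F' = pre @ [sl (fst (raise p)), sl (snd (raise p))] @ post" "Suc (length post) = i" "gp p" "up p \<noteq> {}"
    by (rule raise_fact_split[OF r inc assms(4,5)])
  then show ?thesis using raise_Q_hat[OF r] by blast
qed

end
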